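(* Let $A=\begin{pmatrix} H & 0\\ M & R\end{pmatrix}$ be a basic connected Artin algebra which is a local extension of the hereditary algebra $H$ (so $R$ is a local algebra and $M$ is an $R$-$H$-bimodule), where $R$ is not a skew field. The following statements are equivalent: (1) $\mathrm{add}(\mathcal{L}_A)$ is an abelian exact subcategory of $\mathrm{mod}_A$. (2) $\mathcal{L}_A=\mathrm{ind}_H$. (3) $M_H$ is injective.
   Context: Algebras are basic and connected Artin algebras (connected: indecomposable as a ring). $\mathrm{mod}_A$ is the category of finitely generated right $A$-modules, and $\mathrm{ind}_A$ is a full subcategory of $\mathrm{mod}_A$ consisting of a complete set of representatives of the isomorphism classes of indecomposable $A$-modules; all subcategories are closed under isomorphic images. For a full subcategory $\mathcal{C}$ of $\mathrm{mod}_A$, $\mathrm{add}(\mathcal{C})$ is the full subcategory of $\mathrm{mod}_A$ whose objects are the direct summands of finite direct sums of modules in $\mathcal{C}$. For $X,Y\in\mathrm{ind}_A$, $X$ is a predecessor of $Y$ if there is a sequence $X=X_0\to X_1\to\cdots\to X_t=Y$ of non-zero morphisms between indecomposable $A$-modules. The left part $\mathcal{L}_A$ is the full subcategory of $\mathrm{ind}_A$ consisting of those $X\in\mathrm{ind}_A$ such that every predecessor of $X$ has projective dimension at most one. A full subcategory $\mathcal{A}$ of $\mathrm{mod}_A$ is an abelian exact subcategory if it is abelian as a category and the inclusion functor $\mathcal{A}\hookrightarrow\mathrm{mod}_A$ is exact; equivalently, it is closed under kernels and cokernels. A triangular matrix algebra $A=\begin{pmatrix} H & 0\\ M & R\end{pmatrix}$,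 with $M$ an $R$-$H$-bimodule, is a local extension of $H$ if $R$ is a local algebra. Right $A$-modules are viewed as triples $(X,Y,\varphi)$ with $X\in\mathrm{mod}_H$, $Y\in\mathrm{mod}_R$ and $\varphi:Y\otimes_R M\to X$ a morphism in $\mathrm{mod}_H$; $\mathrm{mod}_H$ (and likewise $\mathrm{ind}_H$) is identified with the full subcategory of $\mathrm{mod}_A$ of triples $(X,0,0)$. *)

theory Defs
  imports "HOL-Algebra.Module" "HOL-Algebra.Ideal" "HOL-Algebra.RingHom"
    "HOL-Library.FuncSet" "HOL-Library.Extended_Nat"
begin

section \<open>Right modules over a non-commutative ring\<close>

text \<open>
  The record type of the library's (commutative) modules is reused; its fields for multiplication
  and unit play no role.  For a right module, \<open>a \<odot>\<^bsub>X\<^esub> x\<close> stands for the product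
  that is written \<open>x a\<close> on paper.
\<close>

locale right_module = A?: ring A + X?: abelian_group X
  for A :: "('a, 'c) ring_scheme" (structure) and X :: "('a, 'x, 'd) module_scheme" (structure) +
  assumes smult_closed [simp, intro]:
      "\<lbrakk>a \<in> carrier A; x \<in> carrier X\<rbrakk> \<Longrightarrow> a \<odot>\<^bsub>X\<^esub> x \<in> carrier X"
    and smult_l_distr:
      "\<lbrakk>a \<in> carrier A; b \<in> carrier A; x \<in> carrier X\<rbrakk> \<Longrightarrow>
        (a \<oplus>\<^bsub>A\<^esub> b) \<odot>\<^bsub>X\<^esub> x = a \<odot>\<^bsub>X\<^esub> x \<oplus>\<^bsub>X\<^esub> b \<odot>\<^bsub>X\<^esub> x"
    and smult_r_distr:
      "\<lbrakk>a \<in> carrier A; x \<in> carrier X; y \<in> carrier X\<rbrakk> \<Longrightarrow>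
        a \<odot>\<^bsub>X\<^esub> (x \<oplus>\<^bsub>X\<^esub> y) = a \<odot>\<^bsub>X\<^esub> x \<oplus>\<^bsub>X\<^esub> a \<odot>\<^bsub>X\<^esub> y"
    and smult_assoc:
      "\<lbrakk>a \<in> carrier A; b \<in> carrier A; x \<in> carrier X\<rbrakk> \<Longrightarrow>
        (a \<otimes>\<^bsub>A\<^esub> b) \<odot>\<^bsub>X\<^esub> x = b \<odot>\<^bsub>X\<^esub> (a \<odot>\<^bsub>X\<^esub> x)"
    and smult_one [simp]:
      "x \<in> carrier X \<Longrightarrow> \<one>\<^bsub>A\<^esub> \<odot>\<^bsub>X\<^esub> x = x"

definition fin_gen :: "('a, 'c) ring_scheme \<Rightarrow> ('a, 'x, 'd) module_scheme \<Rightarrow> bool" where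
  "fin_gen A X \<longleftrightarrow>
    (\<exists>S \<subseteq> carrier X. finite S \<and>
      (\<forall>x \<in> carrier X. \<exists>c \<in> S \<rightarrow> carrier A. x = (\<Oplus>\<^bsub>X\<^esub>s\<in>S. c s \<odot>\<^bsub>X\<^esub> s)))"

text \<open>
  Homomorphisms are extensional functions, so that equality in a hom-set is equality of functions;
  they are composed with \<open>compose (carrier X)\<close>.
\<close>

definition rhom ::
  "('a, 'c) ring_scheme \<Rightarrow> ('a, 'x, 'd) module_scheme \<Rightarrow> ('a, 'y, 'e) module_scheme \<Rightarrow> ('x \<Rightarrow> 'y) set"
where
  "rhom A X Y = {f \<in> carrier X \<rightarrow>\<^sub>E carrier Y.
      (\<forall>x \<in> carrier X. \<forall>y \<in> carrier X. f (x \<oplus>\<^bsub>X\<^esub> y) = f x \<oplus>\<^bsub>Y\<^esub> f y) \<and>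
      (\<forall>a \<in> carrier A. \<forall>x \<in> carrier X. f (a \<odot>\<^bsub>X\<^esub> x) = a \<odot>\<^bsub>Y\<^esub> f x)}"

definition zero_hom :: "('a, 'x, 'd) module_scheme \<Rightarrow> ('a, 'y, 'e) module_scheme \<Rightarrow> 'x \<Rightarrow> 'y" where
  "zero_hom X Y = (\<lambda>x \<in> carrier X. \<zero>\<^bsub>Y\<^esub>)"

definition id_hom :: "('a, 'x, 'd) module_scheme \<Rightarrow> 'x \<Rightarrow> 'x" where
  "id_hom X = (\<lambda>x \<in> carrier X. x)"

definition ker_hom ::
  "('a, 'x, 'd) module_scheme \<Rightarrow> ('a, 'y, 'e) module_scheme \<Rightarrow> ('x \<Rightarrow> 'y) \<Rightarrow> 'x set" where
  "ker_hom X Y f = {x \<in> carrier X. f x = \<zero>\<^bsub>Y\<^esub>}"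

definition mod_iso ::
  "('a, 'c) ring_scheme \<Rightarrow> ('a, 'x, 'd) module_scheme \<Rightarrow> ('a, 'y, 'e) module_scheme \<Rightarrow> bool" where
  "mod_iso A X Y \<longleftrightarrow> (\<exists>f \<in> rhom A X Y. bij_betw f (carrier X) (carrier Y))"

definition internal_dsum ::
  "('a, 'c) ring_scheme \<Rightarrow> ('a, 'x, 'd) module_scheme \<Rightarrow> 'x set \<Rightarrow> 'x set \<Rightarrow> bool" where
  "internal_dsum A X U V \<longleftrightarrow>
    submodule U A X \<and> submodule V A X \<and> U \<inter> V = {\<zero>\<^bsub>X\<^esub>} \<and> U <+>\<^bsub>X\<^esub> V = carrier X"

definition indecomposable :: "('a, 'c) ring_scheme \<Rightarrow> ('a, 'x, 'd) module_scheme \<Rightarrow> bool" where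
  "indecomposable A X \<longleftrightarrow> carrier X \<noteq> {\<zero>\<^bsub>X\<^esub>} \<and>
    (\<forall>U V. internal_dsum A X U V \<longrightarrow> U = {\<zero>\<^bsub>X\<^esub>} \<or> V = {\<zero>\<^bsub>X\<^esub>})"

text \<open>The right regular module; its submodules are the right ideals.\<close>

definition regular :: "('a, 'c) ring_scheme \<Rightarrow> ('a, 'a) module" where
  "regular A = \<lparr>carrier = carrier A, mult = mult A, one = one A, zero = zero A, add = add A,
     smult = (\<lambda>a x. x \<otimes>\<^bsub>A\<^esub> a)\<rparr>"

abbreviation right_ideal :: "'a set \<Rightarrow> ('a, 'c) ring_scheme \<Rightarrow> bool" where
  "right_ideal I A \<equiv> submodule I A (regular A)"


section \<open>The category of finitely generated modules\<close>

text \<open>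
  A finitely generated module over a ring on \<open>'a\<close> is isomorphic to one whose elements are sets of
  coefficient lists (see \<open>ex_mod_cat_iso\<close> below), so the carrier type \<open>'a list set\<close> is large enough
  to represent every object.  The classes below are closed under isomorphism inside this type.
\<close>

definition mod_cat :: "('a, 'c) ring_scheme \<Rightarrow> ('a, 'a list set) module set" where
  "mod_cat A = {X. right_module A X \<and> fin_gen A X}"

definition ind_cat :: "('a, 'c) ring_scheme \<Rightarrow> ('a, 'a list set) module set" where
  "ind_cat A = {X \<in> mod_cat A. indecomposable A X}"

text \<open>Projective and injective objects relative to \<open>mod_cat A\<close>.\<close>

definition projective :: "('a, 'c) ring_scheme \<Rightarrow> ('a, 'x, 'd) module_scheme \<Rightarrow> bool" where
  "projective A P \<longleftrightarrow> right_module A P \<and>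
    (\<forall>Y \<in> mod_cat A. \<forall>Z \<in> mod_cat A. \<forall>g \<in> rhom A Y Z. \<forall>f \<in> rhom A P Z.
      g ` carrier Y = carrier Z \<longrightarrow> (\<exists>h \<in> rhom A P Y. compose (carrier P) g h = f))"

definition injective :: "('a, 'c) ring_scheme \<Rightarrow> ('a, 'x, 'd) module_scheme \<Rightarrow> bool" where
  "injective A I \<longleftrightarrow> right_module A I \<and>
    (\<forall>Y \<in> mod_cat A. \<forall>Z \<in> mod_cat A. \<forall>g \<in> rhom A Y Z. \<forall>f \<in> rhom A Y I.
      inj_on g (carrier Y) \<longrightarrow> (\<exists>h \<in> rhom A Z I. compose (carrier Y) h g = f))"

text \<open>
  A projective resolution of length \<open>n\<close>,
  \<open>0 \<rightarrow> P n \<rightarrow> \<dots> \<rightarrow> P 1 \<rightarrow> P 0 \<rightarrow> X \<rightarrow> 0\<close>, where \<open>d 0\<close> is the augmentation \<open>P 0 \<rightarrow> X\<close> and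
  \<open>d (Suc i)\<close> maps \<open>P (Suc i)\<close> to \<open>P i\<close>.
\<close>

definition proj_resolution ::
  "('a, 'c) ring_scheme \<Rightarrow> ('a, 'a list set) module \<Rightarrow> nat \<Rightarrow>
    (nat \<Rightarrow> ('a, 'a list set) module) \<Rightarrow> (nat \<Rightarrow> 'a list set \<Rightarrow> 'a list set) \<Rightarrow> bool" where
  "proj_resolution A X n P d \<longleftrightarrow>
    (let T = (\<lambda>i. case i of 0 \<Rightarrow> X | Suc j \<Rightarrow> P j) in
      (\<forall>i\<le>n. P i \<in> mod_cat A \<and> projective A (P i) \<and> d i \<in> rhom A (P i) (T i)) \<and>
      d 0 ` carrier (P 0) = carrier X \<and>
      (\<forall>i<n. d (Suc i) ` carrier (P (Suc i)) = ker_hom (P i) (T i) (d i)) \<and>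
      inj_on (d n) (carrier (P n)))"

definition proj_dim :: "('a, 'c) ring_scheme \<Rightarrow> ('a, 'a list set) module \<Rightarrow> enat" where
  "proj_dim A X = Inf {enat n | n. \<exists>P d. proj_resolution A X n P d}"


section \<open>The left part\<close>

definition nonzero_step ::
  "('a, 'c) ring_scheme \<Rightarrow> ('a, 'a list set) module \<Rightarrow> ('a, 'a list set) module \<Rightarrow> bool" where
  "nonzero_step A X Y \<longleftrightarrow> X \<in> ind_cat A \<and> Y \<in> ind_cat A \<and> (\<exists>f \<in> rhom A X Y. f \<noteq> zero_hom X Y)"

definition predecessor ::
  "('a, 'c) ring_scheme \<Rightarrow> ('a, 'a list set) module \<Rightarrow> ('a, 'a list set) module \<Rightarrow> bool" where
  "predecessor A X Y \<longleftrightarrow> X \<in> ind_cat A \<and> Y \<in> ind_cat A \<and> (nonzero_step A)\<^sup>*\<^sup>* X Y"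

definition left_part :: "('a, 'c) ring_scheme \<Rightarrow> ('a, 'a list set) module set" where
  "left_part A = {X \<in> ind_cat A. \<forall>Z. predecessor A Z X \<longrightarrow> proj_dim A Z \<le> 1}"


section \<open>Full subcategories of the module category\<close>

definition ext_dsum :: "nat \<Rightarrow> (nat \<Rightarrow> ('a, 'x) module) \<Rightarrow> ('a, nat \<Rightarrow> 'x) module" where
  "ext_dsum n X =
    \<lparr>carrier = (\<Pi>\<^sub>E i\<in>{..<n}. carrier (X i)),
     mult = undefined, one = undefined,
     zero = (\<lambda>i\<in>{..<n}. \<zero>\<^bsub>X i\<^esub>),
     add = (\<lambda>x y. \<lambda>i\<in>{..<n}. x i \<oplus>\<^bsub>X i\<^esub> y i),
     smult = (\<lambda>a x. \<lambda>i\<in>{..<n}. a \<odot>\<^bsub>X i\<^esub> x i)\<rparr>"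

definition add_cat ::
  "('a, 'c) ring_scheme \<Rightarrow> ('a, 'a list set) module set \<Rightarrow> ('a, 'a list set) module set" where
  "add_cat A C = {N \<in> mod_cat A.
     \<exists>n X U V. (\<forall>i<n. X i \<in> C) \<and> internal_dsum A (ext_dsum n X) U V \<and>
       mod_iso A N ((ext_dsum n X)\<lparr>carrier := U\<rparr>)}"

text \<open>
  A set \<open>C\<close> of modules stands for the full subcategory with these objects.  The notions below are
  the categorical ones internal to \<open>C\<close>: all universal properties are tested on objects of \<open>C\<close> only.
\<close>

context
  fixes A :: "('a, 'c) ring_scheme" and C :: "('a, 'x) module set"
begin

definition zero_object :: "('a, 'x) module \<Rightarrow> bool" where
  "zero_object Z \<longleftrightarrow> Z \<in> C \<and>
    (\<forall>X \<in> C. rhom A X Z = {zero_hom X Z} \<and> rhom A Z X = {zero_hom Z X})"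

definition is_biproduct ::
  "('a, 'x) module \<Rightarrow> ('a, 'x) module \<Rightarrow> ('a, 'x) module \<Rightarrow>
    ('x \<Rightarrow> 'x) \<Rightarrow> ('x \<Rightarrow> 'x) \<Rightarrow> ('x \<Rightarrow> 'x) \<Rightarrow> ('x \<Rightarrow> 'x) \<Rightarrow> bool" where
  "is_biproduct X Y B i j p q \<longleftrightarrow> B \<in> C \<and>
    i \<in> rhom A X B \<and> j \<in> rhom A Y B \<and> p \<in> rhom A B X \<and> q \<in> rhom A B Y \<and>
    compose (carrier X) p i = id_hom X \<and> compose (carrier Y) q j = id_hom Y \<and>
    compose (carrier X) q i = zero_hom X Y \<and> compose (carrier Y) p j = zero_hom Y X \<and>
    (\<lambda>b \<in> carrier B. i (p b) \<oplus>\<^bsub>B\<^esub> j (q b)) = id_hom B"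

definition is_mono :: "('a, 'x) module \<Rightarrow> ('a, 'x) module \<Rightarrow> ('x \<Rightarrow> 'x) \<Rightarrow> bool" where
  "is_mono X Y f \<longleftrightarrow>
    (\<forall>Z \<in> C. \<forall>g \<in> rhom A Z X. \<forall>h \<in> rhom A Z X.
      compose (carrier Z) f g = compose (carrier Z) f h \<longrightarrow> g = h)"

definition is_epi :: "('a, 'x) module \<Rightarrow> ('a, 'x) module \<Rightarrow> ('x \<Rightarrow> 'x) \<Rightarrow> bool" where
  "is_epi X Y f \<longleftrightarrow>
    (\<forall>Z \<in> C. \<forall>g \<in> rhom A Y Z. \<forall>h \<in> rhom A Y Z.
      compose (carrier X) g f = compose (carrier X) h f \<longrightarrow> g = h)"

text \<open>\<open>k : K \<rightarrow> X\<close> is a kernel of \<open>f : X \<rightarrow> Y\<close>.\<close>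

definition is_kernel ::
  "('a, 'x) module \<Rightarrow> ('a, 'x) module \<Rightarrow> ('a, 'x) module \<Rightarrow> ('x \<Rightarrow> 'x) \<Rightarrow> ('x \<Rightarrow> 'x) \<Rightarrow> bool" where
  "is_kernel K X Y k f \<longleftrightarrow> K \<in> C \<and> k \<in> rhom A K X \<and> compose (carrier K) f k = zero_hom K Y \<and>
    (\<forall>Z \<in> C. \<forall>g \<in> rhom A Z X. compose (carrier Z) f g = zero_hom Z Y \<longrightarrow>
      (\<exists>!h. h \<in> rhom A Z K \<and> compose (carrier Z) k h = g))"

text \<open>\<open>q : Y \<rightarrow> Q\<close> is a cokernel of \<open>f : X \<rightarrow> Y\<close>.\<close>

definition is_cokernel ::
  "('a, 'x) module \<Rightarrow> ('a, 'x) module \<Rightarrow> ('a, 'x) module \<Rightarrow> ('x \<Rightarrow> 'x) \<Rightarrow> ('x \<Rightarrow> 'x) \<Rightarrow> bool" where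
  "is_cokernel X Y Q f q \<longleftrightarrow> Q \<in> C \<and> q \<in> rhom A Y Q \<and> compose (carrier X) q f = zero_hom X Q \<and>
    (\<forall>Z \<in> C. \<forall>g \<in> rhom A Y Z. compose (carrier X) g f = zero_hom X Z \<longrightarrow>
      (\<exists>!h. h \<in> rhom A Q Z \<and> compose (carrier Y) h q = g))"

definition abelian_cat :: bool where
  "abelian_cat \<longleftrightarrow>
    (\<exists>Z. zero_object Z) \<and>
    (\<forall>X \<in> C. \<forall>Y \<in> C. \<exists>B i j p q. is_biproduct X Y B i j p q) \<and>
    (\<forall>X \<in> C. \<forall>Y \<in> C. \<forall>f \<in> rhom A X Y.
      (\<exists>K k. is_kernel K X Y k f) \<and>
      (\<exists>Q q. is_cokernel X Y Q f q) \<and>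
      (is_mono X Y f \<longrightarrow> (\<exists>Z \<in> C. \<exists>g \<in> rhom A Y Z. is_kernel X Y Z f g)) \<and>
      (is_epi X Y f \<longrightarrow> (\<exists>Z \<in> C. \<exists>g \<in> rhom A Z X. is_cokernel Z X Y g f)))"

text \<open>
  Exactness of the inclusion: a short exact sequence of \<open>C\<close> (each map is the kernel, resp. cokernel,
  of the other in \<open>C\<close>) is a short exact sequence of modules.
\<close>

definition exact_inclusion :: bool where
  "exact_inclusion \<longleftrightarrow>
    (\<forall>X \<in> C. \<forall>Y \<in> C. \<forall>Z \<in> C. \<forall>f \<in> rhom A X Y. \<forall>g \<in> rhom A Y Z.
      is_kernel X Y Z f g \<and> is_cokernel X Y Z f g \<longrightarrow>
      inj_on f (carrier X) \<and> f ` carrier X = ker_hom Y Z g \<and> g ` carrier Y = carrier Z)"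

end

definition abelian_exact_subcat ::
  "('a, 'c) ring_scheme \<Rightarrow> ('a, 'a list set) module set \<Rightarrow> bool" where
  "abelian_exact_subcat A C \<longleftrightarrow> C \<subseteq> mod_cat A \<and> abelian_cat A C \<and> exact_inclusion A C"


section \<open>Classes of rings\<close>

definition artinian_cring :: "('k, 'c) ring_scheme \<Rightarrow> bool" where
  "artinian_cring k \<longleftrightarrow> cring k \<and>
    (\<forall>I :: nat \<Rightarrow> 'k set. (\<forall>n. ideal (I n) k \<and> I (Suc n) \<subseteq> I n) \<longrightarrow> (\<exists>N. \<forall>n\<ge>N. I n = I N))"

text \<open>\<open>A\<close> is an Artin algebra over \<open>k\<close> via the structure map \<open>\<eta> : k \<rightarrow> A\<close>.\<close>

definition artin_algebra ::
  "('k, 'c) ring_scheme \<Rightarrow> ('k \<Rightarrow> 'a) \<Rightarrow> ('a, 'd) ring_scheme \<Rightarrow> bool" where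
  "artin_algebra k \<eta> A \<longleftrightarrow> artinian_cring k \<and> ring A \<and> \<eta> \<in> ring_hom k A \<and>
    (\<forall>c \<in> carrier k. \<forall>a \<in> carrier A. \<eta> c \<otimes>\<^bsub>A\<^esub> a = a \<otimes>\<^bsub>A\<^esub> \<eta> c) \<and>
    (\<exists>S \<subseteq> carrier A. finite S \<and>
      (\<forall>a \<in> carrier A. \<exists>c \<in> S \<rightarrow> carrier k. a = (\<Oplus>\<^bsub>A\<^esub>s\<in>S. \<eta> (c s) \<otimes>\<^bsub>A\<^esub> s)))"

definition connected_ring :: "('a, 'c) ring_scheme \<Rightarrow> bool" where
  "connected_ring A \<longleftrightarrow> ring A \<and> carrier A \<noteq> {\<zero>\<^bsub>A\<^esub>} \<and>
    (\<forall>I J. ideal I A \<and> ideal J A \<and> I \<inter> J = {\<zero>\<^bsub>A\<^esub>} \<and> I <+>\<^bsub>A\<^esub> J = carrier A \<longrightarrow>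
      I = {\<zero>\<^bsub>A\<^esub>} \<or> J = {\<zero>\<^bsub>A\<^esub>})"

definition idempotent_elem :: "('a, 'c) ring_scheme \<Rightarrow> 'a \<Rightarrow> bool" where
  "idempotent_elem A e \<longleftrightarrow> e \<in> carrier A \<and> e \<otimes>\<^bsub>A\<^esub> e = e"

definition primitive_idempotent :: "('a, 'c) ring_scheme \<Rightarrow> 'a \<Rightarrow> bool" where
  "primitive_idempotent A e \<longleftrightarrow> idempotent_elem A e \<and> e \<noteq> \<zero>\<^bsub>A\<^esub> \<and>
    (\<forall>f g. idempotent_elem A f \<and> idempotent_elem A g \<and>
       f \<otimes>\<^bsub>A\<^esub> g = \<zero>\<^bsub>A\<^esub> \<and> g \<otimes>\<^bsub>A\<^esub> f = \<zero>\<^bsub>A\<^esub> \<and> e = f \<oplus>\<^bsub>A\<^esub> g \<longrightarrow>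
       f = \<zero>\<^bsub>A\<^esub> \<or> g = \<zero>\<^bsub>A\<^esub>)"

text \<open>The right module \<open>e A\<close>.\<close>

definition idem_module :: "('a, 'c) ring_scheme \<Rightarrow> 'a \<Rightarrow> ('a, 'a) module" where
  "idem_module A e = (regular A)\<lparr>carrier := {e \<otimes>\<^bsub>A\<^esub> a | a. a \<in> carrier A}\<rparr>"

definition basic_ring :: "('a, 'c) ring_scheme \<Rightarrow> bool" where
  "basic_ring A \<longleftrightarrow>
    (\<exists>n::nat. \<exists>e. (\<forall>i<n. primitive_idempotent A (e i)) \<and>
      (\<forall>i<n. \<forall>j<n. i \<noteq> j \<longrightarrow> e i \<otimes>\<^bsub>A\<^esub> e j = \<zero>\<^bsub>A\<^esub>) \<and>
      (\<Oplus>\<^bsub>A\<^esub>i\<in>{..<n}. e i) = \<one>\<^bsub>A\<^esub> \<and>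
      (\<forall>i<n. \<forall>j<n. i \<noteq> j \<longrightarrow> \<not> mod_iso A (idem_module A (e i)) (idem_module A (e j))))"

text \<open>
  Over an Artin algebra right ideals are finitely generated, so projectivity relative to
  \<open>mod_cat H\<close> is the usual one, and right and left hereditary coincide.
\<close>

definition hereditary_ring :: "('a, 'c) ring_scheme \<Rightarrow> bool" where
  "hereditary_ring H \<longleftrightarrow> ring H \<and>
    (\<forall>I. right_ideal I H \<longrightarrow> projective H ((regular H)\<lparr>carrier := I\<rparr>))"

definition maximal_right_ideal :: "'a set \<Rightarrow> ('a, 'c) ring_scheme \<Rightarrow> bool" where
  "maximal_right_ideal I R \<longleftrightarrow> right_ideal I R \<and> I \<noteq> carrier R \<and>
    (\<forall>J. right_ideal J R \<and> I \<subseteq> J \<longrightarrow> J = I \<or> J = carrier R)"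

definition local_ring :: "('a, 'c) ring_scheme \<Rightarrow> bool" where
  "local_ring R \<longleftrightarrow> ring R \<and> (\<exists>!I. maximal_right_ideal I R)"

definition skew_field :: "('a, 'c) ring_scheme \<Rightarrow> bool" where
  "skew_field R \<longleftrightarrow> ring R \<and> \<one>\<^bsub>R\<^esub> \<noteq> \<zero>\<^bsub>R\<^esub> \<and> Units R = carrier R - {\<zero>\<^bsub>R\<^esub>}"


section \<open>Triangular matrix rings\<close>

record ('r, 'h, 'm) bimodule = "('h, 'm) module" +
  lsmult :: "'r \<Rightarrow> 'm \<Rightarrow> 'm"

text \<open>An \<open>R\<close>-\<open>H\<close>-bimodule: \<open>R\<close> acts on the left by \<open>lsmult\<close>, \<open>H\<close> on the right by \<open>smult\<close>.\<close>

locale bimodule = R?: ring R + M?: right_module H M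
  for R :: "('r, 'c) ring_scheme" (structure) and H :: "('h, 'd) ring_scheme" (structure)
    and M :: "('r, 'h, 'm, 'e) bimodule_scheme" (structure) +
  assumes lsmult_closed [simp, intro]:
      "\<lbrakk>r \<in> carrier R; m \<in> carrier M\<rbrakk> \<Longrightarrow> lsmult M r m \<in> carrier M"
    and lsmult_l_distr:
      "\<lbrakk>r \<in> carrier R; s \<in> carrier R; m \<in> carrier M\<rbrakk> \<Longrightarrow>
        lsmult M (r \<oplus>\<^bsub>R\<^esub> s) m = lsmult M r m \<oplus>\<^bsub>M\<^esub> lsmult M s m"
    and lsmult_r_distr:
      "\<lbrakk>r \<in> carrier R; m \<in> carrier M; n \<in> carrier M\<rbrakk> \<Longrightarrow>
        lsmult M r (m \<oplus>\<^bsub>M\<^esub> n) = lsmult M r m \<oplus>\<^bsub>M\<^esub> lsmult M r n"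
    and lsmult_assoc:
      "\<lbrakk>r \<in> carrier R; s \<in> carrier R; m \<in> carrier M\<rbrakk> \<Longrightarrow>
        lsmult M (r \<otimes>\<^bsub>R\<^esub> s) m = lsmult M r (lsmult M s m)"
    and lsmult_one [simp]:
      "m \<in> carrier M \<Longrightarrow> lsmult M \<one>\<^bsub>R\<^esub> m = m"
    and lsmult_smult:
      "\<lbrakk>r \<in> carrier R; h \<in> carrier H; m \<in> carrier M\<rbrakk> \<Longrightarrow>
        lsmult M r (h \<odot>\<^bsub>M\<^esub> m) = h \<odot>\<^bsub>M\<^esub> lsmult M r m"

text \<open>The triple \<open>(h, m, r)\<close> is the matrix with rows \<open>(h, 0)\<close> and \<open>(m, r)\<close>.\<close>

definition triangular ::
  "('h, 'd) ring_scheme \<Rightarrow> ('r, 'h, 'm, 'e) bimodule_scheme \<Rightarrow> ('r, 'c) ring_scheme \<Rightarrow>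
    ('h \<times> 'm \<times> 'r) ring" where
  "triangular H M R =
    \<lparr>carrier = carrier H \<times> carrier M \<times> carrier R,
     mult = (\<lambda>(h, m, r) (h', m', r').
       (h \<otimes>\<^bsub>H\<^esub> h', h' \<odot>\<^bsub>M\<^esub> m \<oplus>\<^bsub>M\<^esub> lsmult M r m', r \<otimes>\<^bsub>R\<^esub> r')),
     one = (\<one>\<^bsub>H\<^esub>, \<zero>\<^bsub>M\<^esub>, \<one>\<^bsub>R\<^esub>),
     zero = (\<zero>\<^bsub>H\<^esub>, \<zero>\<^bsub>M\<^esub>, \<zero>\<^bsub>R\<^esub>),
     add = (\<lambda>(h, m, r) (h', m', r'). (h \<oplus>\<^bsub>H\<^esub> h', m \<oplus>\<^bsub>M\<^esub> m', r \<oplus>\<^bsub>R\<^esub> r'))\<rparr>"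

text \<open>
  The triple \<open>(X, 0, 0)\<close> as a right module over the triangular matrix ring: the matrix
  \<open>(h, m, r)\<close> acts on \<open>X\<close> through its entry \<open>h\<close>.
\<close>

definition H_embed :: "('h, 'x) module \<Rightarrow> ('h \<times> 'm \<times> 'r, 'x) module" where
  "H_embed X = \<lparr>carrier = carrier X, mult = mult X, one = one X, zero = zero X, add = add X,
     smult = (\<lambda>(h, m, r) x. h \<odot>\<^bsub>X\<^esub> x)\<rparr>"

text \<open>\<open>ind H\<close>, identified with a full subcategory of the modules over the triangular matrix ring.\<close>

definition ind_H ::
  "('h, 'd) ring_scheme \<Rightarrow> ('r, 'h, 'm, 'e) bimodule_scheme \<Rightarrow> ('r, 'c) ring_scheme \<Rightarrow>
    ('h \<times> 'm \<times> 'r, ('h \<times> 'm \<times> 'r) list set) module set" where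
  "ind_H H M R = {N \<in> mod_cat (triangular H M R).
     \<exists>X \<in> ind_cat H. mod_iso (triangular H M R) N (H_embed X)}"


section \<open>Basic facts\<close>

lemma (in bimodule) triangular_ring: "ring (triangular H M R)"
proof (rule ringI)
  show "abelian_group (triangular H M R)"
  proof (rule abelian_groupI)
    fix x assume "x \<in> carrier (triangular H M R)"
    then obtain h m r where x: "x = (h, m, r)" "h \<in> carrier H" "m \<in> carrier M" "r \<in> carrier R"
      by (auto simp: triangular_def)
    show "\<exists>y\<in>carrier (triangular H M R). y \<oplus>\<^bsub>triangular H M R\<^esub> x = \<zero>\<^bsub>triangular H M R\<^esub>"
      by (rule bexI[of _ "(\<ominus>\<^bsub>H\<^esub> h, \<ominus>\<^bsub>M\<^esub> m, \<ominus>\<^bsub>R\<^esub> r)"])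
        (use x in \<open>auto simp: triangular_def M.A.l_neg M.X.l_neg R.l_neg\<close>)
  qed (auto simp: triangular_def M.A.a_ac M.X.a_ac R.a_ac)
  have smult_zero: "h \<odot>\<^bsub>M\<^esub> \<zero>\<^bsub>M\<^esub> = \<zero>\<^bsub>M\<^esub>" if "h \<in> carrier H" for h
    using M.smult_r_distr[OF that M.X.zero_closed M.X.zero_closed] that by simp
  have lsmult_zero: "lsmult M r \<zero>\<^bsub>M\<^esub> = \<zero>\<^bsub>M\<^esub>" if "r \<in> carrier R" for r
    using lsmult_r_distr[OF that M.X.zero_closed M.X.zero_closed] that by simp
  show "monoid (triangular H M R)"
  proof (rule monoidI)
    fix x y z assume "x \<in> carrier (triangular H M R)" "y \<in> carrier (triangular H M R)"
      "z \<in> carrier (triangular H M R)"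
    then show "x \<otimes>\<^bsub>triangular H M R\<^esub> y \<otimes>\<^bsub>triangular H M R\<^esub> z =
        x \<otimes>\<^bsub>triangular H M R\<^esub> (y \<otimes>\<^bsub>triangular H M R\<^esub> z)"
      by (auto simp: triangular_def M.A.m_assoc R.m_assoc M.smult_assoc M.smult_r_distr
          lsmult_r_distr lsmult_assoc lsmult_smult M.X.a_assoc)
  qed (auto simp: triangular_def smult_zero lsmult_zero)
  fix x y z assume xyz: "x \<in> carrier (triangular H M R)" "y \<in> carrier (triangular H M R)"
      "z \<in> carrier (triangular H M R)"
  show "(x \<oplus>\<^bsub>triangular H M R\<^esub> y) \<otimes>\<^bsub>triangular H M R\<^esub> z =
      x \<otimes>\<^bsub>triangular H M R\<^esub> z \<oplus>\<^bsub>triangular H M R\<^esub> y \<otimes>\<^bsub>triangular H M R\<^esub> z"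
    using xyz by (auto simp: triangular_def M.A.l_distr R.l_distr M.smult_r_distr lsmult_l_distr
        M.X.a_ac)
  show "z \<otimes>\<^bsub>triangular H M R\<^esub> (x \<oplus>\<^bsub>triangular H M R\<^esub> y) =
      z \<otimes>\<^bsub>triangular H M R\<^esub> x \<oplus>\<^bsub>triangular H M R\<^esub> z \<otimes>\<^bsub>triangular H M R\<^esub> y"
    using xyz by (auto simp: triangular_def M.A.r_distr R.r_distr M.smult_l_distr lsmult_r_distr
        M.X.a_ac)
qed

lemma (in bimodule) H_embed_right_module:
  fixes X :: "('h, 'x) module"
  assumes "right_module H X"
  shows "right_module (triangular H M R) (H_embed X)"
proof -
  interpret X: right_module H X by fact
  have "abelian_group (H_embed X)"
  proof (rule abelian_groupI)
    fix x assume "x \<in> carrier (H_embed X)"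
    then show "\<exists>y\<in>carrier (H_embed X). y \<oplus>\<^bsub>H_embed X\<^esub> x = \<zero>\<^bsub>H_embed X\<^esub>"
      by (intro bexI[of _ "\<ominus>\<^bsub>X\<^esub> x"]) (auto simp: H_embed_def X.l_neg)
  qed (auto simp: H_embed_def X.a_ac)
  then show ?thesis
    by (intro right_module.intro triangular_ring right_module_axioms.intro)
      (auto simp: H_embed_def triangular_def X.smult_l_distr X.smult_r_distr X.smult_assoc)
qed

lemma ex_mod_cat_iso:
  fixes A :: "('a, 'c) ring_scheme" and X :: "('a, 'x, 'd) module_scheme"
  assumes "right_module A X" and "fin_gen A X"
  shows "\<exists>Y \<in> mod_cat A. mod_iso A X Y"
proof -
  interpret right_module A X by fact
  obtain S where S: "S \<subseteq> carrier X" "finite S"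
    "\<And>x. x \<in> carrier X \<Longrightarrow> \<exists>c \<in> S \<rightarrow> carrier A. x = (\<Oplus>\<^bsub>X\<^esub>s\<in>S. c s \<odot>\<^bsub>X\<^esub> s)"
    using assms(2) by (auto simp: fin_gen_def)
  obtain xs where xs: "set xs = S"
    using finite_list[OF S(2)] by blast
  define \<phi> where "\<phi> x = {map c xs | c. c \<in> S \<rightarrow> carrier A \<and> x = (\<Oplus>\<^bsub>X\<^esub>s\<in>S. c s \<odot>\<^bsub>X\<^esub> s)}" for x
  have inj: "inj_on \<phi> (carrier X)"
  proof (rule inj_onI)
    fix x y assume xy: "x \<in> carrier X" "y \<in> carrier X" "\<phi> x = \<phi> y"
    obtain c where c: "c \<in> S \<rightarrow> carrier A" "x = (\<Oplus>\<^bsub>X\<^esub>s\<in>S. c s \<odot>\<^bsub>X\<^esub> s)"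
      using S(3) xy(1) by blast
    then have "map c xs \<in> \<phi> x"
      unfolding \<phi>_def by blast
    then have "map c xs \<in> \<phi> y"
      using xy(3) by simp
    then obtain c' where c': "map c xs = map c' xs" "c' \<in> S \<rightarrow> carrier A"
      "y = (\<Oplus>\<^bsub>X\<^esub>s\<in>S. c' s \<odot>\<^bsub>X\<^esub> s)"
      by (auto simp: \<phi>_def)
    then have "\<And>s. s \<in> S \<Longrightarrow> c s = c' s"
      using xs by auto
    then show "x = y"
      unfolding c(2) c'(3) using c'(2) S(1)
      by (intro X.finsum_cong') auto
  qed
  define \<psi> where "\<psi> = inv_into (carrier X) \<phi>"
  have \<psi> [simp]: "\<psi> (\<phi> x) = x" if "x \<in> carrier X" for x
    using that inj by (simp add: \<psi>_def)
  define Y :: "('a, 'a list set) module" where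
    "Y = \<lparr>carrier = \<phi> ` carrier X, mult = undefined, one = undefined, zero = \<phi> \<zero>\<^bsub>X\<^esub>,
      add = (\<lambda>u v. \<phi> (\<psi> u \<oplus>\<^bsub>X\<^esub> \<psi> v)), smult = (\<lambda>a u. \<phi> (a \<odot>\<^bsub>X\<^esub> \<psi> u))\<rparr>"
  have "abelian_group Y"
  proof (rule abelian_groupI)
    fix u assume "u \<in> carrier Y"
    then show "\<exists>v\<in>carrier Y. v \<oplus>\<^bsub>Y\<^esub> u = \<zero>\<^bsub>Y\<^esub>"
      by (intro bexI[of _ "\<phi> (\<ominus>\<^bsub>X\<^esub> (\<psi> u))"]) (auto simp: Y_def X.l_neg)
  qed (auto simp: Y_def X.a_ac)
  then have Y: "right_module A Y"
    by (intro right_module.intro ring_axioms right_module_axioms.intro)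
      (auto simp: Y_def smult_l_distr smult_r_distr smult_assoc)
  interpret Y: right_module A Y by fact
  have zero: "\<phi> \<zero>\<^bsub>X\<^esub> = \<zero>\<^bsub>Y\<^esub>"
    by (simp add: Y_def)
  have add: "\<phi> (x \<oplus>\<^bsub>X\<^esub> y) = \<phi> x \<oplus>\<^bsub>Y\<^esub> \<phi> y" if "x \<in> carrier X" "y \<in> carrier X" for x y
    using that by (simp add: Y_def)
  have sum: "\<phi> (\<Oplus>\<^bsub>X\<^esub>i\<in>I. f i) = (\<Oplus>\<^bsub>Y\<^esub>i\<in>I. \<phi> (f i))"
    if "finite I" "f \<in> I \<rightarrow> carrier X" for I :: "'x set" and f
    using that
  proof (induction I rule: finite_induct)
    case (insert i I)
    have "(\<lambda>i. \<phi> (f i)) \<in> I \<rightarrow> carrier Y" "\<phi> (f i) \<in> carrier Y"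
      using insert.prems by (auto simp: Y_def)
    moreover have "f \<in> I \<rightarrow> carrier X" "f i \<in> carrier X"
      using insert.prems by auto
    moreover have "(\<Oplus>\<^bsub>X\<^esub>i\<in>I. f i) \<in> carrier X"
      using calculation by simp
    ultimately show ?case
      using insert.hyps insert.IH
      by (simp add: Y.X.finsum_insert X.finsum_insert add)
  qed (simp add: zero)
  have "fin_gen A Y"
    unfolding fin_gen_def
  proof (intro exI[of _ "\<phi> ` S"] conjI ballI)
    fix u assume "u \<in> carrier Y"
    then obtain x where x: "x \<in> carrier X" "u = \<phi> x"
      by (auto simp: Y_def)
    obtain c where c: "c \<in> S \<rightarrow> carrier A" "x = (\<Oplus>\<^bsub>X\<^esub>s\<in>S. c s \<odot>\<^bsub>X\<^esub> s)"
      using S(3) x(1) by blast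
    have cs: "(\<lambda>s. c s \<odot>\<^bsub>X\<^esub> s) \<in> S \<rightarrow> carrier X"
      using c(1) S(1) by auto
    have "u = (\<Oplus>\<^bsub>Y\<^esub>s\<in>S. \<phi> (c s \<odot>\<^bsub>X\<^esub> s))"
      unfolding x(2) c(2) using sum[OF S(2) cs] .
    also have "\<dots> = (\<Oplus>\<^bsub>Y\<^esub>s\<in>S. c (\<psi> (\<phi> s)) \<odot>\<^bsub>Y\<^esub> \<phi> s)"
      using c(1) S(1) by (intro Y.X.finsum_cong') (auto simp: Y_def Pi_def subset_iff)
    also have "\<dots> = (\<Oplus>\<^bsub>Y\<^esub>t\<in>\<phi> ` S. c (\<psi> t) \<odot>\<^bsub>Y\<^esub> t)"
      using c(1) S(1)
      by (intro Y.X.finsum_reindex[symmetric] inj_on_subset[OF inj] S(1))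
        (auto simp: Y_def Pi_def subset_iff)
    finally show "\<exists>c \<in> \<phi> ` S \<rightarrow> carrier A. u = (\<Oplus>\<^bsub>Y\<^esub>t\<in>\<phi> ` S. c t \<odot>\<^bsub>Y\<^esub> t)"
      using c(1) S(1) by (intro bexI[of _ "\<lambda>t. c (\<psi> t)"]) (auto simp: Pi_def subset_iff)
  qed (use S in \<open>auto simp: Y_def\<close>)
  moreover have "mod_iso A X Y"
    unfolding mod_iso_def rhom_def
    by (intro bexI[of _ "restrict \<phi> (carrier X)"])
      (use inj in \<open>auto simp: Y_def bij_betw_def\<close>)
  ultimately show ?thesis
    using Y by (auto simp: mod_cat_def)
qed

end

(*
  Write e for the idempotent (0, 0, 1) of A, so that e A e = R, e A (1 - e) = M and (1 - e) A = H, and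
  mod H consists of the modules X with X e = 0.

  Modules in the left part lie in mod H, whatever M is: if X e is nonzero, then r A -> e A -> X are
  nonzero maps between indecomposables for any r in the right socle of R, and r A has projective
  dimension at least two since the radical of the non-simple local algebra R is not projective.

  If M is injective, so is every quotient of M^n, because H is hereditary; hence (Z e) M splits off the
  H-part of an indecomposable Z, and a Z outside of mod H admits no nonzero map to mod H.  Thus the left
  part is ind H.  If M is not injective, a nonsplit extension of M in mod H can be glued to e A so as to
  give an indecomposable module outside of mod H that maps onto a nonzero H-module.

  If add of the left part is abelian exact, then it contains mod H: it contains the projective
  H-modules, since a map to one of them from an indecomposable module has projective image and thus is
  zero or injective, and every H-module is the cokernel of a monomorphism between projectives.
*)
theory Submission
  imports Defs
begin

section \<open>Modules and linear maps\<close>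

text \<open>Projectivity is tested against finitely generated modules only, so it is traded for a
  finite dual basis throughout. This is a statement about elements: it lifts maps along every
  surjection whatever the carrier types, passes to summands and sums, and detects that a radical is
  not projective by evaluating linear forms at one element. Finite generation of submodules comes
  from the commutative base ring, where the descending chain condition implies it. Membership in
  add(C) is reached through one decomposition whose terms are retracts, and exploited through maps
  to C that separate elements. The injectivity of quotients of M^n enters in one form: a map from a
  submodule of a projective H-module to such a quotient extends if it is a sum of maps factoring
  through M. Dual bases produce exactly such sums. Conversely, the obstruction to extending a map f
  into M becomes a module by way of a pushout with e A; a quotient of it in which e A is essential
  is indecomposable because e A e is local. The main arguments see the algebra only through e, so
  matrices enter in the last section alone.\<close>

context right_module
begin

lemma smult_zero [simp]: "a \<in> carrier A \<Longrightarrow> a \<odot>\<^bsub>X\<^esub> \<zero>\<^bsub>X\<^esub> = \<zero>\<^bsub>X\<^esub>"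
  using smult_r_distr[of a "\<zero>\<^bsub>X\<^esub>" "\<zero>\<^bsub>X\<^esub>"] by simp

lemma zero_smult [simp]: "x \<in> carrier X \<Longrightarrow> \<zero>\<^bsub>A\<^esub> \<odot>\<^bsub>X\<^esub> x = \<zero>\<^bsub>X\<^esub>"
  using smult_l_distr[of "\<zero>\<^bsub>A\<^esub>" "\<zero>\<^bsub>A\<^esub>" x] by simp

lemma minus_self [simp]: "x \<in> carrier X \<Longrightarrow> x \<ominus>\<^bsub>X\<^esub> x = \<zero>\<^bsub>X\<^esub>"
  by (simp add: a_minus_def X.r_neg)

lemma minus_zero [simp]: "x \<in> carrier X \<Longrightarrow> x \<ominus>\<^bsub>X\<^esub> \<zero>\<^bsub>X\<^esub> = x"
  using X.minus_equality[of "\<zero>\<^bsub>X\<^esub>" "\<zero>\<^bsub>X\<^esub>"] by (simp add: a_minus_def)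

lemma minus_eq_zero_iff:
  assumes "x \<in> carrier X" "y \<in> carrier X"
  shows "x \<ominus>\<^bsub>X\<^esub> y = \<zero>\<^bsub>X\<^esub> \<longleftrightarrow> x = y"
  using assms X.minus_equality[of x "\<ominus>\<^bsub>X\<^esub> y"] minus_self[of y] by (auto simp: a_minus_def)

lemma minus_trans:
  assumes "x \<in> carrier X" "y \<in> carrier X" "z \<in> carrier X"
  shows "(x \<ominus>\<^bsub>X\<^esub> y) \<oplus>\<^bsub>X\<^esub> (y \<ominus>\<^bsub>X\<^esub> z) = x \<ominus>\<^bsub>X\<^esub> z"
proof -
  have "(x \<ominus>\<^bsub>X\<^esub> y) \<oplus>\<^bsub>X\<^esub> (y \<ominus>\<^bsub>X\<^esub> z) = x \<oplus>\<^bsub>X\<^esub> ((\<ominus>\<^bsub>X\<^esub> y \<oplus>\<^bsub>X\<^esub> y) \<oplus>\<^bsub>X\<^esub> \<ominus>\<^bsub>X\<^esub> z)"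
    using assms by (simp add: a_minus_def X.a_assoc)
  then show ?thesis using assms by (simp add: X.l_neg a_minus_def)
qed

lemma neg_minus:
  assumes "x \<in> carrier X" "y \<in> carrier X"
  shows "\<ominus>\<^bsub>X\<^esub> (x \<ominus>\<^bsub>X\<^esub> y) = y \<ominus>\<^bsub>X\<^esub> x"
  using assms by (simp add: a_minus_def X.minus_add X.a_comm)

lemma minus_add_minus:
  assumes "x \<in> carrier X" "x' \<in> carrier X" "y \<in> carrier X" "y' \<in> carrier X"
  shows "(x \<ominus>\<^bsub>X\<^esub> x') \<oplus>\<^bsub>X\<^esub> (y \<ominus>\<^bsub>X\<^esub> y') = (x \<oplus>\<^bsub>X\<^esub> y) \<ominus>\<^bsub>X\<^esub> (x' \<oplus>\<^bsub>X\<^esub> y')"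
  using assms by (simp add: a_minus_def X.minus_add X.a_ac)

lemma minus_smult:
  assumes "a \<in> carrier A" "x \<in> carrier X"
  shows "(\<ominus>\<^bsub>A\<^esub> a) \<odot>\<^bsub>X\<^esub> x = \<ominus>\<^bsub>X\<^esub> (a \<odot>\<^bsub>X\<^esub> x)"
  using smult_l_distr[of "\<ominus>\<^bsub>A\<^esub> a" a x] assms
  by (simp add: A.l_neg X.minus_equality)

lemma smult_minus:
  assumes "a \<in> carrier A" "x \<in> carrier X"
  shows "a \<odot>\<^bsub>X\<^esub> (\<ominus>\<^bsub>X\<^esub> x) = \<ominus>\<^bsub>X\<^esub> (a \<odot>\<^bsub>X\<^esub> x)"
  using smult_r_distr[of a "\<ominus>\<^bsub>X\<^esub> x" x] assms
  by (simp add: X.l_neg X.minus_equality)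

lemma smult_diff:
  assumes "a \<in> carrier A" "x \<in> carrier X" "y \<in> carrier X"
  shows "a \<odot>\<^bsub>X\<^esub> (x \<ominus>\<^bsub>X\<^esub> y) = a \<odot>\<^bsub>X\<^esub> x \<ominus>\<^bsub>X\<^esub> a \<odot>\<^bsub>X\<^esub> y"
  using assms smult_minus[of a y] by (simp add: a_minus_def smult_r_distr)

text \<open>Closure under negation, which the underlying subgroup requires, comes from the action of
  -1.\<close>

lemma submoduleI:
  assumes "N \<subseteq> carrier X" and "\<zero>\<^bsub>X\<^esub> \<in> N"
    and "\<And>x y. \<lbrakk>x \<in> N; y \<in> N\<rbrakk> \<Longrightarrow> x \<oplus>\<^bsub>X\<^esub> y \<in> N"
    and "\<And>a x. \<lbrakk>a \<in> carrier A; x \<in> N\<rbrakk> \<Longrightarrow> a \<odot>\<^bsub>X\<^esub> x \<in> N"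
  shows "submodule N A X"
proof -
  have "\<ominus>\<^bsub>X\<^esub> x \<in> N" if "x \<in> N" for x
    using assms(4)[of "\<ominus>\<^bsub>A\<^esub> \<one>\<^bsub>A\<^esub>" x] that assms(1) by (auto simp: minus_smult subset_iff)
  then show ?thesis
    using assms by (intro submodule.intro subgroup.intro submodule_axioms.intro) (auto simp: a_inv_def)
qed

lemma submoduleD:
  assumes "submodule N A X"
  shows "N \<subseteq> carrier X" and "\<zero>\<^bsub>X\<^esub> \<in> N"
    and "\<And>x. x \<in> N \<Longrightarrow> x \<in> carrier X"
    and "\<And>x y. \<lbrakk>x \<in> N; y \<in> N\<rbrakk> \<Longrightarrow> x \<oplus>\<^bsub>X\<^esub> y \<in> N"
    and "\<And>a x. \<lbrakk>a \<in> carrier A; x \<in> N\<rbrakk> \<Longrightarrow> a \<odot>\<^bsub>X\<^esub> x \<in> N"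
    and "\<And>x. x \<in> N \<Longrightarrow> \<ominus>\<^bsub>X\<^esub> x \<in> N"
proof -
  interpret N: submodule N A X by fact
  show sub: "N \<subseteq> carrier X" and "\<zero>\<^bsub>X\<^esub> \<in> N"
    using N.subset N.one_closed by auto
  show "\<And>x. x \<in> N \<Longrightarrow> x \<in> carrier X" using sub by auto
  show "\<And>x y. \<lbrakk>x \<in> N; y \<in> N\<rbrakk> \<Longrightarrow> x \<oplus>\<^bsub>X\<^esub> y \<in> N" using N.m_closed by simp
  show "\<And>a x. \<lbrakk>a \<in> carrier A; x \<in> N\<rbrakk> \<Longrightarrow> a \<odot>\<^bsub>X\<^esub> x \<in> N" using N.smult_closed by simp
  show "\<And>x. x \<in> N \<Longrightarrow> \<ominus>\<^bsub>X\<^esub> x \<in> N" using N.m_inv_closed by (simp add: a_inv_def)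
qed

lemma submodule_minus:
  assumes "submodule N A X" "x \<in> N" "y \<in> N"
  shows "x \<ominus>\<^bsub>X\<^esub> y \<in> N"
  using assms submoduleD[OF assms(1)] by (simp add: a_minus_def)

lemma submodule_carrier: "submodule (carrier X) A X"
  by (rule submoduleI) auto

lemma submodule_zero: "submodule {\<zero>\<^bsub>X\<^esub>} A X"
  by (rule submoduleI) auto

lemma submodule_Int:
  assumes "submodule N A X" "submodule N' A X"
  shows "submodule (N \<inter> N') A X"
  using submoduleD[OF assms(1)] submoduleD[OF assms(2)] by (intro submoduleI) auto

lemma submodule_sum:
  assumes "submodule N A X" "submodule N' A X"
  shows "submodule (N <+>\<^bsub>X\<^esub> N') A X"
proof (rule submoduleI)
  note N = submoduleD[OF assms(1)] note N' = submoduleD[OF assms(2)]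
  show "N <+>\<^bsub>X\<^esub> N' \<subseteq> carrier X"
    using N N' by (auto simp: set_add_def' subset_iff)
  show "\<zero>\<^bsub>X\<^esub> \<in> N <+>\<^bsub>X\<^esub> N'"
    using N(2) N'(2) by (force simp: set_add_def')
  show "x \<oplus>\<^bsub>X\<^esub> y \<in> N <+>\<^bsub>X\<^esub> N'" if xy: "x \<in> N <+>\<^bsub>X\<^esub> N'" "y \<in> N <+>\<^bsub>X\<^esub> N'" for x y
  proof -
    obtain n n' m m' where *: "x = n \<oplus>\<^bsub>X\<^esub> n'" "y = m \<oplus>\<^bsub>X\<^esub> m'" "n \<in> N" "m \<in> N" "n' \<in> N'" "m' \<in> N'"
      using xy unfolding set_add_def' by blast
    have "x \<oplus>\<^bsub>X\<^esub> y = (n \<oplus>\<^bsub>X\<^esub> m) \<oplus>\<^bsub>X\<^esub> (n' \<oplus>\<^bsub>X\<^esub> m')"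
      using * N(3) N'(3) by (simp add: X.a_ac)
    then show ?thesis
      using * N(4) N'(4) by (force simp: set_add_def')
  qed
  show "a \<odot>\<^bsub>X\<^esub> x \<in> N <+>\<^bsub>X\<^esub> N'" if ax: "a \<in> carrier A" "x \<in> N <+>\<^bsub>X\<^esub> N'" for a x
  proof -
    obtain n n' where *: "x = n \<oplus>\<^bsub>X\<^esub> n'" "n \<in> N" "n' \<in> N'"
      using ax unfolding set_add_def' by blast
    then have "a \<odot>\<^bsub>X\<^esub> x = a \<odot>\<^bsub>X\<^esub> n \<oplus>\<^bsub>X\<^esub> a \<odot>\<^bsub>X\<^esub> n'"
      using ax N(3) N'(3) by (simp add: smult_r_distr)
    then show ?thesis
      using * ax N(5) N'(5) by (force simp: set_add_def')
  qed
qed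

lemma sub_right_module:
  assumes "submodule N A X"
  shows "right_module A (X\<lparr>carrier := N\<rparr>)"
proof -
  note N = submoduleD[OF assms]
  have "abelian_group (X\<lparr>carrier := N\<rparr>)"
  proof (rule abelian_groupI)
    fix x assume "x \<in> carrier (X\<lparr>carrier := N\<rparr>)"
    then show "\<exists>y\<in>carrier (X\<lparr>carrier := N\<rparr>). y \<oplus>\<^bsub>X\<lparr>carrier := N\<rparr>\<^esub> x = \<zero>\<^bsub>X\<lparr>carrier := N\<rparr>\<^esub>"
      using N(3,6) by (auto intro!: bexI[of _ "\<ominus>\<^bsub>X\<^esub> x"] simp: X.l_neg)
  qed (use N in \<open>auto simp: X.a_ac\<close>)
  then show ?thesis
    by (intro right_module.intro right_module_axioms.intro A.ring_axioms)
      (use N in \<open>auto simp: smult_l_distr smult_r_distr smult_assoc\<close>)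
qed

lemma submodule_sub_iff:
  assumes "submodule N A X"
  shows "submodule U A (X\<lparr>carrier := N\<rparr>) \<longleftrightarrow> submodule U A X \<and> U \<subseteq> N"
proof -
  note N = submoduleD[OF assms]
  interpret N: right_module A "X\<lparr>carrier := N\<rparr>" by (rule sub_right_module) fact
  show ?thesis
  proof
    assume "submodule U A (X\<lparr>carrier := N\<rparr>)"
    note U = N.submoduleD[OF this]
    show "submodule U A X \<and> U \<subseteq> N"
      using U N(1) by (auto intro!: submoduleI)
  next
    assume *: "submodule U A X \<and> U \<subseteq> N"
    then have "submodule U A X" by simp
    note U = submoduleD[OF this]
    show "submodule U A (X\<lparr>carrier := N\<rparr>)"
      using U * by (auto intro!: N.submoduleI)
  qed
qed

text \<open>This is the cyclic submodule x A; in \<open>regular A\<close> it is the principal right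
  ideal generated by x.\<close>

lemma smult_closure_submodule:
  assumes "x \<in> carrier X"
  shows "submodule {a \<odot>\<^bsub>X\<^esub> x | a. a \<in> carrier A} A X"
proof (rule submoduleI)
  show "\<zero>\<^bsub>X\<^esub> \<in> {a \<odot>\<^bsub>X\<^esub> x | a. a \<in> carrier A}"
    using zero_smult[OF assms] A.zero_closed by (metis (mono_tags, lifting) mem_Collect_eq)
next
  fix y z assume "y \<in> {a \<odot>\<^bsub>X\<^esub> x | a. a \<in> carrier A}" "z \<in> {a \<odot>\<^bsub>X\<^esub> x | a. a \<in> carrier A}"
  then obtain a b where "y = a \<odot>\<^bsub>X\<^esub> x" "z = b \<odot>\<^bsub>X\<^esub> x" "a \<in> carrier A" "b \<in> carrier A" by auto
  then show "y \<oplus>\<^bsub>X\<^esub> z \<in> {a \<odot>\<^bsub>X\<^esub> x | a. a \<in> carrier A}"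
    using smult_l_distr[of a b x] assms by (auto intro!: exI[of _ "a \<oplus>\<^bsub>A\<^esub> b"])
next
  fix a y assume a: "a \<in> carrier A" and "y \<in> {a \<odot>\<^bsub>X\<^esub> x | a. a \<in> carrier A}"
  then obtain b where "y = b \<odot>\<^bsub>X\<^esub> x" "b \<in> carrier A" by auto
  then show "a \<odot>\<^bsub>X\<^esub> y \<in> {a \<odot>\<^bsub>X\<^esub> x | a. a \<in> carrier A}"
    using smult_assoc[of b a x] assms a by (auto intro!: exI[of _ "b \<otimes>\<^bsub>A\<^esub> a"])
qed (use assms in auto)

lemma finsum_submodule:
  assumes "submodule N A X" "finite S" "f \<in> S \<rightarrow> N"
  shows "(\<Oplus>\<^bsub>X\<^esub>s\<in>S. f s) \<in> N"
  using assms(2,3)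
proof (induction S rule: finite_induct)
  case empty
  then show ?case using submoduleD(2)[OF assms(1)] by simp
next
  case (insert s S)
  have "f s \<in> carrier X" "f \<in> S \<rightarrow> carrier X"
    using insert.prems submoduleD(3)[OF assms(1)] by auto
  then show ?case
    using insert submoduleD(4)[OF assms(1)] by (simp add: X.finsum_insert Pi_def)
qed

lemma finsum_smult:
  assumes "finite S" "f \<in> S \<rightarrow> carrier X" "a \<in> carrier A"
  shows "a \<odot>\<^bsub>X\<^esub> (\<Oplus>\<^bsub>X\<^esub>s\<in>S. f s) = (\<Oplus>\<^bsub>X\<^esub>s\<in>S. a \<odot>\<^bsub>X\<^esub> f s)"
  using assms(1,2)
proof (induction S rule: finite_induct)
  case empty
  then show ?case using assms(3) by simp
next
  case (insert s S)
  have "f s \<in> carrier X" "f \<in> S \<rightarrow> carrier X"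
    using insert.prems by auto
  moreover have "(\<lambda>s. a \<odot>\<^bsub>X\<^esub> f s) \<in> S \<rightarrow> carrier X"
    using calculation assms(3) by auto
  ultimately show ?case
    using insert assms(3) by (simp add: X.finsum_insert smult_r_distr)
qed

text \<open>Trades linear combinations for a condition on submodules: a finite set that lies in no
  proper submodule. In this form finite generation is transported by taking preimages of submodules,
  without handling finite sums.\<close>

lemma fin_gen_iff:
  "fin_gen A X \<longleftrightarrow>
    (\<exists>S \<subseteq> carrier X. finite S \<and> (\<forall>N. submodule N A X \<longrightarrow> S \<subseteq> N \<longrightarrow> carrier X \<subseteq> N))"
proof
  assume "fin_gen A X"
  then obtain S where S: "S \<subseteq> carrier X" "finite S"
    "\<And>x. x \<in> carrier X \<Longrightarrow> \<exists>c \<in> S \<rightarrow> carrier A. x = (\<Oplus>\<^bsub>X\<^esub>s\<in>S. c s \<odot>\<^bsub>X\<^esub> s)"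
    unfolding fin_gen_def by blast
  have "carrier X \<subseteq> N" if N: "submodule N A X" "S \<subseteq> N" for N
  proof
    fix x assume "x \<in> carrier X"
    then obtain c where "c \<in> S \<rightarrow> carrier A" "x = (\<Oplus>\<^bsub>X\<^esub>s\<in>S. c s \<odot>\<^bsub>X\<^esub> s)"
      using S(3) by blast
    then show "x \<in> N"
      using finsum_submodule[OF N(1) S(2), of "\<lambda>s. c s \<odot>\<^bsub>X\<^esub> s"] N submoduleD(5)[OF N(1)]
      by (auto simp: Pi_def)
  qed
  then show "\<exists>S \<subseteq> carrier X. finite S \<and> (\<forall>N. submodule N A X \<longrightarrow> S \<subseteq> N \<longrightarrow> carrier X \<subseteq> N)"
    using S by blast
next
  assume "\<exists>S \<subseteq> carrier X. finite S \<and> (\<forall>N. submodule N A X \<longrightarrow> S \<subseteq> N \<longrightarrow> carrier X \<subseteq> N)"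
  then obtain S where S: "S \<subseteq> carrier X" "finite S"
    "\<And>N. \<lbrakk>submodule N A X; S \<subseteq> N\<rbrakk> \<Longrightarrow> carrier X \<subseteq> N" by blast
  \<comment> \<open>The combinations of S form a submodule containing S, hence exhaust the
    module.\<close>
  define N where "N = {(\<Oplus>\<^bsub>X\<^esub>s\<in>S. c s \<odot>\<^bsub>X\<^esub> s) | c. c \<in> S \<rightarrow> carrier A}"
  have cl: "(\<lambda>s. c s \<odot>\<^bsub>X\<^esub> s) \<in> S \<rightarrow> carrier X" if "c \<in> S \<rightarrow> carrier A" for c
    using that S(1) by auto
  have "submodule N A X"
  proof (rule submoduleI)
    show "N \<subseteq> carrier X"
      unfolding N_def using cl by (auto intro!: X.finsum_closed)
    have "(\<Oplus>\<^bsub>X\<^esub>s\<in>S. \<zero>\<^bsub>A\<^esub> \<odot>\<^bsub>X\<^esub> s) = (\<Oplus>\<^bsub>X\<^esub>s\<in>S. \<zero>\<^bsub>X\<^esub>)"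
      using S(1) by (intro X.finsum_cong') auto
    then have "\<zero>\<^bsub>X\<^esub> = (\<Oplus>\<^bsub>X\<^esub>s\<in>S. \<zero>\<^bsub>A\<^esub> \<odot>\<^bsub>X\<^esub> s)"
      by (simp add: X.finsum_zero)
    then show "\<zero>\<^bsub>X\<^esub> \<in> N"
      unfolding N_def by (auto intro!: exI[of _ "\<lambda>_. \<zero>\<^bsub>A\<^esub>"])
  next
    fix x y assume "x \<in> N" "y \<in> N"
    then obtain c d where c: "c \<in> S \<rightarrow> carrier A" "x = (\<Oplus>\<^bsub>X\<^esub>s\<in>S. c s \<odot>\<^bsub>X\<^esub> s)"
      and d: "d \<in> S \<rightarrow> carrier A" "y = (\<Oplus>\<^bsub>X\<^esub>s\<in>S. d s \<odot>\<^bsub>X\<^esub> s)" unfolding N_def by blast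
    have "x \<oplus>\<^bsub>X\<^esub> y = (\<Oplus>\<^bsub>X\<^esub>s\<in>S. c s \<odot>\<^bsub>X\<^esub> s \<oplus>\<^bsub>X\<^esub> d s \<odot>\<^bsub>X\<^esub> s)"
      unfolding c(2) d(2) using cl c(1) d(1) by (simp add: X.finsum_addf)
    also have "\<dots> = (\<Oplus>\<^bsub>X\<^esub>s\<in>S. (c s \<oplus>\<^bsub>A\<^esub> d s) \<odot>\<^bsub>X\<^esub> s)"
      using c(1) d(1) S(1) by (intro X.finsum_cong') (auto simp: smult_l_distr Pi_def subset_iff)
    finally show "x \<oplus>\<^bsub>X\<^esub> y \<in> N"
      unfolding N_def using c(1) d(1) by (auto intro!: exI[of _ "\<lambda>s. c s \<oplus>\<^bsub>A\<^esub> d s"])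
  next
    fix a x assume a: "a \<in> carrier A" and "x \<in> N"
    then obtain c where c: "c \<in> S \<rightarrow> carrier A" "x = (\<Oplus>\<^bsub>X\<^esub>s\<in>S. c s \<odot>\<^bsub>X\<^esub> s)"
      unfolding N_def by blast
    have "a \<odot>\<^bsub>X\<^esub> x = (\<Oplus>\<^bsub>X\<^esub>s\<in>S. a \<odot>\<^bsub>X\<^esub> (c s \<odot>\<^bsub>X\<^esub> s))"
      unfolding c(2) using cl c(1) a S(2) by (simp add: finsum_smult)
    also have "\<dots> = (\<Oplus>\<^bsub>X\<^esub>s\<in>S. (c s \<otimes>\<^bsub>A\<^esub> a) \<odot>\<^bsub>X\<^esub> s)"
      using c(1) a S(1) by (intro X.finsum_cong') (auto simp: smult_assoc Pi_def subset_iff)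
    finally show "a \<odot>\<^bsub>X\<^esub> x \<in> N"
      unfolding N_def using c(1) a by (auto intro!: exI[of _ "\<lambda>s. c s \<otimes>\<^bsub>A\<^esub> a"])
  qed
  moreover have "S \<subseteq> N"
  proof
    fix s assume s: "s \<in> S"
    have "(\<Oplus>\<^bsub>X\<^esub>t\<in>S. (if s = t then \<one>\<^bsub>A\<^esub> else \<zero>\<^bsub>A\<^esub>) \<odot>\<^bsub>X\<^esub> t) = (\<Oplus>\<^bsub>X\<^esub>t\<in>S. if s = t then t else \<zero>\<^bsub>X\<^esub>)"
      using S(1) by (intro X.finsum_cong') (auto simp: subset_iff)
    also have "\<dots> = s"
      using s S by (intro X.finsum_singleton) auto
    finally show "s \<in> N"
      unfolding N_def by (auto intro!: exI[of _ "\<lambda>t. if s = t then \<one>\<^bsub>A\<^esub> else \<zero>\<^bsub>A\<^esub>"])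
  qed
  ultimately have "carrier X \<subseteq> N" by (rule S(3))
  then show "fin_gen A X"
    unfolding fin_gen_def N_def using S(1,2) by blast
qed

text \<open>Avoiding a set D covers three uses. For D = {1} the result is a maximal right ideal. For
  D = {x} the class of x lies in every nonzero submodule of the quotient by N. If D consists of the
  nonzero elements of a submodule, that submodule embeds into the quotient by N and is essential
  there.\<close>

lemma ex_maximal_submodule_avoiding:
  assumes "submodule U A X" "U \<inter> D = {}"
  obtains N where "submodule N A X" "U \<subseteq> N" "N \<inter> D = {}"
    "\<forall>N'. submodule N' A X \<longrightarrow> N \<subseteq> N' \<longrightarrow> N' \<inter> D = {} \<longrightarrow> N' = N"
proof -
  define \<S> where "\<S> = {N. submodule N A X \<and> U \<subseteq> N \<and> N \<inter> D = {}}"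
  have "\<exists>M\<in>\<S>. \<forall>N\<in>\<S>. M \<subseteq> N \<longrightarrow> N = M"
  proof (rule subset_Zorn_nonempty)
    show "\<S> \<noteq> {}" using assms unfolding \<S>_def by auto
    fix \<C> assume \<C>: "\<C> \<noteq> {}" "subset.chain \<S> \<C>"
    then have C: "submodule N A X" "U \<subseteq> N" "N \<inter> D = {}" if "N \<in> \<C>" for N
      using that by (auto simp: \<S>_def subset.chain_def)
    have "submodule (\<Union>\<C>) A X"
    proof (rule submoduleI)
      fix x y assume "x \<in> \<Union>\<C>" "y \<in> \<Union>\<C>"
      then obtain N N' where N: "x \<in> N" "N \<in> \<C>" "y \<in> N'" "N' \<in> \<C>" by auto
      then have "N \<subseteq> N' \<or> N' \<subseteq> N" using \<C>(2) by (meson subset_chain_def)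
      then show "x \<oplus>\<^bsub>X\<^esub> y \<in> \<Union>\<C>"
        using N submoduleD(4)[OF C(1)] by blast
    next
      show "\<Union>\<C> \<subseteq> carrier X" using submoduleD(1)[OF C(1)] by blast
      show "\<zero>\<^bsub>X\<^esub> \<in> \<Union>\<C>" using \<C>(1) submoduleD(2)[OF C(1)] by blast
      show "a \<odot>\<^bsub>X\<^esub> x \<in> \<Union>\<C>" if "a \<in> carrier A" "x \<in> \<Union>\<C>" for a x
        using submoduleD(5)[OF C(1)] that by blast
    qed
    then show "\<Union>\<C> \<in> \<S>"
      using C \<C>(1) unfolding \<S>_def by blast
  qed
  then obtain N where N: "N \<in> \<S>" "\<And>N'. N' \<in> \<S> \<Longrightarrow> N \<subseteq> N' \<Longrightarrow> N' = N" by blast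
  show ?thesis
  proof (rule that[of N])
    show "\<forall>N'. submodule N' A X \<longrightarrow> N \<subseteq> N' \<longrightarrow> N' \<inter> D = {} \<longrightarrow> N' = N"
      using N unfolding \<S>_def by blast
  qed (use N(1) in \<open>auto simp: \<S>_def\<close>)
qed

end

text \<open>Homomorphisms without the extensionality that \<open>rhom\<close> demands, so that they
  can be written as plain lambda terms and composed by application; \<open>lin_restrict\<close>
  leads back to \<open>rhom\<close>.\<close>

definition lin ::
  "('a, 'c) ring_scheme \<Rightarrow> ('a, 'x, 'd) module_scheme \<Rightarrow> ('a, 'y, 'e) module_scheme \<Rightarrow> ('x \<Rightarrow> 'y) \<Rightarrow> bool"
where
  "lin A X Y f \<longleftrightarrow> f \<in> carrier X \<rightarrow> carrier Y \<and>
      (\<forall>x \<in> carrier X. \<forall>y \<in> carrier X. f (x \<oplus>\<^bsub>X\<^esub> y) = f x \<oplus>\<^bsub>Y\<^esub> f y) \<and>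
      (\<forall>a \<in> carrier A. \<forall>x \<in> carrier X. f (a \<odot>\<^bsub>X\<^esub> x) = a \<odot>\<^bsub>Y\<^esub> f x)"

lemma linI:
  assumes "\<And>x. x \<in> carrier X \<Longrightarrow> f x \<in> carrier Y"
    and "\<And>x y. \<lbrakk>x \<in> carrier X; y \<in> carrier X\<rbrakk> \<Longrightarrow> f (x \<oplus>\<^bsub>X\<^esub> y) = f x \<oplus>\<^bsub>Y\<^esub> f y"
    and "\<And>a x. \<lbrakk>a \<in> carrier A; x \<in> carrier X\<rbrakk> \<Longrightarrow> f (a \<odot>\<^bsub>X\<^esub> x) = a \<odot>\<^bsub>Y\<^esub> f x"
  shows "lin A X Y f"
  using assms by (auto simp: lin_def)

lemma linD:
  assumes "lin A X Y f"
  shows "\<And>x. x \<in> carrier X \<Longrightarrow> f x \<in> carrier Y"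
    and "\<And>x y. \<lbrakk>x \<in> carrier X; y \<in> carrier X\<rbrakk> \<Longrightarrow> f (x \<oplus>\<^bsub>X\<^esub> y) = f x \<oplus>\<^bsub>Y\<^esub> f y"
    and "\<And>a x. \<lbrakk>a \<in> carrier A; x \<in> carrier X\<rbrakk> \<Longrightarrow> f (a \<odot>\<^bsub>X\<^esub> x) = a \<odot>\<^bsub>Y\<^esub> f x"
  using assms by (auto simp: lin_def)

lemma rhom_iff_lin: "f \<in> rhom A X Y \<longleftrightarrow> lin A X Y f \<and> f \<in> extensional (carrier X)"
  by (auto simp: rhom_def lin_def PiE_def)

lemma rhom_lin: "f \<in> rhom A X Y \<Longrightarrow> lin A X Y f"
  by (simp add: rhom_iff_lin)

lemma lin_cong:
  assumes "lin A X Y f" "\<And>x. x \<in> carrier X \<Longrightarrow> g x = f x" "right_module A X"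
  shows "lin A X Y g"
proof -
  interpret X: right_module A X by fact
  show ?thesis using linD[OF assms(1)] assms(2) by (intro linI) simp_all
qed

lemma lin_restrict:
  assumes "lin A X Y f" "right_module A X"
  shows "restrict f (carrier X) \<in> rhom A X Y"
  using lin_cong[OF assms(1) _ assms(2), of "restrict f (carrier X)"] by (simp add: rhom_iff_lin)

lemma lin_comp:
  assumes "lin A X Y f" "lin A Y Z g"
  shows "lin A X Z (\<lambda>x. g (f x))"
  using linD[OF assms(1)] linD[OF assms(2)] by (intro linI) simp_all

lemma lin_id: "lin A X X (\<lambda>x. x)"
  by (rule linI) auto

lemma lin_sub:
  assumes "lin A X Y f" "right_module A X" "submodule N A X"
  shows "lin A (X\<lparr>carrier := N\<rparr>) Y f"
  using linD[OF assms(1)] right_module.submoduleD[OF assms(2,3)] by (intro linI) auto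

lemma lin_into_sub:
  assumes "lin A X Y f" "\<And>x. x \<in> carrier X \<Longrightarrow> f x \<in> N"
  shows "lin A X (Y\<lparr>carrier := N\<rparr>) f"
  using linD[OF assms(1)] assms(2) by (intro linI) auto

lemma lin_from_sub:
  assumes "lin A X (Y\<lparr>carrier := N\<rparr>) f" "N \<subseteq> carrier Y"
  shows "lin A X Y f"
  using linD[OF assms(1)] assms(2) by (intro linI) auto

locale two_modules = X: right_module A X + Y: right_module A Y
  for A :: "('a, 'c) ring_scheme" and X :: "('a, 'x, 'd) module_scheme"
    and Y :: "('a, 'y, 'e) module_scheme"
begin

lemma lin_zero:
  assumes "lin A X Y f"
  shows "f \<zero>\<^bsub>X\<^esub> = \<zero>\<^bsub>Y\<^esub>"
  using linD(3)[OF assms, of "\<zero>\<^bsub>A\<^esub>" "\<zero>\<^bsub>X\<^esub>"] linD(1)[OF assms, of "\<zero>\<^bsub>X\<^esub>"] by simp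

lemma lin_neg:
  assumes "lin A X Y f" "x \<in> carrier X"
  shows "f (\<ominus>\<^bsub>X\<^esub> x) = \<ominus>\<^bsub>Y\<^esub> (f x)"
proof -
  have "f (\<ominus>\<^bsub>X\<^esub> x) \<oplus>\<^bsub>Y\<^esub> f x = \<zero>\<^bsub>Y\<^esub>"
    using linD(2)[OF assms(1), of "\<ominus>\<^bsub>X\<^esub> x" x] assms lin_zero[OF assms(1)] by (simp add: X.X.l_neg)
  then show ?thesis
    using linD(1)[OF assms(1)] assms(2) by (simp add: Y.X.minus_equality)
qed

lemma lin_minus:
  assumes "lin A X Y f" "x \<in> carrier X" "y \<in> carrier X"
  shows "f (x \<ominus>\<^bsub>X\<^esub> y) = f x \<ominus>\<^bsub>Y\<^esub> f y"
  using linD[OF assms(1)] assms(2,3) lin_neg[OF assms(1,3)] by (simp add: a_minus_def)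

lemma lin_zero_fun: "lin A X Y (\<lambda>x. \<zero>\<^bsub>Y\<^esub>)"
  by (rule linI) auto

lemma lin_add:
  assumes "lin A X Y f" "lin A X Y g"
  shows "lin A X Y (\<lambda>x. f x \<oplus>\<^bsub>Y\<^esub> g x)"
  using linD[OF assms(1)] linD[OF assms(2)]
  by (intro linI) (simp_all add: Y.X.a_ac Y.smult_r_distr)

lemma lin_diff:
  assumes "lin A X Y f" "lin A X Y g"
  shows "lin A X Y (\<lambda>x. f x \<ominus>\<^bsub>Y\<^esub> g x)"
proof (rule linI)
  note f = linD[OF assms(1)] note g = linD[OF assms(2)]
  show "f (x \<oplus>\<^bsub>X\<^esub> y) \<ominus>\<^bsub>Y\<^esub> g (x \<oplus>\<^bsub>X\<^esub> y) = f x \<ominus>\<^bsub>Y\<^esub> g x \<oplus>\<^bsub>Y\<^esub> (f y \<ominus>\<^bsub>Y\<^esub> g y)"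
    if "x \<in> carrier X" "y \<in> carrier X" for x y
    using f g that by (simp add: a_minus_def Y.X.minus_add Y.X.a_ac)
  show "f (a \<odot>\<^bsub>X\<^esub> x) \<ominus>\<^bsub>Y\<^esub> g (a \<odot>\<^bsub>X\<^esub> x) = a \<odot>\<^bsub>Y\<^esub> (f x \<ominus>\<^bsub>Y\<^esub> g x)"
    if "a \<in> carrier A" "x \<in> carrier X" for a x
    using f g that by (simp add: a_minus_def Y.smult_r_distr Y.smult_minus)
qed (use linD[OF assms(1)] linD[OF assms(2)] in simp)

lemma ker_submodule:
  assumes "lin A X Y f"
  shows "submodule {x \<in> carrier X. f x = \<zero>\<^bsub>Y\<^esub>} A X"
  using linD[OF assms] lin_zero[OF assms] by (intro X.submoduleI) auto

lemma vimage_submodule: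
  assumes "lin A X Y f" "submodule N A Y"
  shows "submodule {x \<in> carrier X. f x \<in> N} A X"
  using linD[OF assms(1)] lin_zero[OF assms(1)] Y.submoduleD[OF assms(2)] by (intro X.submoduleI) auto

lemma image_submodule:
  assumes "lin A X Y f" "submodule N A X"
  shows "submodule (f ` N) A Y"
proof (rule Y.submoduleI)
  note f = linD[OF assms(1)] note N = X.submoduleD[OF assms(2)]
  show "f ` N \<subseteq> carrier Y" using f(1) N(3) by auto
  show "\<zero>\<^bsub>Y\<^esub> \<in> f ` N" using N(2) lin_zero[OF assms(1)] by (metis image_eqI)
  show "x \<oplus>\<^bsub>Y\<^esub> y \<in> f ` N" if xy: "x \<in> f ` N" "y \<in> f ` N" for x y
  proof -
    obtain u v where uv: "u \<in> N" "v \<in> N" "x = f u" "y = f v" using xy by auto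
    then have "x \<oplus>\<^bsub>Y\<^esub> y = f (u \<oplus>\<^bsub>X\<^esub> v)" using f(2) N(3) by simp
    then show ?thesis using N(4) uv by auto
  qed
  show "a \<odot>\<^bsub>Y\<^esub> x \<in> f ` N" if ax: "a \<in> carrier A" "x \<in> f ` N" for a x
  proof -
    obtain u where uv: "u \<in> N" "x = f u" using ax by auto
    then have "a \<odot>\<^bsub>Y\<^esub> x = f (a \<odot>\<^bsub>X\<^esub> u)" using f(3) N(3) ax by simp
    then show ?thesis using N(5) uv ax by auto
  qed
qed

lemma inj_on_iff_ker:
  assumes "lin A X Y f"
  shows "inj_on f (carrier X) \<longleftrightarrow> (\<forall>x \<in> carrier X. f x = \<zero>\<^bsub>Y\<^esub> \<longrightarrow> x = \<zero>\<^bsub>X\<^esub>)"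
proof
  assume "inj_on f (carrier X)"
  then show "\<forall>x \<in> carrier X. f x = \<zero>\<^bsub>Y\<^esub> \<longrightarrow> x = \<zero>\<^bsub>X\<^esub>"
    using lin_zero[OF assms] by (metis X.X.zero_closed inj_onD)
next
  assume *: "\<forall>x \<in> carrier X. f x = \<zero>\<^bsub>Y\<^esub> \<longrightarrow> x = \<zero>\<^bsub>X\<^esub>"
  show "inj_on f (carrier X)"
  proof (rule inj_onI)
    fix x y assume xy: "x \<in> carrier X" "y \<in> carrier X" "f x = f y"
    then have "f (x \<ominus>\<^bsub>X\<^esub> y) = \<zero>\<^bsub>Y\<^esub>"
      using lin_minus[OF assms xy(1,2)] linD(1)[OF assms] by simp
    then have "x \<ominus>\<^bsub>X\<^esub> y = \<zero>\<^bsub>X\<^esub>" using * xy by simp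
    then show "x = y" using xy by (simp add: X.minus_eq_zero_iff)
  qed
qed

lemma lin_inverse:
  assumes "lin A X Y f" "bij_betw f (carrier X) (carrier Y)"
  shows "lin A Y X (inv_into (carrier X) f)"
proof (rule linI)
  let ?g = "inv_into (carrier X) f"
  note f = linD[OF assms(1)]
  have g: "?g y \<in> carrier X" "f (?g y) = y" if "y \<in> carrier Y" for y
    using that assms(2) by (auto simp: bij_betw_def inv_into_into f_inv_into_f)
  have gf: "?g (f x) = x" if "x \<in> carrier X" for x
    using that assms(2) by (simp add: bij_betw_def)
  show "?g y \<in> carrier X" if "y \<in> carrier Y" for y using g that by simp
  show "?g (x \<oplus>\<^bsub>Y\<^esub> y) = ?g x \<oplus>\<^bsub>X\<^esub> ?g y" if "x \<in> carrier Y" "y \<in> carrier Y" for x y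
    using f(2)[of "?g x" "?g y"] g[OF that(1)] g[OF that(2)] gf[of "?g x \<oplus>\<^bsub>X\<^esub> ?g y"]
    by (metis X.X.a_closed)
  show "?g (a \<odot>\<^bsub>Y\<^esub> x) = a \<odot>\<^bsub>X\<^esub> ?g x" if "a \<in> carrier A" "x \<in> carrier Y" for x a
    using f(3)[of a "?g x"] g[OF that(2)] gf[of "a \<odot>\<^bsub>X\<^esub> ?g x"] that by (metis X.smult_closed)
qed

lemma fin_gen_image:
  assumes "lin A X Y f" "f ` carrier X = carrier Y" "fin_gen A X"
  shows "fin_gen A Y"
proof -
  obtain S where S: "S \<subseteq> carrier X" "finite S"
    "\<And>N. \<lbrakk>submodule N A X; S \<subseteq> N\<rbrakk> \<Longrightarrow> carrier X \<subseteq> N"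
    using assms(3) unfolding X.fin_gen_iff by blast
  have "carrier Y \<subseteq> N" if "submodule N A Y" "f ` S \<subseteq> N" for N
  proof -
    have "carrier X \<subseteq> {x \<in> carrier X. f x \<in> N}"
      using that S(1) by (intro S(3) vimage_submodule[OF assms(1)]) auto
    then show ?thesis unfolding assms(2)[symmetric] by blast
  qed
  then show ?thesis
    unfolding Y.fin_gen_iff using S(1,2) linD(1)[OF assms(1)] by (intro exI[of _ "f ` S"]) auto
qed

end

section \<open>Isomorphisms, transport of structure and quotient modules\<close>

lemma mod_catD:
  assumes "X \<in> mod_cat A"
  shows "right_module A X" "fin_gen A X"
  using assms by (auto simp: mod_cat_def)

lemma mod_iso_lin:
  assumes "mod_iso A X Y"
  obtains f where "lin A X Y f" "bij_betw f (carrier X) (carrier Y)"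
  using assms by (auto simp: mod_iso_def rhom_iff_lin)

lemma mod_isoI:
  assumes "lin A X Y f" "bij_betw f (carrier X) (carrier Y)" "right_module A X"
  shows "mod_iso A X Y"
  unfolding mod_iso_def using lin_restrict[OF assms(1,3)] assms(2)
  by (intro bexI[of _ "restrict f (carrier X)"]) auto

lemma mod_iso_sym:
  assumes "mod_iso A X Y" "right_module A X" "right_module A Y"
  shows "mod_iso A Y X"
proof -
  interpret two_modules A X Y using assms(2,3) by (rule two_modules.intro)
  obtain f where f: "lin A X Y f" "bij_betw f (carrier X) (carrier Y)"
    using mod_iso_lin[OF assms(1)] .
  show ?thesis
    using lin_inverse[OF f] bij_betw_inv_into[OF f(2)] assms(3) by (rule mod_isoI)
qed

lemma mod_iso_trans:
  assumes "mod_iso A X Y" "mod_iso A Y Z" "right_module A X"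
  shows "mod_iso A X Z"
proof -
  obtain f where f: "lin A X Y f" "bij_betw f (carrier X) (carrier Y)"
    using mod_iso_lin[OF assms(1)] .
  obtain g where g: "lin A Y Z g" "bij_betw g (carrier Y) (carrier Z)"
    using mod_iso_lin[OF assms(2)] .
  show ?thesis
    using lin_comp[OF f(1) g(1)] bij_betw_trans[OF f(2) g(2)] assms(3)
    by (intro mod_isoI) (auto simp: comp_def)
qed

text \<open>Transport of structure along a map that need not be injective: compatibility of its
  fibres with the operations makes the choice of preimages immaterial. Applied to the map from an
  element to its coset, it yields quotient modules.\<close>

lemma image_module:
  fixes A :: "('a, 'c) ring_scheme" and X :: "('a, 'x, 'd) module_scheme" and \<phi> :: "'x \<Rightarrow> 'y"
  assumes "right_module A X"
    and add: "\<And>x x' y y'. \<lbrakk>x \<in> carrier X; x' \<in> carrier X; y \<in> carrier X; y' \<in> carrier X;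
      \<phi> x = \<phi> x'; \<phi> y = \<phi> y'\<rbrakk> \<Longrightarrow> \<phi> (x \<oplus>\<^bsub>X\<^esub> y) = \<phi> (x' \<oplus>\<^bsub>X\<^esub> y')"
    and smult: "\<And>a x x'. \<lbrakk>a \<in> carrier A; x \<in> carrier X; x' \<in> carrier X; \<phi> x = \<phi> x'\<rbrakk> \<Longrightarrow>
      \<phi> (a \<odot>\<^bsub>X\<^esub> x) = \<phi> (a \<odot>\<^bsub>X\<^esub> x')"
  obtains Y :: "('a, 'y) module"
  where "right_module A Y" "carrier Y = \<phi> ` carrier X" "lin A X Y \<phi>"
proof -
  interpret right_module A X by fact
  define \<psi> where "\<psi> = inv_into (carrier X) \<phi>"
  have \<psi>: "\<psi> (\<phi> x) \<in> carrier X" "\<phi> (\<psi> (\<phi> x)) = \<phi> x" if "x \<in> carrier X" for x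
    using that by (auto simp: \<psi>_def inv_into_into f_inv_into_f)
  define Y :: "('a, 'y) module" where
    "Y = \<lparr>carrier = \<phi> ` carrier X, mult = undefined, one = undefined, zero = \<phi> \<zero>\<^bsub>X\<^esub>,
      add = (\<lambda>u v. \<phi> (\<psi> u \<oplus>\<^bsub>X\<^esub> \<psi> v)), smult = (\<lambda>a u. \<phi> (a \<odot>\<^bsub>X\<^esub> \<psi> u))\<rparr>"
  have Yadd: "\<phi> x \<oplus>\<^bsub>Y\<^esub> \<phi> y = \<phi> (x \<oplus>\<^bsub>X\<^esub> y)" if "x \<in> carrier X" "y \<in> carrier X" for x y
    using add[of "\<psi> (\<phi> x)" x "\<psi> (\<phi> y)" y] that \<psi> by (simp add: Y_def)
  have Ysmult: "a \<odot>\<^bsub>Y\<^esub> \<phi> x = \<phi> (a \<odot>\<^bsub>X\<^esub> x)" if "a \<in> carrier A" "x \<in> carrier X" for a x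
    using smult[of a "\<psi> (\<phi> x)" x] that \<psi> by (simp add: Y_def)
  have Yzero: "\<zero>\<^bsub>Y\<^esub> = \<phi> \<zero>\<^bsub>X\<^esub>" and Yc: "carrier Y = \<phi> ` carrier X" by (simp_all add: Y_def)
  have "abelian_group Y"
  proof (rule abelian_groupI)
    fix u assume "u \<in> carrier Y"
    then obtain x where "u = \<phi> x" "x \<in> carrier X" by (auto simp: Yc)
    then show "\<exists>v\<in>carrier Y. v \<oplus>\<^bsub>Y\<^esub> u = \<zero>\<^bsub>Y\<^esub>"
      by (intro bexI[of _ "\<phi> (\<ominus>\<^bsub>X\<^esub> x)"]) (auto simp: Yadd Yzero Yc X.l_neg)
  qed (auto simp: Yc Yadd Yzero X.a_ac)
  then have "right_module A Y"
    by (intro right_module.intro A.ring_axioms right_module_axioms.intro)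
      (auto simp: Yc Yadd Ysmult smult_l_distr smult_r_distr smult_assoc)
  moreover have "lin A X Y \<phi>"
    by (rule linI) (auto simp: Yc Yadd Ysmult)
  ultimately show ?thesis using that Yc by blast
qed

text \<open>The cosets are sets of elements of X, a carrier type that varies with X. Finite
  generation allows the quotient to be copied to the fixed carrier type of \<open>mod_cat\<close>;
  what is remembered is a surjection with prescribed kernel.\<close>

lemma ex_quotient:
  fixes A :: "('a, 'c) ring_scheme" and X :: "('a, 'x, 'd) module_scheme"
  assumes "right_module A X" "fin_gen A X" "submodule N A X"
  obtains Q q where "Q \<in> mod_cat A" "lin A X Q q" "q ` carrier X = carrier Q"
    "\<forall>x\<in>carrier X. q x = \<zero>\<^bsub>Q\<^esub> \<longleftrightarrow> x \<in> N"
proof -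
  interpret X: right_module A X by fact
  note N = X.submoduleD[OF assms(3)]
  define \<phi> where "\<phi> x = {y \<in> carrier X. y \<ominus>\<^bsub>X\<^esub> x \<in> N}" for x
  have \<phi>: "\<phi> x = \<phi> y \<longleftrightarrow> x \<ominus>\<^bsub>X\<^esub> y \<in> N" if xy: "x \<in> carrier X" "y \<in> carrier X" for x y
  proof
    assume "\<phi> x = \<phi> y"
    moreover have "x \<in> \<phi> x" using xy N(2) by (simp add: \<phi>_def)
    ultimately show "x \<ominus>\<^bsub>X\<^esub> y \<in> N" by (simp add: \<phi>_def)
  next
    assume *: "x \<ominus>\<^bsub>X\<^esub> y \<in> N"
    then have "y \<ominus>\<^bsub>X\<^esub> x \<in> N" using N(6) X.neg_minus[OF xy] by metis
    with * have "z \<ominus>\<^bsub>X\<^esub> x \<in> N \<longleftrightarrow> z \<ominus>\<^bsub>X\<^esub> y \<in> N" if z: "z \<in> carrier X" for z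
      using N(4) X.minus_trans[OF z xy] X.minus_trans[OF z xy(2,1)] by metis
    then show "\<phi> x = \<phi> y" by (auto simp: \<phi>_def)
  qed
  have add: "\<phi> (x \<oplus>\<^bsub>X\<^esub> y) = \<phi> (x' \<oplus>\<^bsub>X\<^esub> y')"
    if *: "x \<in> carrier X" "x' \<in> carrier X" "y \<in> carrier X" "y' \<in> carrier X" "\<phi> x = \<phi> x'" "\<phi> y = \<phi> y'"
    for x x' y y'
  proof -
    from * have "(x \<ominus>\<^bsub>X\<^esub> x') \<oplus>\<^bsub>X\<^esub> (y \<ominus>\<^bsub>X\<^esub> y') \<in> N"
      using \<phi>[of x x'] \<phi>[of y y'] N(4) by simp
    moreover have "(x \<ominus>\<^bsub>X\<^esub> x') \<oplus>\<^bsub>X\<^esub> (y \<ominus>\<^bsub>X\<^esub> y') = (x \<oplus>\<^bsub>X\<^esub> y) \<ominus>\<^bsub>X\<^esub> (x' \<oplus>\<^bsub>X\<^esub> y')"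
      using * by (simp add: X.minus_add_minus)
    ultimately show ?thesis
      using * \<phi>[of "x \<oplus>\<^bsub>X\<^esub> y" "x' \<oplus>\<^bsub>X\<^esub> y'"] by simp
  qed
  have smult: "\<phi> (a \<odot>\<^bsub>X\<^esub> x) = \<phi> (a \<odot>\<^bsub>X\<^esub> x')"
    if *: "a \<in> carrier A" "x \<in> carrier X" "x' \<in> carrier X" "\<phi> x = \<phi> x'" for a x x'
  proof -
    from * have "a \<odot>\<^bsub>X\<^esub> (x \<ominus>\<^bsub>X\<^esub> x') \<in> N" using \<phi>[of x x'] N(5) by simp
    then show ?thesis
      using * \<phi>[of "a \<odot>\<^bsub>X\<^esub> x" "a \<odot>\<^bsub>X\<^esub> x'"] X.smult_diff[of a x x'] by simp
  qed
  obtain Y :: "('a, 'x set) module" where Y: "right_module A Y" "carrier Y = \<phi> ` carrier X" "lin A X Y \<phi>"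
    using image_module[of A X \<phi>, OF assms(1) add smult] .
  interpret XY: two_modules A X Y using assms(1) Y(1) by (rule two_modules.intro)
  have "fin_gen A Y" using XY.fin_gen_image[OF Y(3)] Y(2) assms(2) by simp
  then obtain Q where Q: "Q \<in> mod_cat A" "mod_iso A Y Q" using ex_mod_cat_iso[OF Y(1)] by blast
  obtain g where g: "lin A Y Q g" "bij_betw g (carrier Y) (carrier Q)" using mod_iso_lin[OF Q(2)] .
  interpret YQ: two_modules A Y Q using Y(1) mod_catD(1)[OF Q(1)] by (rule two_modules.intro)
  have ker: "g (\<phi> x) = \<zero>\<^bsub>Q\<^esub> \<longleftrightarrow> x \<in> N" if x: "x \<in> carrier X" for x
  proof -
    have "g (\<phi> x) = \<zero>\<^bsub>Q\<^esub> \<longleftrightarrow> \<phi> x = \<phi> \<zero>\<^bsub>X\<^esub>"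
      using YQ.inj_on_iff_ker[OF g(1)] g(2) XY.lin_zero[OF Y(3)] YQ.lin_zero[OF g(1)] x Y(2)
      by (auto simp: bij_betw_def)
    also have "\<dots> \<longleftrightarrow> x \<in> N" using \<phi>[OF x] x by simp
    finally show ?thesis .
  qed
  have surj: "(\<lambda>x. g (\<phi> x)) ` carrier X = carrier Q"
    using Y(2) g(2) by (simp add: bij_betw_def image_image)
  show ?thesis
    by (rule that[OF Q(1) lin_comp[OF Y(3) g(1)] surj]) (simp add: ker)
qed

lemma lin_factor:
  fixes A :: "('a, 'c) ring_scheme" and X :: "('a, 'x, 'd) module_scheme"
    and Q :: "('a, 'q, 'd') module_scheme" and Z :: "('a, 'z, 'd'') module_scheme"
  assumes mods: "right_module A X" "right_module A Q" "right_module A Z"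
    and q: "lin A X Q q" "q ` carrier X = carrier Q" and g: "lin A X Z g"
    and ker: "\<And>x. \<lbrakk>x \<in> carrier X; q x = \<zero>\<^bsub>Q\<^esub>\<rbrakk> \<Longrightarrow> g x = \<zero>\<^bsub>Z\<^esub>"
  obtains h where "lin A Q Z h" "\<forall>x\<in>carrier X. h (q x) = g x"
proof -
  interpret XQ: two_modules A X Q using mods by (intro two_modules.intro)
  interpret XZ: two_modules A X Z using mods by (intro two_modules.intro)
  let ?h = "\<lambda>u. g (inv_into (carrier X) q u)"
  have h: "?h (q x) = g x" if x: "x \<in> carrier X" for x
  proof -
    let ?y = "inv_into (carrier X) q (q x)"
    have y: "?y \<in> carrier X" "q ?y = q x" using x by (auto simp: inv_into_into f_inv_into_f)
    then have "q (?y \<ominus>\<^bsub>X\<^esub> x) = \<zero>\<^bsub>Q\<^esub>"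
      using XQ.lin_minus[OF q(1)] x linD(1)[OF q(1) x] by simp
    then have "g ?y \<ominus>\<^bsub>Z\<^esub> g x = \<zero>\<^bsub>Z\<^esub>" using ker[of "?y \<ominus>\<^bsub>X\<^esub> x"] XZ.lin_minus[OF g] y x by simp
    then show ?thesis using linD(1)[OF g] y x by (simp add: XZ.Y.minus_eq_zero_iff)
  qed
  have "lin A Q Z ?h"
  proof (rule linI)
    fix u v assume "u \<in> carrier Q" "v \<in> carrier Q"
    then obtain x y where xy: "x \<in> carrier X" "y \<in> carrier X" "u = q x" "v = q y" using q(2) by blast
    then have "u \<oplus>\<^bsub>Q\<^esub> v = q (x \<oplus>\<^bsub>X\<^esub> y)" using linD(2)[OF q(1)] by simp
    then show "?h (u \<oplus>\<^bsub>Q\<^esub> v) = ?h u \<oplus>\<^bsub>Z\<^esub> ?h v" using xy h linD(2)[OF g] by simp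
  next
    fix a u assume a: "a \<in> carrier A" and "u \<in> carrier Q"
    then obtain x where xy: "x \<in> carrier X" "u = q x" using q(2) by blast
    then have "a \<odot>\<^bsub>Q\<^esub> u = q (a \<odot>\<^bsub>X\<^esub> x)" using linD(3)[OF q(1)] a by simp
    then show "?h (a \<odot>\<^bsub>Q\<^esub> u) = a \<odot>\<^bsub>Z\<^esub> ?h u" using xy h a linD(3)[OF g] by simp
  next
    fix u assume "u \<in> carrier Q"
    then obtain x where xy: "x \<in> carrier X" "u = q x" using q(2) by blast
    then show "?h u \<in> carrier Z" using h linD(1)[OF g] by simp
  qed
  then show ?thesis by (rule that) (simp add: h)
qed

section \<open>Chain conditions\<close>

lemma regular_simps [simp]:
  "carrier (regular A) = carrier A" "\<zero>\<^bsub>regular A\<^esub> = \<zero>\<^bsub>A\<^esub>" "x \<oplus>\<^bsub>regular A\<^esub> y = x \<oplus>\<^bsub>A\<^esub> y"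
  "a \<odot>\<^bsub>regular A\<^esub> x = x \<otimes>\<^bsub>A\<^esub> a"
  by (simp_all add: regular_def)

lemma (in ring) regular_right_module: "right_module R (regular R)"
proof -
  have "abelian_group (regular R)"
  proof (rule abelian_groupI)
    fix x assume "x \<in> carrier (regular R)"
    then show "\<exists>y\<in>carrier (regular R). y \<oplus>\<^bsub>regular R\<^esub> x = \<zero>\<^bsub>regular R\<^esub>"
      by (intro bexI[of _ "\<ominus> x"]) (auto simp: l_neg)
  qed (auto simp: a_ac)
  then show ?thesis
    by (intro right_module.intro right_module_axioms.intro ring_axioms)
      (auto simp: l_distr r_distr m_assoc)
qed

lemma (in right_module) lin_smult_elem:
  assumes "x \<in> carrier X"
  shows "lin A (regular A) X (\<lambda>a. a \<odot>\<^bsub>X\<^esub> x)"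
  using assms by (intro linI) (auto simp: smult_l_distr smult_assoc)

definition dcc :: "('a, 'c) ring_scheme \<Rightarrow> ('a, 'x, 'd) module_scheme \<Rightarrow> bool" where
  "dcc A X \<longleftrightarrow> (\<forall>U :: nat \<Rightarrow> 'x set. (\<forall>n. submodule (U n) A X \<and> U (Suc n) \<subseteq> U n) \<longrightarrow>
    (\<exists>N. \<forall>n\<ge>N. U n = U N))"

lemma dcc_minimal:
  fixes X :: "('a, 'x, 'd) module_scheme"
  assumes "dcc A X" "P U0" "\<And>U. P U \<Longrightarrow> submodule U A X"
  shows "\<exists>U. P U \<and> (\<forall>V. P V \<longrightarrow> V \<subseteq> U \<longrightarrow> V = U)"
proof (rule ccontr)
  assume "\<not> ?thesis"
  then have *: "\<exists>V. P V \<and> V \<subset> U" if "P U" for U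
    using that by blast
  obtain U where U: "\<And>n. P (U n)" "\<And>n. U (Suc n) \<subset> U n"
  proof -
    have "\<exists>f. \<forall>n. P (f n) \<and> f (Suc n) \<subset> f n"
      by (rule dependent_nat_choice[of "\<lambda>_. P" "\<lambda>_ U V. V \<subset> U"]) (use assms(2) * in auto)
    then show ?thesis using that by blast
  qed
  then have "\<forall>n. submodule (U n) A X \<and> U (Suc n) \<subseteq> U n"
    using assms(3) by (simp add: psubset_imp_subset)
  then have "\<exists>N. \<forall>n\<ge>N. U n = U N"
    using assms(1)[unfolded dcc_def, rule_format, of U] by simp
  then obtain N where N: "\<forall>n\<ge>N. U n = U N" ..
  have "U (Suc N) = U N" by (rule N[rule_format]) simp
  then show False using U(2)[of N] by simp
qed

lemma (in right_module) fin_gen_sub_iff: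
  assumes "submodule N A X"
  shows "fin_gen A (X\<lparr>carrier := N\<rparr>) \<longleftrightarrow>
    (\<exists>S \<subseteq> N. finite S \<and> (\<forall>N'. submodule N' A X \<longrightarrow> S \<subseteq> N' \<longrightarrow> N \<subseteq> N'))"
proof -
  interpret N: right_module A "X\<lparr>carrier := N\<rparr>" by (rule sub_right_module) fact
  show ?thesis
    unfolding N.fin_gen_iff submodule_sub_iff[OF assms]
  proof
    assume "\<exists>S\<subseteq>carrier (X\<lparr>carrier := N\<rparr>). finite S \<and>
      (\<forall>Na. submodule Na A X \<and> Na \<subseteq> N \<longrightarrow> S \<subseteq> Na \<longrightarrow> carrier (X\<lparr>carrier := N\<rparr>) \<subseteq> Na)"
    then obtain S where S: "S \<subseteq> N" "finite S" "\<forall>N'. submodule N' A X \<and> N' \<subseteq> N \<longrightarrow> S \<subseteq> N' \<longrightarrow> N \<subseteq> N'"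
      by simp blast
    have "N \<subseteq> N'" if "submodule N' A X" "S \<subseteq> N'" for N'
      using S(3)[rule_format, of "N \<inter> N'"] submodule_Int[OF assms that(1)] S(1) that(2) by blast
    then show "\<exists>S\<subseteq>N. finite S \<and> (\<forall>N'. submodule N' A X \<longrightarrow> S \<subseteq> N' \<longrightarrow> N \<subseteq> N')"
      using S(1,2) by blast
  next
    assume "\<exists>S\<subseteq>N. finite S \<and> (\<forall>N'. submodule N' A X \<longrightarrow> S \<subseteq> N' \<longrightarrow> N \<subseteq> N')"
    then obtain S where "S \<subseteq> N" "finite S" "\<forall>N'. submodule N' A X \<longrightarrow> S \<subseteq> N' \<longrightarrow> N \<subseteq> N'" by blast
    then show "\<exists>S\<subseteq>carrier (X\<lparr>carrier := N\<rparr>). finite S \<and>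
      (\<forall>Na. submodule Na A X \<and> Na \<subseteq> N \<longrightarrow> S \<subseteq> Na \<longrightarrow> carrier (X\<lparr>carrier := N\<rparr>) \<subseteq> Na)"
      by (intro exI[of _ S]) simp
  qed
qed

lemma artinian_cring_dcc:
  assumes "artinian_cring k"
  shows "dcc k (regular k)"
proof -
  interpret k: cring k using assms by (simp add: artinian_cring_def)
  interpret K: right_module k "regular k" by (rule k.regular_right_module)
  have "ideal I k" if "submodule I k (regular k)" for I
  proof (rule idealI)
    interpret I: submodule I k "regular k" by fact
    show "subgroup I (add_monoid k)"
      using I.subgroup_axioms unfolding regular_def by (simp add: subgroup_def m_inv_def)
    show "x \<otimes>\<^bsub>k\<^esub> a \<in> I" if "a \<in> I" "x \<in> carrier k" for a x
      using K.submoduleD(5)[OF \<open>submodule I k (regular k)\<close>, of x a]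
        K.submoduleD(3)[OF \<open>submodule I k (regular k)\<close>, of a] that k.m_comm[of a x] by auto
    show "a \<otimes>\<^bsub>k\<^esub> x \<in> I" if "a \<in> I" "x \<in> carrier k" for a x
      using K.submoduleD(5)[OF \<open>submodule I k (regular k)\<close>, of x a]
        K.submoduleD(3)[OF \<open>submodule I k (regular k)\<close>, of a] that k.m_comm[of a x] by auto
  qed (rule k.ring_axioms)
  then show ?thesis
    using assms unfolding artinian_cring_def dcc_def by blast
qed

lemma (in right_module) in_sum_iff:
  "x \<in> U <+>\<^bsub>X\<^esub> V \<longleftrightarrow> (\<exists>u\<in>U. \<exists>v\<in>V. x = u \<oplus>\<^bsub>X\<^esub> v)"
  by (auto simp: set_add_def')

lemma (in right_module) sum_supset:
  assumes "submodule U A X" "submodule V A X"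
  shows "U \<subseteq> U <+>\<^bsub>X\<^esub> V" "V \<subseteq> U <+>\<^bsub>X\<^esub> V"
  using submoduleD[OF assms(1)] submoduleD[OF assms(2)]
  unfolding in_sum_iff subset_iff by (metis X.r_zero, metis X.l_zero)

lemma (in right_module) sum_least:
  assumes "submodule N A X" "U \<subseteq> N" "V \<subseteq> N"
  shows "U <+>\<^bsub>X\<^esub> V \<subseteq> N"
  using assms(2,3) submoduleD(4)[OF assms(1)] unfolding in_sum_iff subset_iff by metis

text \<open>Induction on a generating set. The predicate \<open>D N\<close> speaks of chains of
  submodules of X lying inside N, so the carrier stays fixed while N grows by one cyclic
  summand.\<close>

lemma fin_gen_dcc:
  fixes k :: "('k, 'c) ring_scheme" and X :: "('k, 'x, 'd) module_scheme"
  assumes k: "dcc k (regular k)" and X: "right_module k X" "fin_gen k X"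
  shows "dcc k X"
proof -
  interpret X: right_module k X by fact
  interpret K: right_module k "regular k" by (rule X.A.regular_right_module)
  interpret KX: two_modules k "regular k" X
    by (intro two_modules.intro X.right_module_axioms K.right_module_axioms)
  define D where "D N \<longleftrightarrow> (\<forall>U :: nat \<Rightarrow> 'x set. (\<forall>n. submodule (U n) k X \<and> U n \<subseteq> N \<and> U (Suc n) \<subseteq> U n)
    \<longrightarrow> (\<exists>m. \<forall>n\<ge>m. U n = U m))" for N
  have "\<exists>N. submodule N k X \<and> S \<subseteq> N \<and> D N" if "finite S" "S \<subseteq> carrier X" for S
    using that
  proof (induction S rule: finite_induct)
    case empty
    have "D {\<zero>\<^bsub>X\<^esub>}"
      unfolding D_def
    proof (intro allI impI)
      fix U :: "nat \<Rightarrow> 'x set" assume "\<forall>n. submodule (U n) k X \<and> U n \<subseteq> {\<zero>\<^bsub>X\<^esub>} \<and> U (Suc n) \<subseteq> U n"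
      then have "U n = {\<zero>\<^bsub>X\<^esub>}" for n using X.submoduleD(2)[of "U n"] by blast
      then show "\<exists>m. \<forall>n\<ge>m. U n = U m" by simp
    qed
    then show ?case using X.submodule_zero by blast
  next
    case (insert x S)
    then obtain N where N: "submodule N k X" "S \<subseteq> N" "D N" by auto
    have x: "x \<in> carrier X" using insert by simp
    let ?N = "N <+>\<^bsub>X\<^esub> {a \<odot>\<^bsub>X\<^esub> x | a. a \<in> carrier k}"
    note kx = X.smult_closure_submodule[OF x]
    have "D ?N"
      unfolding D_def
    proof (intro allI impI)
      fix U :: "nat \<Rightarrow> 'x set"
      assume U: "\<forall>n. submodule (U n) k X \<and> U n \<subseteq> ?N \<and> U (Suc n) \<subseteq> U n"
      then have Us: "submodule (U n) k X" and dec: "\<And>m. m \<le> n \<Longrightarrow> U n \<subseteq> U m" for n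
        using lift_Suc_antimono_le[of U] by auto
      have "\<exists>m. \<forall>n\<ge>m. U n \<inter> N = U m \<inter> N"
        using N(3)[unfolded D_def, rule_format, of "\<lambda>n. U n \<inter> N"] U X.submodule_Int[OF _ N(1)]
        by blast
      then obtain m1 where m1: "\<And>n. n \<ge> m1 \<Longrightarrow> U n \<inter> N = U m1 \<inter> N" by blast
      \<comment> \<open>The chain U n is controlled by two others: its traces on N, and the ideals
        of scalars a for which x a lies in U n modulo N.\<close>
      define I where "I n = {a \<in> carrier k. a \<odot>\<^bsub>X\<^esub> x \<in> U n <+>\<^bsub>X\<^esub> N}" for n
      have "submodule (I n) k (regular k)" for n
        using KX.vimage_submodule[OF X.lin_smult_elem[OF x] X.submodule_sum[OF Us N(1)]]
        by (simp add: I_def)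
      moreover have "I (Suc n) \<subseteq> I n" for n
        using U by (auto simp: I_def X.in_sum_iff)
      ultimately obtain m2 where m2: "\<And>n. n \<ge> m2 \<Longrightarrow> I n = I m2"
        using k unfolding dcc_def by metis
      let ?m = "max m1 m2"
      have "U n = U ?m" if n: "n \<ge> ?m" for n
      proof
        show "U n \<subseteq> U ?m" using dec n by simp
        show "U ?m \<subseteq> U n"
        proof
          \<comment> \<open>Modular law: u is n0 + x a with n0 in N, and equality of the ideals
            provides u' in U n with the same x a modulo N. Then u - u' lies in U m and in N, hence
            in U n.\<close>
          fix u assume u: "u \<in> U ?m"
          then have "u \<in> ?N" using U by blast
          then obtain \<nu> a where nu: "\<nu> \<in> N" "a \<in> carrier k" "u = \<nu> \<oplus>\<^bsub>X\<^esub> a \<odot>\<^bsub>X\<^esub> x"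
            by (auto simp: X.in_sum_iff)
          have uX: "u \<in> carrier X" "\<nu> \<in> carrier X"
            using X.submoduleD(3)[OF Us u] X.submoduleD(3)[OF N(1) nu(1)] by auto
          have "a \<odot>\<^bsub>X\<^esub> x = u \<oplus>\<^bsub>X\<^esub> (\<ominus>\<^bsub>X\<^esub> \<nu>)"
            using nu uX x by (simp add: X.X.a_ac X.X.r_neg2 X.X.r_neg1)
          then have "a \<in> I ?m"
            unfolding I_def X.in_sum_iff using u nu X.submoduleD(6)[OF N(1)] by blast
          then have "a \<in> I n" using m2[of n] m2[of ?m] n by simp
          then obtain u' \<nu>' where u': "u' \<in> U n" "\<nu>' \<in> N" "a \<odot>\<^bsub>X\<^esub> x = u' \<oplus>\<^bsub>X\<^esub> \<nu>'"
            unfolding I_def X.in_sum_iff by blast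
          have uX': "u' \<in> carrier X" "\<nu>' \<in> carrier X"
            using X.submoduleD(3)[OF Us u'(1)] X.submoduleD(3)[OF N(1) u'(2)] by auto
          have u'm: "u' \<in> U ?m" using u'(1) dec[of ?m n] n by blast
          have eq: "u = (\<nu> \<oplus>\<^bsub>X\<^esub> \<nu>') \<oplus>\<^bsub>X\<^esub> u'" using nu u' uX uX' by (simp add: X.X.a_ac)
          then have "u \<ominus>\<^bsub>X\<^esub> u' = \<nu> \<oplus>\<^bsub>X\<^esub> \<nu>'"
            using uX uX' by (simp add: a_minus_def X.X.a_assoc X.X.r_neg)
          then have "\<nu> \<oplus>\<^bsub>X\<^esub> \<nu>' \<in> U ?m \<inter> N"
            using X.submodule_minus[OF Us u u'm] X.submoduleD(4)[OF N(1) nu(1) u'(2)] by simp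
          then have "\<nu> \<oplus>\<^bsub>X\<^esub> \<nu>' \<in> U n" using m1[of n] m1[of ?m] n by auto
          then show "u \<in> U n" using eq X.submoduleD(4)[OF Us _ u'(1)] by simp
        qed
      qed
      then show "\<exists>m. \<forall>n\<ge>m. U n = U m" by blast
    qed
    moreover have "x \<in> {a \<odot>\<^bsub>X\<^esub> x | a. a \<in> carrier k}"
      using X.smult_one[OF x] X.A.one_closed by force
    ultimately show ?case
      using X.submodule_sum[OF N(1) kx] X.sum_supset[OF N(1) kx] N(2) by (intro exI[of _ ?N]) blast
  qed
  then obtain N where "D N" "carrier X \<subseteq> N"
    using X(2) unfolding X.fin_gen_iff by meson
  moreover have "U n \<subseteq> carrier X" if "submodule (U n) k X" for U and n :: nat
    using X.submoduleD(1)[OF that] .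
  ultimately show ?thesis unfolding D_def dcc_def by (meson order.trans)
qed

text \<open>
  In a minimal submodule \<open>I\<close> that is not finitely generated every scalar acts as zero or bijectively,
  so that \<open>I\<close> is a vector space; it has a hyperplane, which is finitely generated by minimality.
\<close>

lemma dcc_imp_sub_fin_gen:
  fixes k :: "('k, 'c) ring_scheme" and X :: "('k, 'x, 'd) module_scheme"
  assumes "cring k" and k: "dcc k (regular k)" and X: "right_module k X" "dcc k X"
    and N: "submodule N k X"
  shows "fin_gen k (X\<lparr>carrier := N\<rparr>)"
proof (rule ccontr)
  assume "\<not> ?thesis"
  interpret k: cring k by fact
  interpret X: right_module k X by fact
  interpret K: right_module k "regular k" by (rule k.regular_right_module)
  interpret XX: two_modules k X X by (intro two_modules.intro X.right_module_axioms)
  define fg where "fg N \<longleftrightarrow> (\<exists>S \<subseteq> N. finite S \<and> (\<forall>N'. submodule N' k X \<longrightarrow> S \<subseteq> N' \<longrightarrow> N \<subseteq> N'))" for N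
  have "submodule N k X \<and> \<not> fg N"
    using N \<open>\<not> fin_gen _ _\<close> X.fin_gen_sub_iff[OF N] by (simp add: fg_def)
  then obtain I where I: "submodule I k X" "\<not> fg I"
    and min: "\<And>V. \<lbrakk>submodule V k X; \<not> fg V; V \<subseteq> I\<rbrakk> \<Longrightarrow> V = I"
    using dcc_minimal[OF X(2), of "\<lambda>U. submodule U k X \<and> \<not> fg U" N] by metis
  have lin: "lin k X X (\<lambda>x. a \<odot>\<^bsub>X\<^esub> x)" if "a \<in> carrier k" for a
    using that by (intro linI) (auto simp: X.smult_r_distr X.smult_assoc[symmetric] k.m_comm)
  \<comment> \<open>Otherwise the kernel and the image of the action of a on I are both strictly
    smaller than I, hence finitely generated. Preimages of generators of the image together with
    generators of the kernel would then generate I.\<close>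
  have dich: "(\<forall>x\<in>I. a \<odot>\<^bsub>X\<^esub> x = \<zero>\<^bsub>X\<^esub>) \<or> (\<lambda>x. a \<odot>\<^bsub>X\<^esub> x) ` I = I" if a: "a \<in> carrier k" for a
  proof (rule ccontr)
    assume "\<not> ?thesis"
    then obtain x where x: "x \<in> I" "a \<odot>\<^bsub>X\<^esub> x \<noteq> \<zero>\<^bsub>X\<^esub>" and ne: "(\<lambda>x. a \<odot>\<^bsub>X\<^esub> x) ` I \<noteq> I" by blast
    let ?K = "{x \<in> carrier X. a \<odot>\<^bsub>X\<^esub> x = \<zero>\<^bsub>X\<^esub>} \<inter> I"
    have "submodule ((\<lambda>x. a \<odot>\<^bsub>X\<^esub> x) ` I) k X" "(\<lambda>x. a \<odot>\<^bsub>X\<^esub> x) ` I \<subseteq> I"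
      using XX.image_submodule[OF lin[OF a] I(1)] X.submoduleD(5)[OF I(1) a] by auto
    then have "fg ((\<lambda>x. a \<odot>\<^bsub>X\<^esub> x) ` I)" using min ne by blast
    then obtain S where S: "S \<subseteq> (\<lambda>x. a \<odot>\<^bsub>X\<^esub> x) ` I" "finite S"
      "\<And>N'. \<lbrakk>submodule N' k X; S \<subseteq> N'\<rbrakk> \<Longrightarrow> (\<lambda>x. a \<odot>\<^bsub>X\<^esub> x) ` I \<subseteq> N'" unfolding fg_def by blast
    obtain S' where S': "S' \<subseteq> I" "finite S'" "S = (\<lambda>x. a \<odot>\<^bsub>X\<^esub> x) ` S'"
      using finite_subset_image[OF S(2,1)] by blast
    have "submodule ?K k X" using XX.ker_submodule[OF lin[OF a]] I(1) by (rule X.submodule_Int)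
    moreover have "?K \<noteq> I" using x by auto
    ultimately have "fg ?K" using min by blast
    then obtain T where T: "T \<subseteq> ?K" "finite T"
      "\<And>N'. \<lbrakk>submodule N' k X; T \<subseteq> N'\<rbrakk> \<Longrightarrow> ?K \<subseteq> N'" unfolding fg_def by blast
    have "I \<subseteq> N'" if N': "submodule N' k X" "S' \<union> T \<subseteq> N'" for N'
    proof
      fix y assume y: "y \<in> I"
      have "submodule ((\<lambda>x. a \<odot>\<^bsub>X\<^esub> x) ` (I \<inter> N')) k X"
        using XX.image_submodule[OF lin[OF a]] X.submodule_Int I(1) N'(1) by blast
      moreover have "S \<subseteq> (\<lambda>x. a \<odot>\<^bsub>X\<^esub> x) ` (I \<inter> N')" using S' N'(2) by blast
      ultimately obtain z where z: "z \<in> I" "z \<in> N'" "a \<odot>\<^bsub>X\<^esub> y = a \<odot>\<^bsub>X\<^esub> z"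
        using S(3) y by blast
      have yz: "y \<in> carrier X" "z \<in> carrier X" using X.submoduleD(3)[OF I(1)] y z by auto
      have "y \<ominus>\<^bsub>X\<^esub> z \<in> ?K"
        using X.submodule_minus[OF I(1) y z(1)] yz z(3) a by (simp add: X.smult_diff)
      then have "y \<ominus>\<^bsub>X\<^esub> z \<in> N'" using T(3) N' by blast
      then have "(y \<ominus>\<^bsub>X\<^esub> z) \<oplus>\<^bsub>X\<^esub> z \<in> N'" using z(2) X.submoduleD(4)[OF N'(1)] by blast
      then show "y \<in> N'" using yz by (simp add: a_minus_def X.X.a_assoc X.X.l_neg)
    qed
    moreover have "S' \<union> T \<subseteq> I" "finite (S' \<union> T)" using S' T by auto
    ultimately show False using I(2) unfolding fg_def by blast
  qed
  obtain x where x: "x \<in> I" "x \<noteq> \<zero>\<^bsub>X\<^esub>"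
  proof (rule ccontr)
    assume "\<not> thesis"
    then have "I \<subseteq> {\<zero>\<^bsub>X\<^esub>}" using that by blast
    then have "fg I" unfolding fg_def using X.submoduleD(2) by (intro exI[of _ "{}"]) blast
    then show False using I(2) by simp
  qed
  have xX: "x \<in> carrier X" using x X.submoduleD(3)[OF I(1)] by simp
  \<comment> \<open>The avoided set keeps W inside I and x outside of W. Maximality of W then puts x
    into W + y k for every y of I outside of W, so W acts as a hyperplane with complement spanned by
    x.\<close>
  have D: "{\<zero>\<^bsub>X\<^esub>} \<inter> ({x} \<union> (carrier X - I)) = {}" using x X.submoduleD(2)[OF I(1)] by auto
  obtain W where W: "submodule W k X" "{\<zero>\<^bsub>X\<^esub>} \<subseteq> W" "W \<inter> ({x} \<union> (carrier X - I)) = {}"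
    and Wmax: "\<forall>N'. submodule N' k X \<longrightarrow> W \<subseteq> N' \<longrightarrow> N' \<inter> ({x} \<union> (carrier X - I)) = {} \<longrightarrow> N' = W"
    using X.ex_maximal_submodule_avoiding[OF X.submodule_zero D] .
  have WI: "W \<subseteq> I" "x \<notin> W" using W(3) X.submoduleD(1)[OF W(1)] by auto
  then have "fg W" using min[OF W(1)] x(1) by blast
  then obtain S where S: "S \<subseteq> W" "finite S" "\<And>N'. \<lbrakk>submodule N' k X; S \<subseteq> N'\<rbrakk> \<Longrightarrow> W \<subseteq> N'"
    unfolding fg_def by blast
  have "I \<subseteq> N'" if N': "submodule N' k X" "insert x S \<subseteq> N'" for N'
  proof
    fix y assume y: "y \<in> I"
    have WN: "W \<subseteq> N'" using S(3) N' by blast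
    have yX: "y \<in> carrier X" using y X.submoduleD(3)[OF I(1)] by simp
    show "y \<in> N'"
    proof (cases "y \<in> W")
      case False
      let ?Y = "{a \<odot>\<^bsub>X\<^esub> y | a. a \<in> carrier k}"
      note Y = X.smult_closure_submodule[OF yX]
      have "y \<in> ?Y" using X.smult_one[OF yX] k.one_closed by force
      then have "W <+>\<^bsub>X\<^esub> ?Y \<noteq> W" using X.sum_supset[OF W(1) Y] False by blast
      moreover have "W <+>\<^bsub>X\<^esub> ?Y \<subseteq> I"
        using WI(1) X.submoduleD(5)[OF I(1) _ y] by (intro X.sum_least[OF I(1)]) auto
      ultimately have "x \<in> W <+>\<^bsub>X\<^esub> ?Y"
        using Wmax[rule_format, OF X.submodule_sum[OF W(1) Y]] X.sum_supset[OF W(1) Y] by blast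
      then obtain w a where wa: "w \<in> W" "a \<in> carrier k" "x = w \<oplus>\<^bsub>X\<^esub> a \<odot>\<^bsub>X\<^esub> y"
        by (auto simp: X.in_sum_iff)
      have wX: "w \<in> carrier X" using wa X.submoduleD(3)[OF W(1)] by simp
      have "a \<odot>\<^bsub>X\<^esub> y \<noteq> \<zero>\<^bsub>X\<^esub>" using wa WI(2) wX by auto
      then have aI: "(\<lambda>x. a \<odot>\<^bsub>X\<^esub> x) ` I = I" using dich[OF wa(2)] y by blast
      \<comment> \<open>The principal ideals c k with c acting onto I. For a minimal one, c a k = c
        k, so c = c a b for some b; since c maps I onto itself, b inverts the action of a on I. Thus
        y is recovered from y a.\<close>
      define P where "P U \<longleftrightarrow> (\<exists>c. c \<in> carrier k \<and> (\<lambda>x. c \<odot>\<^bsub>X\<^esub> x) ` I = I \<and>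
        U = {a \<odot>\<^bsub>regular k\<^esub> c | a. a \<in> carrier k})" for U
      have P0: "P {d \<odot>\<^bsub>regular k\<^esub> a | d. d \<in> carrier k}"
        unfolding P_def using aI wa(2) by (intro exI[of _ a]) simp
      have "submodule U k (regular k)" if "P U" for U
        using that K.smult_closure_submodule unfolding P_def by auto
      with dcc_minimal[OF k, of P, OF P0] obtain U where U: "P U" "\<forall>V. P V \<longrightarrow> V \<subseteq> U \<longrightarrow> V = U"
        by blast
      from U(1) obtain c where c: "c \<in> carrier k" "(\<lambda>x. c \<odot>\<^bsub>X\<^esub> x) ` I = I"
        "U = {a \<odot>\<^bsub>regular k\<^esub> c | a. a \<in> carrier k}"
        unfolding P_def by blast
      have "(\<lambda>x. (c \<otimes>\<^bsub>k\<^esub> a) \<odot>\<^bsub>X\<^esub> x) ` I = (\<lambda>x. a \<odot>\<^bsub>X\<^esub> x) ` (\<lambda>x. c \<odot>\<^bsub>X\<^esub> x) ` I"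
        unfolding image_image using X.smult_assoc[OF c(1) wa(2)] X.submoduleD(3)[OF I(1)] by simp
      then have "(\<lambda>x. (c \<otimes>\<^bsub>k\<^esub> a) \<odot>\<^bsub>X\<^esub> x) ` I = I" using c(2) aI by simp
      then have P: "P {d \<odot>\<^bsub>regular k\<^esub> (c \<otimes>\<^bsub>k\<^esub> a) | d. d \<in> carrier k}"
        unfolding P_def using c(1) wa(2) by (intro exI[of _ "c \<otimes>\<^bsub>k\<^esub> a"]) simp
      have "{d \<odot>\<^bsub>regular k\<^esub> (c \<otimes>\<^bsub>k\<^esub> a) | d. d \<in> carrier k} \<subseteq> U"
        unfolding c(3) using c(1) wa(2) by (auto simp: k.m_assoc)
      then have "{d \<odot>\<^bsub>regular k\<^esub> (c \<otimes>\<^bsub>k\<^esub> a) | d. d \<in> carrier k} = U" using U(2) P by blast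
      moreover have "c \<in> U" unfolding c(3) using k.r_one[OF c(1)] k.one_closed by force
      ultimately obtain b where b: "b \<in> carrier k" "c = c \<otimes>\<^bsub>k\<^esub> a \<otimes>\<^bsub>k\<^esub> b" by auto
      obtain y' where y': "y' \<in> I" "y = c \<odot>\<^bsub>X\<^esub> y'" using c(2) y by blast
      have y'X: "y' \<in> carrier X" using y' X.submoduleD(3)[OF I(1)] by simp
      have "b \<odot>\<^bsub>X\<^esub> (a \<odot>\<^bsub>X\<^esub> y) = (c \<otimes>\<^bsub>k\<^esub> a \<otimes>\<^bsub>k\<^esub> b) \<odot>\<^bsub>X\<^esub> y'"
        using y' y'X c(1) wa(2) b(1) by (simp add: X.smult_assoc)
      then have ba: "b \<odot>\<^bsub>X\<^esub> (a \<odot>\<^bsub>X\<^esub> y) = y" using b(2) y' by simp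
      have "a \<odot>\<^bsub>X\<^esub> y = x \<ominus>\<^bsub>X\<^esub> w"
        using wa wX yX by (simp add: a_minus_def X.X.a_ac X.X.r_neg2 X.X.r_neg1)
      then have "a \<odot>\<^bsub>X\<^esub> y \<in> N'" using X.submodule_minus[OF N'(1)] N'(2) WN wa(1) by auto
      then have "b \<odot>\<^bsub>X\<^esub> (a \<odot>\<^bsub>X\<^esub> y) \<in> N'" using X.submoduleD(5)[OF N'(1) b(1)] by blast
      then show ?thesis by (simp add: ba)
    qed (use WN in auto)
  qed
  moreover have "insert x S \<subseteq> I" "finite (insert x S)" using S x WI by auto
  ultimately show False
    using I(2) unfolding fg_def by blast
qed

text \<open>Restriction of scalars along an arbitrary function; properties of \<eta> are imposed
  where they matter. It is applied both to the structure map of an Artin algebra and to the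
  embedding of H into the matrix ring, which does not preserve the unit.\<close>

definition restr :: "('k \<Rightarrow> 'a) \<Rightarrow> ('a, 'x, 'd) module_scheme \<Rightarrow> ('k, 'x) module" where
  "restr \<eta> X = \<lparr>carrier = carrier X, mult = mult X, one = one X, zero = zero X, add = add X,
     smult = (\<lambda>c x. \<eta> c \<odot>\<^bsub>X\<^esub> x)\<rparr>"

lemma restr_simps [simp]:
  "carrier (restr \<eta> X) = carrier X" "\<zero>\<^bsub>restr \<eta> X\<^esub> = \<zero>\<^bsub>X\<^esub>" "x \<oplus>\<^bsub>restr \<eta> X\<^esub> y = x \<oplus>\<^bsub>X\<^esub> y"
  "a \<odot>\<^bsub>restr \<eta> X\<^esub> x = \<eta> a \<odot>\<^bsub>X\<^esub> x"
  by (simp_all add: restr_def)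

lemma (in right_module) restr_abelian_group: "abelian_group (restr \<eta> X)"
proof (rule abelian_groupI)
  fix x assume "x \<in> carrier (restr \<eta> X)"
  then show "\<exists>y\<in>carrier (restr \<eta> X). y \<oplus>\<^bsub>restr \<eta> X\<^esub> x = \<zero>\<^bsub>restr \<eta> X\<^esub>"
    by (auto intro!: bexI[of _ "\<ominus>\<^bsub>X\<^esub> x"] simp: X.l_neg)
qed (auto simp: X.a_ac)

section \<open>Artin algebras seen through their base ring\<close>

locale artin_alg = ring A for A :: "('a, 'c) ring_scheme" (structure) +
  fixes k :: "('k, 'd) ring_scheme" and \<eta> :: "'k \<Rightarrow> 'a"
  assumes artinian: "artinian_cring k"
    and eta_hom: "\<eta> \<in> ring_hom k A"
    and eta_comm: "\<lbrakk>c \<in> carrier k; a \<in> carrier A\<rbrakk> \<Longrightarrow> \<eta> c \<otimes> a = a \<otimes> \<eta> c"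
    and fin_gen_scalars: "fin_gen k (restr \<eta> (regular A))"
begin

lemma artin_cring: "cring k" "ring k" and artin_dcc: "dcc k (regular k)"
  using artinian by (auto simp: artinian_cring_def intro!: artinian_cring_dcc cring.axioms)

lemma eta:
  "c \<in> carrier k \<Longrightarrow> \<eta> c \<in> carrier A"
  "\<lbrakk>c \<in> carrier k; d \<in> carrier k\<rbrakk> \<Longrightarrow> \<eta> (c \<oplus>\<^bsub>k\<^esub> d) = \<eta> c \<oplus> \<eta> d"
  "\<lbrakk>c \<in> carrier k; d \<in> carrier k\<rbrakk> \<Longrightarrow> \<eta> (c \<otimes>\<^bsub>k\<^esub> d) = \<eta> c \<otimes> \<eta> d"
  "\<eta> \<one>\<^bsub>k\<^esub> = \<one>"
  using eta_hom by (auto simp: ring_hom_def)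

lemma restr_right_module:
  assumes "right_module A X"
  shows "right_module k (restr \<eta> X)"
proof -
  interpret X: right_module A X by fact
  show ?thesis
    by (intro right_module.intro artin_cring X.restr_abelian_group right_module_axioms.intro)
      (auto simp: eta X.smult_l_distr X.smult_r_distr X.smult_assoc)
qed

lemma submodule_restr:
  assumes "right_module A X" "submodule N A X"
  shows "submodule N k (restr \<eta> X)"
  using right_module.submoduleD[OF assms] eta
  by (intro right_module.submoduleI restr_right_module assms(1)) auto

lemma fin_gen_restr:
  assumes "right_module A X" "fin_gen A X"
  shows "fin_gen k (restr \<eta> X)"
proof -
  interpret X: right_module A X by fact
  interpret A: right_module A "regular A" by (rule regular_right_module)
  interpret X': right_module k "restr \<eta> X" by (rule restr_right_module) fact
  interpret A': right_module k "restr \<eta> (regular A)" by (rule restr_right_module) unfold_locales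
  obtain T where T: "T \<subseteq> carrier A" "finite T"
    "\<And>N. \<lbrakk>submodule N k (restr \<eta> (regular A)); T \<subseteq> N\<rbrakk> \<Longrightarrow> carrier A \<subseteq> N"
    using fin_gen_scalars unfolding A'.fin_gen_iff by auto
  obtain U where U: "U \<subseteq> carrier X" "finite U"
    "\<And>N. \<lbrakk>submodule N A X; U \<subseteq> N\<rbrakk> \<Longrightarrow> carrier X \<subseteq> N"
    using assms(2) unfolding X.fin_gen_iff by auto
  let ?W = "(\<lambda>(t, u). t \<odot>\<^bsub>X\<^esub> u) ` (T \<times> U)"
  have "carrier X \<subseteq> N" if N: "submodule N k (restr \<eta> X)" "?W \<subseteq> N" for N
  proof -
    note D = X'.submoduleD[OF N(1), simplified]
    \<comment> \<open>The largest A-submodule contained in the k-submodule N; it contains the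
      A-generators U because N contains all products of U with the k-generators T of A.\<close>
    let ?N = "{x \<in> carrier X. \<forall>a\<in>carrier A. a \<odot>\<^bsub>X\<^esub> x \<in> N}"
    have "submodule ?N A X"
      using D by (intro X.submoduleI) (auto simp: X.smult_r_distr X.smult_assoc[symmetric])
    moreover have "U \<subseteq> ?N"
    proof
      fix u assume u: "u \<in> U"
      have "submodule {a \<in> carrier A. a \<odot>\<^bsub>X\<^esub> u \<in> N} k (restr \<eta> (regular A))"
      proof (rule A'.submoduleI)
        fix c a assume "c \<in> carrier k" "a \<in> {a \<in> carrier A. a \<odot>\<^bsub>X\<^esub> u \<in> N}"
        then show "c \<odot>\<^bsub>restr \<eta> (regular A)\<^esub> a \<in> {a \<in> carrier A. a \<odot>\<^bsub>X\<^esub> u \<in> N}"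
          using u U(1) D(5) eta(1) by (auto simp: X.smult_assoc)
      qed (use u U(1) D in \<open>auto simp: X.smult_l_distr\<close>)
      moreover have "T \<subseteq> {a \<in> carrier A. a \<odot>\<^bsub>X\<^esub> u \<in> N}" using T(1) N(2) u by auto
      ultimately have "carrier A \<subseteq> {a \<in> carrier A. a \<odot>\<^bsub>X\<^esub> u \<in> N}" by (rule T(3))
      then show "u \<in> ?N" using u U(1) by auto
    qed
    ultimately have sub: "carrier X \<subseteq> ?N" by (rule U(3))
    show ?thesis
    proof
      fix x assume x: "x \<in> carrier X"
      then have "\<one> \<odot>\<^bsub>X\<^esub> x \<in> N" using subsetD[OF sub x] one_closed by blast
      then show "x \<in> N" using x by simp
    qed
  qed
  moreover have "?W \<subseteq> carrier X" "finite ?W" using T U by auto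
  ultimately show ?thesis unfolding X'.fin_gen_iff by (intro exI[of _ ?W]) auto
qed

lemma fin_gen_imp_dcc:
  assumes "right_module A X" "fin_gen A X"
  shows "dcc A X"
  using fin_gen_dcc[OF artin_dcc restr_right_module[OF assms(1)] fin_gen_restr[OF assms]]
    submodule_restr[OF assms(1)] unfolding dcc_def by metis

text \<open>Over k the chain condition passes from the module to finite generation of its
  k-submodules, and k-generators of N are A-generators. This is the noetherian property of A on the
  right.\<close>

lemma sub_fin_gen:
  assumes "right_module A X" "fin_gen A X" "submodule N A X"
  shows "fin_gen A (X\<lparr>carrier := N\<rparr>)"
proof -
  interpret X: right_module A X by fact
  interpret X': right_module k "restr \<eta> X" by (rule restr_right_module) fact
  note N' = submodule_restr[OF assms(1,3)]
  have "fin_gen k (restr \<eta> X \<lparr>carrier := N\<rparr>)"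
    using dcc_imp_sub_fin_gen[OF artin_cring(1) artin_dcc restr_right_module[OF assms(1)] _ N']
      fin_gen_dcc[OF artin_dcc restr_right_module[OF assms(1)] fin_gen_restr[OF assms(1,2)]] by blast
  then show ?thesis
    unfolding X'.fin_gen_sub_iff[OF N'] X.fin_gen_sub_iff[OF assms(3)]
    using submodule_restr[OF assms(1)] by meson
qed

lemma sub_mod_cat:
  assumes "X \<in> mod_cat A" "submodule N A X"
  shows "X\<lparr>carrier := N\<rparr> \<in> mod_cat A"
  using sub_fin_gen[OF mod_catD[OF assms(1)] assms(2)]
    right_module.sub_right_module[OF mod_catD(1)[OF assms(1)] assms(2)] by (simp add: mod_cat_def)

end

lemma artin_algebra_artin_alg:
  assumes "artin_algebra k \<eta> A"
  shows "artin_alg A k \<eta>"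
proof -
  interpret ring A using assms by (simp add: artin_algebra_def)
  have k: "artinian_cring k" "cring k" "ring k" and hom: "\<eta> \<in> ring_hom k A"
    using assms by (auto simp: artin_algebra_def artinian_cring_def intro: cring.axioms)
  have eta: "\<eta> c \<in> carrier A" "d \<in> carrier k \<Longrightarrow> \<eta> (c \<oplus>\<^bsub>k\<^esub> d) = \<eta> c \<oplus>\<^bsub>A\<^esub> \<eta> d"
    "d \<in> carrier k \<Longrightarrow> \<eta> (c \<otimes>\<^bsub>k\<^esub> d) = \<eta> c \<otimes>\<^bsub>A\<^esub> \<eta> d" "\<eta> \<one>\<^bsub>k\<^esub> = \<one>\<^bsub>A\<^esub>"
    if "c \<in> carrier k" for c d
    using hom that by (auto simp: ring_hom_def)
  have eta_comm: "\<eta> c \<otimes>\<^bsub>A\<^esub> a = a \<otimes>\<^bsub>A\<^esub> \<eta> c" if "c \<in> carrier k" "a \<in> carrier A" for c a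
    using assms that by (auto simp: artin_algebra_def)
  interpret A: right_module A "regular A" by (rule regular_right_module)
  interpret A': right_module k "restr \<eta> (regular A)"
    using eta(4)[OF monoid.one_closed[OF ring.is_monoid[OF k(3)]]]
    by (intro right_module.intro k(3) A.restr_abelian_group right_module_axioms.intro)
      (auto simp: eta A.smult_l_distr A.smult_r_distr l_distr r_distr m_assoc)
  obtain S where S: "S \<subseteq> carrier A" "finite S"
    "\<And>a. a \<in> carrier A \<Longrightarrow> \<exists>c \<in> S \<rightarrow> carrier k. a = (\<Oplus>\<^bsub>A\<^esub>s\<in>S. \<eta> (c s) \<otimes>\<^bsub>A\<^esub> s)"
    using assms unfolding artin_algebra_def by blast
  have fs: "finsum (restr \<eta> (regular A)) f S = finsum A f S" if "f \<in> S \<rightarrow> carrier A" for f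
    using S(2) that by (induction S rule: finite_induct)
      (simp_all add: A'.X.finsum_insert finsum_insert Pi_def)
  have "fin_gen k (restr \<eta> (regular A))"
    unfolding fin_gen_def
  proof (intro exI[of _ S] conjI ballI)
    fix a assume "a \<in> carrier (restr \<eta> (regular A))"
    then obtain c where c: "c \<in> S \<rightarrow> carrier k" "a = (\<Oplus>\<^bsub>A\<^esub>s\<in>S. \<eta> (c s) \<otimes>\<^bsub>A\<^esub> s)" using S(3) by auto
    moreover have "(\<Oplus>\<^bsub>A\<^esub>s\<in>S. \<eta> (c s) \<otimes>\<^bsub>A\<^esub> s) = (\<Oplus>\<^bsub>restr \<eta> (regular A)\<^esub>s\<in>S. c s \<odot>\<^bsub>restr \<eta> (regular A)\<^esub> s)"
    proof -
      have "(\<Oplus>\<^bsub>A\<^esub>s\<in>S. \<eta> (c s) \<otimes>\<^bsub>A\<^esub> s) = (\<Oplus>\<^bsub>A\<^esub>s\<in>S. s \<otimes>\<^bsub>A\<^esub> \<eta> (c s))"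
        using c(1) S(1) eta(1) eta_comm by (intro finsum_cong') (auto simp: Pi_def subset_iff)
      then show ?thesis
        using c(1) S(1) eta(1) by (subst fs) (auto simp: Pi_def subset_iff)
    qed
    ultimately show "\<exists>c\<in>S \<rightarrow> carrier k. a = (\<Oplus>\<^bsub>restr \<eta> (regular A)\<^esub>s\<in>S. c s \<odot>\<^bsub>restr \<eta> (regular A)\<^esub> s)"
      by auto
  qed (use S in auto)
  then show ?thesis
    by unfold_locales (use k hom eta_comm in auto)
qed

text \<open>Meant for H and R, which are quotient rings of the matrix algebra by way of its diagonal
  entries and so inherit the base ring k.\<close>

lemma (in artin_alg) artin_alg_image:
  assumes "ring B" and p: "p \<in> ring_hom A B" "p ` carrier A = carrier B"
  shows "artin_alg B k (\<lambda>c. p (\<eta> c))"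
proof -
  interpret B: ring B by fact
  interpret Am: right_module A "regular A" by (rule regular_right_module)
  interpret Bm: right_module B "regular B" by (rule B.regular_right_module)
  interpret A': right_module k "restr \<eta> (regular A)" by (rule restr_right_module) unfold_locales
  have pD: "p a \<in> carrier B" "b \<in> carrier A \<Longrightarrow> p (a \<oplus> b) = p a \<oplus>\<^bsub>B\<^esub> p b"
    "b \<in> carrier A \<Longrightarrow> p (a \<otimes> b) = p a \<otimes>\<^bsub>B\<^esub> p b" if "a \<in> carrier A" for a b
    using p(1) that by (auto simp: ring_hom_def)
  have p1: "p \<one> = \<one>\<^bsub>B\<^esub>" using p(1) by (simp add: ring_hom_def)
  let ?\<eta> = "\<lambda>c. p (\<eta> c)"
  have hom: "?\<eta> \<in> ring_hom k B"
    by (rule ring_hom_memI) (simp_all add: eta pD p1)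
  interpret B': right_module k "restr ?\<eta> (regular B)"
    by (intro right_module.intro artin_cring Bm.restr_abelian_group right_module_axioms.intro)
      (auto simp: eta pD p1 B.l_distr B.r_distr B.m_assoc)
  interpret AB: two_modules k "restr \<eta> (regular A)" "restr ?\<eta> (regular B)" by unfold_locales
  have "lin k (restr \<eta> (regular A)) (restr ?\<eta> (regular B)) p"
    by (rule linI) (auto simp: eta pD)
  then have "fin_gen k (restr ?\<eta> (regular B))"
    by (rule AB.fin_gen_image) (simp_all add: p(2) fin_gen_scalars)
  moreover have "?\<eta> c \<otimes>\<^bsub>B\<^esub> b = b \<otimes>\<^bsub>B\<^esub> ?\<eta> c" if c: "c \<in> carrier k" and b: "b \<in> carrier B" for c b
  proof -
    obtain a where a: "a \<in> carrier A" "b = p a" using b p(2) by (metis imageE)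
    then show ?thesis using pD(3)[OF eta(1)[OF c] a(1)] pD(3)[OF a(1) eta(1)[OF c]] eta_comm[OF c a(1)] by simp
  qed
  ultimately show ?thesis
    by unfold_locales (use artinian hom in auto)
qed

section \<open>Dual bases and projectivity\<close>

text \<open>The maps of the form \<open>x \<mapsto> \<Sum>\<^sub>i q\<^sub>i g\<^sub>i(x)\<close> with linear forms \<open>g\<^sub>i\<close> on \<open>P\<close>.\<close>

inductive finite_rank ::
  "('a, 'c) ring_scheme \<Rightarrow> ('a, 'x, 'd) module_scheme \<Rightarrow> ('a, 'y, 'e) module_scheme \<Rightarrow> ('x \<Rightarrow> 'y) \<Rightarrow> bool"
  for A P Q where
  zero: "finite_rank A P Q (\<lambda>x. \<zero>\<^bsub>Q\<^esub>)"
| add: "\<lbrakk>finite_rank A P Q \<phi>; lin A P (regular A) g; q \<in> carrier Q\<rbrakk> \<Longrightarrow>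
    finite_rank A P Q (\<lambda>x. \<phi> x \<oplus>\<^bsub>Q\<^esub> g x \<odot>\<^bsub>Q\<^esub> q)"

text \<open>The conclusion of the dual basis lemma taken as a definition: the identity has finite
  rank. Agreement with the identity is asked on the carrier only, because \<open>finite_rank\<close>
  describes functions on the whole type.\<close>

definition dual_basis :: "('a, 'c) ring_scheme \<Rightarrow> ('a, 'x, 'd) module_scheme \<Rightarrow> bool" where
  "dual_basis A P \<longleftrightarrow> right_module A P \<and> (\<exists>\<phi>. finite_rank A P P \<phi> \<and> (\<forall>x \<in> carrier P. \<phi> x = x))"

context two_modules
begin

lemma finite_rank_lin:
  assumes "finite_rank A X Y \<phi>"
  shows "lin A X Y \<phi>"
  using assms
proof induction
  case (add \<phi> g q)
  show ?case
    by (rule lin_add[OF add.IH]) (rule lin_comp[OF add.hyps(2) Y.lin_smult_elem[OF add.hyps(3)]])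
qed (rule lin_zero_fun)

lemma finite_rank_closed: "\<lbrakk>finite_rank A X Y \<phi>; x \<in> carrier X\<rbrakk> \<Longrightarrow> \<phi> x \<in> carrier Y"
  using linD(1)[OF finite_rank_lin] .

lemma finite_rank_plus:
  assumes "finite_rank A X Y \<phi>" "finite_rank A X Y \<psi>"
  shows "\<exists>\<chi>. finite_rank A X Y \<chi> \<and> (\<forall>x\<in>carrier X. \<chi> x = \<phi> x \<oplus>\<^bsub>Y\<^esub> \<psi> x)"
  using assms(2)
proof induction
  case zero
  show ?case using assms(1) finite_rank_closed[OF assms(1)] by (intro exI[of _ \<phi>]) simp
next
  case (add \<psi> g q)
  then obtain \<chi> where \<chi>: "finite_rank A X Y \<chi>" "\<forall>x\<in>carrier X. \<chi> x = \<phi> x \<oplus>\<^bsub>Y\<^esub> \<psi> x" by auto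
  show ?case
    using finite_rank.add[OF \<chi>(1) add.hyps(2,3)] \<chi>(2) finite_rank_closed[OF assms(1)]
      finite_rank_closed[OF add.hyps(1)] linD(1)[OF add.hyps(2)] add.hyps(3)
    by (intro exI[of _ "\<lambda>x. \<chi> x \<oplus>\<^bsub>Y\<^esub> g x \<odot>\<^bsub>Y\<^esub> q"]) (simp add: Y.X.a_assoc)
qed

lemma finite_rank_finite:
  assumes "finite_rank A X Y \<phi>"
  shows "\<exists>S \<subseteq> carrier Y. finite S \<and> (\<forall>N. submodule N A Y \<longrightarrow> S \<subseteq> N \<longrightarrow> (\<forall>x\<in>carrier X. \<phi> x \<in> N))"
  using assms
proof induction
  case zero
  show ?case using Y.submoduleD(2) by (intro exI[of _ "{}"]) simp
next
  case (add \<phi> g q)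
  then obtain S where S: "S \<subseteq> carrier Y" "finite S"
    "\<forall>N. submodule N A Y \<longrightarrow> S \<subseteq> N \<longrightarrow> (\<forall>x\<in>carrier X. \<phi> x \<in> N)" by auto
  show ?case
  proof (intro exI[of _ "insert q S"] conjI allI impI ballI)
    fix N x assume N: "submodule N A Y" "insert q S \<subseteq> N" and x: "x \<in> carrier X"
    then show "\<phi> x \<oplus>\<^bsub>Y\<^esub> g x \<odot>\<^bsub>Y\<^esub> q \<in> N"
      using S(3)[rule_format, of N x] Y.submoduleD(4,5)[OF N(1)] linD(1)[OF add.hyps(2) x] by simp
  qed (use S add.hyps in auto)
qed

end

lemma finite_rank_post:
  assumes "finite_rank A P Q \<phi>" "lin A Q Q' h"
    and mods: "right_module A P" "right_module A Q" "right_module A Q'"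
  shows "\<exists>\<chi>. finite_rank A P Q' \<chi> \<and> (\<forall>x\<in>carrier P. \<chi> x = h (\<phi> x))"
proof -
  interpret PQ: two_modules A P Q using mods by (intro two_modules.intro)
  interpret QQ: two_modules A Q Q' using mods by (intro two_modules.intro)
  show ?thesis
    using assms(1)
  proof induction
    case zero
    show ?case
      using finite_rank.zero[of A P Q'] QQ.lin_zero[OF assms(2)]
      by (intro exI[of _ "\<lambda>x. \<zero>\<^bsub>Q'\<^esub>"]) simp
  next
    case (add \<phi> g q)
    then obtain \<chi> where \<chi>: "finite_rank A P Q' \<chi>" "\<forall>x\<in>carrier P. \<chi> x = h (\<phi> x)" by auto
    have "finite_rank A P Q' (\<lambda>x. \<chi> x \<oplus>\<^bsub>Q'\<^esub> g x \<odot>\<^bsub>Q'\<^esub> h q)"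
      by (rule finite_rank.add[OF \<chi>(1) add.hyps(2)]) (rule linD(1)[OF assms(2) add.hyps(3)])
    then show ?case
      using \<chi>(2) PQ.finite_rank_closed[OF add.hyps(1)] linD(1)[OF add.hyps(2)] add.hyps(3)
        linD(2,3)[OF assms(2)]
      by (intro exI[of _ "\<lambda>x. \<chi> x \<oplus>\<^bsub>Q'\<^esub> g x \<odot>\<^bsub>Q'\<^esub> h q"]) simp
  qed
qed

lemma finite_rank_pre:
  assumes "finite_rank A P Q \<phi>" "lin A P' P h"
  shows "finite_rank A P' Q (\<lambda>x. \<phi> (h x))"
  using assms(1)
proof induction
  case (add \<phi> g q)
  show ?case
    by (rule finite_rank.add[OF add.IH lin_comp[OF assms(2) add.hyps(2)] add.hyps(3)])
qed (rule finite_rank.zero)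

text \<open>Only the finitely many coefficients q have to be lifted along g; the linear forms stay
  the same.\<close>

lemma finite_rank_lift:
  assumes "finite_rank A P Z \<phi>" "lin A Y Z g" "g ` carrier Y = carrier Z"
    and mods: "right_module A P" "right_module A Y" "right_module A Z"
  shows "\<exists>\<chi>. finite_rank A P Y \<chi> \<and> (\<forall>x\<in>carrier P. g (\<chi> x) = \<phi> x)"
proof -
  interpret PY: two_modules A P Y using mods by (intro two_modules.intro)
  interpret YZ: two_modules A Y Z using mods by (intro two_modules.intro)
  show ?thesis
    using assms(1)
  proof induction
    case zero
    show ?case
      using finite_rank.zero[of A P Y] YZ.lin_zero[OF assms(2)]
      by (intro exI[of _ "\<lambda>x. \<zero>\<^bsub>Y\<^esub>"]) simp
  next
    case (add \<phi> f q)
    then obtain \<chi> where \<chi>: "finite_rank A P Y \<chi>" "\<forall>x\<in>carrier P. g (\<chi> x) = \<phi> x" by auto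
    have "q \<in> g ` carrier Y" using add.hyps(3) assms(3) by simp
    then obtain y where y: "y \<in> carrier Y" "g y = q" by auto
    have "finite_rank A P Y (\<lambda>x. \<chi> x \<oplus>\<^bsub>Y\<^esub> f x \<odot>\<^bsub>Y\<^esub> y)"
      by (rule finite_rank.add[OF \<chi>(1) add.hyps(2) y(1)])
    then show ?case
      using \<chi>(2) PY.finite_rank_closed[OF \<chi>(1)] linD(1)[OF add.hyps(2)] y
        linD(2,3)[OF assms(2)]
      by (intro exI[of _ "\<lambda>x. \<chi> x \<oplus>\<^bsub>Y\<^esub> f x \<odot>\<^bsub>Y\<^esub> y"]) simp
  qed
qed

lemma dual_basisE:
  assumes "dual_basis A P"
  obtains \<phi> where "right_module A P" "finite_rank A P P \<phi>" "\<forall>x\<in>carrier P. \<phi> x = x"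
  using assms unfolding dual_basis_def by blast

text \<open>Valid for targets on any carrier type, in contrast to \<open>projective\<close>. The
  lift is again of finite rank, which makes it usable as a summand when a dual basis of an extension
  is assembled.\<close>

lemma dual_basis_lift:
  assumes "dual_basis A P" "lin A Y Z g" "g ` carrier Y = carrier Z" "lin A P Z f"
    and mods: "right_module A Y" "right_module A Z"
  shows "\<exists>h. finite_rank A P Y h \<and> lin A P Y h \<and> (\<forall>x\<in>carrier P. g (h x) = f x)"
proof -
  obtain \<phi> where \<phi>: "right_module A P" "finite_rank A P P \<phi>" "\<forall>x\<in>carrier P. \<phi> x = x"
    using dual_basisE[OF assms(1)] .
  interpret PY: two_modules A P Y using mods \<phi> by (intro two_modules.intro)
  obtain \<psi> where \<psi>: "finite_rank A P Z \<psi>" "\<forall>x\<in>carrier P. \<psi> x = f (\<phi> x)"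
    using finite_rank_post[OF \<phi>(2) assms(4) \<phi>(1) \<phi>(1) mods(2)] by blast
  obtain h where h: "finite_rank A P Y h" "\<forall>x\<in>carrier P. g (h x) = \<psi> x"
    using finite_rank_lift[OF \<psi>(1) assms(2,3) \<phi>(1) mods] by blast
  show ?thesis
    using h \<psi>(2) \<phi>(3) PY.finite_rank_lin[OF h(1)] by (intro exI[of _ h]) simp
qed

lemma dual_basis_fin_gen:
  assumes "dual_basis A P"
  shows "fin_gen A P"
proof -
  obtain \<phi> where \<phi>: "right_module A P" "finite_rank A P P \<phi>" "\<forall>x\<in>carrier P. \<phi> x = x"
    using dual_basisE[OF assms] .
  interpret PP: two_modules A P P using \<phi> by (intro two_modules.intro)
  obtain S where S: "S \<subseteq> carrier P" "finite S"
    "\<forall>N. submodule N A P \<longrightarrow> S \<subseteq> N \<longrightarrow> (\<forall>x\<in>carrier P. \<phi> x \<in> N)"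
    using PP.finite_rank_finite[OF \<phi>(2)] by blast
  have "\<forall>N. submodule N A P \<longrightarrow> S \<subseteq> N \<longrightarrow> carrier P \<subseteq> N"
    using S(3) \<phi>(3) by (metis subsetI)
  then show ?thesis
    unfolding PP.X.fin_gen_iff using S(1,2) by (intro exI[of _ S]) simp
qed

lemma dual_basis_projective:
  assumes "dual_basis A P"
  shows "projective A P"
  unfolding projective_def
proof (intro conjI ballI impI)
  show P: "right_module A P" using assms by (simp add: dual_basis_def)
  fix Y Z g f
  assume YZ: "Y \<in> mod_cat A" "Z \<in> mod_cat A" and g: "g \<in> rhom A Y Z" "g ` carrier Y = carrier Z"
    and f: "f \<in> rhom A P Z"
  obtain h where h: "lin A P Y h" "\<forall>x\<in>carrier P. g (h x) = f x"
    using dual_basis_lift[OF assms rhom_lin[OF g(1)] g(2) rhom_lin[OF f]] YZ by (auto dest: mod_catD(1))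
  show "\<exists>h\<in>rhom A P Y. compose (carrier P) g h = f"
  proof (rule bexI[of _ "restrict h (carrier P)"])
    show "compose (carrier P) g (restrict h (carrier P)) = f"
      using f h(2) by (intro ext) (auto simp: compose_def rhom_def PiE_def extensional_def)
  qed (rule lin_restrict[OF h(1) P])
qed

lemma dual_basis_retract:
  assumes P: "dual_basis A P" and Q: "right_module A Q"
    and i: "lin A Q P i" and p: "lin A P Q p" and pi: "\<forall>x\<in>carrier Q. p (i x) = x"
  shows "dual_basis A Q"
proof -
  obtain \<phi> where \<phi>: "right_module A P" "finite_rank A P P \<phi>" "\<forall>x\<in>carrier P. \<phi> x = x"
    using dual_basisE[OF P] .
  obtain \<chi> where "finite_rank A Q Q \<chi>" "\<forall>x\<in>carrier Q. \<chi> x = p (\<phi> (i x))"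
    using finite_rank_post[OF finite_rank_pre[OF \<phi>(2) i] p Q \<phi>(1) Q] by blast
  then show ?thesis
    unfolding dual_basis_def using Q \<phi>(3) pi linD(1)[OF i] by (intro conjI exI[of _ \<chi>]) simp_all
qed

lemma dual_basis_iso:
  assumes "dual_basis A P" "mod_iso A P Q" "right_module A Q"
  shows "dual_basis A Q"
proof -
  have P: "right_module A P" using assms(1) by (simp add: dual_basis_def)
  interpret two_modules A P Q using P assms(3) by (rule two_modules.intro)
  obtain f where f: "lin A P Q f" "bij_betw f (carrier P) (carrier Q)"
    using mod_iso_lin[OF assms(2)] .
  show ?thesis
    by (rule dual_basis_retract[OF assms(1,3) lin_inverse[OF f] f(1)])
      (use f(2) in \<open>auto simp: bij_betw_def f_inv_into_f\<close>)
qed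

lemma (in ring) dual_basis_regular: "dual_basis R (regular R)"
proof -
  interpret A: right_module R "regular R" by (rule regular_right_module)
  have "finite_rank R (regular R) (regular R) (\<lambda>x. \<zero>\<^bsub>regular R\<^esub> \<oplus>\<^bsub>regular R\<^esub> x \<odot>\<^bsub>regular R\<^esub> \<one>)"
    by (rule finite_rank.add[OF finite_rank.zero lin_id]) simp
  then show ?thesis
    unfolding dual_basis_def using A.right_module_axioms
    by (intro conjI exI[of _ "\<lambda>x. \<zero>\<^bsub>regular R\<^esub> \<oplus>\<^bsub>regular R\<^esub> x \<odot>\<^bsub>regular R\<^esub> \<one>"]) simp_all
qed

section \<open>Direct sums of two modules, finite covers and the dual basis lemma\<close>

definition dsum :: "('a, 'x, 'd) module_scheme \<Rightarrow> ('a, 'y, 'e) module_scheme \<Rightarrow> ('a, 'x \<times> 'y) module" where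
  "dsum X Y = \<lparr>carrier = carrier X \<times> carrier Y, mult = undefined, one = undefined,
     zero = (\<zero>\<^bsub>X\<^esub>, \<zero>\<^bsub>Y\<^esub>), add = (\<lambda>(x, y) (x', y'). (x \<oplus>\<^bsub>X\<^esub> x', y \<oplus>\<^bsub>Y\<^esub> y')),
     smult = (\<lambda>a (x, y). (a \<odot>\<^bsub>X\<^esub> x, a \<odot>\<^bsub>Y\<^esub> y))\<rparr>"

lemma dsum_simps [simp]:
  "carrier (dsum X Y) = carrier X \<times> carrier Y" "\<zero>\<^bsub>dsum X Y\<^esub> = (\<zero>\<^bsub>X\<^esub>, \<zero>\<^bsub>Y\<^esub>)"
  "(x, y) \<oplus>\<^bsub>dsum X Y\<^esub> (x', y') = (x \<oplus>\<^bsub>X\<^esub> x', y \<oplus>\<^bsub>Y\<^esub> y')"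
  "a \<odot>\<^bsub>dsum X Y\<^esub> (x, y) = (a \<odot>\<^bsub>X\<^esub> x, a \<odot>\<^bsub>Y\<^esub> y)"
  by (simp_all add: dsum_def)

context two_modules
begin

lemma dsum_right_module: "right_module A (dsum X Y)"
proof -
  have "abelian_group (dsum X Y)"
  proof (rule abelian_groupI)
    fix x assume "x \<in> carrier (dsum X Y)"
    then show "\<exists>y\<in>carrier (dsum X Y). y \<oplus>\<^bsub>dsum X Y\<^esub> x = \<zero>\<^bsub>dsum X Y\<^esub>"
      by (intro bexI[of _ "(\<ominus>\<^bsub>X\<^esub> fst x, \<ominus>\<^bsub>Y\<^esub> snd x)"]) (auto simp: X.X.l_neg Y.X.l_neg)
  qed (auto simp: X.X.a_ac Y.X.a_ac)
  then show ?thesis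
    by (intro right_module.intro right_module_axioms.intro X.A.ring_axioms)
      (auto simp: X.smult_l_distr X.smult_r_distr X.smult_assoc
        Y.smult_l_distr Y.smult_r_distr Y.smult_assoc)
qed

lemma dsum_lin:
  "lin A X (dsum X Y) (\<lambda>x. (x, \<zero>\<^bsub>Y\<^esub>))" "lin A Y (dsum X Y) (\<lambda>y. (\<zero>\<^bsub>X\<^esub>, y))"
  "lin A (dsum X Y) X fst" "lin A (dsum X Y) Y snd"
  by (auto intro!: linI)

lemma dsum_fin_gen:
  assumes "fin_gen A X" "fin_gen A Y"
  shows "fin_gen A (dsum X Y)"
proof -
  interpret S: right_module A "dsum X Y" by (rule dsum_right_module)
  interpret XS: two_modules A X "dsum X Y" by (intro two_modules.intro X.right_module_axioms S.right_module_axioms)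
  interpret YS: two_modules A Y "dsum X Y" by (intro two_modules.intro Y.right_module_axioms S.right_module_axioms)
  obtain S where S: "S \<subseteq> carrier X" "finite S" "\<forall>N. submodule N A X \<longrightarrow> S \<subseteq> N \<longrightarrow> carrier X \<subseteq> N"
    using assms(1) unfolding X.fin_gen_iff by blast
  obtain T where T: "T \<subseteq> carrier Y" "finite T" "\<forall>N. submodule N A Y \<longrightarrow> T \<subseteq> N \<longrightarrow> carrier Y \<subseteq> N"
    using assms(2) unfolding Y.fin_gen_iff by blast
  let ?U = "(\<lambda>x. (x, \<zero>\<^bsub>Y\<^esub>)) ` S \<union> (\<lambda>y. (\<zero>\<^bsub>X\<^esub>, y)) ` T"
  have "carrier (dsum X Y) \<subseteq> N" if N: "submodule N A (dsum X Y)" "?U \<subseteq> N" for N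
  proof -
    have x: "carrier X \<subseteq> {x \<in> carrier X. (x, \<zero>\<^bsub>Y\<^esub>) \<in> N}"
      using S(3)[rule_format, OF XS.vimage_submodule[OF dsum_lin(1) N(1)]] S(1) N(2) by blast
    have y: "carrier Y \<subseteq> {y \<in> carrier Y. (\<zero>\<^bsub>X\<^esub>, y) \<in> N}"
      using T(3)[rule_format, OF YS.vimage_submodule[OF dsum_lin(2) N(1)]] T(1) N(2) by blast
    have "(u, v) \<in> N" if "u \<in> carrier X" "v \<in> carrier Y" for u v
    proof -
      have "(u, \<zero>\<^bsub>Y\<^esub>) \<oplus>\<^bsub>dsum X Y\<^esub> (\<zero>\<^bsub>X\<^esub>, v) \<in> N"
        using x y that by (intro S.submoduleD(4)[OF N(1)]) auto
      then show ?thesis using that by simp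
    qed
    then show ?thesis by auto
  qed
  moreover have "?U \<subseteq> carrier (dsum X Y)" "finite ?U" using S T by auto
  ultimately show ?thesis unfolding S.fin_gen_iff by (intro exI[of _ ?U]) simp
qed

lemma dual_basis_dsum:
  assumes "dual_basis A X" "dual_basis A Y"
  shows "dual_basis A (dsum X Y)"
proof -
  note S = dsum_right_module
  interpret SS: two_modules A "dsum X Y" "dsum X Y" by (intro two_modules.intro S)
  obtain \<phi> where \<phi>: "right_module A X" "finite_rank A X X \<phi>" "\<forall>x\<in>carrier X. \<phi> x = x"
    using dual_basisE[OF assms(1)] .
  obtain \<psi> where \<psi>: "right_module A Y" "finite_rank A Y Y \<psi>" "\<forall>x\<in>carrier Y. \<psi> x = x"
    using dual_basisE[OF assms(2)] .
  obtain \<phi>' where \<phi>': "finite_rank A (dsum X Y) (dsum X Y) \<phi>'"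
    "\<forall>x\<in>carrier (dsum X Y). \<phi>' x = (\<phi> (fst x), \<zero>\<^bsub>Y\<^esub>)"
    using finite_rank_post[OF finite_rank_pre[OF \<phi>(2) dsum_lin(3)] dsum_lin(1) S \<phi>(1) S] by blast
  obtain \<psi>' where \<psi>': "finite_rank A (dsum X Y) (dsum X Y) \<psi>'"
    "\<forall>x\<in>carrier (dsum X Y). \<psi>' x = (\<zero>\<^bsub>X\<^esub>, \<psi> (snd x))"
    using finite_rank_post[OF finite_rank_pre[OF \<psi>(2) dsum_lin(4)] dsum_lin(2) S \<psi>(1) S] by blast
  obtain \<chi> where \<chi>: "finite_rank A (dsum X Y) (dsum X Y) \<chi>"
    "\<forall>x\<in>carrier (dsum X Y). \<chi> x = \<phi>' x \<oplus>\<^bsub>dsum X Y\<^esub> \<psi>' x"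
    using SS.finite_rank_plus[OF \<phi>'(1) \<psi>'(1)] by blast
  have "\<forall>x\<in>carrier (dsum X Y). \<chi> x = x"
    using \<chi>(2) \<phi>'(2) \<psi>'(2) \<phi>(3) \<psi>(3) by auto
  then show ?thesis unfolding dual_basis_def using S \<chi>(1) by (intro conjI exI[of _ \<chi>])
qed

end

lemma ex_zero_module:
  fixes A :: "('a, 'c) ring_scheme"
  assumes "ring A"
  obtains Z where "Z \<in> mod_cat A" "carrier Z = {\<zero>\<^bsub>Z\<^esub>}"
proof -
  interpret ring A by fact
  interpret A: right_module A "regular A" by (rule regular_right_module)
  let ?Z = "regular A \<lparr>carrier := {\<zero>\<^bsub>A\<^esub>}\<rparr>"
  have s: "submodule {\<zero>\<^bsub>A\<^esub>} A (regular A)" using A.submodule_zero by simp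
  then have "right_module A ?Z" by (rule A.sub_right_module)
  moreover have "fin_gen A ?Z"
    unfolding A.fin_gen_sub_iff[OF s] using A.submoduleD(2) by (intro exI[of _ "{}"]) auto
  ultimately obtain Z where Z: "Z \<in> mod_cat A" "mod_iso A ?Z Z" using ex_mod_cat_iso by blast
  interpret Z: right_module A Z using mod_catD(1)[OF Z(1)] .
  obtain f where "bij_betw f (carrier ?Z) (carrier Z)" using mod_iso_lin[OF Z(2)] .
  then have "carrier Z = {f \<zero>\<^bsub>A\<^esub>}" by (auto simp: bij_betw_def)
  moreover have "\<zero>\<^bsub>Z\<^esub> \<in> carrier Z" by simp
  ultimately have "carrier Z = {\<zero>\<^bsub>Z\<^esub>}" by auto
  then show ?thesis using that Z(1) by simp
qed

text \<open>The cover is a finite direct sum of copies of \<open>B\<close>, built by adding one copy at a time.\<close>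

lemma ex_cover:
  fixes A :: "('a, 'c) ring_scheme" and X :: "('a, 'x, 'd) module_scheme"
    and B :: "('a, 'b, 'e) module_scheme"
  assumes X: "right_module A X" "fin_gen A X" and B: "right_module A B" "fin_gen A B"
    and gen: "\<And>x. x \<in> carrier X \<Longrightarrow> \<exists>h. lin A B X h \<and> x \<in> h ` carrier B"
    and zero: "\<And>Z. \<lbrakk>Z \<in> mod_cat A; carrier Z = {\<zero>\<^bsub>Z\<^esub>}\<rbrakk> \<Longrightarrow> Pr Z"
    and step: "\<And>F G. \<lbrakk>F \<in> mod_cat A; Pr F; G \<in> mod_cat A; mod_iso A (dsum F B) G\<rbrakk> \<Longrightarrow> Pr G"
  obtains F h where "F \<in> mod_cat A" "Pr F" "lin A F X h" "h ` carrier F = carrier X"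
proof -
  interpret X: right_module A X by fact
  have ex: "\<exists>F h. F \<in> mod_cat A \<and> Pr F \<and> lin A F X h \<and> S \<subseteq> h ` carrier F"
    if "finite S" "S \<subseteq> carrier X" for S
    using that
  proof (induction S rule: finite_induct)
    case empty
    obtain Z where Z: "Z \<in> mod_cat A" "carrier Z = {\<zero>\<^bsub>Z\<^esub>}"
      using ex_zero_module[OF X.A.ring_axioms] .
    interpret ZX: two_modules A Z X using mod_catD(1)[OF Z(1)] X(1) by (rule two_modules.intro)
    show ?case using Z zero[OF Z] ZX.lin_zero_fun by blast
  next
    case (insert x S)
    then obtain F h where F: "F \<in> mod_cat A" "Pr F" "lin A F X h" "S \<subseteq> h ` carrier F" by auto
    obtain b where b: "lin A B X b" "x \<in> b ` carrier B" using gen[of x] insert.prems by auto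
    interpret FB: two_modules A F B using mod_catD(1)[OF F(1)] B(1) by (rule two_modules.intro)
    interpret SX: two_modules A "dsum F B" X using FB.dsum_right_module X(1) by (rule two_modules.intro)
    obtain G where G: "G \<in> mod_cat A" "mod_iso A (dsum F B) G"
      using ex_mod_cat_iso[OF FB.dsum_right_module FB.dsum_fin_gen[OF mod_catD(2)[OF F(1)] B(2)]] by blast
    interpret GS: two_modules A G "dsum F B"
      using mod_catD(1)[OF G(1)] FB.dsum_right_module by (rule two_modules.intro)
    obtain g where g: "lin A G (dsum F B) g" "bij_betw g (carrier G) (carrier (dsum F B))"
      using mod_iso_lin[OF mod_iso_sym[OF G(2) FB.dsum_right_module mod_catD(1)[OF G(1)]]] .
    let ?h = "\<lambda>s. h (fst s) \<oplus>\<^bsub>X\<^esub> b (snd s)"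
    have lin: "lin A (dsum F B) X ?h"
      by (intro SX.lin_add lin_comp[OF FB.dsum_lin(3) F(3)] lin_comp[OF FB.dsum_lin(4) b(1)])
    interpret FX: two_modules A F X using mod_catD(1)[OF F(1)] X(1) by (rule two_modules.intro)
    interpret BX: two_modules A B X using B(1) X(1) by (rule two_modules.intro)
    have "insert x S \<subseteq> ?h ` carrier (dsum F B)"
    proof
      fix y assume "y \<in> insert x S"
      then consider "y = x" | "y \<in> S" by blast
      then show "y \<in> ?h ` carrier (dsum F B)"
      proof cases
        case 1
        obtain u where "u \<in> carrier B" "x = b u" using b(2) by blast
        then show ?thesis
          using 1 FX.lin_zero[OF F(3)] linD(1)[OF b(1)]
          by (intro image_eqI[of _ _ "(\<zero>\<^bsub>F\<^esub>, u)"]) auto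
      next
        case 2
        then obtain u where "u \<in> carrier F" "y = h u" using F(4) by blast
        then show ?thesis
          using BX.lin_zero[OF b(1)] linD(1)[OF F(3)]
          by (intro image_eqI[of _ _ "(u, \<zero>\<^bsub>B\<^esub>)"]) auto
      qed
    qed
    also have "\<dots> = (\<lambda>y. ?h (g y)) ` carrier G"
      unfolding bij_betw_imp_surj_on[OF g(2), symmetric] by (simp only: image_image)
    finally show ?case
      using G(1) step[OF F(1,2) G] lin_comp[OF g(1) lin]
      by (intro exI[of _ G] exI[of _ "\<lambda>y. ?h (g y)"]) simp
  qed
  obtain S where S: "S \<subseteq> carrier X" "finite S" "\<forall>N. submodule N A X \<longrightarrow> S \<subseteq> N \<longrightarrow> carrier X \<subseteq> N"
    using X(2) unfolding X.fin_gen_iff by blast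
  obtain F h where F: "F \<in> mod_cat A" "Pr F" "lin A F X h" "S \<subseteq> h ` carrier F"
    using ex[OF S(2,1)] by (elim exE conjE)
  interpret FX: two_modules A F X using mod_catD(1)[OF F(1)] X(1) by (rule two_modules.intro)
  have "carrier X \<subseteq> h ` carrier F"
    using S(3)[rule_format, OF FX.image_submodule[OF F(3) FX.X.submodule_carrier] F(4)] .
  then have "h ` carrier F = carrier X" using linD(1)[OF F(3)] by auto
  then show ?thesis using that F by simp
qed

text \<open>The lifting property speaks of targets in \<open>mod_cat\<close>, so P is copied there
  and covered by a finite direct sum of copies of A. Lifting the isomorphism along the cover
  exhibits P as a direct summand of it.\<close>

lemma projective_dual_basis:
  assumes P: "projective A P" "fin_gen A P"
  shows "dual_basis A P"
proof -
  have rP: "right_module A P" using P(1) by (simp add: projective_def)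
  interpret P: right_module A P by fact
  interpret A: right_module A "regular A" by (rule P.A.regular_right_module)
  obtain P' where P': "P' \<in> mod_cat A" "mod_iso A P P'" using ex_mod_cat_iso[OF rP P(2)] by blast
  obtain f where f: "lin A P P' f" "bij_betw f (carrier P) (carrier P')" using mod_iso_lin[OF P'(2)] .
  interpret PP: two_modules A P P' using rP mod_catD(1)[OF P'(1)] by (rule two_modules.intro)
  have gen: "\<exists>h. lin A (regular A) P' h \<and> x \<in> h ` carrier (regular A)" if "x \<in> carrier P'" for x
    using PP.Y.lin_smult_elem[OF that] PP.Y.smult_one[OF that] P.A.one_closed
    by (intro exI[of _ "\<lambda>a. a \<odot>\<^bsub>P'\<^esub> x"]) force
  have Z: "dual_basis A Z" if Z: "Z \<in> mod_cat A" "carrier Z = {\<zero>\<^bsub>Z\<^esub>}" for Z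
    unfolding dual_basis_def using Z finite_rank.zero[of A Z Z] mod_catD(1)[OF Z(1)]
    by (intro conjI exI[of _ "\<lambda>x. \<zero>\<^bsub>Z\<^esub>"]) auto
  have S: "dual_basis A G" if "F \<in> mod_cat A" "dual_basis A F" "G \<in> mod_cat A"
    "mod_iso A (dsum F (regular A)) G" for F G
  proof -
    interpret FA: two_modules A F "regular A"
      using mod_catD(1)[OF that(1)] A.right_module_axioms by (rule two_modules.intro)
    show ?thesis
      by (rule dual_basis_iso[OF FA.dual_basis_dsum[OF that(2) P.A.dual_basis_regular] that(4)
            mod_catD(1)[OF that(3)]])
  qed
  obtain F h where F: "F \<in> mod_cat A" "dual_basis A F" "lin A F P' h" "h ` carrier F = carrier P'"
    using ex_cover[OF mod_catD[OF P'(1)] A.right_module_axioms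
        dual_basis_fin_gen[OF P.A.dual_basis_regular] gen Z S] .
  note rF = mod_catD(1)[OF F(1)]
  have "restrict h (carrier F) \<in> rhom A F P'" "restrict f (carrier P) \<in> rhom A P P'"
    using lin_restrict[OF F(3) rF] lin_restrict[OF f(1) rP] by auto
  moreover have "restrict h (carrier F) ` carrier F = carrier P'" using F(4) by simp
  ultimately obtain s where s: "s \<in> rhom A P F"
    "compose (carrier P) (restrict h (carrier F)) s = restrict f (carrier P)"
    using P(1) F(1) P'(1) unfolding projective_def by blast
  note ls = rhom_lin[OF s(1)]
  have hs: "h (s x) = f x" if "x \<in> carrier P" for x
    using fun_cong[OF s(2), of x] that linD(1)[OF ls that] by (simp add: compose_def)
  show ?thesis
    by (rule dual_basis_retract[OF F(2) rP ls lin_comp[OF F(3) PP.lin_inverse[OF f]]])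
      (use hs f(2) in \<open>simp add: bij_betw_def\<close>)
qed

section \<open>Indecomposable modules and direct sums\<close>

lemma carrier_update_id [simp]: "X\<lparr>carrier := carrier X\<rparr> = X"
  by (cases X) simp

context right_module
begin

lemma internal_dsumD:
  assumes "internal_dsum A X U V"
  shows "submodule U A X" "submodule V A X" "U \<inter> V = {\<zero>\<^bsub>X\<^esub>}"
    "\<And>x. x \<in> carrier X \<Longrightarrow> \<exists>u\<in>U. \<exists>v\<in>V. x = u \<oplus>\<^bsub>X\<^esub> v"
proof -
  have *: "U <+>\<^bsub>X\<^esub> V = carrier X" using assms by (simp add: internal_dsum_def)
  show "\<exists>u\<in>U. \<exists>v\<in>V. x = u \<oplus>\<^bsub>X\<^esub> v" if "x \<in> carrier X" for x
    using that unfolding *[symmetric] in_sum_iff .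
qed (use assms[unfolded internal_dsum_def] in simp_all)

lemma internal_dsumI:
  assumes "submodule U A X" "submodule V A X" "\<And>x. \<lbrakk>x \<in> U; x \<in> V\<rbrakk> \<Longrightarrow> x = \<zero>\<^bsub>X\<^esub>"
    "\<And>x. x \<in> carrier X \<Longrightarrow> \<exists>u\<in>U. \<exists>v\<in>V. x = u \<oplus>\<^bsub>X\<^esub> v"
  shows "internal_dsum A X U V"
  unfolding internal_dsum_def
proof (intro conjI)
  show "U \<inter> V = {\<zero>\<^bsub>X\<^esub>}"
  proof
    show "U \<inter> V \<subseteq> {\<zero>\<^bsub>X\<^esub>}" using assms(3) by blast
    show "{\<zero>\<^bsub>X\<^esub>} \<subseteq> U \<inter> V"
      using submoduleD(2)[OF assms(1)] submoduleD(2)[OF assms(2)] by blast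
  qed
  show "U <+>\<^bsub>X\<^esub> V = carrier X"
  proof
    show "U <+>\<^bsub>X\<^esub> V \<subseteq> carrier X" by (rule submoduleD(1)[OF submodule_sum[OF assms(1,2)]])
    show "carrier X \<subseteq> U <+>\<^bsub>X\<^esub> V"
    proof
      fix x assume "x \<in> carrier X"
      then show "x \<in> U <+>\<^bsub>X\<^esub> V" unfolding in_sum_iff by (rule assms(4))
    qed
  qed
qed (fact assms)+

lemma internal_dsum_sym:
  assumes "internal_dsum A X U V"
  shows "internal_dsum A X V U"
proof -
  note D = internal_dsumD[OF assms]
  show ?thesis
  proof (rule internal_dsumI[OF D(2,1)])
    fix x assume "x \<in> carrier X"
    then obtain u v where "u \<in> U" "v \<in> V" "x = u \<oplus>\<^bsub>X\<^esub> v" using D(4) by blast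
    then show "\<exists>v\<in>V. \<exists>u\<in>U. x = v \<oplus>\<^bsub>X\<^esub> u"
      using submoduleD(3)[OF D(1)] submoduleD(3)[OF D(2)] X.a_comm by metis
  qed (use D(3) in blast)
qed

lemma internal_dsum_unique:
  assumes "internal_dsum A X U V" "u \<in> U" "u' \<in> U" "v \<in> V" "v' \<in> V"
    and eq: "u \<oplus>\<^bsub>X\<^esub> v = u' \<oplus>\<^bsub>X\<^esub> v'"
  shows "u = u'" "v = v'"
proof -
  note D = internal_dsumD[OF assms(1)]
  have c: "u \<in> carrier X" "u' \<in> carrier X" "v \<in> carrier X" "v' \<in> carrier X"
    using assms submoduleD(3)[OF D(1)] submoduleD(3)[OF D(2)] by auto
  have "(u \<ominus>\<^bsub>X\<^esub> u') \<oplus>\<^bsub>X\<^esub> (v \<ominus>\<^bsub>X\<^esub> v') = \<zero>\<^bsub>X\<^esub>"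
    using c eq by (simp add: minus_add_minus)
  then have "u \<ominus>\<^bsub>X\<^esub> u' = \<ominus>\<^bsub>X\<^esub> (v \<ominus>\<^bsub>X\<^esub> v')"
    using c X.minus_equality[of "u \<ominus>\<^bsub>X\<^esub> u'" "v \<ominus>\<^bsub>X\<^esub> v'"] by simp
  then have "u \<ominus>\<^bsub>X\<^esub> u' \<in> U \<inter> V"
    using submodule_minus[OF D(1) assms(2,3)] submoduleD(6)[OF D(2) submodule_minus[OF D(2) assms(4,5)]]
    by simp
  then have "u \<ominus>\<^bsub>X\<^esub> u' = \<zero>\<^bsub>X\<^esub>" using D(3) by auto
  then show "u = u'" using c minus_eq_zero_iff by simp
  then show "v = v'" using eq c by simp
qed

lemma internal_dsum_projections:
  assumes "internal_dsum A X U V"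
  obtains p q where "lin A X X p" "lin A X X q"
    "\<forall>x\<in>carrier X. p x \<in> U \<and> q x \<in> V \<and> p x \<oplus>\<^bsub>X\<^esub> q x = x"
    "\<forall>u\<in>U. p u = u \<and> q u = \<zero>\<^bsub>X\<^esub>" "\<forall>v\<in>V. p v = \<zero>\<^bsub>X\<^esub> \<and> q v = v"
proof -
  note D = internal_dsumD[OF assms]
  note uni = internal_dsum_unique[OF assms]
  have "\<forall>x. \<exists>uv. x \<in> carrier X \<longrightarrow> fst uv \<in> U \<and> snd uv \<in> V \<and> fst uv \<oplus>\<^bsub>X\<^esub> snd uv = x"
    using D(4) by (metis fst_conv snd_conv)
  then obtain d where d: "\<And>x. x \<in> carrier X \<Longrightarrow> fst (d x) \<in> U \<and> snd (d x) \<in> V \<and> fst (d x) \<oplus>\<^bsub>X\<^esub> snd (d x) = x"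
    by metis
  define p q where "p x = fst (d x)" and "q x = snd (d x)" for x
  have pq: "p x \<in> U" "q x \<in> V" "p x \<oplus>\<^bsub>X\<^esub> q x = x" if "x \<in> carrier X" for x
    using d[OF that] by (simp_all add: p_def q_def)
  have c: "p x \<in> carrier X" "q x \<in> carrier X" if "x \<in> carrier X" for x
    using pq[OF that] submoduleD(3)[OF D(1)] submoduleD(3)[OF D(2)] by auto
  have un: "p x = u \<and> q x = v" if "u \<in> U" "v \<in> V" "x = u \<oplus>\<^bsub>X\<^esub> v" for x u v
  proof -
    have "x \<in> carrier X" using that submoduleD(3)[OF D(1)] submoduleD(3)[OF D(2)] by simp
    then have "p x \<oplus>\<^bsub>X\<^esub> q x = u \<oplus>\<^bsub>X\<^esub> v" "p x \<in> U" "q x \<in> V" using pq[of x] that by auto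
    then show ?thesis using uni[of "p x" u "q x" v] that(1,2) by blast
  qed
  have add: "p (x \<oplus>\<^bsub>X\<^esub> y) = p x \<oplus>\<^bsub>X\<^esub> p y \<and> q (x \<oplus>\<^bsub>X\<^esub> y) = q x \<oplus>\<^bsub>X\<^esub> q y"
    if "x \<in> carrier X" "y \<in> carrier X" for x y
  proof (rule un)
    have "x \<oplus>\<^bsub>X\<^esub> y = (p x \<oplus>\<^bsub>X\<^esub> q x) \<oplus>\<^bsub>X\<^esub> (p y \<oplus>\<^bsub>X\<^esub> q y)" using pq that by simp
    also have "\<dots> = p x \<oplus>\<^bsub>X\<^esub> p y \<oplus>\<^bsub>X\<^esub> (q x \<oplus>\<^bsub>X\<^esub> q y)" using c that by (simp add: X.a_ac)
    finally show "x \<oplus>\<^bsub>X\<^esub> y = p x \<oplus>\<^bsub>X\<^esub> p y \<oplus>\<^bsub>X\<^esub> (q x \<oplus>\<^bsub>X\<^esub> q y)" .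
  qed (use pq that submoduleD(4)[OF D(1)] submoduleD(4)[OF D(2)] in auto)
  have smult: "p (a \<odot>\<^bsub>X\<^esub> x) = a \<odot>\<^bsub>X\<^esub> p x \<and> q (a \<odot>\<^bsub>X\<^esub> x) = a \<odot>\<^bsub>X\<^esub> q x"
    if "x \<in> carrier X" "a \<in> carrier A" for x a
  proof (rule un)
    show "a \<odot>\<^bsub>X\<^esub> x = a \<odot>\<^bsub>X\<^esub> p x \<oplus>\<^bsub>X\<^esub> a \<odot>\<^bsub>X\<^esub> q x"
      using smult_r_distr[of a "p x" "q x"] pq c that by simp
  qed (use pq that submoduleD(5)[OF D(1)] submoduleD(5)[OF D(2)] in auto)
  show ?thesis
  proof (rule that)
    show "lin A X X p" "lin A X X q" using c add smult by (auto intro!: linI)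
    show "\<forall>x\<in>carrier X. p x \<in> U \<and> q x \<in> V \<and> p x \<oplus>\<^bsub>X\<^esub> q x = x" using pq by simp
    show "\<forall>u\<in>U. p u = u \<and> q u = \<zero>\<^bsub>X\<^esub>" "\<forall>v\<in>V. p v = \<zero>\<^bsub>X\<^esub> \<and> q v = v"
      using un[OF _ submoduleD(2)[OF D(2)]] un[OF submoduleD(2)[OF D(1)]]
        submoduleD(3)[OF D(1)] submoduleD(3)[OF D(2)] by simp_all
  qed
qed

end

lemma indecomposable_iso:
  assumes "mod_iso A X Y" "right_module A X" "right_module A Y" "indecomposable A X"
  shows "indecomposable A Y"
proof -
  interpret two_modules A X Y using assms(2,3) by (rule two_modules.intro)
  obtain f where f: "lin A X Y f" "bij_betw f (carrier X) (carrier Y)" using mod_iso_lin[OF assms(1)] .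
  have inj: "\<forall>x \<in> carrier X. f x = \<zero>\<^bsub>Y\<^esub> \<longrightarrow> x = \<zero>\<^bsub>X\<^esub>"
    using inj_on_iff_ker[OF f(1)] f(2) by (simp add: bij_betw_def)
  have surj: "f ` carrier X = carrier Y" using f(2) by (simp add: bij_betw_def)
  have "carrier X \<noteq> {\<zero>\<^bsub>X\<^esub>}" using assms(4) by (simp add: indecomposable_def)
  then obtain x where "x \<in> carrier X" "x \<noteq> \<zero>\<^bsub>X\<^esub>" using X.X.zero_closed by blast
  then have "carrier Y \<noteq> {\<zero>\<^bsub>Y\<^esub>}" using inj linD(1)[OF f(1)] by blast
  moreover have "U = {\<zero>\<^bsub>Y\<^esub>} \<or> V = {\<zero>\<^bsub>Y\<^esub>}" if "internal_dsum A Y U V" for U V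
  proof -
    note D = Y.internal_dsumD[OF that]
    let ?U = "{x \<in> carrier X. f x \<in> U}" and ?V = "{x \<in> carrier X. f x \<in> V}"
    have "internal_dsum A X ?U ?V"
    proof (rule X.internal_dsumI)
      show "submodule ?U A X" "submodule ?V A X"
        using D(1,2) by (auto intro: vimage_submodule[OF f(1)])
      show "x = \<zero>\<^bsub>X\<^esub>" if "x \<in> ?U" "x \<in> ?V" for x using that D(3) inj by auto
      fix x assume x: "x \<in> carrier X"
      then obtain u v where uv: "u \<in> U" "v \<in> V" "f x = u \<oplus>\<^bsub>Y\<^esub> v" using D(4) linD(1)[OF f(1)] by blast
      then have "u \<in> f ` carrier X" "v \<in> f ` carrier X"
        using surj Y.submoduleD(3)[OF D(1)] Y.submoduleD(3)[OF D(2)] by auto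
      then obtain u' v' where uv': "u' \<in> carrier X" "v' \<in> carrier X" "u = f u'" "v = f v'" by auto
      then have "f x = f (u' \<oplus>\<^bsub>X\<^esub> v')" using uv linD(2)[OF f(1)] by simp
      then have "x = u' \<oplus>\<^bsub>X\<^esub> v'"
        using inj_onD[OF bij_betw_imp_inj_on[OF f(2)]] x uv' X.X.a_closed by blast
      then show "\<exists>u\<in>?U. \<exists>v\<in>?V. x = u \<oplus>\<^bsub>X\<^esub> v" using uv uv' by auto
    qed
    then have "?U = {\<zero>\<^bsub>X\<^esub>} \<or> ?V = {\<zero>\<^bsub>X\<^esub>}" using assms(4) by (simp add: indecomposable_def)
    moreover have "W = {\<zero>\<^bsub>Y\<^esub>}" if W: "{x \<in> carrier X. f x \<in> W} = {\<zero>\<^bsub>X\<^esub>}" "submodule W A Y" for W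
    proof -
      have "w = \<zero>\<^bsub>Y\<^esub>" if "w \<in> W" for w
      proof -
        have "w \<in> f ` carrier X" using surj that Y.submoduleD(3)[OF W(2)] by simp
        then obtain x where "x \<in> carrier X" "w = f x" by auto
        moreover from this have "x = \<zero>\<^bsub>X\<^esub>" using W(1) that by blast
        ultimately show ?thesis using lin_zero[OF f(1)] by simp
      qed
      moreover have "\<zero>\<^bsub>Y\<^esub> \<in> W" by (rule Y.submoduleD(2)[OF W(2)])
      ultimately show ?thesis by blast
    qed
    ultimately show ?thesis using D(1,2) by auto
  qed
  ultimately show ?thesis unfolding indecomposable_def by blast
qed

section \<open>Predecessors, the left part and projective dimension\<close>

lemma ind_catD:
  assumes "X \<in> ind_cat A"
  shows "X \<in> mod_cat A" "right_module A X" "fin_gen A X" "indecomposable A X"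
  using assms by (auto simp: ind_cat_def mod_cat_def)

lemma ex_ind_cat_iso:
  fixes A :: "('a, 'c) ring_scheme" and X :: "('a, 'x, 'd) module_scheme"
  assumes "right_module A X" "fin_gen A X" "indecomposable A X"
  obtains Y where "Y \<in> ind_cat A" "mod_iso A X Y"
proof -
  obtain Y where Y: "Y \<in> mod_cat A" "mod_iso A X Y" using ex_mod_cat_iso[OF assms(1,2)] by blast
  then have "Y \<in> ind_cat A"
    using indecomposable_iso[OF Y(2) assms(1) mod_catD(1)[OF Y(1)] assms(3)] by (simp add: ind_cat_def)
  then show ?thesis using that Y by simp
qed

lemma nonzero_stepI:
  assumes "X \<in> ind_cat A" "Y \<in> ind_cat A" "lin A X Y f" "x \<in> carrier X" "f x \<noteq> \<zero>\<^bsub>Y\<^esub>"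
  shows "nonzero_step A X Y"
  unfolding nonzero_step_def
proof (intro conjI assms(1,2) bexI)
  show "restrict f (carrier X) \<in> rhom A X Y" using assms(3) ind_catD(2)[OF assms(1)] by (rule lin_restrict)
  show "restrict f (carrier X) \<noteq> zero_hom X Y"
  proof
    assume "restrict f (carrier X) = zero_hom X Y"
    from fun_cong[OF this, of x] show False using assms(4,5) by (simp add: zero_hom_def)
  qed
qed

lemma nonzero_stepE:
  assumes "nonzero_step A X Y"
  obtains f x where "X \<in> ind_cat A" "Y \<in> ind_cat A" "lin A X Y f" "x \<in> carrier X" "f x \<noteq> \<zero>\<^bsub>Y\<^esub>"
proof -
  obtain f where f: "X \<in> ind_cat A" "Y \<in> ind_cat A" "f \<in> rhom A X Y" "f \<noteq> zero_hom X Y"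
    using assms unfolding nonzero_step_def by blast
  have "\<exists>x\<in>carrier X. f x \<noteq> \<zero>\<^bsub>Y\<^esub>"
  proof (rule ccontr)
    assume "\<not> ?thesis"
    then have "f = zero_hom X Y"
      using f(3) by (intro ext) (auto simp: zero_hom_def rhom_iff_lin extensional_def)
    then show False using f(4) by simp
  qed
  then show ?thesis using that f(1,2) rhom_lin[OF f(3)] by blast
qed

lemma left_part_step:
  assumes "nonzero_step A Z X" "X \<in> left_part A"
  shows "Z \<in> left_part A"
proof -
  have Z: "Z \<in> ind_cat A" and X: "X \<in> ind_cat A" using assms(1) by (auto simp: nonzero_step_def)
  have "predecessor A W X" if "predecessor A W Z" for W
    using that assms(1) X unfolding predecessor_def by auto
  then show ?thesis using assms(2) Z unfolding left_part_def by auto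
qed

text \<open>Induction backwards along a path of nonzero maps. The invariants to which it is applied
  are being an H-module and being embeddable into a fixed projective module.\<close>

lemma left_partI:
  assumes "X \<in> ind_cat A" "Pr X" "\<And>Y. \<lbrakk>Y \<in> ind_cat A; Pr Y\<rbrakk> \<Longrightarrow> proj_dim A Y \<le> 1"
    and "\<And>Z Y. \<lbrakk>nonzero_step A Z Y; Pr Y\<rbrakk> \<Longrightarrow> Pr Z"
  shows "X \<in> left_part A"
proof -
  have "proj_dim A Z \<le> 1" if "predecessor A Z X" for Z
  proof -
    have "(nonzero_step A)\<^sup>*\<^sup>* Z X" "Z \<in> ind_cat A" using that by (auto simp: predecessor_def)
    then have "Pr Z"
    proof (induction rule: converse_rtranclp_induct)
      case (step Y Z)
      then show ?case using assms(4)[of Y Z] by (auto simp: nonzero_step_def[of A Y Z])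
    qed (rule assms(2))
    then show ?thesis using assms(3) \<open>Z \<in> ind_cat A\<close> by blast
  qed
  then show ?thesis using assms(1) by (simp add: left_part_def)
qed

lemma proj_dim_le_1I:
  assumes "P0 \<in> mod_cat A" "P1 \<in> mod_cat A" "dual_basis A P0" "dual_basis A P1" "X \<in> mod_cat A"
    and d0: "lin A P0 X d0" "d0 ` carrier P0 = carrier X"
    and d1: "lin A P1 P0 d1" "inj_on d1 (carrier P1)" "d1 ` carrier P1 = {x \<in> carrier P0. d0 x = \<zero>\<^bsub>X\<^esub>}"
  shows "proj_dim A X \<le> 1"
proof -
  define P where "P i = (if i = (0::nat) then P0 else P1)" for i
  define d where "d i = (if i = (0::nat) then restrict d0 (carrier P0) else restrict d1 (carrier P1))" for i
  have "proj_resolution A X 1 P d"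
    unfolding proj_resolution_def Let_def
  proof (intro conjI allI impI)
    fix i :: nat assume "i \<le> 1"
    then have i: "i = 0 \<or> i = 1" by auto
    then show "P i \<in> mod_cat A" "projective A (P i)"
      using assms dual_basis_projective by (auto simp: P_def)
    show "d i \<in> rhom A (P i) (case i of 0 \<Rightarrow> X | Suc j \<Rightarrow> P j)"
      using i lin_restrict[OF d0(1) mod_catD(1)[OF assms(1)]] lin_restrict[OF d1(1) mod_catD(1)[OF assms(2)]]
      by (auto simp: P_def d_def)
  qed (use d0 d1 in \<open>auto simp: P_def d_def ker_hom_def inj_on_def\<close>)
  then have "enat 1 \<in> {enat n | n. \<exists>P d. proj_resolution A X n P d}" by blast
  then have "proj_dim A X \<le> enat 1" unfolding proj_dim_def by (rule Inf_lower)
  then show ?thesis by (simp add: one_enat_def)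
qed

text \<open>A resolution of length zero has zero kernel, so both lengths give a surjection from a
  projective with projective kernel. The surjection is whichever one the resolution contains, so an
  application must cope with covers that are not minimal.\<close>

lemma proj_dim_le_1D:
  assumes "X \<in> mod_cat A" "proj_dim A X \<le> 1"
  shows "\<exists>P d. P \<in> mod_cat A \<and> dual_basis A P \<and> lin A P X d \<and> d ` carrier P = carrier X \<and>
    dual_basis A (P\<lparr>carrier := {x \<in> carrier P. d x = \<zero>\<^bsub>X\<^esub>}\<rparr>)"
proof -
  \<comment> \<open>A strict bound turns the infimum into an actual resolution, of length 0 or
    1.\<close>
  have "proj_dim A X < 2" using assms(2) by (rule le_less_trans) (simp add: one_enat_def numeral_eq_enat)
  then have "\<exists>x\<in>{enat n | n. \<exists>P d. proj_resolution A X n P d}. x < 2"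
    unfolding proj_dim_def by (simp only: Inf_less_iff)
  then obtain n P d where n: "enat n < 2" and r: "proj_resolution A X n P d" by blast
  let ?T = "\<lambda>i. case i of 0 \<Rightarrow> X | Suc j \<Rightarrow> P j"
  have P: "\<And>i. i \<le> n \<Longrightarrow> P i \<in> mod_cat A \<and> projective A (P i) \<and> d i \<in> rhom A (P i) (?T i)"
    and surj: "d 0 ` carrier (P 0) = carrier X"
    and ex: "\<And>i. i < n \<Longrightarrow> d (Suc i) ` carrier (P (Suc i)) = ker_hom (P i) (?T i) (d i)"
    and inj: "inj_on (d n) (carrier (P n))"
    using r unfolding proj_resolution_def Let_def by auto
  have db: "dual_basis A (P i)" if "i \<le> n" for i
    using P[OF that] mod_catD(2) by (intro projective_dual_basis) auto
  have d0: "lin A (P 0) X (d 0)" using P[of 0] by (simp add: rhom_lin)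
  note rP0 = mod_catD(1)[of "P 0" A] and rX = mod_catD(1)[OF assms(1)]
  interpret PX: two_modules A "P 0" X using P[of 0] rX by (intro two_modules.intro rP0) auto
  let ?K = "{x \<in> carrier (P 0). d 0 x = \<zero>\<^bsub>X\<^esub>}"
  note K = PX.ker_submodule[OF d0]
  have rK: "right_module A ((P 0)\<lparr>carrier := ?K\<rparr>)" using PX.X.sub_right_module[OF K] .
  have "n = 0 \<or> n = 1" using n by (simp add: numeral_eq_enat) arith
  then have "dual_basis A ((P 0)\<lparr>carrier := ?K\<rparr>)"
  proof
    assume "n = 0"
    then have "?K = {\<zero>\<^bsub>P 0\<^esub>}"
      using inj PX.inj_on_iff_ker[OF d0] PX.lin_zero[OF d0] by auto
    then show ?thesis
      unfolding dual_basis_def using rK finite_rank.zero[of A "(P 0)\<lparr>carrier := ?K\<rparr>" "(P 0)\<lparr>carrier := ?K\<rparr>"]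
      by (intro conjI exI[of _ "\<lambda>x. \<zero>\<^bsub>(P 0)\<lparr>carrier := ?K\<rparr>\<^esub>"]) auto
  next
    assume n: "n = 1"
    have d1: "lin A (P 1) (P 0) (d 1)" using P[of 1] n by (simp add: rhom_lin)
    have im: "d 1 ` carrier (P 1) = ?K" using ex[of 0] n by (simp add: ker_hom_def)
    have "lin A (P 1) ((P 0)\<lparr>carrier := ?K\<rparr>) (d 1)"
      by (rule lin_into_sub[OF d1]) (simp only: im[symmetric] imageI)
    moreover have "bij_betw (d 1) (carrier (P 1)) (carrier ((P 0)\<lparr>carrier := ?K\<rparr>))"
      using inj n im by (simp add: bij_betw_def)
    ultimately have iso: "mod_iso A (P 1) ((P 0)\<lparr>carrier := ?K\<rparr>)"
      using mod_catD(1) P[of 1] n by (intro mod_isoI) auto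
    have "dual_basis A (P 1)" using db[of 1] n by simp
    then show ?thesis using iso rK by (rule dual_basis_iso)
  qed
  then show ?thesis using P[of 0] db[of 0] d0 surj by (intro exI[of _ "P 0"] exI[of _ "d 0"]) simp
qed

section \<open>Finite direct sums, decompositions and the additive closure\<close>

lemma ext_dsum_simps [simp]:
  "carrier (ext_dsum n Y) = (\<Pi>\<^sub>E i\<in>{..<n}. carrier (Y i))"
  "\<zero>\<^bsub>ext_dsum n Y\<^esub> = (\<lambda>i\<in>{..<n}. \<zero>\<^bsub>Y i\<^esub>)"
  "x \<oplus>\<^bsub>ext_dsum n Y\<^esub> y = (\<lambda>i\<in>{..<n}. x i \<oplus>\<^bsub>Y i\<^esub> y i)"
  "a \<odot>\<^bsub>ext_dsum n Y\<^esub> x = (\<lambda>i\<in>{..<n}. a \<odot>\<^bsub>Y i\<^esub> x i)"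
  by (simp_all add: ext_dsum_def)

lemma ext_dsum_right_module:
  fixes A :: "('a, 'c) ring_scheme" and Y :: "nat \<Rightarrow> ('a, 'x) module"
  assumes "\<And>i. i < n \<Longrightarrow> right_module A (Y i)" "ring A"
  shows "right_module A (ext_dsum n Y)"
proof -
  have Y: "abelian_group (Y i)" if "i < n" for i using assms(1)[OF that] by (simp add: right_module_def)
  note YY = abelian_group.axioms(1)[OF Y]
  have mem: "x i \<in> carrier (Y i)" if "x \<in> carrier (ext_dsum n Y)" "i < n" for x i
    using that by (simp add: PiE_iff)
  have memI: "(\<lambda>i\<in>{..<n}. f i) \<in> carrier (ext_dsum n Y)" if "\<And>i. i < n \<Longrightarrow> f i \<in> carrier (Y i)" for f
    using that by simp
  have eqI: "(\<lambda>i\<in>{..<n}. f i) = (\<lambda>i\<in>{..<n}. g i)" if "\<And>i. i < n \<Longrightarrow> f i = g i" for f g :: "nat \<Rightarrow> 'x"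
    using that by (intro restrict_ext) simp
  have eta: "(\<lambda>i\<in>{..<n}. f i) = x" if "\<And>i. i < n \<Longrightarrow> f i = x i" "x \<in> carrier (ext_dsum n Y)" for f x
    using that by (intro extensionalityI[of _ "{..<n}"]) (simp_all add: PiE_iff)
  note simps = ext_dsum_simps(2-4)
  have "abelian_group (ext_dsum n Y)"
  proof (rule abelian_groupI)
    fix x assume x: "x \<in> carrier (ext_dsum n Y)"
    show "\<exists>y\<in>carrier (ext_dsum n Y). y \<oplus>\<^bsub>ext_dsum n Y\<^esub> x = \<zero>\<^bsub>ext_dsum n Y\<^esub>"
    proof (rule bexI)
      show "(\<lambda>i\<in>{..<n}. \<ominus>\<^bsub>Y i\<^esub> (x i)) \<oplus>\<^bsub>ext_dsum n Y\<^esub> x = \<zero>\<^bsub>ext_dsum n Y\<^esub>"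
        unfolding simps by (rule eqI) (simp add: abelian_group.l_neg[OF Y mem[OF x]])
      show "(\<lambda>i\<in>{..<n}. \<ominus>\<^bsub>Y i\<^esub> (x i)) \<in> carrier (ext_dsum n Y)"
        by (rule memI) (rule abelian_group.a_inv_closed[OF Y mem[OF x]])
    qed
    show "\<zero>\<^bsub>ext_dsum n Y\<^esub> \<oplus>\<^bsub>ext_dsum n Y\<^esub> x = x"
      unfolding simps by (rule eta[OF _ x]) (simp add: abelian_monoid.l_zero[OF YY mem[OF x]])
    fix y assume y: "y \<in> carrier (ext_dsum n Y)"
    show "x \<oplus>\<^bsub>ext_dsum n Y\<^esub> y \<in> carrier (ext_dsum n Y)"
      unfolding simps by (rule memI) (rule abelian_monoid.a_closed[OF YY mem[OF x] mem[OF y]])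
    show "x \<oplus>\<^bsub>ext_dsum n Y\<^esub> y = y \<oplus>\<^bsub>ext_dsum n Y\<^esub> x"
      unfolding simps by (rule eqI) (rule abelian_monoid.a_comm[OF YY mem[OF x] mem[OF y]])
    fix z assume z: "z \<in> carrier (ext_dsum n Y)"
    show "x \<oplus>\<^bsub>ext_dsum n Y\<^esub> y \<oplus>\<^bsub>ext_dsum n Y\<^esub> z = x \<oplus>\<^bsub>ext_dsum n Y\<^esub> (y \<oplus>\<^bsub>ext_dsum n Y\<^esub> z)"
      unfolding simps
      by (rule eqI) (simp add: abelian_monoid.a_assoc[OF YY mem[OF x] mem[OF y] mem[OF z]])
  next
    show "\<zero>\<^bsub>ext_dsum n Y\<^esub> \<in> carrier (ext_dsum n Y)"
      unfolding simps by (rule memI) (rule abelian_monoid.zero_closed[OF YY])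
  qed
  then show ?thesis
  proof (intro right_module.intro assms(2) right_module_axioms.intro)
    fix x assume x: "x \<in> carrier (ext_dsum n Y)"
    show "\<one>\<^bsub>A\<^esub> \<odot>\<^bsub>ext_dsum n Y\<^esub> x = x"
      unfolding simps by (rule eta[OF _ x]) (simp add: right_module.smult_one[OF assms(1) mem[OF x]])
    fix a assume a: "a \<in> carrier A"
    show "a \<odot>\<^bsub>ext_dsum n Y\<^esub> x \<in> carrier (ext_dsum n Y)"
      unfolding simps by (rule memI) (rule right_module.smult_closed[OF assms(1) a mem[OF x]])
    {
      fix y assume y: "y \<in> carrier (ext_dsum n Y)"
      show "a \<odot>\<^bsub>ext_dsum n Y\<^esub> (x \<oplus>\<^bsub>ext_dsum n Y\<^esub> y) =
          a \<odot>\<^bsub>ext_dsum n Y\<^esub> x \<oplus>\<^bsub>ext_dsum n Y\<^esub> a \<odot>\<^bsub>ext_dsum n Y\<^esub> y"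
        unfolding simps
        by (rule eqI) (simp add: right_module.smult_r_distr[OF assms(1) a mem[OF x] mem[OF y]])
    }
    fix b assume b: "b \<in> carrier A"
    show "(a \<oplus>\<^bsub>A\<^esub> b) \<odot>\<^bsub>ext_dsum n Y\<^esub> x =
        a \<odot>\<^bsub>ext_dsum n Y\<^esub> x \<oplus>\<^bsub>ext_dsum n Y\<^esub> b \<odot>\<^bsub>ext_dsum n Y\<^esub> x"
      unfolding simps by (rule eqI) (simp add: right_module.smult_l_distr[OF assms(1) a b mem[OF x]])
    show "(a \<otimes>\<^bsub>A\<^esub> b) \<odot>\<^bsub>ext_dsum n Y\<^esub> x = b \<odot>\<^bsub>ext_dsum n Y\<^esub> (a \<odot>\<^bsub>ext_dsum n Y\<^esub> x)"
      unfolding simps by (rule eqI) (simp add: right_module.smult_assoc[OF assms(1) a b mem[OF x]])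
  qed
qed

text \<open>The isomorphism with a summand of a direct sum is injective, so one of its coordinates
  does not vanish at x. Later proofs exploit membership in add(C) by means of this map.\<close>

lemma add_cat_separates:
  assumes N: "N \<in> add_cat A C" and C: "C \<subseteq> mod_cat A" and x: "x \<in> carrier N" "x \<noteq> \<zero>\<^bsub>N\<^esub>"
  obtains Y g where "Y \<in> C" "lin A N Y g" "g x \<noteq> \<zero>\<^bsub>Y\<^esub>"
proof -
  obtain n X U V where n: "\<forall>i<n. X i \<in> C" "internal_dsum A (ext_dsum n X) U V"
    "mod_iso A N ((ext_dsum n X)\<lparr>carrier := U\<rparr>)" and NA: "N \<in> mod_cat A"
    using N unfolding add_cat_def by blast
  interpret N: right_module A N using mod_catD(1)[OF NA] .
  have Xm: "right_module A (X i)" if "i < n" for i using n(1) C that mod_catD(1) by blast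
  interpret E: right_module A "ext_dsum n X" using Xm N.A.ring_axioms by (rule ext_dsum_right_module)
  note U = E.submoduleD[OF E.internal_dsumD(1)[OF n(2)]]
  obtain f where f: "lin A N ((ext_dsum n X)\<lparr>carrier := U\<rparr>) f"
    "bij_betw f (carrier N) (carrier ((ext_dsum n X)\<lparr>carrier := U\<rparr>))"
    using mod_iso_lin[OF n(3)] .
  have f': "lin A N (ext_dsum n X) f" using lin_from_sub[OF f(1) U(1)] .
  interpret NE: two_modules A N "ext_dsum n X"
    by (intro two_modules.intro N.right_module_axioms E.right_module_axioms)
  have fx: "f x \<noteq> \<zero>\<^bsub>ext_dsum n X\<^esub>"
    using NE.inj_on_iff_ker[OF f'] f(2) x by (auto simp: bij_betw_def)
  have "\<exists>i<n. f x i \<noteq> \<zero>\<^bsub>X i\<^esub>"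
  proof (rule ccontr)
    assume "\<not> ?thesis"
    then have "f x = (\<lambda>i\<in>{..<n}. \<zero>\<^bsub>X i\<^esub>)"
      using linD(1)[OF f' x(1)] by (intro extensionalityI[of _ "{..<n}"]) (auto simp: PiE_iff)
    then show False using fx by simp
  qed
  then obtain i where i: "i < n" "f x i \<noteq> \<zero>\<^bsub>X i\<^esub>" by blast
  have "lin A N (X i) (\<lambda>y. f y i)"
    using linD[OF f'] i(1) by (intro linI) (auto simp: PiE_iff)
  then show ?thesis using that[of "X i" "\<lambda>y. f y i"] n(1) i by simp
qed

context artin_alg
begin

text \<open>A submodule W minimal among those without a decomposition is nonzero; a minimal nonzero
  direct summand U of W is indecomposable, and its complement is decomposable by minimality of W.
  Stating this for submodules of one X lets the chain condition of X serve both choices. The maps s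
  and p record that each term is a retract.\<close>

lemma decomposition_sub:
  fixes X :: "('a, 'a list set) module"
  assumes X: "X \<in> mod_cat A" and W: "submodule W A X"
  shows "\<exists>n Y. (\<forall>i<n. Y i \<in> ind_cat A \<and> (\<exists>s p. lin A (Y i) X s \<and> (\<forall>y\<in>carrier (Y i). s y \<in> W) \<and>
      lin A (X\<lparr>carrier := W\<rparr>) (Y i) p \<and> (\<forall>y\<in>carrier (Y i). p (s y) = y))) \<and>
    mod_iso A (X\<lparr>carrier := W\<rparr>) (ext_dsum n Y)" (is "?D W")
proof (rule ccontr)
  define D where "D W \<longleftrightarrow> ?D W" for W
  assume "\<not> ?D W"
  then have W0: "submodule W A X \<and> \<not> D W" using W by (simp add: D_def)
  note rX = mod_catD(1)[OF X]
  interpret X: right_module A X using rX .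
  note dcc = fin_gen_imp_dcc[OF mod_catD[OF X]]
  from dcc_minimal[OF dcc, of "\<lambda>W. submodule W A X \<and> \<not> D W", OF W0]
  obtain W where W: "submodule W A X" "\<not> D W"
    and min: "\<And>V. submodule V A X \<Longrightarrow> V \<subseteq> W \<Longrightarrow> V \<noteq> W \<Longrightarrow> D V" by blast
  let ?W = "X\<lparr>carrier := W\<rparr>"
  note rW = X.sub_right_module[OF W(1)]
  interpret W: right_module A ?W using rW .
  have "W \<noteq> {\<zero>\<^bsub>X\<^esub>}"
  proof
    assume W0: "W = {\<zero>\<^bsub>X\<^esub>}"
    \<comment> \<open>The empty direct sum has one element, the function that is
      \<open>undefined\<close> everywhere.\<close>
    have "lin A ?W (ext_dsum 0 (\<lambda>_. X)) (\<lambda>_ _. undefined)" by (rule linI) (auto simp: restrict_def)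
    moreover have "bij_betw (\<lambda>_ _. undefined) (carrier ?W) (carrier (ext_dsum 0 (\<lambda>_. X)))"
      by (simp add: W0 bij_betw_def)
    ultimately have "mod_iso A ?W (ext_dsum 0 (\<lambda>_. X))" using rW by (intro mod_isoI)
    then have "D W" unfolding D_def by (intro exI[of _ 0] exI[of _ "\<lambda>_. X"]) simp
    then show False using W(2) by simp
  qed
  define S where "S U \<longleftrightarrow> submodule U A X \<and> U \<noteq> {\<zero>\<^bsub>X\<^esub>} \<and> (\<exists>V. internal_dsum A ?W U V)" for U
  have "internal_dsum A ?W W {\<zero>\<^bsub>X\<^esub>}"
    using W.submodule_carrier W.submodule_zero W.X.r_zero by (intro W.internal_dsumI) auto
  then have SW: "S W" unfolding S_def using W(1) \<open>W \<noteq> _\<close> by blast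
  have Ssub: "submodule U A X" if "S U" for U using that by (simp add: S_def)
  from dcc_minimal[OF dcc, of S, OF SW Ssub] obtain U where U: "S U" and Umin: "\<And>V. S V \<Longrightarrow> V \<subseteq> U \<Longrightarrow> V = U"
    by blast
  then obtain V where UV: "internal_dsum A ?W U V" "U \<noteq> {\<zero>\<^bsub>X\<^esub>}" "submodule U A X" unfolding S_def by blast
  note D = W.internal_dsumD[OF UV(1)]
  have V: "submodule V A X" "V \<subseteq> W" and UW: "U \<subseteq> W" using D(1,2) X.submodule_sub_iff[OF W(1)] by auto
  let ?U = "X\<lparr>carrier := U\<rparr>"
  note rU = X.sub_right_module[OF UV(3)]
  interpret U: right_module A ?U using rU .
  have "indecomposable A ?U"
    unfolding indecomposable_def
  proof (intro conjI allI impI)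
    show "carrier ?U \<noteq> {\<zero>\<^bsub>?U\<^esub>}" using UV(2) by simp
    fix U1 U2 assume U12: "internal_dsum A ?U U1 U2"
    note D' = U.internal_dsumD[OF U12, simplified]
    have s: "submodule U1 A X" "submodule U2 A X" and sU: "U1 \<subseteq> U" "U2 \<subseteq> U"
      using D'(1,2) X.submodule_sub_iff[OF UV(3)] by auto
    \<comment> \<open>Adding the complement V to U2 makes U1 a direct summand of W, where minimality
      of U decides between zero and U.\<close>
    have "internal_dsum A ?W U1 (U2 <+>\<^bsub>?W\<^esub> V)"
    proof (rule W.internal_dsumI)
      have "submodule U1 A ?W" "submodule U2 A ?W"
        using s sU UW X.submodule_sub_iff[OF W(1)] by auto
      then show "submodule U1 A ?W" and "submodule (U2 <+>\<^bsub>?W\<^esub> V) A ?W"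
        using W.submodule_sum[OF _ D(2)] by auto
      show "x = \<zero>\<^bsub>?W\<^esub>" if x: "x \<in> U1" "x \<in> U2 <+>\<^bsub>?W\<^esub> V" for x
      proof -
        obtain u v where uv: "u \<in> U2" "v \<in> V" "x = u \<oplus>\<^bsub>?W\<^esub> v" using x(2) W.in_sum_iff by blast
        have "x \<oplus>\<^bsub>?W\<^esub> \<zero>\<^bsub>?W\<^esub> = u \<oplus>\<^bsub>?W\<^esub> v" using uv(3) x(1) sU UW W.X.r_zero[of x] by auto
        then have "x = u" by (rule W.internal_dsum_unique[OF UV(1), rotated 4]) (use x uv sU W.submoduleD(2)[OF D(2)] in auto)
        then show ?thesis using D'(3) x uv by auto
      qed
      fix x assume "x \<in> carrier ?W"
      then have "\<exists>u\<in>U. \<exists>v\<in>V. x = u \<oplus>\<^bsub>X\<^esub> v" using D(4)[of x] by simp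
      then obtain u v where uv: "u \<in> U" "v \<in> V" "x = u \<oplus>\<^bsub>X\<^esub> v" by blast
      obtain u1 u2 where u: "u1 \<in> U1" "u2 \<in> U2" "u = u1 \<oplus>\<^bsub>X\<^esub> u2" using D'(4) uv(1) by blast
      have "x = u1 \<oplus>\<^bsub>X\<^esub> (u2 \<oplus>\<^bsub>X\<^esub> v)"
        using u uv X.submoduleD(3)[OF s(1)] X.submoduleD(3)[OF s(2)] X.submoduleD(3)[OF V(1)]
        by (simp add: X.X.a_assoc)
      then show "\<exists>u\<in>U1. \<exists>v\<in>U2 <+>\<^bsub>?W\<^esub> V. x = u \<oplus>\<^bsub>?W\<^esub> v"
        using u uv W.in_sum_iff by (intro bexI[of _ u1] bexI[of _ "u2 \<oplus>\<^bsub>X\<^esub> v"]) auto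
    qed
    then have "S U1" if "U1 \<noteq> {\<zero>\<^bsub>X\<^esub>}" unfolding S_def using s that by blast
    then have "U1 = {\<zero>\<^bsub>X\<^esub>} \<or> U1 = U" using Umin sU(1) by blast
    then show "U1 = {\<zero>\<^bsub>?U\<^esub>} \<or> U2 = {\<zero>\<^bsub>?U\<^esub>}" using D'(3) sU by auto
  qed
  then have Uind: "?U \<in> ind_cat A"
    using sub_mod_cat[OF X UV(3)] by (simp add: ind_cat_def)
  have "V \<noteq> W" using D(3) UV(2) UW by auto
  with min[OF V] have "D V" .
  then obtain n Y where
    Y: "\<forall>i<n. Y i \<in> ind_cat A \<and> (\<exists>s p. lin A (Y i) X s \<and> (\<forall>y\<in>carrier (Y i). s y \<in> V) \<and>
      lin A (X\<lparr>carrier := V\<rparr>) (Y i) p \<and> (\<forall>y\<in>carrier (Y i). p (s y) = y))"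
    and iso: "mod_iso A (X\<lparr>carrier := V\<rparr>) (ext_dsum n Y)" unfolding D_def by (elim exE conjE)
  obtain p q where pq: "lin A ?W ?W p" "lin A ?W ?W q"
    "\<forall>x\<in>carrier ?W. p x \<in> U \<and> q x \<in> V \<and> p x \<oplus>\<^bsub>?W\<^esub> q x = x"
    "\<forall>u\<in>U. p u = u \<and> q u = \<zero>\<^bsub>?W\<^esub>" "\<forall>v\<in>V. p v = \<zero>\<^bsub>?W\<^esub> \<and> q v = v"
    using W.internal_dsum_projections[OF UV(1)] .
  have p: "lin A ?W ?U p" using linD[OF pq(1)] pq(3) by (intro linI) auto
  have q: "lin A ?W (X\<lparr>carrier := V\<rparr>) q" using linD[OF pq(2)] pq(3) by (intro linI) auto
  obtain \<psi> where psi: "lin A (X\<lparr>carrier := V\<rparr>) (ext_dsum n Y) \<psi>" "bij_betw \<psi> V (carrier (ext_dsum n Y))"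
    using mod_iso_lin[OF iso] by auto
  define Y' where "Y' = Y(n := ?U)"
  have Y's: "Y' i \<in> ind_cat A \<and> (\<exists>s p. lin A (Y' i) X s \<and> (\<forall>y\<in>carrier (Y' i). s y \<in> W) \<and>
      lin A ?W (Y' i) p \<and> (\<forall>y\<in>carrier (Y' i). p (s y) = y))" if "i < Suc n" for i
  proof (cases "i = n")
    case True
    have "lin A ?U X (\<lambda>x. x)" using X.submoduleD(3)[OF UV(3)] by (intro linI) auto
    moreover have "\<forall>y\<in>carrier ?U. y \<in> W" "\<forall>y\<in>carrier ?U. p y = y" using pq(4) UW by auto
    moreover have "Y' i = ?U" using True by (simp add: Y'_def)
    ultimately show ?thesis using Uind p by metis
  next
    case False
    then have "i < n" using that by simp
    obtain s r where sr: "lin A (Y i) X s" "\<forall>y\<in>carrier (Y i). s y \<in> V"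
      "lin A (X\<lparr>carrier := V\<rparr>) (Y i) r" "\<forall>y\<in>carrier (Y i). r (s y) = y" "Y i \<in> ind_cat A"
      using Y[THEN spec, THEN mp, OF \<open>i < n\<close>] by (elim exE conjE)
    have "lin A ?W (Y i) (\<lambda>x. r (q x))" using lin_comp[OF q sr(3)] .
    moreover have "\<forall>y\<in>carrier (Y i). r (q (s y)) = y" using sr(2,4) pq(5) by simp
    moreover have "\<forall>y\<in>carrier (Y i). s y \<in> W" using sr(2) V(2) by auto
    moreover have "Y' i = Y i" using False by (simp add: Y'_def)
    ultimately show ?thesis using sr(1,5) by metis
  qed
  \<comment> \<open>The coordinates of the complement are extensional on \<open>{..<n}\<close>, so
    their value at n is \<open>undefined\<close>; this slot receives the new coordinate p w, and
    injectivity has to treat the index n separately.\<close>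
  let ?f = "\<lambda>w. (\<psi> (q w))(n := p w)"
  note psiD = linD[OF psi(1), simplified] and qD = linD[OF q, simplified] and pD = linD[OF p, simplified]
  have f: "lin A ?W (ext_dsum (Suc n) Y') ?f"
  proof (rule linI)
    fix x assume x: "x \<in> carrier ?W"
    then show "?f x \<in> carrier (ext_dsum (Suc n) Y')"
      using psiD(1)[OF qD(1)] pD(1) by (auto simp: Y'_def PiE_iff extensional_def less_Suc_eq)
  next
    fix x y assume xy: "x \<in> carrier ?W" "y \<in> carrier ?W"
    have "?f (x \<oplus>\<^bsub>X\<^esub> y) i = (\<lambda>i\<in>{..<Suc n}. ?f x i \<oplus>\<^bsub>Y' i\<^esub> ?f y i) i" for i
      using xy psiD(2) qD pD(2) by (auto simp: Y'_def)
    then show "?f (x \<oplus>\<^bsub>?W\<^esub> y) = ?f x \<oplus>\<^bsub>ext_dsum (Suc n) Y'\<^esub> ?f y" by (simp add: fun_eq_iff)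
  next
    fix a x assume ax: "a \<in> carrier A" "x \<in> carrier ?W"
    have "?f (a \<odot>\<^bsub>X\<^esub> x) i = (\<lambda>i\<in>{..<Suc n}. a \<odot>\<^bsub>Y' i\<^esub> ?f x i) i" for i
      using ax psiD(3) qD pD(3) by (auto simp: Y'_def)
    then show "?f (a \<odot>\<^bsub>?W\<^esub> x) = a \<odot>\<^bsub>ext_dsum (Suc n) Y'\<^esub> ?f x" by (simp add: fun_eq_iff)
  qed
  have out: "z n = undefined" if "z \<in> carrier (ext_dsum n Y)" for z
    using that by (auto simp: PiE_iff extensional_def)
  have "bij_betw ?f (carrier ?W) (carrier (ext_dsum (Suc n) Y'))"
    unfolding bij_betw_def
  proof
    show "inj_on ?f (carrier ?W)"
    proof (rule inj_onI)
      fix x y assume xy: "x \<in> carrier ?W" "y \<in> carrier ?W" "?f x = ?f y"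
      have "p x = p y" using fun_cong[OF xy(3), of n] by simp
      moreover have "\<psi> (q x) = \<psi> (q y)"
      proof
        fix i show "\<psi> (q x) i = \<psi> (q y) i"
          using fun_cong[OF xy(3), of i] out[of "\<psi> (q x)"] out[of "\<psi> (q y)"] linD(1)[OF psi(1)] qD(1) xy(1,2)
          by (cases "i = n") auto
      qed
      then have "q x = q y" using psi(2) qD(1) xy(1,2) by (auto simp: bij_betw_def inj_on_def)
      ultimately show "x = y" using pq(3) xy(1,2) by metis
    qed
    show "?f ` carrier ?W = carrier (ext_dsum (Suc n) Y')"
    proof
      show "?f ` carrier ?W \<subseteq> carrier (ext_dsum (Suc n) Y')" using linD(1)[OF f] by blast
      show "carrier (ext_dsum (Suc n) Y') \<subseteq> ?f ` carrier ?W"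
      proof
        fix y assume y: "y \<in> carrier (ext_dsum (Suc n) Y')"
        have yi: "y i \<in> carrier (Y' i)" if "i < Suc n" for i using y that by (simp add: PiE_iff)
        then have yU: "y n \<in> U" using yi[of n] by (simp add: Y'_def)
        have y': "y(n := undefined) \<in> carrier (ext_dsum n Y)"
        proof -
          have "(y(n := undefined)) i \<in> carrier (Y i)" if "i < n" for i
            using yi[of i] that by (simp add: Y'_def)
          moreover have "y \<in> extensional {..<Suc n}" using y by (simp add: PiE_iff)
          then have "(y(n := undefined)) i = undefined" if "\<not> i < n" for i
            using that by (cases "i = n") (simp_all add: extensional_def)
          ultimately show ?thesis by (simp add: PiE_iff extensional_def)
        qed
        then have "y(n := undefined) \<in> \<psi> ` V" using psi(2) by (simp add: bij_betw_def)
        then obtain v where v: "v \<in> V" "\<psi> v = y(n := undefined)" by auto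
        have uvW: "y n \<in> carrier ?W" "v \<in> carrier ?W" using yU v(1) UW V(2) by auto
        have "p (y n \<oplus>\<^bsub>X\<^esub> v) = y n" "q (y n \<oplus>\<^bsub>X\<^esub> v) = v"
          using linD(2)[OF pq(1) uvW] linD(2)[OF pq(2) uvW] pq(4,5) yU v(1)
            X.submoduleD(3)[OF UV(3)] X.submoduleD(3)[OF V(1)] by simp_all
        then have fy: "?f (y n \<oplus>\<^bsub>X\<^esub> v) = y" using v(2) by simp
        have mem: "y n \<oplus>\<^bsub>X\<^esub> v \<in> carrier ?W" using X.submoduleD(4)[OF W(1)] uvW by simp
        show "y \<in> ?f ` carrier ?W" using imageI[OF mem, of ?f] unfolding fy .
      qed
    qed
  qed
  then have "mod_iso A ?W (ext_dsum (Suc n) Y')" using f rW by (intro mod_isoI)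
  then have "D W" unfolding D_def using Y's by (intro exI[of _ "Suc n"] exI[of _ Y'] conjI) auto
  then show False using W(2) by simp
qed

text \<open>The terms of a decomposition of X are indecomposable retracts of X, so it suffices that
  C contains all of these; the complementary summand in the definition of \<open>add_cat\<close> is
  taken to be zero.\<close>

lemma add_catI:
  assumes X: "X \<in> mod_cat A"
    and C: "\<And>Y s p. \<lbrakk>Y \<in> ind_cat A; lin A Y X s; lin A X Y p; \<forall>y\<in>carrier Y. p (s y) = y\<rbrakk> \<Longrightarrow> Y \<in> C"
  shows "X \<in> add_cat A C"
proof -
  interpret X: right_module A X using mod_catD(1)[OF X] .
  from decomposition_sub[OF X X.submodule_carrier] obtain n Y where
    Y: "\<forall>i<n. Y i \<in> ind_cat A \<and> (\<exists>s p. lin A (Y i) X s \<and> (\<forall>y\<in>carrier (Y i). s y \<in> carrier X) \<and>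
      lin A X (Y i) p \<and> (\<forall>y\<in>carrier (Y i). p (s y) = y))"
    and iso: "mod_iso A X (ext_dsum n Y)" by (simp only: carrier_update_id) (elim exE conjE)
  interpret E: right_module A "ext_dsum n Y"
    using Y ind_catD(2)[of _ A] by (intro ext_dsum_right_module ring_axioms) blast
  have "internal_dsum A (ext_dsum n Y) (carrier (ext_dsum n Y)) {\<zero>\<^bsub>ext_dsum n Y\<^esub>}"
    using E.submodule_carrier E.submodule_zero by (intro E.internal_dsumI) (auto simp del: ext_dsum_simps)
  moreover have "\<forall>i<n. Y i \<in> C" using Y C by blast
  ultimately show ?thesis
    unfolding add_cat_def using X iso
    by (intro CollectI conjI exI[of _ n] exI[of _ Y] exI[of _ "carrier (ext_dsum n Y)"]
        exI[of _ "{\<zero>\<^bsub>ext_dsum n Y\<^esub>}"]) (simp_all only: carrier_update_id)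
qed

end

section \<open>Abelian exact subcategories\<close>

lemma compose_eq_iff:
  "h \<in> extensional S \<Longrightarrow> compose S g f = h \<longleftrightarrow> (\<forall>x\<in>S. g (f x) = h x)"
  by (auto simp: compose_def fun_eq_iff extensional_def)

lemma rhom_ext: "f \<in> rhom A X Y \<Longrightarrow> f \<in> extensional (carrier X)"
  by (simp add: rhom_iff_lin)

lemma zero_hom_ext [simp]: "zero_hom X Y \<in> extensional (carrier X)"
  by (simp add: zero_hom_def)

lemma id_hom_ext [simp]: "id_hom X \<in> extensional (carrier X)"
  by (simp add: id_hom_def)

lemma zero_hom_apply [simp]: "x \<in> carrier X \<Longrightarrow> zero_hom X Y x = \<zero>\<^bsub>Y\<^esub>"
  by (simp add: zero_hom_def)

lemma id_hom_apply [simp]: "x \<in> carrier X \<Longrightarrow> id_hom X x = x"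
  by (simp add: id_hom_def)

lemma rhom_eqI:
  assumes "f \<in> rhom A X Y" "g \<in> rhom A X Y" "\<And>x. x \<in> carrier X \<Longrightarrow> f x = g x"
  shows "f = g"
  using extensionalityI[OF rhom_ext[OF assms(1)] rhom_ext[OF assms(2)]] assms(3) by simp

lemma (in two_modules) zero_hom_rhom: "zero_hom X Y \<in> rhom A X Y"
  unfolding zero_hom_def by (rule lin_restrict[OF lin_zero_fun X.right_module_axioms])

lemma compose_zero_iff: "compose (carrier X) g f = zero_hom X Y \<longleftrightarrow> (\<forall>x\<in>carrier X. g (f x) = \<zero>\<^bsub>Y\<^esub>)"
  by (simp add: compose_eq_iff)

lemma ex1_rhomI:
  assumes "lin A Z K h" "right_module A Z" "\<And>x. x \<in> carrier Z \<Longrightarrow> k (h x) = g x" "g \<in> extensional (carrier Z)"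
    and "\<And>h'. \<lbrakk>h' \<in> rhom A Z K; \<forall>x\<in>carrier Z. k (h' x) = g x\<rbrakk> \<Longrightarrow> \<forall>x\<in>carrier Z. h' x = h x"
  shows "\<exists>!h. h \<in> rhom A Z K \<and> compose (carrier Z) k h = g"
proof (rule ex1I[of _ "restrict h (carrier Z)"])
  show "restrict h (carrier Z) \<in> rhom A Z K \<and> compose (carrier Z) k (restrict h (carrier Z)) = g"
    using lin_restrict[OF assms(1,2)] assms(3,4) by (simp add: compose_eq_iff)
  fix h' assume "h' \<in> rhom A Z K \<and> compose (carrier Z) k h' = g"
  then have h': "h' \<in> rhom A Z K" "\<forall>x\<in>carrier Z. k (h' x) = g x"
    using compose_eq_iff[OF assms(4)] by auto
  show "h' = restrict h (carrier Z)"
    using assms(5)[OF h'] by (intro rhom_eqI[OF h'(1) lin_restrict[OF assms(1,2)]]) simp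
qed

lemma ex1_rhomI':
  assumes "lin A Q Z h" "right_module A Q" "\<And>x. x \<in> carrier Y \<Longrightarrow> h (q x) = g x"
    "\<And>x. x \<in> carrier Y \<Longrightarrow> q x \<in> carrier Q" "g \<in> extensional (carrier Y)"
    and "\<And>h'. \<lbrakk>h' \<in> rhom A Q Z; \<forall>x\<in>carrier Y. h' (q x) = g x\<rbrakk> \<Longrightarrow> \<forall>x\<in>carrier Q. h' x = h x"
  shows "\<exists>!h. h \<in> rhom A Q Z \<and> compose (carrier Y) h q = g"
proof (rule ex1I[of _ "restrict h (carrier Q)"])
  show "restrict h (carrier Q) \<in> rhom A Q Z \<and> compose (carrier Y) (restrict h (carrier Q)) q = g"
    using lin_restrict[OF assms(1,2)] assms(3-5) by (simp add: compose_eq_iff)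
  fix h' assume "h' \<in> rhom A Q Z \<and> compose (carrier Y) h' q = g"
  then have h': "h' \<in> rhom A Q Z" "\<forall>x\<in>carrier Y. h' (q x) = g x"
    using compose_eq_iff[OF assms(5)] by auto
  show "h' = restrict h (carrier Q)"
    using assms(6)[OF h'] by (intro rhom_eqI[OF h'(1) lin_restrict[OF assms(1,2)]]) simp
qed

text \<open>Cokernels in C are tested on C only and need not be quotients of modules. But the
  injective f is a monomorphism of C, hence the kernel of some g. Since g factors through the
  cokernel q, whatever q kills is killed by g, so f is a kernel of q as well. Exactness of the
  inclusion, applied to f and q, makes q a module-theoretic cokernel.\<close>

lemma abelian_exact_cokernel:
  assumes C: "abelian_exact_subcat A C" and XY: "X \<in> C" "Y \<in> C"
    and f: "lin A X Y f" "inj_on f (carrier X)"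
  obtains Q q where "Q \<in> C" "lin A Y Q q" "q ` carrier Y = carrier Q"
    "{y \<in> carrier Y. q y = \<zero>\<^bsub>Q\<^esub>} = f ` carrier X"
proof -
  have CA: "C \<subseteq> mod_cat A" and ab: "abelian_cat A C" and ex: "exact_inclusion A C"
    using C by (auto simp: abelian_exact_subcat_def)
  have rm: "right_module A Z" if "Z \<in> C" for Z using that CA mod_catD(1) by blast
  define f' where "f' = restrict f (carrier X)"
  have f': "f' \<in> rhom A X Y" unfolding f'_def by (rule lin_restrict[OF f(1) rm[OF XY(1)]])
  have f'x: "f' x = f x" if "x \<in> carrier X" for x using that by (simp add: f'_def)
  have inj: "inj_on f' (carrier X)" using f(2) f'x by (simp add: inj_on_def)
  have "is_mono A C X Y f'"
    unfolding is_mono_def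
  proof (intro ballI impI)
    fix Z g h assume Z: "Z \<in> C" and gh: "g \<in> rhom A Z X" "h \<in> rhom A Z X"
      and eq: "compose (carrier Z) f' g = compose (carrier Z) f' h"
    show "g = h"
    proof (rule rhom_eqI[OF gh])
      fix x assume x: "x \<in> carrier Z"
      then have "f' (g x) = f' (h x)" using fun_cong[OF eq, of x] by (simp add: compose_def)
      then show "g x = h x"
        using inj_onD[OF inj] linD(1)[OF rhom_lin[OF gh(1)] x] linD(1)[OF rhom_lin[OF gh(2)] x] by blast
    qed
  qed
  then obtain Z g where Z: "Z \<in> C" "g \<in> rhom A Y Z" "is_kernel A C X Y Z f' g"
    using ab XY f' unfolding abelian_cat_def by blast
  obtain Q q where Q: "is_cokernel A C X Y Q f' q"
    using ab XY f' unfolding abelian_cat_def by blast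
  then have QC: "Q \<in> C" "q \<in> rhom A Y Q" "compose (carrier X) q f' = zero_hom X Q"
    and Qu: "\<And>W w. \<lbrakk>W \<in> C; w \<in> rhom A Y W; compose (carrier X) w f' = zero_hom X W\<rbrakk> \<Longrightarrow>
      \<exists>!h. h \<in> rhom A Q W \<and> compose (carrier Y) h q = w"
    unfolding is_cokernel_def by auto
  have gf: "compose (carrier X) g f' = zero_hom X Z"
    and Ku: "\<And>W w. \<lbrakk>W \<in> C; w \<in> rhom A W Y; compose (carrier W) g w = zero_hom W Z\<rbrakk> \<Longrightarrow>
      \<exists>!h. h \<in> rhom A W X \<and> compose (carrier W) f' h = w"
    using Z(3) unfolding is_kernel_def by auto
  obtain h where h: "h \<in> rhom A Q Z" "compose (carrier Y) h q = g"
    using Qu[OF Z(1,2) gf] by blast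
  have hq: "h (q y) = g y" if "y \<in> carrier Y" for y
    using h(2) that compose_eq_iff[OF rhom_ext[OF Z(2)]] by blast
  have "is_kernel A C X Y Q f' q"
    unfolding is_kernel_def
  proof (intro conjI ballI impI XY(1) f' QC(3))
    fix W w assume W: "W \<in> C" "w \<in> rhom A W Y" "compose (carrier W) q w = zero_hom W Q"
    interpret QZ: two_modules A Q Z using rm QC(1) Z(1) by (intro two_modules.intro)
    have "g (w x) = \<zero>\<^bsub>Z\<^esub>" if x: "x \<in> carrier W" for x
      using hq[OF linD(1)[OF rhom_lin[OF W(2)] x]] W(3) x QZ.lin_zero[OF rhom_lin[OF h(1)]]
      unfolding compose_zero_iff by simp
    then have "compose (carrier W) g w = zero_hom W Z" unfolding compose_zero_iff by simp
    then show "\<exists>!h. h \<in> rhom A W X \<and> compose (carrier W) f' h = w" by (rule Ku[OF W(1,2)])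
  qed
  then have "f' ` carrier X = ker_hom Y Q q" "q ` carrier Y = carrier Q"
    using ex XY QC(1,2) f' Q unfolding exact_inclusion_def by blast+
  moreover have "f' ` carrier X = f ` carrier X" using f'x by (intro image_cong) auto
  ultimately show ?thesis
    using that[OF QC(1) rhom_lin[OF QC(2)]] by (simp add: ker_hom_def)
qed

text \<open>Kernels, images and quotients formed among modules stay in C and therefore have the
  universal properties tested on C. In return, every categorical notion of C can be compared with
  its module-theoretic counterpart by testing on these objects.\<close>

lemma (in artin_alg) abelian_exact_subcatI:
  fixes C :: "('a, 'a list set) module set"
  assumes C: "C \<subseteq> mod_cat A"
    and zero: "\<And>Z. \<lbrakk>Z \<in> mod_cat A; carrier Z = {\<zero>\<^bsub>Z\<^esub>}\<rbrakk> \<Longrightarrow> Z \<in> C"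
    and sub: "\<And>X N. \<lbrakk>X \<in> C; submodule N A X\<rbrakk> \<Longrightarrow> X\<lparr>carrier := N\<rparr> \<in> C"
    and quot: "\<And>X Q q. \<lbrakk>X \<in> C; Q \<in> mod_cat A; lin A X Q q; q ` carrier X = carrier Q\<rbrakk> \<Longrightarrow> Q \<in> C"
    and sum: "\<And>X Y B. \<lbrakk>X \<in> C; Y \<in> C; B \<in> mod_cat A; mod_iso A (dsum X Y) B\<rbrakk> \<Longrightarrow> B \<in> C"
  shows "abelian_exact_subcat A C"
proof -
  have rm: "right_module A Z" and fg: "fin_gen A Z" if "Z \<in> C" for Z using that C mod_catD by blast+
  have tm: "two_modules A X Y" if "X \<in> C" "Y \<in> C" for X Y using rm that by (intro two_modules.intro)
  have kerC: "X\<lparr>carrier := {x \<in> carrier X. f x = \<zero>\<^bsub>Y\<^esub>}\<rparr> \<in> C"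
    and inclker: "lin A (X\<lparr>carrier := {x \<in> carrier X. f x = \<zero>\<^bsub>Y\<^esub>}\<rparr>) X (\<lambda>x. x)"
    if "X \<in> C" "Y \<in> C" "lin A X Y f" for X Y f
    using sub[OF that(1) two_modules.ker_submodule[OF tm[OF that(1,2)] that(3)]]
    by (auto intro!: linI)
  have coker: "\<exists>Q q. Q \<in> C \<and> q \<in> rhom A Y Q \<and> q ` carrier Y = carrier Q \<and>
      (\<forall>y\<in>carrier Y. q y = \<zero>\<^bsub>Q\<^esub> \<longleftrightarrow> y \<in> f ` carrier X)" if XYf: "X \<in> C" "Y \<in> C" "lin A X Y f" for X Y f
  proof -
    interpret XY: two_modules A X Y by (rule tm; fact XYf)
    obtain Q q where Q: "Q \<in> mod_cat A" "lin A Y Q q" "q ` carrier Y = carrier Q"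
      "\<forall>y\<in>carrier Y. q y = \<zero>\<^bsub>Q\<^esub> \<longleftrightarrow> y \<in> f ` carrier X"
      using ex_quotient[OF rm[OF XYf(2)] fg[OF XYf(2)] XY.image_submodule[OF XYf(3) XY.X.submodule_carrier]] .
    then show ?thesis
      using quot[OF XYf(2) Q(1-3)] lin_restrict[OF Q(2) rm[OF XYf(2)]]
      by (intro exI[of _ Q] exI[of _ "restrict q (carrier Y)"]) simp
  qed
  have "\<exists>Z. zero_object A C Z"
  proof -
    obtain Z where Z: "Z \<in> mod_cat A" "carrier Z = {\<zero>\<^bsub>Z\<^esub>}"
      using ex_zero_module[OF ring_axioms] .
    note ZC = zero[OF Z]
    have "rhom A X Z = {zero_hom X Z} \<and> rhom A Z X = {zero_hom Z X}" if X: "X \<in> C" for X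
    proof -
      interpret XZ: two_modules A X Z by (rule tm; fact X ZC)
      interpret ZX: two_modules A Z X by (rule tm; fact X ZC)
      have "f = zero_hom X Z" if f: "f \<in> rhom A X Z" for f
        using linD(1)[OF rhom_lin[OF f]] Z(2) by (intro rhom_eqI[OF f XZ.zero_hom_rhom]) auto
      moreover have "f = zero_hom Z X" if f: "f \<in> rhom A Z X" for f
        using ZX.lin_zero[OF rhom_lin[OF f]] Z(2) by (intro rhom_eqI[OF f ZX.zero_hom_rhom]) auto
      ultimately show ?thesis using XZ.zero_hom_rhom ZX.zero_hom_rhom by blast
    qed
    then show ?thesis unfolding zero_object_def using ZC by blast
  qed
  moreover have "\<exists>B i j p q. is_biproduct A C X Y B i j p q" if XYC: "X \<in> C" "Y \<in> C" for X Y
  proof -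
    interpret XY: two_modules A X Y by (rule tm; fact XYC)
    note S = XY.dsum_right_module
    obtain B where B: "B \<in> mod_cat A" "mod_iso A (dsum X Y) B"
      using ex_mod_cat_iso[OF S XY.dsum_fin_gen[OF fg[OF XYC(1)] fg[OF XYC(2)]]] by blast
    note rB = mod_catD(1)[OF B(1)]
    interpret SB: two_modules A "dsum X Y" B using S rB by (rule two_modules.intro)
    obtain f where f: "lin A (dsum X Y) B f" "bij_betw f (carrier (dsum X Y)) (carrier B)"
      using mod_iso_lin[OF B(2)] .
    define f' where "f' = inv_into (carrier (dsum X Y)) f"
    note g = SB.lin_inverse[OF f, folded f'_def]
    have gf: "f' (f s) = s" if "s \<in> carrier (dsum X Y)" for s
      unfolding f'_def using bij_betw_inv_into_left[OF f(2) that] .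
    have fg': "f (f' b) = b" if "b \<in> carrier B" for b
      unfolding f'_def using bij_betw_inv_into_right[OF f(2) that] .
    define i j p q where "i = restrict (\<lambda>x. f (x, \<zero>\<^bsub>Y\<^esub>)) (carrier X)"
      and "j = restrict (\<lambda>y. f (\<zero>\<^bsub>X\<^esub>, y)) (carrier Y)"
      and "p = restrict (\<lambda>b. fst (f' b)) (carrier B)" and "q = restrict (\<lambda>b. snd (f' b)) (carrier B)"
    have hom: "i \<in> rhom A X B" "j \<in> rhom A Y B" "p \<in> rhom A B X" "q \<in> rhom A B Y"
      unfolding i_def j_def p_def q_def
      by (rule lin_restrict[OF lin_comp[OF XY.dsum_lin(1) f(1)]] lin_restrict[OF lin_comp[OF XY.dsum_lin(2) f(1)]]
          lin_restrict[OF lin_comp[OF g XY.dsum_lin(3)]] lin_restrict[OF lin_comp[OF g XY.dsum_lin(4)]];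
          fact rm[OF XYC(1)] rm[OF XYC(2)] rB)+
    have pi: "p (i x) = x" "q (i x) = \<zero>\<^bsub>Y\<^esub>" if "x \<in> carrier X" for x
      using that linD(1)[OF f(1)] by (simp_all add: p_def q_def i_def gf)
    have qj: "q (j y) = y" "p (j y) = \<zero>\<^bsub>X\<^esub>" if "y \<in> carrier Y" for y
      using that linD(1)[OF f(1)] by (simp_all add: p_def q_def j_def gf)
    have sum1: "i (p b) \<oplus>\<^bsub>B\<^esub> j (q b) = b" if b: "b \<in> carrier B" for b
    proof -
      obtain x y where xy: "f' b = (x, y)" "x \<in> carrier X" "y \<in> carrier Y"
        using linD(1)[OF g b] by (cases "f' b") auto
      have "i (p b) \<oplus>\<^bsub>B\<^esub> j (q b) = f ((x, \<zero>\<^bsub>Y\<^esub>) \<oplus>\<^bsub>dsum X Y\<^esub> (\<zero>\<^bsub>X\<^esub>, y))"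
        using linD(2)[OF f(1), of "(x, \<zero>\<^bsub>Y\<^esub>)" "(\<zero>\<^bsub>X\<^esub>, y)"] b xy by (simp add: i_def j_def p_def q_def)
      also have "\<dots> = b" using xy fg'[OF b] by simp
      finally show ?thesis .
    qed
    have "is_biproduct A C X Y B i j p q"
      unfolding is_biproduct_def
    proof (intro conjI hom sum[OF XYC B])
      show "compose (carrier X) p i = id_hom X" "compose (carrier Y) q j = id_hom Y"
        "compose (carrier X) q i = zero_hom X Y" "compose (carrier Y) p j = zero_hom Y X"
        using pi qj by (simp_all add: compose_eq_iff)
      show "(\<lambda>b\<in>carrier B. i (p b) \<oplus>\<^bsub>B\<^esub> j (q b)) = id_hom B"
        unfolding id_hom_def by (rule restrict_ext) (rule sum1)
    qed
    then show ?thesis by blast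
  qed
  moreover have "(\<exists>K k. is_kernel A C K X Y k f) \<and> (\<exists>Q q. is_cokernel A C X Y Q f q) \<and>
      (is_mono A C X Y f \<longrightarrow> (\<exists>Z \<in> C. \<exists>g \<in> rhom A Y Z. is_kernel A C X Y Z f g)) \<and>
      (is_epi A C X Y f \<longrightarrow> (\<exists>Z \<in> C. \<exists>g \<in> rhom A Z X. is_cokernel A C Z X Y g f))"
    if XYC: "X \<in> C" "Y \<in> C" and f: "f \<in> rhom A X Y" for X Y f
  proof -
    interpret XY: two_modules A X Y by (rule tm; fact XYC)
    note lf = rhom_lin[OF f]
    let ?K = "X\<lparr>carrier := {x \<in> carrier X. f x = \<zero>\<^bsub>Y\<^esub>}\<rparr>"
    note K = kerC[OF XYC lf] and iK = inclker[OF XYC lf]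
    interpret KX: two_modules A ?K X by (rule tm; fact K XYC)
    interpret KY: two_modules A ?K Y by (rule tm; fact K XYC)
    define k where "k = restrict (\<lambda>x. x) (carrier ?K)"
    have k: "k \<in> rhom A ?K X" unfolding k_def by (rule lin_restrict[OF iK rm[OF K]])
    have kx: "k x = x" if "x \<in> carrier ?K" for x using that by (simp add: k_def)
    have fk: "compose (carrier ?K) f k = zero_hom ?K Y" unfolding compose_zero_iff k_def by simp
    obtain Q q where Q: "Q \<in> C" "q \<in> rhom A Y Q" "q ` carrier Y = carrier Q"
      "\<forall>y\<in>carrier Y. q y = \<zero>\<^bsub>Q\<^esub> \<longleftrightarrow> y \<in> f ` carrier X"
      using coker[OF XYC lf] by (elim exE conjE)
    interpret XQ: two_modules A X Q by (rule tm; fact Q(1) XYC)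
    interpret YQ: two_modules A Y Q by (rule tm; fact Q(1) XYC)
    have qf: "compose (carrier X) q f = zero_hom X Q"
      using Q(4) linD(1)[OF lf] unfolding compose_zero_iff by simp
    have "is_kernel A C ?K X Y k f"
      unfolding is_kernel_def
    proof (intro conjI ballI impI K k fk)
      fix Z g assume Z: "Z \<in> C" "g \<in> rhom A Z X" "compose (carrier Z) f g = zero_hom Z Y"
      have g: "g x \<in> carrier ?K" if "x \<in> carrier Z" for x
        using Z(3) that linD(1)[OF rhom_lin[OF Z(2)] that] unfolding compose_zero_iff by simp
      have "lin A Z ?K g" by (rule lin_into_sub[OF rhom_lin[OF Z(2)]]) (use g in simp)
      then show "\<exists>!h. h \<in> rhom A Z ?K \<and> compose (carrier Z) k h = g"
      proof (rule ex1_rhomI[OF _ rm[OF Z(1)] _ rhom_ext[OF Z(2)]])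
        fix h' assume h': "h' \<in> rhom A Z ?K" "\<forall>x\<in>carrier Z. k (h' x) = g x"
        show "\<forall>x\<in>carrier Z. h' x = g x"
        proof
          fix x assume x: "x \<in> carrier Z"
          show "h' x = g x" using kx[OF linD(1)[OF rhom_lin[OF h'(1)] x]] h'(2) x by simp
        qed
      qed (rule kx[OF g])
    qed
    moreover have "is_cokernel A C X Y Q f q"
      unfolding is_cokernel_def
    proof (intro conjI ballI impI Q(1,2) qf)
      fix Z g assume Z: "Z \<in> C" "g \<in> rhom A Y Z" "compose (carrier X) g f = zero_hom X Z"
      have "g y = \<zero>\<^bsub>Z\<^esub>" if "y \<in> carrier Y" "q y = \<zero>\<^bsub>Q\<^esub>" for y
        using Q(4) that Z(3) unfolding compose_zero_iff by auto
      from lin_factor[OF rm[OF XYC(2)] rm[OF Q(1)] rm[OF Z(1)] rhom_lin[OF Q(2)] Q(3) rhom_lin[OF Z(2)] this]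
      obtain h where h: "lin A Q Z h" "\<forall>y\<in>carrier Y. h (q y) = g y" .
      from h(1) rm[OF Q(1)] show "\<exists>!h. h \<in> rhom A Q Z \<and> compose (carrier Y) h q = g"
      proof (rule ex1_rhomI'[OF _ _ _ _ rhom_ext[OF Z(2)]])
        fix h' assume h': "h' \<in> rhom A Q Z" "\<forall>y\<in>carrier Y. h' (q y) = g y"
        then show "\<forall>x\<in>carrier Q. h' x = h x" unfolding Q(3)[symmetric] using h(2) by auto
      qed (use h(2) linD(1)[OF rhom_lin[OF Q(2)]] in auto)
    qed
    moreover have "\<exists>Z \<in> C. \<exists>g \<in> rhom A Y Z. is_kernel A C X Y Z f g" if mono: "is_mono A C X Y f"
    proof (intro bexI[of _ Q] bexI[of _ q] Q(1,2))
      \<comment> \<open>The kernel of f is an object of C; testing the monomorphism f on its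
        inclusion and on zero shows that it vanishes.\<close>
      have z: "zero_hom ?K X \<in> rhom A ?K X" by (rule KX.zero_hom_rhom)
      have "compose (carrier ?K) f (zero_hom ?K X) = zero_hom ?K Y"
        using XY.lin_zero[OF lf] unfolding compose_zero_iff by simp
      then have "k = zero_hom ?K X" using mono[unfolded is_mono_def, rule_format, OF K k z] fk by simp
      then have kz: "k x = \<zero>\<^bsub>X\<^esub>" if "x \<in> carrier ?K" for x
        using zero_hom_apply[OF that, where Y = X] by simp
      then have kz': "x = \<zero>\<^bsub>X\<^esub>" if "x \<in> carrier X" "f x = \<zero>\<^bsub>Y\<^esub>" for x
        using kx[of x] that by simp
      then have inj: "inj_on f (carrier X)" unfolding XY.inj_on_iff_ker[OF lf] by blast
      have ims: "submodule (f ` carrier X) A Y"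
        by (rule XY.image_submodule[OF lf XY.X.submodule_carrier])
      let ?I = "Y\<lparr>carrier := f ` carrier X\<rparr>"
      note I = sub[OF XYC(2) ims]
      interpret XI: two_modules A X ?I by (rule tm; fact I XYC)
      have fI: "lin A X ?I f" by (rule lin_into_sub[OF lf]) simp
      have bij: "bij_betw f (carrier X) (carrier ?I)" using inj by (simp add: bij_betw_def)
      note inv = XI.lin_inverse[OF fI bij]
      show "is_kernel A C X Y Q f q"
        unfolding is_kernel_def
      proof (intro conjI ballI impI XYC f qf)
        fix Z g assume Z: "Z \<in> C" "g \<in> rhom A Z Y" "compose (carrier Z) q g = zero_hom Z Q"
        have g: "g x \<in> f ` carrier X" if "x \<in> carrier Z" for x
          using Z(3) that linD(1)[OF rhom_lin[OF Z(2)] that] Q(4) unfolding compose_zero_iff by blast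
        have "lin A Z ?I g" by (rule lin_into_sub[OF rhom_lin[OF Z(2)]]) (use g in simp)
        from lin_comp[OF this inv] rm[OF Z(1)]
        show "\<exists>!h. h \<in> rhom A Z X \<and> compose (carrier Z) f h = g"
        proof (rule ex1_rhomI[OF _ _ _ rhom_ext[OF Z(2)]])
          show "f (inv_into (carrier X) f (g x)) = g x" if "x \<in> carrier Z" for x
            using g[OF that] by (rule f_inv_into_f)
          fix h' assume h': "h' \<in> rhom A Z X" "\<forall>x\<in>carrier Z. f (h' x) = g x"
          show "\<forall>x\<in>carrier Z. h' x = inv_into (carrier X) f (g x)"
          proof
            fix x assume x: "x \<in> carrier Z"
            show "h' x = inv_into (carrier X) f (g x)"
              using inv_into_f_f[OF inj linD(1)[OF rhom_lin[OF h'(1)] x]] h'(2) x by simp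
          qed
        qed
      qed
    qed
    moreover have "\<exists>Z \<in> C. \<exists>g \<in> rhom A Z X. is_cokernel A C Z X Y g f" if epi: "is_epi A C X Y f"
    proof (intro bexI[of _ ?K] bexI[of _ k] K k)
      \<comment> \<open>Dually, testing the epimorphism f on the quotient map to its cokernel and on
        zero shows that f is onto.\<close>
      have z: "zero_hom Y Q \<in> rhom A Y Q" by (rule YQ.zero_hom_rhom)
      have "compose (carrier X) (zero_hom Y Q) f = zero_hom X Q"
        using linD(1)[OF lf] unfolding compose_zero_iff by simp
      then have "q = zero_hom Y Q" using epi[unfolded is_epi_def, rule_format, OF Q(1,2) z] qf by simp
      then have "q y = \<zero>\<^bsub>Q\<^esub>" if "y \<in> carrier Y" for y using that by simp
      then have "carrier Y \<subseteq> f ` carrier X" using Q(4) by (intro subsetI) simp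
      then have surj: "f ` carrier X = carrier Y"
        by (intro equalityI image_subsetI linD(1)[OF lf])
      show "is_cokernel A C ?K X Y k f"
        unfolding is_cokernel_def
      proof (intro conjI ballI impI XYC f fk)
        fix Z g assume Z: "Z \<in> C" "g \<in> rhom A X Z" "compose (carrier ?K) g k = zero_hom ?K Z"
        have "g x = \<zero>\<^bsub>Z\<^esub>" if "x \<in> carrier X" "f x = \<zero>\<^bsub>Y\<^esub>" for x
          using Z(3) that kx[of x] unfolding compose_zero_iff by auto
        from lin_factor[OF rm[OF XYC(1)] rm[OF XYC(2)] rm[OF Z(1)] lf surj rhom_lin[OF Z(2)] this]
        obtain h where h: "lin A Y Z h" "\<forall>x\<in>carrier X. h (f x) = g x" .
        from h(1) rm[OF XYC(2)] show "\<exists>!h. h \<in> rhom A Y Z \<and> compose (carrier X) h f = g"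
        proof (rule ex1_rhomI'[OF _ _ _ _ rhom_ext[OF Z(2)]])
          fix h' assume h': "h' \<in> rhom A Y Z" "\<forall>x\<in>carrier X. h' (f x) = g x"
          then show "\<forall>y\<in>carrier Y. h' y = h y" unfolding surj[symmetric] using h(2) by auto
        qed (use h(2) linD(1)[OF lf] in auto)
      qed
    qed
    ultimately show ?thesis by blast
  qed
  ultimately have ab: "abelian_cat A C"
    unfolding abelian_cat_def by (intro conjI ballI) blast+
  have "exact_inclusion A C"
    unfolding exact_inclusion_def
  proof (intro ballI impI)
    fix X Y Z f g
    assume XYZ: "X \<in> C" "Y \<in> C" "Z \<in> C" and fg: "f \<in> rhom A X Y" "g \<in> rhom A Y Z"
      and "is_kernel A C X Y Z f g \<and> is_cokernel A C X Y Z f g"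
    then have gf: "\<forall>x\<in>carrier X. g (f x) = \<zero>\<^bsub>Z\<^esub>"
      and ker: "\<And>W w. \<lbrakk>W \<in> C; w \<in> rhom A W Y; compose (carrier W) g w = zero_hom W Z\<rbrakk> \<Longrightarrow>
        \<exists>!h. h \<in> rhom A W X \<and> compose (carrier W) f h = w"
      and cok: "\<And>W w. \<lbrakk>W \<in> C; w \<in> rhom A Y W; compose (carrier X) w f = zero_hom X W\<rbrakk> \<Longrightarrow>
        \<exists>!h. h \<in> rhom A Z W \<and> compose (carrier Y) h g = w"
      unfolding is_kernel_def is_cokernel_def compose_zero_iff by auto
    note lf = rhom_lin[OF fg(1)] and lg = rhom_lin[OF fg(2)]
    interpret XY: two_modules A X Y by (rule tm; fact XYZ)
    interpret YZ: two_modules A Y Z by (rule tm; fact XYZ)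
    show "inj_on f (carrier X) \<and> f ` carrier X = ker_hom Y Z g \<and> g ` carrier Y = carrier Z"
    proof (intro conjI)
      let ?K = "X\<lparr>carrier := {x \<in> carrier X. f x = \<zero>\<^bsub>Y\<^esub>}\<rparr>"
      note K = kerC[OF XYZ(1,2) lf] and iK = inclker[OF XYZ(1,2) lf]
      interpret KX: two_modules A ?K X by (rule tm; fact K XYZ)
      interpret KY: two_modules A ?K Y by (rule tm; fact K XYZ)
      define k where "k = restrict (\<lambda>x. x) (carrier ?K)"
      have k: "k \<in> rhom A ?K X" unfolding k_def by (rule lin_restrict[OF iK rm[OF K]])
      have a: "compose (carrier ?K) f k = zero_hom ?K Y" unfolding compose_zero_iff k_def by simp
      have b: "compose (carrier ?K) f (zero_hom ?K X) = zero_hom ?K Y"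
        using XY.lin_zero[OF lf] unfolding compose_zero_iff by simp
      have c: "compose (carrier ?K) g (zero_hom ?K Y) = zero_hom ?K Z"
        using YZ.lin_zero[OF lg] unfolding compose_zero_iff by simp
      \<comment> \<open>The inclusion of the kernel of f and the zero map both factor zero through
        f, and such a factorization is unique.\<close>
      have "k = zero_hom ?K X"
        using ker[OF K KY.zero_hom_rhom c] conjI[OF k a] conjI[OF KX.zero_hom_rhom b] by blast
      from fun_cong[OF this] have "x = \<zero>\<^bsub>X\<^esub>" if "x \<in> carrier X" "f x = \<zero>\<^bsub>Y\<^esub>" for x
        using that by (simp add: k_def zero_hom_def) metis
      then show "inj_on f (carrier X)" unfolding XY.inj_on_iff_ker[OF lf] by blast
      let ?L = "Y\<lparr>carrier := {y \<in> carrier Y. g y = \<zero>\<^bsub>Z\<^esub>}\<rparr>"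
      note L = kerC[OF XYZ(2,3) lg] and iL = inclker[OF XYZ(2,3) lg]
      define l where "l = restrict (\<lambda>x. x) (carrier ?L)"
      have l: "l \<in> rhom A ?L Y" unfolding l_def by (rule lin_restrict[OF iL rm[OF L]])
      have "compose (carrier ?L) g l = zero_hom ?L Z" unfolding compose_zero_iff l_def by simp
      \<comment> \<open>The inclusion of the kernel of g factors through f, so this kernel lies in
        the image of f.\<close>
      then obtain h where h: "h \<in> rhom A ?L X" "compose (carrier ?L) f h = l"
        using ker[OF L l] by blast
      have "y \<in> f ` carrier X" if y: "y \<in> carrier Y" "g y = \<zero>\<^bsub>Z\<^esub>" for y
      proof -
        have "f (h y) = y" using fun_cong[OF h(2), of y] y by (simp add: compose_def l_def)
        moreover have "h y \<in> carrier X" using linD(1)[OF rhom_lin[OF h(1)], of y] y by simp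
        ultimately show ?thesis using imageI[of "h y" "carrier X" f] by simp
      qed
      then show "f ` carrier X = ker_hom Y Z g"
        unfolding ker_hom_def using gf linD(1)[OF lf] by (intro equalityI subsetI) auto
      obtain Q q where Q: "Q \<in> C" "q \<in> rhom A Z Q" "q ` carrier Z = carrier Q"
        "\<forall>z\<in>carrier Z. q z = \<zero>\<^bsub>Q\<^esub> \<longleftrightarrow> z \<in> g ` carrier Y"
        using coker[OF XYZ(2,3) lg] by (elim exE conjE)
      interpret YQ: two_modules A Y Q by (rule tm; fact XYZ Q(1))
      interpret ZQ: two_modules A Z Q by (rule tm; fact XYZ Q(1))
      have c: "compose (carrier X) (zero_hom Y Q) f = zero_hom X Q"
        using linD(1)[OF lf] unfolding compose_zero_iff by simp
      have a: "compose (carrier Y) q g = zero_hom Y Q"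
        using Q(4) linD(1)[OF lg] unfolding compose_zero_iff by simp
      have b: "compose (carrier Y) (zero_hom Z Q) g = zero_hom Y Q"
        using linD(1)[OF lg] unfolding compose_zero_iff by simp
      \<comment> \<open>The quotient map by the image of g and the zero map both factor zero through
        g, so they agree and g is onto.\<close>
      have "q = zero_hom Z Q"
        using cok[OF Q(1) YQ.zero_hom_rhom c] conjI[OF Q(2) a] conjI[OF ZQ.zero_hom_rhom b] by blast
      then have "q z = \<zero>\<^bsub>Q\<^esub>" if "z \<in> carrier Z" for z using that by simp
      then have "carrier Z \<subseteq> g ` carrier Y" using Q(4) by (intro subsetI) simp
      then show "g ` carrier Y = carrier Z" by (intro equalityI image_subsetI linD(1)[OF lg])
    qed
  qed
  then show ?thesis unfolding abelian_exact_subcat_def using C ab by blast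
qed

text \<open>Paths live on the carrier type of \<open>ind_cat\<close>, whereas the modules r A and e
  A are right ideals on the type of the ring; maps between the latter are moved to
  representatives.\<close>

lemma nonzero_step_iso:
  assumes "X' \<in> ind_cat A" "Y' \<in> ind_cat A" "mod_iso A X X'" "mod_iso A Y Y'"
    and XY: "right_module A X" "right_module A Y"
    and f: "lin A X Y f" "x \<in> carrier X" "f x \<noteq> \<zero>\<^bsub>Y\<^esub>"
  shows "nonzero_step A X' Y'"
proof -
  interpret XX: two_modules A X X' using XY(1) ind_catD(2)[OF assms(1)] by (rule two_modules.intro)
  interpret YY: two_modules A Y Y' using XY(2) ind_catD(2)[OF assms(2)] by (rule two_modules.intro)
  obtain u where u: "lin A X X' u" "bij_betw u (carrier X) (carrier X')" using mod_iso_lin[OF assms(3)] .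
  obtain v where v: "lin A Y Y' v" "bij_betw v (carrier Y) (carrier Y')" using mod_iso_lin[OF assms(4)] .
  show ?thesis
  proof (rule nonzero_stepI[OF assms(1,2) lin_comp[OF lin_comp[OF XX.lin_inverse[OF u] f(1)] v(1)]])
    show "u x \<in> carrier X'" using linD(1)[OF u(1) f(2)] .
    have "v (f x) \<noteq> \<zero>\<^bsub>Y'\<^esub>"
      using YY.inj_on_iff_ker[OF v(1)] v(2) f(3) linD(1)[OF f(1,2)] by (auto simp: bij_betw_def)
    then show "v (f (inv_into (carrier X) u (u x))) \<noteq> \<zero>\<^bsub>Y'\<^esub>"
      using bij_betw_inv_into_left[OF u(2) f(2)] by simp
  qed
qed

section \<open>Local extensions of hereditary algebras\<close>

text \<open>
  The triangular matrix algebra seen through its idempotent \<open>e = (0, 0, 1)\<close>: then \<open>e A e = R\<close>,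
  \<open>e A (1 - e) = M\<close> and \<open>(1 - e) A = H\<close>.  The set \<open>J\<close> is the radical of \<open>R\<close>, the elements
  \<open>r\<close> and \<open>t\<close> lie in its right and left socle, and \<open>D\<close> contains the square of \<open>J\<close>.
\<close>

locale local_extension = artin_alg A k \<eta>
  for A :: "('a, 'c) ring_scheme" (structure) and k :: "('k, 'd) ring_scheme" and \<eta> :: "'k \<Rightarrow> 'a" +
  fixes e r t c :: 'a and J D :: "'a set"
  assumes e [simp]: "e \<in> carrier A" "e \<otimes> e = e"
    and lower: "a \<in> carrier A \<Longrightarrow> a \<otimes> e = e \<otimes> a \<otimes> e"
    and J: "x \<in> J \<Longrightarrow> x \<in> carrier A" "x \<in> J \<Longrightarrow> e \<otimes> x = x" "x \<in> J \<Longrightarrow> x \<otimes> e = x"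
    and J_add: "\<lbrakk>x \<in> J; y \<in> J\<rbrakk> \<Longrightarrow> x \<oplus> y \<in> J"
    and e_J: "e \<notin> J"
    and unit: "\<lbrakk>x \<in> carrier A; e \<otimes> x = x; x \<otimes> e = x; x \<notin> J\<rbrakk> \<Longrightarrow>
      \<exists>y\<in>carrier A. x \<otimes> y = e \<and> y \<otimes> x = e"
    and r: "r \<in> carrier A" "e \<otimes> r = r" "r \<otimes> e = r" "r \<noteq> \<zero>" "x \<in> J \<Longrightarrow> r \<otimes> x = \<zero>"
    and t: "t \<in> carrier A" "e \<otimes> t = t" "t \<otimes> e = t" "t \<noteq> \<zero>" "x \<in> J \<Longrightarrow> x \<otimes> t = \<zero>"
    and c: "c \<in> J" "c \<notin> D"
    and D: "\<zero> \<in> D" "\<lbrakk>x \<in> D; y \<in> D\<rbrakk> \<Longrightarrow> x \<oplus> y \<in> D" "\<lbrakk>x \<in> J; y \<in> J\<rbrakk> \<Longrightarrow> x \<otimes> y \<in> D"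
    and hereditary: "\<lbrakk>right_ideal I A; \<And>x. x \<in> I \<Longrightarrow> e \<otimes> x = \<zero>\<rbrakk> \<Longrightarrow>
      dual_basis A ((regular A)\<lparr>carrier := I\<rparr>)"
begin

interpretation A: right_module A "regular A" by (rule regular_right_module)

text \<open>The right ideals e A, e A (1 - e) and (1 - e) A, given by equations instead of as
  images. In these terms (1 - e) A is H as a right module.\<close>

definition eA :: "'a set" where "eA = {a \<in> carrier A. e \<otimes> a = a}"
definition M :: "'a set" where "M = {a \<in> carrier A. e \<otimes> a = a \<and> a \<otimes> e = \<zero>}"
definition fA :: "'a set" where "fA = {a \<in> carrier A. e \<otimes> a = \<zero>}"

definition killed :: "('a, 'x, 'e) module_scheme \<Rightarrow> bool" where
  "killed X \<longleftrightarrow> (\<forall>x\<in>carrier X. e \<odot>\<^bsub>X\<^esub> x = \<zero>\<^bsub>X\<^esub>)"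

lemma eA_submodule: "right_ideal eA A"
  by (rule A.submoduleI) (auto simp: eA_def r_distr m_assoc[symmetric])

lemma M_submodule: "right_ideal M A"
proof (rule A.submoduleI)
  fix a x assume a: "a \<in> carrier A" and "x \<in> M"
  then have x: "x \<in> carrier A" "e \<otimes> x = x" "x \<otimes> e = \<zero>" by (auto simp: M_def)
  have "x \<otimes> a \<otimes> e = x \<otimes> (e \<otimes> a \<otimes> e)" using a x lower[OF a] by (simp add: m_assoc)
  also have "\<dots> = x \<otimes> e \<otimes> (a \<otimes> e)" using a x(1) by (simp add: m_assoc)
  also have "\<dots> = \<zero>" using a x by simp
  finally show "a \<odot>\<^bsub>regular A\<^esub> x \<in> M" using a x by (auto simp: M_def m_assoc[symmetric])
qed (auto simp: M_def r_distr l_distr)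

lemma fA_submodule: "right_ideal fA A"
  by (rule A.submoduleI) (auto simp: fA_def r_distr m_assoc[symmetric])

text \<open>Triangularity says (1 - e) A e = 0, so the component (x a) e depends on x e alone. In
  particular the elements with x e = 0 form a submodule.\<close>

lemma e_smult:
  assumes "right_module A X" "x \<in> carrier X" "a \<in> carrier A"
  shows "e \<odot>\<^bsub>X\<^esub> (a \<odot>\<^bsub>X\<^esub> x) = e \<odot>\<^bsub>X\<^esub> (a \<odot>\<^bsub>X\<^esub> (e \<odot>\<^bsub>X\<^esub> x))"
proof -
  interpret X: right_module A X by fact
  have "e \<odot>\<^bsub>X\<^esub> (a \<odot>\<^bsub>X\<^esub> x) = (a \<otimes> e) \<odot>\<^bsub>X\<^esub> x" using assms by (simp add: X.smult_assoc)
  also have "\<dots> = (e \<otimes> a \<otimes> e) \<odot>\<^bsub>X\<^esub> x" using lower[OF assms(3)] by simp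
  also have "\<dots> = e \<odot>\<^bsub>X\<^esub> (a \<odot>\<^bsub>X\<^esub> (e \<odot>\<^bsub>X\<^esub> x))" using assms by (simp add: X.smult_assoc)
  finally show ?thesis .
qed

lemma e_e_smult:
  assumes "right_module A X" "x \<in> carrier X"
  shows "e \<odot>\<^bsub>X\<^esub> (e \<odot>\<^bsub>X\<^esub> x) = e \<odot>\<^bsub>X\<^esub> x"
  using right_module.smult_assoc[OF assms(1) e(1) e(1) assms(2)] by simp

lemma killed_inj:
  assumes "right_module A X" "right_module A Y" "lin A X Y f" "inj_on f (carrier X)" "killed Y"
  shows "killed X"
proof -
  interpret two_modules A X Y using assms(1,2) by (rule two_modules.intro)
  show ?thesis
    using assms(4,5) linD(1,3)[OF assms(3)] e(1) X.smult_closed[OF e(1)]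
    unfolding killed_def inj_on_iff_ker[OF assms(3)] by simp
qed

lemma killed_surj:
  assumes "right_module A X" "right_module A Y" "lin A X Y f" "f ` carrier X = carrier Y" "killed X"
  shows "killed Y"
proof -
  interpret two_modules A X Y using assms(1,2) by (rule two_modules.intro)
  have "e \<odot>\<^bsub>Y\<^esub> f x = \<zero>\<^bsub>Y\<^esub>" if "x \<in> carrier X" for x
    using linD(3)[OF assms(3) e(1) that] assms(5) that lin_zero[OF assms(3)] by (simp add: killed_def)
  then show ?thesis unfolding killed_def assms(4)[symmetric] by simp
qed

lemma killed_iso:
  assumes "right_module A X" "right_module A Y" "mod_iso A X Y" "killed X"
  shows "killed Y"
proof -
  obtain f where f: "lin A X Y f" "bij_betw f (carrier X) (carrier Y)" using mod_iso_lin[OF assms(3)] .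
  show ?thesis by (rule killed_surj[OF assms(1,2) f(1) bij_betw_imp_surj_on[OF f(2)] assms(4)])
qed

lemma killed_sub:
  assumes "right_module A X" "submodule N A X" "killed X"
  shows "killed (X\<lparr>carrier := N\<rparr>)"
  using right_module.submoduleD(3)[OF assms(1,2)] assms(3) by (simp add: killed_def)

subsection \<open>Modules outside of mod H\<close>

text \<open>Of the two components of \<open>x\<close>, one is a multiple of \<open>x\<close> by a unit of the local ring \<open>e A e\<close>.\<close>

lemma local_splitting:
  assumes X: "right_module A X" and x: "x \<in> carrier X" "e \<odot>\<^bsub>X\<^esub> x = x" "x \<noteq> \<zero>\<^bsub>X\<^esub>"
    and gen: "\<And>y. y \<in> carrier X \<Longrightarrow> \<exists>a\<in>carrier A. e \<odot>\<^bsub>X\<^esub> y = a \<odot>\<^bsub>X\<^esub> x"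
    and UV: "internal_dsum A X U V"
  shows "x \<in> U \<or> x \<in> V"
proof -
  interpret X: right_module A X by fact
  note UVD = X.internal_dsumD[OF UV]
  \<comment> \<open>Because x = x e, the scalar with y e = x a may be replaced by e a e, which lies
    in the local ring e A e.\<close>
  have comp: "\<exists>s\<in>carrier A. e \<otimes> s = s \<and> s \<otimes> e = s \<and> e \<odot>\<^bsub>X\<^esub> y = s \<odot>\<^bsub>X\<^esub> x" if y: "y \<in> carrier X" for y
  proof -
    obtain a where a: "a \<in> carrier A" "e \<odot>\<^bsub>X\<^esub> y = a \<odot>\<^bsub>X\<^esub> x" using gen[OF y] by blast
    have "e \<odot>\<^bsub>X\<^esub> y = e \<odot>\<^bsub>X\<^esub> (a \<odot>\<^bsub>X\<^esub> (e \<odot>\<^bsub>X\<^esub> x))"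
      using a e_e_smult[OF X y] x(2) by simp
    also have "\<dots> = (e \<otimes> a \<otimes> e) \<odot>\<^bsub>X\<^esub> x" using a(1) x(1) by (simp add: X.smult_assoc)
    finally show ?thesis
      using a(1) by (intro bexI[of _ "e \<otimes> a \<otimes> e"]) (simp_all add: m_assoc, simp add: m_assoc[symmetric])
  qed
  have good: "x \<in> W" if W: "submodule W A X" and s: "s \<in> carrier A" "e \<otimes> s = s" "s \<otimes> e = s" "s \<notin> J"
    and sx: "s \<odot>\<^bsub>X\<^esub> x \<in> W" for W s
  proof -
    obtain b where b: "b \<in> carrier A" "s \<otimes> b = e" using unit[OF s] by blast
    have "x = b \<odot>\<^bsub>X\<^esub> (s \<odot>\<^bsub>X\<^esub> x)" using X.smult_assoc[OF s(1) b(1) x(1)] b x by simp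
    then show ?thesis using X.submoduleD(5)[OF W b(1) sx] by simp
  qed
  obtain u v where uv: "u \<in> U" "v \<in> V" "x = u \<oplus>\<^bsub>X\<^esub> v" using UVD(4)[OF x(1)] by blast
  have uvX: "u \<in> carrier X" "v \<in> carrier X"
    using uv X.submoduleD(3)[OF UVD(1)] X.submoduleD(3)[OF UVD(2)] by auto
  obtain s where s: "s \<in> carrier A" "e \<otimes> s = s" "s \<otimes> e = s" "e \<odot>\<^bsub>X\<^esub> u = s \<odot>\<^bsub>X\<^esub> x"
    using comp[OF uvX(1)] by blast
  obtain s' where s': "s' \<in> carrier A" "e \<otimes> s' = s'" "s' \<otimes> e = s'" "e \<odot>\<^bsub>X\<^esub> v = s' \<odot>\<^bsub>X\<^esub> x"
    using comp[OF uvX(2)] by blast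
  have eU: "s \<odot>\<^bsub>X\<^esub> x \<in> U" and eV: "s' \<odot>\<^bsub>X\<^esub> x \<in> V"
    using X.submoduleD(5)[OF UVD(1) e(1) uv(1)] X.submoduleD(5)[OF UVD(2) e(1) uv(2)] s s' by auto
  \<comment> \<open>If both scalars lay in J, their sum j would lie in J and fix x. Then e - j
    annihilates x although it is a unit of e A e.\<close>
  have "\<not> (s \<in> J \<and> s' \<in> J)"
  proof
    assume "s \<in> J \<and> s' \<in> J"
    then have j: "s \<oplus> s' \<in> J" using J_add by simp
    let ?j = "s \<oplus> s'"
    have jx: "?j \<odot>\<^bsub>X\<^esub> x = x"
    proof -
      have "?j \<odot>\<^bsub>X\<^esub> x = e \<odot>\<^bsub>X\<^esub> u \<oplus>\<^bsub>X\<^esub> e \<odot>\<^bsub>X\<^esub> v"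
        using s s' x(1) by (simp add: X.smult_l_distr)
      also have "\<dots> = e \<odot>\<^bsub>X\<^esub> x" using uv uvX by (simp add: X.smult_r_distr)
      finally show ?thesis using x(2) by simp
    qed
    have jA: "?j \<in> carrier A" using s s' by simp
    have "e \<ominus> ?j \<notin> J"
    proof
      assume "e \<ominus> ?j \<in> J"
      then have "(e \<ominus> ?j) \<oplus> ?j \<in> J" using j by (rule J_add)
      moreover have "(e \<ominus> ?j) \<oplus> ?j = e" using jA by (simp add: a_minus_def a_assoc l_neg)
      ultimately show False using e_J by simp
    qed
    moreover have "e \<otimes> (e \<ominus> ?j) = e \<ominus> ?j" "(e \<ominus> ?j) \<otimes> e = e \<ominus> ?j"
      using J[OF j] jA by (simp_all add: a_minus_def r_distr l_distr r_minus l_minus)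
    ultimately obtain b where b: "b \<in> carrier A" "(e \<ominus> ?j) \<otimes> b = e"
      using unit[of "e \<ominus> ?j"] jA by auto
    have "(e \<ominus> ?j) \<odot>\<^bsub>X\<^esub> x = \<zero>\<^bsub>X\<^esub>"
      using jx jA x by (simp add: a_minus_def X.smult_l_distr X.minus_smult X.X.r_neg)
    moreover have "e \<odot>\<^bsub>X\<^esub> x = b \<odot>\<^bsub>X\<^esub> ((e \<ominus> ?j) \<odot>\<^bsub>X\<^esub> x)"
      using X.smult_assoc[of "e \<ominus> ?j" b x] b jA x(1) by simp
    ultimately show False using x b by simp
  qed
  then show ?thesis
    using good[OF UVD(1) s(1-3) _ eU] good[OF UVD(2) s'(1-3) _ eV] by blast
qed

text \<open>By \<open>local_splitting\<close> one of two complementary summands contains the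
  generator, hence everything.\<close>

lemma cyclic_indecomposable:
  assumes X: "right_module A X" and x: "x \<in> carrier X" "e \<odot>\<^bsub>X\<^esub> x = x" "x \<noteq> \<zero>\<^bsub>X\<^esub>"
    and gen: "\<And>y. y \<in> carrier X \<Longrightarrow> \<exists>a\<in>carrier A. y = a \<odot>\<^bsub>X\<^esub> x"
  shows "indecomposable A X"
proof -
  interpret X: right_module A X by fact
  have gen': "\<exists>a\<in>carrier A. e \<odot>\<^bsub>X\<^esub> y = a \<odot>\<^bsub>X\<^esub> x" if y: "y \<in> carrier X" for y
    using gen[of "e \<odot>\<^bsub>X\<^esub> y"] y by simp
  show ?thesis
    unfolding indecomposable_def
  proof (intro conjI allI impI)
    show "carrier X \<noteq> {\<zero>\<^bsub>X\<^esub>}" using x by auto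
    fix U V assume UV: "internal_dsum A X U V"
    note UVD = X.internal_dsumD[OF UV]
    have all: "carrier X \<subseteq> W" if "x \<in> W" "submodule W A X" for W
    proof
      fix y assume "y \<in> carrier X"
      then obtain a where "a \<in> carrier A" "y = a \<odot>\<^bsub>X\<^esub> x" using gen by blast
      then show "y \<in> W" using X.submoduleD(5)[OF that(2)] that(1) by simp
    qed
    from local_splitting[OF X x gen' UV] show "U = {\<zero>\<^bsub>X\<^esub>} \<or> V = {\<zero>\<^bsub>X\<^esub>}"
    proof
      assume "x \<in> U"
      from all[OF this UVD(1)] X.submoduleD(1)[OF UVD(2)] UVD(3) show ?thesis by blast
    next
      assume "x \<in> V"
      from all[OF this UVD(2)] X.submoduleD(1)[OF UVD(1)] UVD(3) show ?thesis by blast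
    qed
  qed
qed

abbreviation eAm :: "('a, 'a) module" where "eAm \<equiv> (regular A)\<lparr>carrier := eA\<rparr>"

lemma eAm_module: "right_module A eAm" by (rule A.sub_right_module[OF eA_submodule])

lemma e_nonzero: "e \<noteq> \<zero>" using r by auto

lemma eAm_fin_gen: "fin_gen A eAm"
  by (rule sub_fin_gen[OF regular_right_module dual_basis_fin_gen[OF dual_basis_regular] eA_submodule])

lemma eAm_indecomposable: "indecomposable A eAm"
proof (rule cyclic_indecomposable[OF eAm_module, of e])
  fix y assume "y \<in> carrier eAm"
  then show "\<exists>a\<in>carrier A. y = a \<odot>\<^bsub>eAm\<^esub> e" by (intro bexI[of _ y]) (auto simp: eA_def)
qed (use e_nonzero in \<open>auto simp: eA_def\<close>)

abbreviation rA :: "'a set" where "rA \<equiv> {a \<odot>\<^bsub>regular A\<^esub> r | a. a \<in> carrier A}"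
abbreviation rAm :: "('a, 'a) module" where "rAm \<equiv> (regular A)\<lparr>carrier := rA\<rparr>"

lemma rA_submodule: "right_ideal rA A" by (rule A.smult_closure_submodule) (simp add: r)

lemma r_rA: "r \<in> rA" using r by (auto intro!: exI[of _ e])

lemma rAm_module: "right_module A rAm" by (rule A.sub_right_module[OF rA_submodule])

lemma rAm_fin_gen: "fin_gen A rAm"
  by (rule sub_fin_gen[OF regular_right_module dual_basis_fin_gen[OF dual_basis_regular] rA_submodule])

lemma rAm_indecomposable: "indecomposable A rAm"
proof (rule cyclic_indecomposable[OF rAm_module, of r])
  fix y assume "y \<in> carrier rAm"
  then show "\<exists>a\<in>carrier A. y = a \<odot>\<^bsub>rAm\<^esub> r" by auto
qed (use r_rA r in auto)

text \<open>
  The kernel of the projective cover of \<open>r A\<close> has \<open>e\<close>-part \<open>J\<close>; if it had a dual basis,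
  \<open>J\<close> would equal its square, because a linear form cannot take a unit value at an element of \<open>J\<close>,
  which is annihilated by \<open>t\<close>.
\<close>

lemma rA_proj_dim:
  assumes Z: "Z \<in> mod_cat A" "mod_iso A rAm Z"
  shows "\<not> proj_dim A Z \<le> 1"
proof
  assume pd: "proj_dim A Z \<le> 1"
  obtain P d where P: "P \<in> mod_cat A" "dual_basis A P" "lin A P Z d" "d ` carrier P = carrier Z"
    and K: "dual_basis A (P\<lparr>carrier := {x \<in> carrier P. d x = \<zero>\<^bsub>Z\<^esub>}\<rparr>)"
    using proj_dim_le_1D[OF Z(1) pd] by (elim exE conjE)
  let ?K = "P\<lparr>carrier := {x \<in> carrier P. d x = \<zero>\<^bsub>Z\<^esub>}\<rparr>"
  note rZ = mod_catD(1)[OF Z(1)] and rP = mod_catD(1)[OF P(1)]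
  interpret PZ: two_modules A P Z using rP rZ by (rule two_modules.intro)
  interpret RZ: two_modules A rAm Z using rAm_module rZ by (rule two_modules.intro)
  interpret PE: two_modules A P eAm using rP eAm_module by (rule two_modules.intro)
  obtain \<zeta> where \<zeta>: "lin A rAm Z \<zeta>" "bij_betw \<zeta> (carrier rAm) (carrier Z)"
    using mod_iso_lin[OF Z(2)] .
  have inj: "inj_on \<zeta> rA" using \<zeta>(2) by (simp add: bij_betw_def)
  have \<zeta>0: "\<zeta> \<zero> = \<zero>\<^bsub>Z\<^esub>" using RZ.lin_zero[OF \<zeta>(1)] by simp
  have zero_rA: "\<zero> \<in> rA" using A.submoduleD(2)[OF rA_submodule] by simp
  \<comment> \<open>Left multiplication by r is a right linear surjection of e A onto r A; composed
    with the isomorphism to Z it is a projective cover.\<close>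
  define \<pi> where "\<pi> a = \<zeta> (r \<otimes> a)" for a
  have rlin: "lin A eAm rAm (\<lambda>a. r \<otimes> a)"
    by (rule linI) (auto simp: eA_def r r_distr m_assoc[symmetric])
  have \<pi>: "lin A eAm Z \<pi>" unfolding \<pi>_def by (rule lin_comp[OF rlin \<zeta>(1)])
  have \<pi>eq: "\<pi> a = \<pi> b \<longleftrightarrow> r \<otimes> a = r \<otimes> b" if "a \<in> carrier A" "b \<in> carrier A" for a b
    unfolding \<pi>_def using inj_onD[OF inj, of "r \<otimes> a" "r \<otimes> b"] that by auto
  have \<pi>0: "\<pi> a = \<zero>\<^bsub>Z\<^esub> \<longleftrightarrow> r \<otimes> a = \<zero>" if "a \<in> carrier A" for a
    using \<pi>eq[OF that zero_closed] \<zeta>0 r(1) by (simp add: \<pi>_def)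
  have surj: "\<pi> ` carrier eAm = carrier Z"
  proof
    show "\<pi> ` carrier eAm \<subseteq> carrier Z" using linD(1)[OF \<pi>] by blast
    show "carrier Z \<subseteq> \<pi> ` carrier eAm"
    proof
      fix z assume "z \<in> carrier Z"
      then have "z \<in> \<zeta> ` rA" using \<zeta>(2) by (simp add: bij_betw_def)
      then obtain a where a: "a \<in> carrier A" "z = \<zeta> (r \<otimes> a)" by auto
      have "r \<otimes> a = r \<otimes> (e \<otimes> a)" using a r by (simp add: m_assoc[symmetric])
      then have "z = \<pi> (e \<otimes> a)" using a by (simp add: \<pi>_def)
      moreover have "e \<otimes> a \<in> carrier eAm" using a by (simp add: eA_def m_assoc[symmetric])
      ultimately show "z \<in> \<pi> ` carrier eAm" by blast
    qed
  qed
  \<comment> \<open>The given cover P need not be minimal. The map b compares it with e A over Z,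
    and the image of an element of P can be computed inside the ring.\<close>
  obtain b where b: "lin A P eAm b" "\<forall>x\<in>carrier P. \<pi> (b x) = d x"
    using dual_basis_lift[OF P(2) \<pi> surj P(3) eAm_module rZ] by (elim exE conjE)
  note bD = linD[OF b(1), simplified]
  have bA: "b x \<in> carrier A" "e \<otimes> b x = b x" if "x \<in> carrier P" for x
    using bD(1)[OF that] by (auto simp: eA_def)
  have "\<pi> e \<in> d ` carrier P" unfolding P(4) using linD(1)[OF \<pi>, of e] by (simp add: eA_def)
  then obtain p where p: "p \<in> carrier P" "d p = \<pi> e" by auto
  note cA = J[OF c(1)]
  \<comment> \<open>Here p lies over the generator and q = p c. Since r c = 0, q is in the kernel of
    d; since c t = 0, also q t = 0.\<close>
  define q where "q = c \<odot>\<^bsub>P\<^esub> p"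
  have q: "q \<in> carrier P" "t \<odot>\<^bsub>P\<^esub> q = \<zero>\<^bsub>P\<^esub>"
    using p cA t by (simp_all add: q_def PZ.X.smult_assoc[symmetric] t(5)[OF c(1)])
  have dq: "d q = \<zero>\<^bsub>Z\<^esub>"
  proof -
    have "d q = \<pi> (c \<odot>\<^bsub>eAm\<^esub> e)"
      unfolding q_def using linD(3)[OF P(3) cA(1) p(1)] linD(3)[OF \<pi>, of c e] cA p(2) by (simp add: eA_def)
    also have "\<dots> = \<zero>\<^bsub>Z\<^esub>" using \<pi>0[of c] cA r(5)[OF c(1)] by simp
    finally show ?thesis .
  qed
  \<comment> \<open>A unit x of e A e satisfies neither r x = 0 nor x t = 0, as r and t are nonzero.
    So each of these equations forces an element of e A e into J.\<close>
  have memJ: "x \<in> J" if xs: "x \<in> carrier A" "e \<otimes> x = x" "x \<otimes> e = x" "r \<otimes> x = \<zero>" for x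
  proof (rule ccontr)
    assume "x \<notin> J"
    then obtain y where y: "y \<in> carrier A" "x \<otimes> y = e" using unit[OF xs(1-3)] by blast
    have "r = r \<otimes> x \<otimes> y" using m_assoc[OF r(1) xs(1) y(1)] y r(3) by simp
    then show False using xs(4) y(1) r(4) by simp
  qed
  have memJ': "x \<in> J" if xs: "x \<in> carrier A" "e \<otimes> x = x" "x \<otimes> e = x" "x \<otimes> t = \<zero>" for x
  proof (rule ccontr)
    assume "x \<notin> J"
    then obtain y where y: "y \<in> carrier A" "y \<otimes> x = e" using unit[OF xs(1-3)] by blast
    have "t = y \<otimes> (x \<otimes> t)" using m_assoc[OF y(1) xs(1) t(1)] y t(2) by simp
    then show False using xs(4) y(1) t(4) by simp
  qed
  note Ksub = PZ.ker_submodule[OF P(3)]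
  interpret K: right_module A ?K by (rule PZ.X.sub_right_module[OF Ksub])
  interpret KK: two_modules A ?K ?K by (intro two_modules.intro K.right_module_axioms)
  have qK: "q \<in> carrier ?K" using q dq by simp
  \<comment> \<open>Each term of b (\<psi> q) e is a product of b(x) e and e g(q) e; the middle e
    may be inserted by triangularity. The left factor is in J because x is in the kernel of d, so r
    b(x) = 0; the right one because g(q) t = g(q t) = 0. Hence every term lies in D.\<close>
  have main: "b (\<psi> q) \<otimes> e \<in> D" if "finite_rank A ?K ?K \<psi>" for \<psi>
    using that
  proof induction
    case zero
    then show ?case using PE.lin_zero[OF b(1)] D(1) by simp
  next
    case (add \<psi> g x)
    have \<psi>q: "\<psi> q \<in> carrier P" using KK.finite_rank_closed[OF add.hyps(1) qK] by simp
    have gq: "g q \<in> carrier A" using linD(1)[OF add.hyps(2) qK] by simp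
    have x: "x \<in> carrier P" "d x = \<zero>\<^bsub>Z\<^esub>" using add.hyps(3) by auto
    let ?x = "b x \<otimes> e" and ?y = "e \<otimes> g q \<otimes> e"
    have "r \<otimes> b x = \<zero>" using \<pi>0[of "b x"] bA[OF x(1)] b(2) x by simp
    then have "r \<otimes> ?x = \<zero>" using bA[OF x(1)] r by (simp add: m_assoc[symmetric])
    then have xJ: "?x \<in> J" using bA[OF x(1)] by (intro memJ) (simp_all add: m_assoc, simp add: m_assoc[symmetric])
    have "g q \<otimes> t = \<zero>"
    proof -
      have "g q \<otimes> t = g (t \<odot>\<^bsub>P\<^esub> q)" using linD(3)[OF add.hyps(2) t(1) qK] by simp
      also have "\<dots> = \<zero>"
        using q(2) two_modules.lin_zero[OF two_modules.intro[OF K.right_module_axioms A.right_module_axioms] add.hyps(2)]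
        by simp
      finally show ?thesis .
    qed
    then have "?y \<otimes> t = \<zero>" using gq t by (simp add: m_assoc)
    then have yJ: "?y \<in> J" using gq by (intro memJ') (simp_all add: m_assoc, simp add: m_assoc[symmetric])
    have "b (\<psi> q \<oplus>\<^bsub>?K\<^esub> g q \<odot>\<^bsub>?K\<^esub> x) = b (\<psi> q) \<oplus> b x \<otimes> g q"
      using bD(2)[OF \<psi>q, of "g q \<odot>\<^bsub>P\<^esub> x"] bD(3)[OF gq x(1)] gq x by simp
    then have "b (\<psi> q \<oplus>\<^bsub>?K\<^esub> g q \<odot>\<^bsub>?K\<^esub> x) \<otimes> e = b (\<psi> q) \<otimes> e \<oplus> b x \<otimes> (g q \<otimes> e)"
      using bA[OF \<psi>q] bA[OF x(1)] gq by (simp add: l_distr m_assoc)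
    also have "b x \<otimes> (g q \<otimes> e) = ?x \<otimes> ?y"
    proof -
      have "b x \<otimes> (g q \<otimes> e) = b x \<otimes> (e \<otimes> g q \<otimes> e)" using lower[OF gq] by simp
      also have "\<dots> = b x \<otimes> (e \<otimes> (e \<otimes> g q \<otimes> e))" using gq by (simp add: m_assoc[symmetric])
      finally show ?thesis using bA[OF x(1)] gq by (simp add: m_assoc)
    qed
    finally show ?case using D(2)[OF add.IH D(3)[OF xJ yJ]] by simp
  qed
  obtain \<phi> where \<phi>: "right_module A ?K" "finite_rank A ?K ?K \<phi>" "\<forall>x\<in>carrier ?K. \<phi> x = x"
    using dual_basisE[OF K] .
  have 1: "b q \<otimes> e \<in> D" using main[OF \<phi>(2)] \<phi>(3) qK by simp
  have bq: "b q = b p \<otimes> c" unfolding q_def using bD(3)[OF cA(1) p(1)] by simp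
  note bp = bA[OF p(1)]
  \<comment> \<open>Up to an element w of J, the image of p is e, so c is b(q) e plus w c. The dual
    basis puts the first summand into D, and w c lies there as well, against the choice of
    c.\<close>
  let ?w = "(e \<ominus> b p) \<otimes> e"
  have "r \<otimes> b p = r" using \<pi>eq[OF bp(1) e(1)] b(2) p r by simp
  then have "r \<otimes> (e \<ominus> b p) = \<zero>" using r bp by (simp add: a_minus_def r_distr r_minus r_neg)
  then have "r \<otimes> ?w = \<zero>" using r bp by (simp add: m_assoc[symmetric])
  moreover have "e \<otimes> (e \<ominus> b p) = e \<ominus> b p" using bp by (simp add: a_minus_def r_distr r_minus)
  ultimately have w: "?w \<in> J" using bp by (intro memJ) (simp_all add: m_assoc, simp add: m_assoc[symmetric])
  have "?w \<otimes> c = (e \<ominus> b p) \<otimes> c" using bp cA by (simp add: m_assoc)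
  also have "\<dots> = c \<ominus> b p \<otimes> c" using bp cA by (simp add: a_minus_def l_distr l_minus)
  finally have wc: "?w \<otimes> c = c \<ominus> b p \<otimes> c" .
  have "b q \<otimes> e = b p \<otimes> c" using bq bp cA by (simp add: m_assoc)
  then have "b q \<otimes> e \<oplus> ?w \<otimes> c = c" using wc bp cA by (simp add: a_minus_def a_ac r_neg1 r_neg2 r_neg)
  then show False using D(2)[OF 1 D(3)[OF w c(1)]] c(2) by simp
qed

lemma left_part_killed:
  assumes "X \<in> left_part A"
  shows "killed X"
proof (rule ccontr)
  assume "\<not> killed X"
  then obtain x where x: "x \<in> carrier X" "e \<odot>\<^bsub>X\<^esub> x \<noteq> \<zero>\<^bsub>X\<^esub>" by (auto simp: killed_def)
  have X: "X \<in> ind_cat A" using assms by (simp add: left_part_def)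
  note rX = ind_catD(2)[OF X]
  interpret X: right_module A X using rX .
  obtain E where E: "E \<in> ind_cat A" "mod_iso A eAm E"
    using ex_ind_cat_iso[OF eAm_module eAm_fin_gen eAm_indecomposable] .
  obtain Z where Z: "Z \<in> ind_cat A" "mod_iso A rAm Z"
    using ex_ind_cat_iso[OF rAm_module rAm_fin_gen rAm_indecomposable] .
  have XX: "mod_iso A X X" by (rule mod_isoI[OF lin_id _ rX]) (simp add: bij_betw_def)
  have "nonzero_step A E X"
  proof (rule nonzero_step_iso[OF E(1) X E(2) XX eAm_module rX])
    show "lin A eAm X (\<lambda>a. a \<odot>\<^bsub>X\<^esub> (e \<odot>\<^bsub>X\<^esub> x))"
      by (rule lin_sub[OF X.lin_smult_elem regular_right_module eA_submodule]) (use x in simp)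
    show "e \<in> carrier eAm" by (simp add: eA_def)
    show "e \<odot>\<^bsub>X\<^esub> (e \<odot>\<^bsub>X\<^esub> x) \<noteq> \<zero>\<^bsub>X\<^esub>" using x e_e_smult[OF rX x(1)] by simp
  qed
  moreover have "nonzero_step A Z E"
  proof (rule nonzero_step_iso[OF Z(1) E(1) Z(2) E(2) rAm_module eAm_module])
    show "lin A rAm eAm (\<lambda>a. a)" by (rule linI) (auto simp: eA_def r m_assoc[symmetric])
    show "r \<in> carrier rAm" using r_rA by simp
  qed (use r in simp)
  ultimately have "Z \<in> left_part A" using assms left_part_step by blast
  moreover have "predecessor A Z Z" using Z(1) by (simp add: predecessor_def)
  ultimately have "proj_dim A Z \<le> 1" by (simp add: left_part_def)
  then show False using rA_proj_dim[OF ind_catD(1)[OF Z(1)] Z(2)] by simp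
qed

subsection \<open>Modules over H\<close>

abbreviation fAm :: "('a, 'a) module" where "fAm \<equiv> (regular A)\<lparr>carrier := fA\<rparr>"
abbreviation Mm :: "('a, 'a) module" where "Mm \<equiv> (regular A)\<lparr>carrier := M\<rparr>"

lemma fAm_module: "right_module A fAm" by (rule A.sub_right_module[OF fA_submodule])

lemma fAm_fin_gen: "fin_gen A fAm"
  by (rule sub_fin_gen[OF regular_right_module dual_basis_fin_gen[OF dual_basis_regular] fA_submodule])

lemma fAm_killed: "killed fAm"
  unfolding killed_def
proof
  fix x assume "x \<in> carrier fAm"
  then have "x \<in> carrier A" "e \<otimes> x = \<zero>" by (auto simp: fA_def)
  then show "e \<odot>\<^bsub>fAm\<^esub> x = \<zero>\<^bsub>fAm\<^esub>" using lower[of x] by simp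
qed

text \<open>Projectivity is demanded of all submodules at once. This stronger property is stable
  under adding a copy of (1 - e) A, so the covers built one copy at a time have projective kernels
  by construction.\<close>

definition hereditary_module :: "('a, 'x, 'e) module_scheme \<Rightarrow> bool" where
  "hereditary_module F \<longleftrightarrow> right_module A F \<and> killed F \<and>
    (\<forall>N. submodule N A F \<longrightarrow> dual_basis A (F\<lparr>carrier := N\<rparr>))"

lemma hereditary_moduleD:
  assumes "hereditary_module F"
  shows "right_module A F" "killed F" "submodule N A F \<Longrightarrow> dual_basis A (F\<lparr>carrier := N\<rparr>)"
  using assms by (auto simp: hereditary_module_def)

lemma hereditary_module_iso:
  assumes F: "hereditary_module F" and iso: "mod_iso A F G" and G: "right_module A G"
  shows "hereditary_module G"
  unfolding hereditary_module_def
proof (intro conjI allI impI G)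
  note FD = hereditary_moduleD[OF F]
  interpret FG: two_modules A F G using FD(1) G by (rule two_modules.intro)
  interpret GF: two_modules A G F using G FD(1) by (rule two_modules.intro)
  show "killed G" by (rule killed_iso[OF FD(1) G iso FD(2)])
  fix N assume N: "submodule N A G"
  obtain g where g: "lin A G F g" "bij_betw g (carrier G) (carrier F)"
    using mod_iso_lin[OF mod_iso_sym[OF iso FD(1) G]] .
  note gN = GF.image_submodule[OF g(1) N]
  note rN = FG.Y.sub_right_module[OF N] and rgN = FG.X.sub_right_module[OF gN]
  have "lin A (G\<lparr>carrier := N\<rparr>) (F\<lparr>carrier := g ` N\<rparr>) g"
    by (rule lin_into_sub[OF lin_sub[OF g(1) G N]]) simp
  moreover have "bij_betw g (carrier (G\<lparr>carrier := N\<rparr>)) (carrier (F\<lparr>carrier := g ` N\<rparr>))"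
    using bij_betw_subset[OF g(2) FG.Y.submoduleD(1)[OF N]] by simp
  ultimately have "mod_iso A (G\<lparr>carrier := N\<rparr>) (F\<lparr>carrier := g ` N\<rparr>)"
    using rN by (intro mod_isoI)
  from mod_iso_sym[OF this rN rgN] show "dual_basis A (G\<lparr>carrier := N\<rparr>)"
    by (rule dual_basis_iso[OF FD(3)[OF gN] _ rN])
qed

text \<open>A submodule of \<open>F \<oplus> H\<close> is an extension of its projection to \<open>H\<close>, which is projective.\<close>

lemma hereditary_module_dsum:
  assumes F: "hereditary_module F"
  shows "hereditary_module (dsum F fAm)"
  unfolding hereditary_module_def
proof (intro conjI allI impI)
  note FD = hereditary_moduleD[OF F]
  interpret FB: two_modules A F fAm using FD(1) fAm_module by (rule two_modules.intro)
  note S = FB.dsum_right_module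
  show "right_module A (dsum F fAm)" by (rule S)
  show "killed (dsum F fAm)" using FD(2) fAm_killed by (auto simp: killed_def)
  fix K assume K: "submodule K A (dsum F fAm)"
  interpret S: right_module A "dsum F fAm" by (rule S)
  note KD = S.submoduleD[OF K]
  let ?K = "(dsum F fAm)\<lparr>carrier := K\<rparr>"
  interpret K: right_module A ?K by (rule S.sub_right_module[OF K])
  interpret KK: two_modules A ?K ?K by (intro two_modules.intro K.right_module_axioms)
  interpret SB: two_modules A "dsum F fAm" fAm by (intro two_modules.intro S fAm_module)
  interpret FS: two_modules A F "dsum F fAm" by (intro two_modules.intro S FD(1))
  have snd: "submodule (snd ` K) A fAm" by (rule SB.image_submodule[OF FB.dsum_lin(4) K])
  then have I: "right_ideal (snd ` K) A" "snd ` K \<subseteq> fA"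
    using A.submodule_sub_iff[OF fA_submodule] by auto
  let ?I = "(regular A)\<lparr>carrier := snd ` K\<rparr>"
  have dI: "dual_basis A ?I" by (rule hereditary[OF I(1)]) (use I(2) in \<open>auto simp: fA_def\<close>)
  interpret I: right_module A ?I by (rule A.sub_right_module[OF I(1)])
  interpret IK: two_modules A ?I ?K by (intro two_modules.intro K.right_module_axioms I.right_module_axioms)
  have sndK: "lin A ?K ?I snd"
    using linD[OF lin_sub[OF FB.dsum_lin(4) S K]] by (intro linI) auto
  obtain s where s: "finite_rank A ?I ?K s" "lin A ?I ?K s" "\<forall>x\<in>carrier ?I. snd (s x) = x"
    using dual_basis_lift[OF dI sndK _ lin_id K.right_module_axioms I.right_module_axioms] by auto
  \<comment> \<open>The kernel of the projection of K to H, regarded as a submodule of F, where a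
    dual basis is available.\<close>
  let ?N = "{x \<in> carrier F. (x, \<zero>) \<in> K}"
  have N: "submodule ?N A F" using FS.vimage_submodule[OF FB.dsum_lin(1) K] by simp
  let ?F = "F\<lparr>carrier := ?N\<rparr>"
  interpret N: right_module A ?F by (rule FB.X.sub_right_module[OF N])
  \<comment> \<open>The section s of the projection splits K; this is the complementary projection,
    with values in N x 0.\<close>
  define \<rho> where "\<rho> x = x \<ominus>\<^bsub>?K\<^esub> s (snd x)" for x
  have \<rho>l: "lin A ?K ?K \<rho>"
    unfolding \<rho>_def by (rule KK.lin_diff[OF lin_id lin_comp[OF sndK s(2)]])
  have \<rho>s: "snd (\<rho> x) = \<zero>" if x: "x \<in> K" for x
  proof -
    interpret KI: two_modules A ?K ?I by (intro two_modules.intro K.right_module_axioms I.right_module_axioms)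
    have "snd (\<rho> x) = snd x \<ominus>\<^bsub>?I\<^esub> snd (s (snd x))"
      unfolding \<rho>_def using KI.lin_minus[OF sndK] x linD(1)[OF s(2), of "snd x"] by simp
    then show ?thesis using s(3) x I.minus_self[of "snd x"] by simp
  qed
  have \<rho>K: "\<rho> x \<in> K" if "x \<in> K" for x using linD(1)[OF \<rho>l] that by simp
  have \<rho>N: "fst (\<rho> x) \<in> ?N" if x: "x \<in> K" for x
    using \<rho>K[OF x] \<rho>s[OF x] KD(3)[OF \<rho>K[OF x]] by (cases "\<rho> x") auto
  have l1: "lin A ?K ?F (\<lambda>x. fst (\<rho> x))"
  proof (rule lin_into_sub)
    show "lin A ?K F (\<lambda>x. fst (\<rho> x))"
      by (rule lin_comp[OF \<rho>l lin_sub[OF FB.dsum_lin(3) S K]])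
  qed (use \<rho>N in simp)
  have l2: "lin A ?F ?K (\<lambda>x. (x, \<zero>))" by (rule linI) auto
  obtain \<phi> where \<phi>: "right_module A ?F" "finite_rank A ?F ?F \<phi>" "\<forall>x\<in>carrier ?F. \<phi> x = x"
    using dual_basisE[OF FD(3)[OF N]] .
  obtain \<phi>' where \<phi>': "finite_rank A ?K ?K \<phi>'" "\<forall>x\<in>carrier ?K. \<phi>' x = (\<phi> (fst (\<rho> x)), \<zero>)"
    using finite_rank_post[OF finite_rank_pre[OF \<phi>(2) l1] l2 K.right_module_axioms \<phi>(1) K.right_module_axioms]
    by (elim exE conjE)
  note s' = finite_rank_pre[OF s(1) sndK]
  \<comment> \<open>The identity of K is the sum of the dual basis of N after \<rho> and the finite
    rank section s after the second projection.\<close>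
  obtain \<chi> where \<chi>: "finite_rank A ?K ?K \<chi>" "\<forall>x\<in>carrier ?K. \<chi> x = \<phi>' x \<oplus>\<^bsub>?K\<^esub> s (snd x)"
    using KK.finite_rank_plus[OF \<phi>'(1) s'] by (elim exE conjE)
  have "\<chi> x = x" if x: "x \<in> K" for x
  proof -
    have "\<phi>' x = \<rho> x" using \<phi>'(2) \<phi>(3) \<rho>N[OF x] \<rho>s[OF x] x by (simp add: prod_eq_iff)
    then have "\<chi> x = (x \<ominus>\<^bsub>?K\<^esub> s (snd x)) \<oplus>\<^bsub>?K\<^esub> s (snd x)"
      using \<chi>(2) x by (simp add: \<rho>_def)
    also have "\<dots> = x"
      using x linD(1)[OF s(2), of "snd x"] K.X.a_assoc[of x "\<ominus>\<^bsub>?K\<^esub> s (snd x)" "s (snd x)"]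
        K.X.l_neg[of "s (snd x)"] K.X.r_zero[of x] K.X.a_inv_closed[of "s (snd x)"]
      unfolding a_minus_def by simp
    finally show ?thesis .
  qed
  then show "dual_basis A ?K"
    unfolding dual_basis_def using K.right_module_axioms \<chi>(1) by (intro conjI exI[of _ \<chi>]) simp_all
qed

lemma hereditary_cover:
  fixes X :: "('a, 'x, 'e) module_scheme"
  assumes X: "right_module A X" "fin_gen A X" "killed X"
  obtains F h where "F \<in> mod_cat A" "hereditary_module F" "lin A F X h" "h ` carrier F = carrier X"
proof -
  interpret X: right_module A X by (rule X(1))
  have gen: "\<exists>h. lin A fAm X h \<and> x \<in> h ` carrier fAm" if x: "x \<in> carrier X" for x
  proof (intro exI conjI)
    show "lin A fAm X (\<lambda>a. a \<odot>\<^bsub>X\<^esub> x)"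
      by (rule lin_sub[OF X.lin_smult_elem[OF x] regular_right_module fA_submodule])
    \<comment> \<open>On a module with X e = 0 the element 1 - e of (1 - e) A acts as the identity,
      so it is mapped to x by a \<mapsto> x a.\<close>
    have mem: "\<one> \<ominus> e \<in> carrier fAm" by (simp add: fA_def a_minus_def r_distr r_minus r_neg)
    have eq: "(\<one> \<ominus> e) \<odot>\<^bsub>X\<^esub> x = x"
      using x X(3) X.X.minus_equality[of "\<zero>\<^bsub>X\<^esub>" "\<zero>\<^bsub>X\<^esub>"]
      by (simp add: a_minus_def X.smult_l_distr X.minus_smult killed_def)
    show "x \<in> (\<lambda>a. a \<odot>\<^bsub>X\<^esub> x) ` carrier fAm"
      using imageI[OF mem, of "\<lambda>a. a \<odot>\<^bsub>X\<^esub> x"] unfolding eq .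
  qed
  have zero: "hereditary_module Z" if Z: "Z \<in> mod_cat A" "carrier Z = {\<zero>\<^bsub>Z\<^esub>}" for Z :: "('a, 'a list set) module"
    unfolding hereditary_module_def
  proof (intro conjI allI impI)
    show rZ: "right_module A Z" using mod_catD(1)[OF Z(1)] .
    interpret Z: right_module A Z by (rule rZ)
    show "killed Z" using Z(2) Z.smult_zero[OF e(1)] by (simp add: killed_def)
    fix N assume N: "submodule N A Z"
    let ?N = "Z\<lparr>carrier := N\<rparr>"
    have "x = \<zero>\<^bsub>Z\<^esub>" if "x \<in> N" for x using Z.submoduleD(3)[OF N that] Z(2) by simp
    then show "dual_basis A ?N"
      unfolding dual_basis_def using Z.sub_right_module[OF N] finite_rank.zero[of A ?N ?N]
      by (intro conjI exI[of _ "\<lambda>x. \<zero>\<^bsub>?N\<^esub>"]) auto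
  qed
  have step: "hereditary_module G" if "F \<in> mod_cat A" "hereditary_module F" "G \<in> mod_cat A"
    "mod_iso A (dsum F fAm) G" for F G :: "('a, 'a list set) module"
    by (rule hereditary_module_iso[OF hereditary_module_dsum[OF that(2)] that(4) mod_catD(1)[OF that(3)]])
  obtain F h where F: "F \<in> mod_cat A" "hereditary_module F" "lin A F X h" "h ` carrier F = carrier X"
    using ex_cover[where Pr = hereditary_module, OF X(1,2) fAm_module fAm_fin_gen gen zero step] .
  then show ?thesis by (rule that)
qed

lemma hereditary_module_dual_basis:
  assumes "hereditary_module F"
  shows "dual_basis A F"
  using hereditary_moduleD(3)[OF assms right_module.submodule_carrier[OF hereditary_moduleD(1)[OF assms]]]
  by simp

lemma killed_proj_dim:
  assumes X: "X \<in> mod_cat A" "killed X"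
  shows "proj_dim A X \<le> 1"
proof -
  obtain F h where F: "F \<in> mod_cat A" "hereditary_module F" "lin A F X h" "h ` carrier F = carrier X"
    using hereditary_cover[OF mod_catD[OF X(1)] X(2)] .
  interpret FX: two_modules A F X using mod_catD(1)[OF F(1)] mod_catD(1)[OF X(1)] by (rule two_modules.intro)
  note K = FX.ker_submodule[OF F(3)]
  let ?K = "F\<lparr>carrier := {x \<in> carrier F. h x = \<zero>\<^bsub>X\<^esub>}\<rparr>"
  have "lin A ?K F (\<lambda>x. x)" by (rule linI) auto
  from proj_dim_le_1I[OF F(1) sub_mod_cat[OF F(1) K] hereditary_module_dual_basis[OF F(2)]
      hereditary_moduleD(3)[OF F(2) K] X(1) F(3,4) this]
  show ?thesis by simp
qed

subsection \<open>The left part and abelian exact subcategories\<close>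

text \<open>The image of a map to \<open>F\<close> is projective, hence splits off.\<close>

lemma step_embeds:
  assumes "nonzero_step A Z Y" "hereditary_module F" "lin A Y F s" "inj_on s (carrier Y)"
  obtains s' where "lin A Z F s'" "inj_on s' (carrier Z)"
proof -
  obtain f z where f: "Z \<in> ind_cat A" "Y \<in> ind_cat A" "lin A Z Y f" "z \<in> carrier Z" "f z \<noteq> \<zero>\<^bsub>Y\<^esub>"
    using nonzero_stepE[OF assms(1)] .
  note rZ = ind_catD(2)[OF f(1)] and rY = ind_catD(2)[OF f(2)]
  note FD = hereditary_moduleD[OF assms(2)]
  interpret ZF: two_modules A Z F using rZ FD(1) by (rule two_modules.intro)
  interpret YF: two_modules A Y F using rY FD(1) by (rule two_modules.intro)
  define h where "h x = s (f x)" for x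
  have h: "lin A Z F h" unfolding h_def by (rule lin_comp[OF f(3) assms(3)])
  have hz: "h z \<noteq> \<zero>\<^bsub>F\<^esub>"
    using YF.inj_on_iff_ker[OF assms(3)] assms(4) f(5) linD(1)[OF f(3,4)] unfolding h_def by blast
  note I = ZF.image_submodule[OF h ZF.X.submodule_carrier]
  let ?I = "F\<lparr>carrier := h ` carrier Z\<rparr>"
  note rI = ZF.Y.sub_right_module[OF I]
  interpret IZ: two_modules A ?I Z using rI rZ by (rule two_modules.intro)
  interpret ZI: two_modules A Z ?I using rZ rI by (rule two_modules.intro)
  have hI: "lin A Z ?I h" by (rule lin_into_sub[OF h]) simp
  obtain \<sigma> where \<sigma>: "lin A ?I Z \<sigma>" "\<forall>x\<in>carrier ?I. h (\<sigma> x) = x"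
    using dual_basis_lift[OF FD(3)[OF I] hI _ lin_id rZ rI] by auto
  let ?K = "{x \<in> carrier Z. h x = \<zero>\<^bsub>F\<^esub>}" and ?S = "\<sigma> ` carrier ?I"
  have hmem: "h x \<in> carrier ?I" if "x \<in> carrier Z" for x using that by simp
  have dsum: "internal_dsum A Z ?K ?S"
  proof (rule ZF.X.internal_dsumI)
    show "submodule ?K A Z" by (rule ZF.ker_submodule[OF h])
    show "submodule ?S A Z" by (rule IZ.image_submodule[OF \<sigma>(1) IZ.X.submodule_carrier])
    show "x = \<zero>\<^bsub>Z\<^esub>" if x: "x \<in> ?K" "x \<in> ?S" for x
    proof -
      obtain y where y: "y \<in> carrier ?I" "x = \<sigma> y" using x(2) by blast
      then have "y = \<zero>\<^bsub>F\<^esub>" using \<sigma>(2) x(1) by auto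
      then show ?thesis using y IZ.lin_zero[OF \<sigma>(1)] by simp
    qed
    fix x assume x: "x \<in> carrier Z"
    have sx: "\<sigma> (h x) \<in> carrier Z" by (rule linD(1)[OF \<sigma>(1) hmem[OF x]])
    have "h (\<sigma> (h x)) = h x" using \<sigma>(2) hmem[OF x] by blast
    then have "h (x \<ominus>\<^bsub>Z\<^esub> \<sigma> (h x)) = \<zero>\<^bsub>F\<^esub>"
      using ZF.lin_minus[OF h x sx] ZF.Y.minus_self[OF linD(1)[OF h x]] by simp
    then have k1: "x \<ominus>\<^bsub>Z\<^esub> \<sigma> (h x) \<in> ?K" using x sx by simp
    have k2: "\<sigma> (h x) \<in> ?S" using hmem[OF x] by (rule imageI)
    have eq: "x = (x \<ominus>\<^bsub>Z\<^esub> \<sigma> (h x)) \<oplus>\<^bsub>Z\<^esub> \<sigma> (h x)"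
      using x sx by (simp add: a_minus_def ZF.X.X.a_assoc ZF.X.X.l_neg)
    show "\<exists>u\<in>?K. \<exists>v\<in>?S. x = u \<oplus>\<^bsub>Z\<^esub> v"
      by (rule bexI[OF _ k1], rule bexI[OF _ k2], rule eq)
  qed
  have "?S \<noteq> {\<zero>\<^bsub>Z\<^esub>}"
  proof
    assume S: "?S = {\<zero>\<^bsub>Z\<^esub>}"
    have "\<sigma> (h z) \<in> ?S" using hmem[OF f(4)] by (rule imageI)
    then have "\<sigma> (h z) = \<zero>\<^bsub>Z\<^esub>" using S by blast
    then have "h \<zero>\<^bsub>Z\<^esub> = h z" using \<sigma>(2) hmem[OF f(4)] by metis
    then show False using hz ZF.lin_zero[OF h] by simp
  qed
  then have "?K = {\<zero>\<^bsub>Z\<^esub>}"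
    using ind_catD(4)[OF f(1)] dsum unfolding indecomposable_def by blast
  then have "inj_on h (carrier Z)" unfolding ZF.inj_on_iff_ker[OF h] by blast
  then show ?thesis using that h by blast
qed

text \<open>Embeddability into the fixed F is inherited by predecessors, by
  \<open>step_embeds\<close>, and makes the module an H-module, which has projective dimension at
  most one.\<close>

lemma embedded_left_part:
  assumes Y: "Y \<in> ind_cat A" and F: "hereditary_module F" and s: "lin A Y F s" "inj_on s (carrier Y)"
  shows "Y \<in> left_part A"
proof (rule left_partI[where Pr = "\<lambda>Y. \<exists>s. lin A Y F s \<and> inj_on s (carrier Y)", OF Y])
  show "\<exists>s. lin A Y F s \<and> inj_on s (carrier Y)" using s by blast
  show "proj_dim A Y \<le> 1" if YY: "Y \<in> ind_cat A" "\<exists>s. lin A Y F s \<and> inj_on s (carrier Y)" for Y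
  proof -
    obtain s where s: "lin A Y F s" "inj_on s (carrier Y)" using YY(2) by blast
    have "killed Y"
      by (rule killed_inj[OF ind_catD(2)[OF YY(1)] hereditary_moduleD(1)[OF F] s hereditary_moduleD(2)[OF F]])
    then show ?thesis by (rule killed_proj_dim[OF ind_catD(1)[OF YY(1)]])
  qed
  show "\<exists>s. lin A Z F s \<and> inj_on s (carrier Z)"
    if YY: "nonzero_step A Z Y" "\<exists>s. lin A Y F s \<and> inj_on s (carrier Y)" for Z Y
  proof -
    obtain s where s: "lin A Y F s" "inj_on s (carrier Y)" using YY(2) by blast
    show ?thesis using step_embeds[OF YY(1) F s] by blast
  qed
qed

lemma left_part_mod_cat: "left_part A \<subseteq> mod_cat A"
  by (auto simp: left_part_def ind_cat_def)

text \<open>The cokernel Q in add of the left part has the same kernel as the cover of X, so X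
  embeds into it. It is enough that a nonzero element of X survives in Q: a map separating it from
  zero gives a nonzero map from X to a member of the left part, which is closed under
  predecessors.\<close>

lemma abelian_imp_left_part:
  assumes ab: "abelian_exact_subcat A (add_cat A (left_part A))"
    and X: "X \<in> ind_cat A" "killed X"
  shows "X \<in> left_part A"
proof -
  note rX = ind_catD(2)[OF X(1)]
  obtain F h where F: "F \<in> mod_cat A" "hereditary_module F" "lin A F X h" "h ` carrier F = carrier X"
    using hereditary_cover[OF rX ind_catD(3)[OF X(1)] X(2)] .
  note rF = mod_catD(1)[OF F(1)]
  interpret FX: two_modules A F X using rF rX by (rule two_modules.intro)
  note K = FX.ker_submodule[OF F(3)]
  let ?K = "F\<lparr>carrier := {x \<in> carrier F. h x = \<zero>\<^bsub>X\<^esub>}\<rparr>"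
  have addI: "G \<in> add_cat A (left_part A)" if G: "G \<in> mod_cat A" and i: "lin A G F i" "inj_on i (carrier G)" for G i
  proof (rule add_catI[OF G])
    fix Y s p assume Y: "Y \<in> ind_cat A" "lin A Y G s" "lin A G Y p" "\<forall>y\<in>carrier Y. p (s y) = y"
    have "inj_on s (carrier Y)" using Y(4) by (metis inj_on_inverseI)
    then have "inj_on (\<lambda>y. i (s y)) (carrier Y)"
      using i(2) linD(1)[OF Y(2)] unfolding inj_on_def by blast
    then show "Y \<in> left_part A" by (rule embedded_left_part[OF Y(1) F(2) lin_comp[OF Y(2) i(1)]])
  qed
  have incl: "lin A ?K F (\<lambda>x. x)" by (rule linI) auto
  have FC: "F \<in> add_cat A (left_part A)" by (rule addI[OF F(1) lin_id]) simp
  have KC: "?K \<in> add_cat A (left_part A)" by (rule addI[OF sub_mod_cat[OF F(1) K] incl]) simp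
  have inj: "inj_on (\<lambda>x. x) (carrier ?K)" by simp
  obtain Q q where Q: "Q \<in> add_cat A (left_part A)" "lin A F Q q" "q ` carrier F = carrier Q"
    "{y \<in> carrier F. q y = \<zero>\<^bsub>Q\<^esub>} = (\<lambda>x. x) ` carrier ?K"
    using abelian_exact_cokernel[OF ab KC FC incl inj] .
  have rQ: "right_module A Q" using Q(1) mod_catD(1) by (auto simp: add_cat_def)
  have ker: "q y = \<zero>\<^bsub>Q\<^esub> \<longleftrightarrow> h y = \<zero>\<^bsub>X\<^esub>" if "y \<in> carrier F" for y
    using Q(4) that by auto
  then have "q y = \<zero>\<^bsub>Q\<^esub>" if "y \<in> carrier F" "h y = \<zero>\<^bsub>X\<^esub>" for y using that by simp
  from lin_factor[OF rF rX rQ F(3,4) Q(2) this]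
  obtain g where g: "lin A X Q g" "\<forall>y\<in>carrier F. g (h y) = q y" .
  have "carrier X \<noteq> {\<zero>\<^bsub>X\<^esub>}" using ind_catD(4)[OF X(1)] by (simp add: indecomposable_def)
  then obtain x where x: "x \<in> carrier X" "x \<noteq> \<zero>\<^bsub>X\<^esub>" using FX.Y.X.zero_closed by blast
  have "x \<in> h ` carrier F" using x F(4) by simp
  then obtain y where y: "y \<in> carrier F" "x = h y" by blast
  have gx: "g x \<in> carrier Q" "g x \<noteq> \<zero>\<^bsub>Q\<^esub>" using linD(1)[OF g(1) x(1)] g(2) y ker[OF y(1)] x(2) by auto
  obtain Y u where Y: "Y \<in> left_part A" "lin A Q Y u" "u (g x) \<noteq> \<zero>\<^bsub>Y\<^esub>"
    using add_cat_separates[OF Q(1) left_part_mod_cat gx] .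
  have "nonzero_step A X Y"
    by (rule nonzero_stepI[OF X(1) _ lin_comp[OF g(1) Y(2)] x(1) Y(3)])
      (use Y(1) in \<open>simp add: left_part_def\<close>)
  then show ?thesis by (rule left_part_step[OF _ Y(1)])
qed

text \<open>In this situation add of the left part is all of mod H: if some x e were nonzero, a map
  to a member of the left part would keep it nonzero, although e acts as zero there. Closure of mod
  H under submodules, quotients and sums finishes the argument.\<close>

lemma left_part_imp_abelian:
  assumes L: "left_part A = {X \<in> ind_cat A. killed X}"
  shows "abelian_exact_subcat A (add_cat A (left_part A))"
proof -
  have "add_cat A (left_part A) = {X \<in> mod_cat A. killed X}"
  proof (intro equalityI subsetI CollectI conjI)
    fix N assume N: "N \<in> add_cat A (left_part A)"
    show NA: "N \<in> mod_cat A" using N by (simp add: add_cat_def)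
    interpret N: right_module A N by (rule mod_catD(1)[OF NA])
    show "killed N"
    proof (rule ccontr)
      assume "\<not> killed N"
      then obtain x where x: "x \<in> carrier N" "e \<odot>\<^bsub>N\<^esub> x \<noteq> \<zero>\<^bsub>N\<^esub>" by (auto simp: killed_def)
      have ex: "e \<odot>\<^bsub>N\<^esub> x \<in> carrier N" using x by simp
      obtain Y g where Y: "Y \<in> left_part A" "lin A N Y g" "g (e \<odot>\<^bsub>N\<^esub> x) \<noteq> \<zero>\<^bsub>Y\<^esub>"
        using add_cat_separates[OF N left_part_mod_cat ex x(2)] .
      have "killed Y" using Y(1) L by simp
      then show False using Y(3) linD(3)[OF Y(2) e(1) x(1)] linD(1)[OF Y(2) x(1)] by (simp add: killed_def)
    qed
  next
    fix N assume "N \<in> {X \<in> mod_cat A. killed X}"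
    then have N: "N \<in> mod_cat A" "killed N" by auto
    show "N \<in> add_cat A (left_part A)"
    proof (rule add_catI[OF N(1)])
      fix Y s p assume Y: "Y \<in> ind_cat A" "lin A Y N s" "lin A N Y p" "\<forall>y\<in>carrier Y. p (s y) = y"
      have "inj_on s (carrier Y)" using Y(4) by (metis inj_on_inverseI)
      then have "killed Y" by (rule killed_inj[OF ind_catD(2)[OF Y(1)] mod_catD(1)[OF N(1)] Y(2) _ N(2)])
      then show "Y \<in> left_part A" using L Y(1) by simp
    qed
  qed
  moreover have "abelian_exact_subcat A {X \<in> mod_cat A. killed X}"
  proof (rule abelian_exact_subcatI)
    show "Z \<in> {X \<in> mod_cat A. killed X}" if "Z \<in> mod_cat A" "carrier Z = {\<zero>\<^bsub>Z\<^esub>}" for Z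
      using that right_module.smult_zero[OF mod_catD(1)[OF that(1)] e(1)] by (simp add: killed_def)
    show "X\<lparr>carrier := N\<rparr> \<in> {X \<in> mod_cat A. killed X}"
      if "X \<in> {X \<in> mod_cat A. killed X}" "submodule N A X" for X N
      using that sub_mod_cat killed_sub mod_catD(1) by blast
    show "Q \<in> {X \<in> mod_cat A. killed X}"
      if "X \<in> {X \<in> mod_cat A. killed X}" "Q \<in> mod_cat A" "lin A X Q q" "q ` carrier X = carrier Q" for X Q q
      using that killed_surj[OF mod_catD(1)[of X A] mod_catD(1)[OF that(2)] that(3,4)] by simp
    show "B \<in> {X \<in> mod_cat A. killed X}"
      if XYB: "X \<in> {X \<in> mod_cat A. killed X}" "Y \<in> {X \<in> mod_cat A. killed X}" "B \<in> mod_cat A"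
        "mod_iso A (dsum X Y) B" for X Y B
    proof -
      interpret XY: two_modules A X Y using XYB(1,2) mod_catD(1) by (intro two_modules.intro) auto
      have "killed (dsum X Y)" using XYB(1,2) by (auto simp: killed_def)
      then show ?thesis
        using killed_iso[OF XY.dsum_right_module mod_catD(1)[OF XYB(3)] XYB(4)] XYB(3) by simp
    qed
  qed simp
  ultimately show ?thesis by simp
qed

subsection \<open>The left part and injectivity of M\<close>

text \<open>Injectivity of M over H expressed among A-modules with X e = 0; for the matrix algebra
  it is shown to be equivalent to \<open>injective H M\<close>.\<close>

definition M_injective :: bool where
  "M_injective \<longleftrightarrow> (\<forall>Y\<in>mod_cat A. \<forall>Z\<in>mod_cat A. \<forall>g f. killed Y \<longrightarrow> killed Z \<longrightarrow> lin A Y Z g \<longrightarrow>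
    inj_on g (carrier Y) \<longrightarrow> lin A Y Mm f \<longrightarrow> (\<exists>h. lin A Z Mm h \<and> (\<forall>y\<in>carrier Y. h (g y) = f y)))"

lemma Mm_module: "right_module A Mm" by (rule A.sub_right_module[OF M_submodule])

text \<open>
  Let \<open>E\<close> be the \<open>H\<close>-part of \<open>Z\<close> and \<open>N \<subseteq> E\<close> the submodule generated by \<open>(Z e) M\<close>, a quotient of
  some \<open>M\<^sup>n\<close>.  For a projective cover \<open>\<pi>\<close> of \<open>E\<close>, the map \<open>\<pi>\<^sup>-\<^sup>1(N) \<rightarrow> N\<close> lifts to \<open>M\<^sup>n\<close> because
  \<open>\<pi>\<^sup>-\<^sup>1(N)\<close> is projective, and therefore extends to a map \<open>\<rho>\<close> into \<open>N\<close>; its kernel yields a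
  complement of \<open>N\<close>, so that indecomposability forces \<open>E = N\<close>.
\<close>

lemma killed_step:
  assumes inj: M_injective and st: "nonzero_step A Z X" and X: "killed X"
  shows "killed Z"
proof (rule ccontr)
  assume nk: "\<not> killed Z"
  obtain g z where gz: "Z \<in> ind_cat A" "X \<in> ind_cat A" "lin A Z X g" "z \<in> carrier Z" "g z \<noteq> \<zero>\<^bsub>X\<^esub>"
    using nonzero_stepE[OF st] .
  note rZ = ind_catD(2)[OF gz(1)] and rX = ind_catD(2)[OF gz(2)]
  interpret Z: right_module A Z by (rule rZ)
  interpret ZX: two_modules A Z X using rZ rX by (rule two_modules.intro)
  define E where "E = {x \<in> carrier Z. e \<odot>\<^bsub>Z\<^esub> x = \<zero>\<^bsub>Z\<^esub>}"
  have E: "submodule E A Z"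
  proof (rule Z.submoduleI)
    show "a \<odot>\<^bsub>Z\<^esub> x \<in> E" if "a \<in> carrier A" "x \<in> E" for a x
      using that e_smult[OF rZ, of x a] by (simp add: E_def)
  qed (auto simp: E_def Z.smult_r_distr)
  note ED = Z.submoduleD[OF E]
  let ?E = "Z\<lparr>carrier := E\<rparr>"
  have EA: "?E \<in> mod_cat A" by (rule sub_mod_cat[OF ind_catD(1)[OF gz(1)] E])
  have Ek: "killed ?E" by (simp add: killed_def E_def)
  define gen where "gen = {m \<odot>\<^bsub>Z\<^esub> (e \<odot>\<^bsub>Z\<^esub> x) | m x. m \<in> M \<and> x \<in> carrier Z}"
  have MA: "m \<in> carrier A" "e \<otimes> m = m" "m \<otimes> e = \<zero>" if "m \<in> M" for m using that by (auto simp: M_def)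
  have genE: "gen \<subseteq> E"
  proof
    fix y assume "y \<in> gen"
    then obtain m x where mx: "m \<in> M" "x \<in> carrier Z" "y = m \<odot>\<^bsub>Z\<^esub> (e \<odot>\<^bsub>Z\<^esub> x)" by (auto simp: gen_def)
    have "e \<odot>\<^bsub>Z\<^esub> y = (m \<otimes> e) \<odot>\<^bsub>Z\<^esub> (e \<odot>\<^bsub>Z\<^esub> x)"
      using Z.smult_assoc[of m e "e \<odot>\<^bsub>Z\<^esub> x"] mx MA(1)[OF mx(1)] by simp
    then show "y \<in> E" using mx MA[OF mx(1)] by (simp add: E_def)
  qed
  \<comment> \<open>The submodule generated by (Z e) M is taken as an intersection, so that a
    property closed under the module operations is checked on elements of \<open>gen\<close> only;
    this takes the place of choosing a surjection from M^n.\<close>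
  define N where "N = \<Inter>{U. submodule U A Z \<and> gen \<subseteq> U}"
  have Nmin: "N \<subseteq> U" if "submodule U A Z" "gen \<subseteq> U" for U using that by (auto simp: N_def)
  have NE: "N \<subseteq> E" by (rule Nmin[OF E genE])
  have genN: "gen \<subseteq> N" by (auto simp: N_def)
  have N: "submodule N A Z"
  proof (rule Z.submoduleI)
    show "N \<subseteq> carrier Z" using NE ED(1) by blast
    show "\<zero>\<^bsub>Z\<^esub> \<in> N" unfolding N_def using Z.submoduleD(2) by blast
    show "x \<oplus>\<^bsub>Z\<^esub> y \<in> N" if "x \<in> N" "y \<in> N" for x y
      using that Z.submoduleD(4) unfolding N_def by blast
    show "a \<odot>\<^bsub>Z\<^esub> x \<in> N" if "a \<in> carrier A" "x \<in> N" for a x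
      using that Z.submoduleD(5) unfolding N_def by blast
  qed
  note ND = Z.submoduleD[OF N]
  obtain P \<pi> where P: "P \<in> mod_cat A" "hereditary_module P" "lin A P ?E \<pi>" "\<pi> ` carrier P = carrier ?E"
    using hereditary_cover[OF mod_catD[OF EA] Ek] .
  note rP = mod_catD(1)[OF P(1)]
  interpret PE: two_modules A P ?E by (intro two_modules.intro rP mod_catD(1)[OF EA])
  interpret PZ: two_modules A P Z by (intro two_modules.intro rP rZ)
  have \<pi>Z: "lin A P Z \<pi>" by (rule lin_from_sub[OF P(3) ED(1)])
  let ?Q = "{x \<in> carrier P. \<pi> x \<in> N}"
  have Q: "submodule ?Q A P" by (rule PZ.vimage_submodule[OF \<pi>Z N])
  let ?P = "P\<lparr>carrier := ?Q\<rparr>"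
  have PA: "?P \<in> mod_cat A" by (rule sub_mod_cat[OF P(1) Q])
  have Pk: "killed ?P" by (rule killed_sub[OF rP Q hereditary_moduleD(2)[OF P(2)]])
  note rP' = mod_catD(1)[OF PA]
  interpret PP: two_modules A ?P ?P by (intro two_modules.intro rP')
  interpret PPZ: two_modules A ?P Z by (intro two_modules.intro rP' rZ)
  have incl: "lin A ?P P (\<lambda>x. x)" by (rule linI) auto
  \<comment> \<open>Extendability from the preimage of N to all of P, with values in N. It is closed
    under sums, so it may be verified term by term on a dual basis.\<close>
  define ext where "ext \<sigma> \<longleftrightarrow> (\<exists>\<rho>. lin A P Z \<rho> \<and> (\<forall>x\<in>carrier P. \<rho> x \<in> N) \<and> (\<forall>x\<in>?Q. \<rho> x = \<sigma> x))" for \<sigma>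
  have ext_zero: "ext (\<lambda>x. \<zero>\<^bsub>Z\<^esub>)" unfolding ext_def using PZ.lin_zero_fun ND(2) by blast
  have ext_add: "ext (\<lambda>x. \<sigma> x \<oplus>\<^bsub>Z\<^esub> \<tau> x)" if st: "ext \<sigma>" "ext \<tau>" for \<sigma> \<tau>
  proof -
    obtain \<rho> where \<rho>: "lin A P Z \<rho>" "\<forall>x\<in>carrier P. \<rho> x \<in> N" "\<forall>x\<in>?Q. \<rho> x = \<sigma> x"
      using st(1) unfolding ext_def by blast
    obtain \<rho>' where \<rho>': "lin A P Z \<rho>'" "\<forall>x\<in>carrier P. \<rho>' x \<in> N" "\<forall>x\<in>?Q. \<rho>' x = \<tau> x"
      using st(2) unfolding ext_def by blast
    show ?thesis
      unfolding ext_def using PZ.lin_add[OF \<rho>(1) \<rho>'(1)] \<rho>(2,3) \<rho>'(2,3) ND(4)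
      by (intro exI[of _ "\<lambda>x. \<rho> x \<oplus>\<^bsub>Z\<^esub> \<rho>' x"]) simp
  qed
  have ext_cong: "ext \<sigma>" if "ext \<tau>" "\<And>x. x \<in> ?Q \<Longrightarrow> \<sigma> x = \<tau> x" for \<sigma> \<tau>
    using that unfolding ext_def by auto
  have ext_smult: "ext (\<lambda>x. g x \<odot>\<^bsub>Z\<^esub> n)" if n: "n \<in> N" and g: "lin A ?P (regular A) g" for n g
  proof -
    \<comment> \<open>All linear forms g are quantified here: replacing n by n a amounts to
      replacing g by a g, and this makes U a submodule.\<close>
    define U where "U = {n \<in> N. \<forall>g. lin A ?P (regular A) g \<longrightarrow> ext (\<lambda>x. g x \<odot>\<^bsub>Z\<^esub> n)}"
    have gA: "g x \<in> carrier A" if "lin A ?P (regular A) g" "x \<in> ?Q" for g x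
      using linD(1)[OF that(1)] that(2) by simp
    have "submodule U A Z"
    proof (rule Z.submoduleI)
      show "U \<subseteq> carrier Z" using ND(1) by (auto simp: U_def)
      have "ext (\<lambda>x. g x \<odot>\<^bsub>Z\<^esub> \<zero>\<^bsub>Z\<^esub>)" if "lin A ?P (regular A) g" for g
        by (rule ext_cong[OF ext_zero]) (simp add: gA[OF that])
      then show "\<zero>\<^bsub>Z\<^esub> \<in> U" using ND(2) by (simp add: U_def)
      show "m \<oplus>\<^bsub>Z\<^esub> n \<in> U" if mn: "m \<in> U" "n \<in> U" for m n
      proof -
        have mn': "m \<in> N" "n \<in> N" using mn by (auto simp: U_def)
        have "ext (\<lambda>x. g x \<odot>\<^bsub>Z\<^esub> (m \<oplus>\<^bsub>Z\<^esub> n))" if g: "lin A ?P (regular A) g" for g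
        proof (rule ext_cong)
          show "ext (\<lambda>x. g x \<odot>\<^bsub>Z\<^esub> m \<oplus>\<^bsub>Z\<^esub> g x \<odot>\<^bsub>Z\<^esub> n)"
            using mn g by (intro ext_add) (auto simp: U_def)
        qed (use mn' ND(3) gA[OF g] in \<open>simp add: Z.smult_r_distr\<close>)
        then show ?thesis using ND(4) mn' by (simp add: U_def)
      qed
      show "a \<odot>\<^bsub>Z\<^esub> n \<in> U" if an: "a \<in> carrier A" "n \<in> U" for a n
      proof -
        have n': "n \<in> N" using an by (auto simp: U_def)
        have "ext (\<lambda>x. g x \<odot>\<^bsub>Z\<^esub> (a \<odot>\<^bsub>Z\<^esub> n))" if g: "lin A ?P (regular A) g" for g
        proof (rule ext_cong)
          have "lin A ?P (regular A) (\<lambda>x. a \<otimes> g x)"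
            using linD[OF g] an(1) by (intro linI) (simp_all add: r_distr m_assoc)
          then show "ext (\<lambda>x. (a \<otimes> g x) \<odot>\<^bsub>Z\<^esub> n)" using an by (simp add: U_def)
        qed (use n' ND(3) gA[OF g] an in \<open>simp add: Z.smult_assoc\<close>)
        then show ?thesis using ND(5) an n' by (simp add: U_def)
      qed
    qed
    moreover have "gen \<subseteq> U"
    proof
      fix y assume y: "y \<in> gen"
      then obtain m x where mx: "m \<in> M" "x \<in> carrier Z" "y = m \<odot>\<^bsub>Z\<^esub> (e \<odot>\<^bsub>Z\<^esub> x)" by (auto simp: gen_def)
      note m = MA[OF mx(1)]
      have "ext (\<lambda>x. g x \<odot>\<^bsub>Z\<^esub> y)" if g: "lin A ?P (regular A) g" for g
      proof -
        \<comment> \<open>For y = (x e) m the map sends u to (x e) (m g(u)). It factors through the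
          M-valued map m g, and this is what injectivity of M extends.\<close>
        have l: "lin A ?P Mm (\<lambda>x. m \<otimes> g x)"
        proof (rule lin_into_sub)
          show "lin A ?P (regular A) (\<lambda>x. m \<otimes> g x)"
            using linD[OF g] m(1) by (intro linI) (simp_all add: r_distr m_assoc)
          show "m \<otimes> g x \<in> M" if "x \<in> carrier ?P" for x
            using A.submoduleD(5)[OF M_submodule _ mx(1), of "g x"] linD(1)[OF g that] by simp
        qed
        have "inj_on (\<lambda>x. x) (carrier ?P)" by simp
        with inj[unfolded M_injective_def, rule_format, OF PA P(1) Pk hereditary_moduleD(2)[OF P(2)] incl _ l]
        obtain \<psi> where \<psi>: "lin A P Mm \<psi>" "\<forall>x\<in>carrier ?P. \<psi> x = m \<otimes> g x" by blast
        have \<psi>M: "\<psi> u \<in> M" if "u \<in> carrier P" for u using linD(1)[OF \<psi>(1) that] by simp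
        have ex: "e \<odot>\<^bsub>Z\<^esub> x \<in> carrier Z" using mx by simp
        show ?thesis
          unfolding ext_def
        proof (intro exI conjI ballI)
          show "lin A P Z (\<lambda>u. \<psi> u \<odot>\<^bsub>Z\<^esub> (e \<odot>\<^bsub>Z\<^esub> x))"
            by (rule lin_comp[OF lin_from_sub[OF \<psi>(1)] Z.lin_smult_elem[OF ex]]) (auto simp: M_def)
          show "\<psi> u \<odot>\<^bsub>Z\<^esub> (e \<odot>\<^bsub>Z\<^esub> x) \<in> N" if "u \<in> carrier P" for u
            using genN \<psi>M[OF that] mx(2) unfolding gen_def by blast
          show "\<psi> u \<odot>\<^bsub>Z\<^esub> (e \<odot>\<^bsub>Z\<^esub> x) = g u \<odot>\<^bsub>Z\<^esub> y" if u: "u \<in> ?Q" for u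
            using \<psi>(2) u gA[OF g u] m(1) ex mx(3) by (simp add: Z.smult_assoc)
        qed
      qed
      then show "y \<in> U" using genN y by (auto simp: U_def)
    qed
    ultimately have "N \<subseteq> U" by (rule Nmin)
    then show ?thesis using n g by (auto simp: U_def)
  qed
  \<comment> \<open>The preimage of N in P has a dual basis; composed with \<pi> it writes \<pi> as
    a sum of maps u \<mapsto> n g(u) with n in N.\<close>
  have ext_rank: "ext (\<lambda>x. \<pi> (\<phi> x))" if "finite_rank A ?P ?P \<phi>" for \<phi>
    using that
  proof induction
    case zero
    show ?case by (rule ext_cong[OF ext_zero]) (use PZ.lin_zero[OF \<pi>Z] in simp)
  next
    case (add \<phi> g q)
    have q: "q \<in> carrier P" "\<pi> q \<in> N" using add.hyps(3) by auto
    show ?case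
    proof (rule ext_cong[OF ext_add[OF add.IH ext_smult[OF q(2) add.hyps(2)]]])
      fix x assume x: "x \<in> ?Q"
      then have "\<phi> x \<in> carrier P" "g x \<in> carrier A"
        using PP.finite_rank_closed[OF add.hyps(1)] linD(1)[OF add.hyps(2)] by auto
      then show "\<pi> (\<phi> x \<oplus>\<^bsub>?P\<^esub> g x \<odot>\<^bsub>?P\<^esub> q) = \<pi> (\<phi> x) \<oplus>\<^bsub>Z\<^esub> g x \<odot>\<^bsub>Z\<^esub> \<pi> q"
        using linD(2,3)[OF \<pi>Z] q by simp
    qed
  qed
  obtain \<phi> where \<phi>: "right_module A ?P" "finite_rank A ?P ?P \<phi>" "\<forall>x\<in>carrier ?P. \<phi> x = x"
    using dual_basisE[OF hereditary_moduleD(3)[OF P(2) Q]] .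
  have "ext \<pi>" by (rule ext_cong[OF ext_rank[OF \<phi>(2)]]) (use \<phi>(3) in simp)
  then obtain \<rho> where \<rho>: "lin A P Z \<rho>" "\<forall>x\<in>carrier P. \<rho> x \<in> N" "\<forall>x\<in>?Q. \<rho> x = \<pi> x"
    unfolding ext_def by blast
  \<comment> \<open>Since \<rho> agrees with \<pi> on the preimage of N, the image C of its kernel
    meets N trivially. Since \<rho> takes values in N, and N is covered by that preimage, C and N
    together span E.\<close>
  define C where "C = \<pi> ` {x \<in> carrier P. \<rho> x = \<zero>\<^bsub>Z\<^esub>}"
  have C: "submodule C A Z"
    unfolding C_def by (rule PZ.image_submodule[OF \<pi>Z PZ.ker_submodule[OF \<rho>(1)]])
  have CE: "C \<subseteq> E" unfolding C_def using linD(1)[OF P(3)] by auto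
  have CN: "y = \<zero>\<^bsub>Z\<^esub>" if "y \<in> C" "y \<in> N" for y
    using that \<rho>(3) by (auto simp: C_def)
  have CNE: "\<exists>u\<in>C. \<exists>v\<in>N. y = u \<oplus>\<^bsub>Z\<^esub> v" if y: "y \<in> E" for y
  proof -
    have "y \<in> \<pi> ` carrier P" using y P(4) by simp
    then obtain x where x: "x \<in> carrier P" "y = \<pi> x" by auto
    have rN: "\<rho> x \<in> N" using \<rho>(2) x(1) by blast
    then have "\<rho> x \<in> \<pi> ` carrier P" using P(4) NE by auto
    then obtain x' where x': "x' \<in> carrier P" "\<rho> x = \<pi> x'" by auto
    then have "x' \<in> ?Q" using rN by simp
    then have rx': "\<rho> x' = \<rho> x" using \<rho>(3) x'(2) by simp
    have "\<rho> (x \<ominus>\<^bsub>P\<^esub> x') = \<zero>\<^bsub>Z\<^esub>"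
      using PZ.lin_minus[OF \<rho>(1) x(1) x'(1)] rx' linD(1)[OF \<rho>(1) x(1)] by simp
    then have "\<pi> (x \<ominus>\<^bsub>P\<^esub> x') \<in> C" unfolding C_def using x x' by blast
    moreover have "y = \<pi> (x \<ominus>\<^bsub>P\<^esub> x') \<oplus>\<^bsub>Z\<^esub> \<rho> x"
      using PZ.lin_minus[OF \<pi>Z x(1) x'(1)] x' x(2) linD(1)[OF \<pi>Z x(1)] linD(1)[OF \<pi>Z x'(1)]
      by (simp add: a_minus_def Z.X.a_assoc Z.X.l_neg)
    ultimately show ?thesis using rN by blast
  qed
  \<comment> \<open>The submodule generated by Z e, namely N + Z e. It is a complement of C in Z
    because E is the sum of C and N, and Z is the sum of E and Z e.\<close>
  define W where "W = {y \<in> carrier Z. \<exists>n\<in>N. \<exists>x\<in>carrier Z. y = n \<oplus>\<^bsub>Z\<^esub> e \<odot>\<^bsub>Z\<^esub> x}"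
  have WI: "n \<oplus>\<^bsub>Z\<^esub> e \<odot>\<^bsub>Z\<^esub> x \<in> W" if "n \<in> N" "x \<in> carrier Z" for n x
    using that ND(3)[OF that(1)] unfolding W_def by auto
  have split1: "a \<odot>\<^bsub>Z\<^esub> (e \<odot>\<^bsub>Z\<^esub> x) \<in> W" if a: "a \<in> carrier A" and x: "x \<in> carrier Z" for a x
  proof -
    \<comment> \<open>Splits e a into its part in M = e A (1 - e) and its part in e A e; applied to
      x e, the former lands in N and the latter in Z e.\<close>
    let ?m = "e \<otimes> a \<ominus> e \<otimes> a \<otimes> e"
    have m: "?m \<in> M" using a by (simp add: M_def a_minus_def r_distr l_distr r_minus l_minus m_assoc r_neg, simp add: m_assoc[symmetric])
    have eq: "e \<otimes> a = ?m \<oplus> e \<otimes> a \<otimes> e" using a by (simp add: a_minus_def a_assoc l_neg)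
    have "a \<odot>\<^bsub>Z\<^esub> (e \<odot>\<^bsub>Z\<^esub> x) = (e \<otimes> a) \<odot>\<^bsub>Z\<^esub> (e \<odot>\<^bsub>Z\<^esub> x)"
      using a x e_e_smult[OF rZ x] by (simp add: Z.smult_assoc)
    also have "\<dots> = ?m \<odot>\<^bsub>Z\<^esub> (e \<odot>\<^bsub>Z\<^esub> x) \<oplus>\<^bsub>Z\<^esub> (e \<otimes> a \<otimes> e) \<odot>\<^bsub>Z\<^esub> (e \<odot>\<^bsub>Z\<^esub> x)"
      by (subst eq, rule Z.smult_l_distr) (use a x in simp_all)
    also have "(e \<otimes> a \<otimes> e) \<odot>\<^bsub>Z\<^esub> (e \<odot>\<^bsub>Z\<^esub> x) = e \<odot>\<^bsub>Z\<^esub> ((e \<otimes> a) \<odot>\<^bsub>Z\<^esub> (e \<odot>\<^bsub>Z\<^esub> x))"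
      by (rule Z.smult_assoc) (use a x in simp_all)
    finally have "a \<odot>\<^bsub>Z\<^esub> (e \<odot>\<^bsub>Z\<^esub> x) = ?m \<odot>\<^bsub>Z\<^esub> (e \<odot>\<^bsub>Z\<^esub> x) \<oplus>\<^bsub>Z\<^esub> e \<odot>\<^bsub>Z\<^esub> ((e \<otimes> a) \<odot>\<^bsub>Z\<^esub> (e \<odot>\<^bsub>Z\<^esub> x))" .
    moreover have "?m \<odot>\<^bsub>Z\<^esub> (e \<odot>\<^bsub>Z\<^esub> x) \<in> N" using genN m x unfolding gen_def by blast
    moreover have "(e \<otimes> a) \<odot>\<^bsub>Z\<^esub> (e \<odot>\<^bsub>Z\<^esub> x) \<in> carrier Z" "a \<odot>\<^bsub>Z\<^esub> (e \<odot>\<^bsub>Z\<^esub> x) \<in> carrier Z" using a x by simp_all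
    ultimately show ?thesis using WI by simp
  qed
  have Wadd: "y \<oplus>\<^bsub>Z\<^esub> y' \<in> W" if yy: "y \<in> W" "y' \<in> W" for y y'
  proof -
    obtain n x where nx: "n \<in> N" "x \<in> carrier Z" "y = n \<oplus>\<^bsub>Z\<^esub> e \<odot>\<^bsub>Z\<^esub> x" using yy(1) by (auto simp: W_def)
    obtain n' x' where nx': "n' \<in> N" "x' \<in> carrier Z" "y' = n' \<oplus>\<^bsub>Z\<^esub> e \<odot>\<^bsub>Z\<^esub> x'" using yy(2) by (auto simp: W_def)
    have "y \<oplus>\<^bsub>Z\<^esub> y' = (n \<oplus>\<^bsub>Z\<^esub> n') \<oplus>\<^bsub>Z\<^esub> e \<odot>\<^bsub>Z\<^esub> (x \<oplus>\<^bsub>Z\<^esub> x')"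
      using nx nx' ND(3) by (simp add: Z.smult_r_distr Z.X.a_ac)
    then show ?thesis using WI[OF ND(4)[OF nx(1) nx'(1)]] nx(2) nx'(2) by simp
  qed
  have NW: "n \<in> W" if "n \<in> N" for n
    using WI[OF that Z.X.zero_closed] ND(3)[OF that] by simp
  have W: "submodule W A Z"
  proof (rule Z.submoduleI)
    show "W \<subseteq> carrier Z" by (auto simp: W_def)
    show "\<zero>\<^bsub>Z\<^esub> \<in> W" by (rule NW[OF ND(2)])
    show "a \<odot>\<^bsub>Z\<^esub> y \<in> W" if ay: "a \<in> carrier A" "y \<in> W" for a y
    proof -
      obtain n x where nx: "n \<in> N" "x \<in> carrier Z" "y = n \<oplus>\<^bsub>Z\<^esub> e \<odot>\<^bsub>Z\<^esub> x" using ay(2) by (auto simp: W_def)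
      have "a \<odot>\<^bsub>Z\<^esub> y = a \<odot>\<^bsub>Z\<^esub> n \<oplus>\<^bsub>Z\<^esub> a \<odot>\<^bsub>Z\<^esub> (e \<odot>\<^bsub>Z\<^esub> x)"
        using nx \<open>a \<in> carrier A\<close> ND(3) by (simp add: Z.smult_r_distr)
      then show ?thesis using Wadd[OF NW[OF ND(5)] split1] nx \<open>a \<in> carrier A\<close> by simp
    qed
  qed (rule Wadd)
  have dsum: "internal_dsum A Z C W"
  proof (rule Z.internal_dsumI[OF C W])
    fix y assume y: "y \<in> C" "y \<in> W"
    then obtain n x where nx: "n \<in> N" "x \<in> carrier Z" "y = n \<oplus>\<^bsub>Z\<^esub> e \<odot>\<^bsub>Z\<^esub> x" by (auto simp: W_def)
    have nE: "n \<in> carrier Z" "e \<odot>\<^bsub>Z\<^esub> n = \<zero>\<^bsub>Z\<^esub>" using nx(1) NE by (auto simp: E_def)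
    have "e \<odot>\<^bsub>Z\<^esub> y = e \<odot>\<^bsub>Z\<^esub> n \<oplus>\<^bsub>Z\<^esub> e \<odot>\<^bsub>Z\<^esub> (e \<odot>\<^bsub>Z\<^esub> x)" using nx nE by (simp add: Z.smult_r_distr)
    also have "\<dots> = e \<odot>\<^bsub>Z\<^esub> x" using nE nx(2) e_e_smult[OF rZ nx(2)] by simp
    finally have "e \<odot>\<^bsub>Z\<^esub> x = \<zero>\<^bsub>Z\<^esub>" using y(1) CE by (auto simp: E_def)
    then show "y = \<zero>\<^bsub>Z\<^esub>" using CN[OF y(1)] nx nE by simp
  next
    fix y assume y: "y \<in> carrier Z"
    have yE: "y \<ominus>\<^bsub>Z\<^esub> e \<odot>\<^bsub>Z\<^esub> y \<in> E"
      using y e_e_smult[OF rZ y] Z.smult_diff[of e y "e \<odot>\<^bsub>Z\<^esub> y"] by (simp add: E_def)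
    then obtain u v where uv: "u \<in> C" "v \<in> N" "y \<ominus>\<^bsub>Z\<^esub> e \<odot>\<^bsub>Z\<^esub> y = u \<oplus>\<^bsub>Z\<^esub> v" using CNE by blast
    have c: "u \<in> carrier Z" "v \<in> carrier Z" using uv Z.submoduleD(3)[OF C] ND(3) by auto
    have "y = (y \<ominus>\<^bsub>Z\<^esub> e \<odot>\<^bsub>Z\<^esub> y) \<oplus>\<^bsub>Z\<^esub> e \<odot>\<^bsub>Z\<^esub> y" using y by (simp add: a_minus_def Z.X.a_assoc Z.X.l_neg)
    then have eq: "y = u \<oplus>\<^bsub>Z\<^esub> (v \<oplus>\<^bsub>Z\<^esub> e \<odot>\<^bsub>Z\<^esub> y)" using uv c y by (simp add: Z.X.a_assoc)
    have vW: "v \<oplus>\<^bsub>Z\<^esub> e \<odot>\<^bsub>Z\<^esub> y \<in> W" by (rule WI[OF uv(2) y])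
    show "\<exists>u\<in>C. \<exists>w\<in>W. y = u \<oplus>\<^bsub>Z\<^esub> w"
      by (rule bexI[OF _ uv(1)], rule bexI[OF _ vW], rule eq)
  qed
  obtain x where x: "x \<in> carrier Z" "e \<odot>\<^bsub>Z\<^esub> x \<noteq> \<zero>\<^bsub>Z\<^esub>" using nk by (auto simp: killed_def)
  have exW: "e \<odot>\<^bsub>Z\<^esub> x \<in> W" if "x \<in> carrier Z" for x
    using WI[OF ND(2) that] that by simp
  have "W \<noteq> {\<zero>\<^bsub>Z\<^esub>}" using exW[OF x(1)] x(2) by blast
  then have C0: "C = {\<zero>\<^bsub>Z\<^esub>}"
    using ind_catD(4)[OF gz(1)] dsum unfolding indecomposable_def by blast
  \<comment> \<open>With C = 0 only Z = N + Z e remains. As X e = 0, the map g vanishes on Z e,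
    hence on the products with M that generate N.\<close>
  have ge: "g (e \<odot>\<^bsub>Z\<^esub> x) = \<zero>\<^bsub>X\<^esub>" if "x \<in> carrier Z" for x
    using linD(3)[OF gz(3) e(1) that] linD(1)[OF gz(3) that] X by (simp add: killed_def)
  have "gen \<subseteq> {x \<in> carrier Z. g x = \<zero>\<^bsub>X\<^esub>}"
  proof
    fix y assume "y \<in> gen"
    then obtain m x where mx: "m \<in> M" "x \<in> carrier Z" "y = m \<odot>\<^bsub>Z\<^esub> (e \<odot>\<^bsub>Z\<^esub> x)" by (auto simp: gen_def)
    then show "y \<in> {x \<in> carrier Z. g x = \<zero>\<^bsub>X\<^esub>}"
      using linD(3)[OF gz(3) MA(1)[OF mx(1)], of "e \<odot>\<^bsub>Z\<^esub> x"] ge[OF mx(2)] MA(1)[OF mx(1)] by simp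
  qed
  then have Ng: "N \<subseteq> {x \<in> carrier Z. g x = \<zero>\<^bsub>X\<^esub>}" by (rule Nmin[OF ZX.ker_submodule[OF gz(3)]])
  obtain u w where uw: "u \<in> C" "w \<in> W" "z = u \<oplus>\<^bsub>Z\<^esub> w" using Z.internal_dsumD(4)[OF dsum gz(4)] by blast
  then have "z \<in> W" using C0 Z.submoduleD(3)[OF W] by simp
  then obtain n y where "n \<in> N" "y \<in> carrier Z" "z = n \<oplus>\<^bsub>Z\<^esub> e \<odot>\<^bsub>Z\<^esub> y" by (auto simp: W_def)
  then have "g z = \<zero>\<^bsub>X\<^esub>" using Ng linD(2)[OF gz(3), of n "e \<odot>\<^bsub>Z\<^esub> y"] ge by auto
  then show False using gz(5) by simp
qed

lemma injective_imp_left_part: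
  assumes M_injective
  shows "left_part A = {X \<in> ind_cat A. killed X}"
proof (intro equalityI subsetI)
  show "X \<in> {X \<in> ind_cat A. killed X}" if "X \<in> left_part A" for X
    using left_part_killed[OF that] that by (simp add: left_part_def)
  show "X \<in> left_part A" if X: "X \<in> {X \<in> ind_cat A. killed X}" for X
  proof (rule left_partI[where Pr = killed])
    show "proj_dim A Y \<le> 1" if "Y \<in> ind_cat A" "killed Y" for Y
      by (rule killed_proj_dim[OF ind_catD(1)[OF that(1)] that(2)])
    show "killed Z" if "nonzero_step A Z Y" "killed Y" for Z Y
      by (rule killed_step[OF assms that])
  qed (use X in auto)
qed

text \<open>
  If \<open>f\<close> does not extend along \<open>g\<close>, consider a quotient \<open>Q\<close> of the pushout of \<open>e A\<close> and \<open>Z\<close> that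
  contains \<open>e A\<close> as an essential submodule.  It is indecomposable, and \<open>Q / e A\<close> is nonzero;
  hence \<open>Q\<close> is a predecessor of some indecomposable \<open>H\<close>-module, although it is none itself.
\<close>

lemma left_part_imp_injective:
  assumes L: "left_part A = {X \<in> ind_cat A. killed X}"
  shows M_injective
  unfolding M_injective_def
proof (intro ballI allI impI)
  fix Y Z g f
  assume YZ: "Y \<in> mod_cat A" "Z \<in> mod_cat A" and k: "killed Y" "killed Z"
    and g: "lin A Y Z g" "inj_on g (carrier Y)" and f: "lin A Y Mm f"
  note rY = mod_catD(1)[OF YZ(1)] and rZ = mod_catD(1)[OF YZ(2)]
  interpret YZ: two_modules A Y Z by (intro two_modules.intro rY rZ)
  interpret YM: two_modules A Y Mm by (intro two_modules.intro rY Mm_module)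
  interpret EZ: two_modules A eAm Z by (intro two_modules.intro eAm_module rZ)
  interpret B: right_module A "dsum eAm Z" by (rule EZ.dsum_right_module)
  interpret YB: two_modules A Y "dsum eAm Z" by (intro two_modules.intro rY B.right_module_axioms)
  let ?B = "dsum eAm Z"
  have ME: "M \<subseteq> eA" by (auto simp: M_def eA_def)
  have fe: "lin A Y eAm f" using linD[OF f] ME by (intro linI) auto
  \<comment> \<open>Its image is the antidiagonal copy of Y, the relations that identify f y with g
    y; the quotient by them is the pushout.\<close>
  define d where "d y = (f y, \<ominus>\<^bsub>Z\<^esub> g y)" for y
  have dl: "lin A Y ?B d"
    unfolding d_def
    using linD[OF fe] linD[OF g(1)]
    by (intro linI) (auto simp: YZ.Y.X.minus_add YZ.Y.smult_minus)
  define \<Delta> where "\<Delta> = d ` carrier Y"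
  have \<Delta>: "submodule \<Delta> A ?B"
    unfolding \<Delta>_def by (rule YB.image_submodule[OF dl YZ.X.submodule_carrier])
  \<comment> \<open>The nonzero elements of e A inside the sum. Injectivity of g keeps the relations
    away from them, so e A embeds into the pushout; a maximal N avoiding them makes e A essential in
    Q.\<close>
  define av where "av = (\<lambda>a. (a, \<zero>\<^bsub>Z\<^esub>)) ` (eA - {\<zero>})"
  have "\<Delta> \<inter> av = {}"
  proof (rule ccontr)
    assume "\<Delta> \<inter> av \<noteq> {}"
    then obtain y a where ya: "y \<in> carrier Y" "(a, \<zero>\<^bsub>Z\<^esub>) = d y" "a \<noteq> \<zero>" by (auto simp: \<Delta>_def av_def)
    then have "\<ominus>\<^bsub>Z\<^esub> g y = \<zero>\<^bsub>Z\<^esub>" "f y = a" by (auto simp: d_def)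
    then have "g y = \<zero>\<^bsub>Z\<^esub>"
      using YZ.Y.X.r_neg[OF linD(1)[OF g(1) ya(1)]] linD(1)[OF g(1) ya(1)] by simp
    then have "y = \<zero>\<^bsub>Y\<^esub>" using YZ.inj_on_iff_ker[OF g(1)] g(2) ya(1) by blast
    then show False using YM.lin_zero[OF f] \<open>f y = a\<close> ya(3) by simp
  qed
  from B.ex_maximal_submodule_avoiding[OF \<Delta> this]
  obtain N where N: "submodule N A ?B" "\<Delta> \<subseteq> N" "N \<inter> av = {}"
    and Nmax: "\<forall>N'. submodule N' A ?B \<longrightarrow> N \<subseteq> N' \<longrightarrow> N' \<inter> av = {} \<longrightarrow> N' = N" .
  have Bfg: "fin_gen A ?B" by (rule EZ.dsum_fin_gen[OF eAm_fin_gen mod_catD(2)[OF YZ(2)]])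
  obtain Q q where Q: "Q \<in> mod_cat A" "lin A ?B Q q" "q ` carrier ?B = carrier Q"
    "\<forall>x\<in>carrier ?B. q x = \<zero>\<^bsub>Q\<^esub> \<longleftrightarrow> x \<in> N"
    using ex_quotient[OF B.right_module_axioms Bfg N(1)] .
  note rQ = mod_catD(1)[OF Q(1)] and qD = linD[OF Q(2)]
  interpret Q: right_module A Q by (rule rQ)
  interpret BQ: two_modules A ?B Q by (intro two_modules.intro rQ B.right_module_axioms)
  define \<epsilon> where "\<epsilon> a = q (a, \<zero>\<^bsub>Z\<^esub>)" for a
  have \<epsilon>: "lin A eAm Q \<epsilon>" unfolding \<epsilon>_def by (rule lin_comp[OF EZ.dsum_lin(1) Q(2)])
  note \<epsilon>D = linD[OF \<epsilon>]
  interpret EQ: two_modules A eAm Q by (intro two_modules.intro rQ eAm_module)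
  have \<epsilon>0: "a = \<zero>" if "a \<in> eA" "\<epsilon> a = \<zero>\<^bsub>Q\<^esub>" for a
    using Q(4) N(3) that unfolding \<epsilon>_def av_def by auto
  have eE: "e \<in> carrier eAm" by (simp add: eA_def)
  have \<epsilon>e: "\<epsilon> a = a \<odot>\<^bsub>Q\<^esub> \<epsilon> e" if "a \<in> eA" for a
  proof -
    have "a \<in> carrier A" "e \<otimes> a = a" using that by (auto simp: eA_def)
    then show ?thesis using \<epsilon>D(3)[OF _ eE, of a] by simp
  qed
  have \<epsilon>ne: "\<epsilon> e \<noteq> \<zero>\<^bsub>Q\<^esub>" using \<epsilon>0[of e] eE e_nonzero by auto
  have \<epsilon>Q: "\<epsilon> e \<in> carrier Q" by (rule \<epsilon>D(1)[OF eE])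
  have \<epsilon>ee: "e \<odot>\<^bsub>Q\<^esub> \<epsilon> e = \<epsilon> e" using \<epsilon>D(3)[OF e(1) eE] by simp
  have Qe: "\<exists>a\<in>eA. e \<odot>\<^bsub>Q\<^esub> y = \<epsilon> a" if y: "y \<in> carrier Q" for y
  proof -
    have "y \<in> q ` carrier ?B" using y Q(3) by simp
    then obtain b where b: "b \<in> carrier ?B" "y = q b" by auto
    then obtain a z where az: "b = (a, z)" "a \<in> eA" "z \<in> carrier Z" by auto
    have "e \<odot>\<^bsub>Q\<^esub> y = q (e \<odot>\<^bsub>?B\<^esub> b)" using qD(3)[OF e(1) b(1)] b by simp
    also have "e \<odot>\<^bsub>?B\<^esub> b = (a \<otimes> e, \<zero>\<^bsub>Z\<^esub>)" using az k(2) by (simp add: killed_def)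
    finally have "e \<odot>\<^bsub>Q\<^esub> y = \<epsilon> (a \<otimes> e)" by (simp add: \<epsilon>_def)
    moreover have "a \<otimes> e \<in> eA" using A.submoduleD(5)[OF eA_submodule e(1) az(2)] by simp
    ultimately show ?thesis by blast
  qed
  have Qi: "indecomposable A Q"
    unfolding indecomposable_def
  proof (intro conjI allI impI)
    show "carrier Q \<noteq> {\<zero>\<^bsub>Q\<^esub>}" using \<epsilon>Q \<epsilon>ne by auto
    \<comment> \<open>A summand V complementary to one containing \<epsilon> e meets the copy of e A
      trivially, so its preimage still avoids the nonzero elements of e A. By maximality this
      preimage is N, and V is zero.\<close>
    have key: "V = {\<zero>\<^bsub>Q\<^esub>}" if UV: "internal_dsum A Q U V" and U: "\<epsilon> e \<in> U" for U V
    proof -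
      note UVD = Q.internal_dsumD[OF UV]
      let ?N = "{x \<in> carrier ?B. q x \<in> V}"
      have "submodule ?N A ?B" by (rule BQ.vimage_submodule[OF Q(2) UVD(2)])
      moreover have "N \<subseteq> ?N"
      proof
        fix b assume b: "b \<in> N"
        then have bB: "b \<in> carrier ?B" by (rule B.submoduleD(3)[OF N(1)])
        then have "q b = \<zero>\<^bsub>Q\<^esub>" using Q(4) b by blast
        then show "b \<in> ?N" using bB Q.submoduleD(2)[OF UVD(2)] by simp
      qed
      moreover have "?N \<inter> av = {}"
      proof (rule ccontr)
        assume "?N \<inter> av \<noteq> {}"
        then obtain a where a: "a \<in> eA" "a \<noteq> \<zero>" "\<epsilon> a \<in> V" by (auto simp: av_def \<epsilon>_def)
        have "a \<in> carrier A" using a(1) by (simp add: eA_def)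
        then have "\<epsilon> a \<in> U" using \<epsilon>e[OF a(1)] Q.submoduleD(5)[OF UVD(1) _ U] by simp
        then have "\<epsilon> a = \<zero>\<^bsub>Q\<^esub>" using UVD(3) a(3) by blast
        then show False using \<epsilon>0 a by blast
      qed
      ultimately have NN: "?N = N" using Nmax by blast
      have "v = \<zero>\<^bsub>Q\<^esub>" if v: "v \<in> V" for v
      proof -
        have "v \<in> q ` carrier ?B" using v Q.submoduleD(3)[OF UVD(2)] Q(3) by simp
        then obtain b where b: "b \<in> carrier ?B" "v = q b" by blast
        then have "b \<in> N" using v unfolding NN[symmetric] by simp
        then show ?thesis using Q(4) b by blast
      qed
      then show ?thesis using Q.submoduleD(2)[OF UVD(2)] by blast
    qed
    fix U V assume UV: "internal_dsum A Q U V"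
    have "\<epsilon> e \<in> U \<or> \<epsilon> e \<in> V"
    proof (rule local_splitting[OF rQ \<epsilon>Q \<epsilon>ee \<epsilon>ne _ UV])
      fix y assume "y \<in> carrier Q"
      then obtain a where a: "a \<in> eA" "e \<odot>\<^bsub>Q\<^esub> y = \<epsilon> a" using Qe by blast
      then show "\<exists>a\<in>carrier A. e \<odot>\<^bsub>Q\<^esub> y = a \<odot>\<^bsub>Q\<^esub> \<epsilon> e"
        using \<epsilon>e[OF a(1)] by (intro bexI[of _ a]) (simp_all add: eA_def)
    qed
    then show "U = {\<zero>\<^bsub>Q\<^esub>} \<or> V = {\<zero>\<^bsub>Q\<^esub>}"
      using key[OF UV] key[OF Q.internal_dsum_sym[OF UV]] by blast
  qed
  then have QI: "Q \<in> ind_cat A" using Q(1) by (simp add: ind_cat_def)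
  let ?E = "\<epsilon> ` eA"
  have E: "submodule ?E A Q" using EQ.image_submodule[OF \<epsilon> EZ.X.submodule_carrier] by simp
  \<comment> \<open>If e A fills Q, then Z -> Q followed by the inverse of \<epsilon> is the
    extension sought. The other case contradicts the description of the left part.\<close>
  show "\<exists>h. lin A Z Mm h \<and> (\<forall>y\<in>carrier Y. h (g y) = f y)"
  proof (cases "?E = carrier Q")
    case False
    then obtain x where x: "x \<in> carrier Q" "x \<notin> ?E" using Q.submoduleD(1)[OF E] by blast
    then have "?E \<inter> {x} = {}" by blast
    \<comment> \<open>Prepares an indecomposable quotient S of Q modulo e A: the class of x will lie
      in every nonzero submodule of S. Since Q e is contained in the copy of e A, the module S is
      killed by e.\<close>
    from Q.ex_maximal_submodule_avoiding[OF E this]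
    obtain N2 where N2: "submodule N2 A Q" "?E \<subseteq> N2" "N2 \<inter> {x} = {}"
      and N2max: "\<forall>N'. submodule N' A Q \<longrightarrow> N2 \<subseteq> N' \<longrightarrow> N' \<inter> {x} = {} \<longrightarrow> N' = N2" .
    obtain S p where S: "S \<in> mod_cat A" "lin A Q S p" "p ` carrier Q = carrier S"
      "\<forall>x\<in>carrier Q. p x = \<zero>\<^bsub>S\<^esub> \<longleftrightarrow> x \<in> N2"
      using ex_quotient[OF rQ mod_catD(2)[OF Q(1)] N2(1)] .
    note rS = mod_catD(1)[OF S(1)]
    interpret QS: two_modules A Q S by (intro two_modules.intro rQ rS)
    have px: "p x \<noteq> \<zero>\<^bsub>S\<^esub>" using S(4) x(1) N2(3) by blast
    have "killed S"
      unfolding killed_def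
    proof
      fix s assume "s \<in> carrier S"
      then have "s \<in> p ` carrier Q" using S(3) by simp
      then obtain y where y: "y \<in> carrier Q" "s = p y" by auto
      have "e \<odot>\<^bsub>Q\<^esub> y \<in> N2" using Qe[OF y(1)] N2(2) by auto
      then have "p (e \<odot>\<^bsub>Q\<^esub> y) = \<zero>\<^bsub>S\<^esub>" using S(4) y(1) by simp
      then show "e \<odot>\<^bsub>S\<^esub> s = \<zero>\<^bsub>S\<^esub>" using linD(3)[OF S(2) e(1) y(1)] y(2) by simp
    qed
    have big: "p x \<in> U" if U: "submodule U A S" "U \<noteq> {\<zero>\<^bsub>S\<^esub>}" for U
    proof (rule ccontr)
      assume "p x \<notin> U"
      let ?N = "{y \<in> carrier Q. p y \<in> U}"
      have "submodule ?N A Q" by (rule QS.vimage_submodule[OF S(2) U(1)])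
      moreover have "N2 \<subseteq> ?N"
      proof
        fix b assume b: "b \<in> N2"
        then have bQ: "b \<in> carrier Q" by (rule Q.submoduleD(3)[OF N2(1)])
        then have "p b = \<zero>\<^bsub>S\<^esub>" using S(4) b by blast
        then show "b \<in> ?N" using bQ QS.Y.submoduleD(2)[OF U(1)] by simp
      qed
      moreover have "?N \<inter> {x} = {}" using \<open>p x \<notin> U\<close> by auto
      ultimately have NN: "?N = N2" using N2max by blast
      have "u = \<zero>\<^bsub>S\<^esub>" if u: "u \<in> U" for u
      proof -
        have "u \<in> p ` carrier Q" using u QS.Y.submoduleD(3)[OF U(1)] S(3) by simp
        then obtain b where b: "b \<in> carrier Q" "u = p b" by blast
        then have "b \<in> N2" using u unfolding NN[symmetric] by simp
        then show ?thesis using S(4) b by blast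
      qed
      then show False using U(2) QS.Y.submoduleD(2)[OF U(1)] by blast
    qed
    have "indecomposable A S"
      unfolding indecomposable_def
    proof (intro conjI allI impI)
      show "carrier S \<noteq> {\<zero>\<^bsub>S\<^esub>}" using px linD(1)[OF S(2) x(1)] by blast
      fix U V assume "internal_dsum A S U V"
      note D = QS.Y.internal_dsumD[OF this]
      show "U = {\<zero>\<^bsub>S\<^esub>} \<or> V = {\<zero>\<^bsub>S\<^esub>}" using big[OF D(1)] big[OF D(2)] D(3) px by blast
    qed
    then have SI: "S \<in> ind_cat A" using S(1) by (simp add: ind_cat_def)
    have "S \<in> left_part A" using SI \<open>killed S\<close> L by simp
    then have "Q \<in> left_part A" by (rule left_part_step[OF nonzero_stepI[OF QI SI S(2) x(1) px]])
    then have "killed Q" by (rule left_part_killed)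
    then show ?thesis using \<epsilon>Q \<epsilon>ee \<epsilon>ne by (simp add: killed_def)
  next
    case True
    have \<epsilon>inj: "inj_on \<epsilon> (carrier eAm)" unfolding EQ.inj_on_iff_ker[OF \<epsilon>] using \<epsilon>0 by simp
    have bij: "bij_betw \<epsilon> (carrier eAm) (carrier Q)" using \<epsilon>inj True by (simp add: bij_betw_def)
    define h where "h z = inv_into (carrier eAm) \<epsilon> (q (\<zero>, z))" for z
    have "lin A Z ?B (\<lambda>z. (\<zero>, z))" using EZ.dsum_lin(2) by simp
    from lin_comp[OF lin_comp[OF this Q(2)] EQ.lin_inverse[OF \<epsilon> bij]]
    have h: "lin A Z eAm h" unfolding h_def .
    have heq: "\<epsilon> (h z) = q (\<zero>, z)" if "z \<in> carrier Z" for z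
      unfolding h_def using bij_betw_inv_into_right[OF bij qD(1), of "(\<zero>, z)"] that eE
        A.submoduleD(2)[OF eA_submodule] by simp
    \<comment> \<open>The values of h lie in e A; because Z e = 0 they are also annihilated by e on
      the right, which places them in M.\<close>
    have hM: "h z \<in> M" if z: "z \<in> carrier Z" for z
    proof -
      have hz: "h z \<in> eA" using linD(1)[OF h z] by simp
      have "h z \<otimes> e = h (e \<odot>\<^bsub>Z\<^esub> z)" using linD(3)[OF h e(1) z] by simp
      also have "\<dots> = \<zero>" using k(2) z two_modules.lin_zero[OF two_modules.intro[OF rZ eAm_module] h] by (simp add: killed_def)
      finally show ?thesis using hz by (simp add: M_def eA_def)
    qed
    have "h (g y) = f y" if y: "y \<in> carrier Y" for y
    proof -
      have gy: "g y \<in> carrier Z" and fy: "f y \<in> eA" using linD(1)[OF g(1) y] linD(1)[OF fe y] by auto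
      have z0: "\<zero> \<in> eA" using A.submoduleD(2)[OF eA_submodule] by simp
      have fA: "f y \<in> carrier A" using fy by (simp add: eA_def)
      have "d y \<in> N" using N(2) y by (auto simp: \<Delta>_def)
      then have "q (d y) = \<zero>\<^bsub>Q\<^esub>" using Q(4) linD(1)[OF dl y] by blast
      moreover have "d y \<oplus>\<^bsub>?B\<^esub> (\<zero>, g y) = (f y, \<zero>\<^bsub>Z\<^esub>)"
        using fA gy by (simp add: d_def YZ.Y.X.l_neg)
      then have "q (d y) \<oplus>\<^bsub>Q\<^esub> q (\<zero>, g y) = \<epsilon> (f y)"
        using qD(2)[OF linD(1)[OF dl y], of "(\<zero>, g y)"] gy z0 by (simp add: \<epsilon>_def)
      ultimately have "q (\<zero>, g y) = \<epsilon> (f y)" using qD(1)[of "(\<zero>, g y)"] gy z0 by simp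
      then have "\<epsilon> (h (g y)) = \<epsilon> (f y)" using heq[OF gy] by simp
      then show ?thesis using inj_onD[OF \<epsilon>inj] linD(1)[OF h gy] fy by simp
    qed
    moreover have "lin A Z Mm h" using linD[OF h] hM by (intro linI) auto
    ultimately show ?thesis by blast
  qed
qed

end

section \<open>Local Artin algebras\<close>

locale local_artin_alg = artin_alg A k \<eta>
  for A :: "('a, 'c) ring_scheme" (structure) and k :: "('k, 'd) ring_scheme" and \<eta> :: "'k \<Rightarrow> 'a" +
  assumes local: "local_ring A"
begin

interpretation A: right_module A "regular A" by (rule regular_right_module)

text \<open>In a local ring this is the Jacobson radical. Its construction makes it a right ideal;
  closure under multiplication from the left is \<open>rad_left\<close>.\<close>

definition rad :: "'a set" where "rad = (THE I. maximal_right_ideal I A)"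

lemma rad_max: "maximal_right_ideal rad A"
  unfolding rad_def by (rule theI') (rule conjunct2[OF local[unfolded local_ring_def]])

lemma rad_unique: "maximal_right_ideal I A \<Longrightarrow> I = rad"
  by (rule ex1E[OF conjunct2[OF local[unfolded local_ring_def]]]) (use rad_max in metis)

lemma rad_ideal: "right_ideal rad A" and rad_proper: "rad \<noteq> carrier A"
  using rad_max by (simp_all add: maximal_right_ideal_def)

lemma rad_closed:
  "x \<in> rad \<Longrightarrow> x \<in> carrier A" "\<lbrakk>x \<in> rad; y \<in> rad\<rbrakk> \<Longrightarrow> x \<oplus> y \<in> rad"
  "\<lbrakk>x \<in> rad; a \<in> carrier A\<rbrakk> \<Longrightarrow> x \<otimes> a \<in> rad"
  using A.submoduleD[OF rad_ideal] by auto

lemma one_notin: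
  assumes "right_ideal I A" "I \<noteq> carrier A"
  shows "\<one> \<notin> I"
proof
  assume "\<one> \<in> I"
  then have "a \<in> I" if "a \<in> carrier A" for a
    using A.submoduleD(5)[OF assms(1) that] that by fastforce
  then show False using A.submoduleD(1)[OF assms(1)] assms(2) by auto
qed

lemma one_rad: "\<one> \<notin> rad" by (rule one_notin[OF rad_ideal rad_proper])

text \<open>Otherwise the right ideal x A avoids 1; enlarged to a maximal such ideal it becomes a
  maximal right ideal, which can only be the radical.\<close>

lemma right_inverse:
  assumes x: "x \<in> carrier A" "x \<notin> rad"
  shows "\<exists>y\<in>carrier A. x \<otimes> y = \<one>"
proof (rule ccontr)
  let ?X = "{a \<odot>\<^bsub>regular A\<^esub> x | a. a \<in> carrier A}"
  assume "\<not> ?thesis"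
  then have "?X \<inter> {\<one>} = {}" by auto
  moreover have X: "right_ideal ?X A" using x by (intro A.smult_closure_submodule) simp
  ultimately obtain N where N: "right_ideal N A" "?X \<subseteq> N" "N \<inter> {\<one>} = {}"
    and max: "\<forall>N'. right_ideal N' A \<longrightarrow> N \<subseteq> N' \<longrightarrow> N' \<inter> {\<one>} = {} \<longrightarrow> N' = N"
    using A.ex_maximal_submodule_avoiding[of ?X "{\<one>}"] by blast
  have "maximal_right_ideal N A"
    unfolding maximal_right_ideal_def
  proof (intro conjI allI impI)
    show "N \<noteq> carrier A" using N(3) by auto
    fix I assume I: "right_ideal I A \<and> N \<subseteq> I"
    show "I = N \<or> I = carrier A"
    proof (cases "I = carrier A")
      case False
      then have "I \<inter> {\<one>} = {}" using one_notin I by blast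
      then show ?thesis using max I by blast
    qed simp
  qed (rule N(1))
  then have "N = rad" by (rule rad_unique)
  moreover have "x \<in> ?X" using x by (auto intro!: exI[of _ \<one>])
  ultimately show False using N(2) x(2) by blast
qed

lemma one_minus_rad:
  assumes "x \<in> rad"
  shows "\<one> \<ominus> x \<in> carrier A" "\<one> \<ominus> x \<notin> rad"
proof -
  show "\<one> \<ominus> x \<in> carrier A" using rad_closed(1)[OF assms] by simp
  show "\<one> \<ominus> x \<notin> rad"
  proof
    assume "\<one> \<ominus> x \<in> rad"
    then have "(\<one> \<ominus> x) \<oplus> x \<in> rad" using assms by (rule rad_closed(2))
    then show False using one_rad rad_closed(1)[OF assms] by (simp add: a_minus_def a_assoc l_neg)
  qed
qed

lemma zero_rad: "\<zero> \<in> rad" using A.submoduleD(2)[OF rad_ideal] by simp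

text \<open>Let x y = 1. If y were in the radical, 1 - y x would have a right inverse, but x (1 - y
  x) = 0 would give x = 0. So y has a right inverse too, and it must be x.\<close>

lemma unit_of_notin_rad:
  assumes x: "x \<in> carrier A" "x \<notin> rad"
  shows "\<exists>y\<in>carrier A. x \<otimes> y = \<one> \<and> y \<otimes> x = \<one>"
proof -
  obtain y where y: "y \<in> carrier A" "x \<otimes> y = \<one>" using right_inverse[OF x] by blast
  have "y \<notin> rad"
  proof
    assume "y \<in> rad"
    then have yx: "y \<otimes> x \<in> rad" using x(1) by (rule rad_closed(3))
    obtain z where z: "z \<in> carrier A" "(\<one> \<ominus> y \<otimes> x) \<otimes> z = \<one>"
      using right_inverse[OF one_minus_rad[OF yx]] by blast
    have "x \<otimes> (\<one> \<ominus> y \<otimes> x) = x \<ominus> x \<otimes> y \<otimes> x"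
      using x y(1) by (simp add: a_minus_def r_distr r_minus m_assoc)
    also have "\<dots> = \<zero>" using x y(2) by (simp add: a_minus_def r_neg)
    finally have "x \<otimes> (\<one> \<ominus> y \<otimes> x) = \<zero>" .
    then have "x \<otimes> ((\<one> \<ominus> y \<otimes> x) \<otimes> z) = \<zero>"
      using m_assoc[of x "\<one> \<ominus> y \<otimes> x" z] x(1) y(1) z(1) by simp
    then have "x = \<zero>" using z(2) x(1) by simp
    then show False using x(2) zero_rad by simp
  qed
  then obtain z where z: "z \<in> carrier A" "y \<otimes> z = \<one>" using right_inverse[OF y(1)] by blast
  have "z = x \<otimes> y \<otimes> z" using y z by simp
  also have "\<dots> = x" using x y(1) z by (simp add: m_assoc)
  finally have "z = x" .
  then show ?thesis using y z(2) by blast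
qed

text \<open>If b x were outside of the radical, x would have a left inverse w. Then x w is in the
  radical, so 1 - x w is a unit, while (1 - x w) x = 0 forces x = 0.\<close>

lemma rad_left:
  assumes "x \<in> rad" "b \<in> carrier A"
  shows "b \<otimes> x \<in> rad"
proof (rule ccontr)
  assume "b \<otimes> x \<notin> rad"
  note xA = rad_closed(1)[OF assms(1)]
  then obtain u where u: "u \<in> carrier A" "u \<otimes> (b \<otimes> x) = \<one>"
    using unit_of_notin_rad[of "b \<otimes> x"] \<open>b \<otimes> x \<notin> rad\<close> assms(2) by auto
  let ?w = "u \<otimes> b"
  have w: "?w \<in> carrier A" "?w \<otimes> x = \<one>" using u assms(2) xA by (simp_all add: m_assoc)
  have xw: "x \<otimes> ?w \<in> rad" by (rule rad_closed(3)[OF assms(1) w(1)])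
  obtain z where z: "z \<in> carrier A" "z \<otimes> (\<one> \<ominus> x \<otimes> ?w) = \<one>"
    using unit_of_notin_rad[OF one_minus_rad[OF xw]] by blast
  have "x \<otimes> ?w \<otimes> x = x" using m_assoc[OF xA w(1) xA] w(2) xA by simp
  then have "(\<one> \<ominus> x \<otimes> ?w) \<otimes> x = \<zero>"
    using xA w(1) by (simp add: a_minus_def l_distr l_minus r_neg del: m_assoc)
  then have "z \<otimes> (\<one> \<ominus> x \<otimes> ?w) \<otimes> x = \<zero>"
    using m_assoc[of z "\<one> \<ominus> x \<otimes> ?w" x] z(1) xA w(1) by simp
  then have "x = \<zero>" using z(2) xA by simp
  then have "\<one> = \<zero>" using w by simp
  then show False using one_rad zero_rad by simp
qed

text \<open>The factor 1 - x is a unit; this is Nakayama's lemma for a single element, on either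
  side.\<close>

lemma rad_cancel:
  assumes "a \<in> carrier A" "x \<in> rad" "a \<otimes> x = a \<or> x \<otimes> a = a"
  shows "a = \<zero>"
proof -
  note xA = rad_closed(1)[OF assms(2)]
  note w = one_minus_rad[OF assms(2)]
  obtain z where z: "z \<in> carrier A" "(\<one> \<ominus> x) \<otimes> z = \<one>" "z \<otimes> (\<one> \<ominus> x) = \<one>"
    using unit_of_notin_rad[OF w] by blast
  from assms(3) show ?thesis
  proof
    assume "a \<otimes> x = a"
    then have "a \<otimes> (\<one> \<ominus> x) = \<zero>" using assms(1) xA by (simp add: a_minus_def r_distr r_minus r_neg)
    then have "a \<otimes> ((\<one> \<ominus> x) \<otimes> z) = \<zero>" using m_assoc[OF assms(1) w(1) z(1)] z(1) by simp
    then show ?thesis using z(2) assms(1) by simp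
  next
    assume "x \<otimes> a = a"
    then have "(\<one> \<ominus> x) \<otimes> a = \<zero>" using assms(1) xA by (simp add: a_minus_def l_distr l_minus r_neg)
    then have "z \<otimes> (\<one> \<ominus> x) \<otimes> a = \<zero>" using m_assoc[OF z(1) w(1) assms(1)] z(1) by simp
    then show ?thesis using z(3) assms(1) by simp
  qed
qed

text \<open>
  If \<open>a A\<close> is minimal among the right ideals with \<open>Q a\<close>, then \<open>a = a x b\<close> for some \<open>b\<close>, and \<open>a = 0\<close>
  because \<open>x b\<close> lies in the radical.
\<close>

lemma right_descent:
  assumes "Q a0" "\<And>a. Q a \<Longrightarrow> a \<in> carrier A \<and> a \<noteq> \<zero> \<and> (\<exists>x\<in>rad. Q (a \<otimes> x))"
  shows False
proof -
  define P where "P U \<longleftrightarrow> (\<exists>a. Q a \<and> U = {b \<odot>\<^bsub>regular A\<^esub> a | b. b \<in> carrier A})" for U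
  have dcc: "dcc A (regular A)"
    by (rule fin_gen_imp_dcc[OF A.right_module_axioms dual_basis_fin_gen[OF dual_basis_regular]])
  have P0: "P {b \<odot>\<^bsub>regular A\<^esub> a0 | b. b \<in> carrier A}" unfolding P_def using assms(1) by blast
  have "right_ideal U A" if PU: "P U" for U
  proof -
    obtain a where a: "Q a" "U = {b \<odot>\<^bsub>regular A\<^esub> a | b. b \<in> carrier A}" using PU unfolding P_def by blast
    show ?thesis unfolding a(2) using assms(2)[OF a(1)] by (intro A.smult_closure_submodule) simp
  qed
  from dcc_minimal[OF dcc, of P, OF P0 this] obtain U where U: "P U" "\<forall>V. P V \<longrightarrow> V \<subseteq> U \<longrightarrow> V = U" by blast
  then obtain a where a: "Q a" "U = {b \<odot>\<^bsub>regular A\<^esub> a | b. b \<in> carrier A}" by (auto simp: P_def)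
  note aA = assms(2)[OF a(1)]
  then obtain x where x: "x \<in> rad" "Q (a \<otimes> x)" by blast
  note xA = rad_closed(1)[OF x(1)]
  let ?V = "{b \<odot>\<^bsub>regular A\<^esub> (a \<otimes> x) | b. b \<in> carrier A}"
  have "P ?V" unfolding P_def using x(2) by blast
  moreover have "?V \<subseteq> U"
  proof
    fix v assume "v \<in> ?V"
    then obtain b where "b \<in> carrier A" "v = a \<otimes> x \<otimes> b" by auto
    then show "v \<in> U" unfolding a(2) using aA xA by (auto simp: m_assoc intro!: exI[of _ "x \<otimes> b"])
  qed
  ultimately have "?V = U" using U(2) by blast
  moreover have "a \<in> U" unfolding a(2) using aA by (auto intro!: exI[of _ \<one>])
  ultimately obtain b where b: "b \<in> carrier A" "a = a \<otimes> x \<otimes> b" by auto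
  then have "a = \<zero>" using aA rad_closed(3)[OF x(1) b(1)] xA
    by (intro rad_cancel[of a "x \<otimes> b"]) (simp_all add: m_assoc)
  then show False using aA by simp
qed

text \<open>The mirror image of \<open>right_descent\<close>. Left ideals are treated as
  k-submodules of A, which they are because the scalars are central, and the chain condition is that
  of A over k.\<close>

lemma left_descent:
  assumes "Q a0" "\<And>a. Q a \<Longrightarrow> a \<in> carrier A \<and> a \<noteq> \<zero> \<and> (\<exists>x\<in>rad. Q (x \<otimes> a))"
  shows False
proof -
  interpret A': right_module k "restr \<eta> (regular A)" by (rule restr_right_module[OF A.right_module_axioms])
  define P where "P U \<longleftrightarrow> (\<exists>a. Q a \<and> U = {b \<otimes> a | b. b \<in> carrier A})" for U
  have dcc: "dcc k (restr \<eta> (regular A))"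
    by (rule fin_gen_dcc[OF artin_dcc A'.right_module_axioms fin_gen_scalars])
  have P0: "P {b \<otimes> a0 | b. b \<in> carrier A}" unfolding P_def using assms(1) by blast
  have "submodule U k (restr \<eta> (regular A))" if PU: "P U" for U
  proof -
    obtain a where a: "Q a" "U = {b \<otimes> a | b. b \<in> carrier A}" using PU unfolding P_def by blast
    have aA: "a \<in> carrier A" using assms(2)[OF a(1)] by simp
    show ?thesis
      unfolding a(2)
    proof (rule A'.submoduleI)
      show "{b \<otimes> a | b. b \<in> carrier A} \<subseteq> carrier (restr \<eta> (regular A))" using aA by auto
      show "\<zero>\<^bsub>restr \<eta> (regular A)\<^esub> \<in> {b \<otimes> a | b. b \<in> carrier A}" using aA by (auto intro!: exI[of _ \<zero>])
      fix x y assume x: "x \<in> {b \<otimes> a | b. b \<in> carrier A}"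
      {
        assume "y \<in> {b \<otimes> a | b. b \<in> carrier A}"
        then show "x \<oplus>\<^bsub>restr \<eta> (regular A)\<^esub> y \<in> {b \<otimes> a | b. b \<in> carrier A}"
          using x aA by (auto simp: l_distr[symmetric])
      }
      fix c assume c: "c \<in> carrier k"
      obtain b where b: "b \<in> carrier A" "x = b \<otimes> a" using x by auto
      have "c \<odot>\<^bsub>restr \<eta> (regular A)\<^esub> x = b \<otimes> \<eta> c \<otimes> a"
        using b aA eta(1)[OF c] eta_comm[OF c aA] by (simp add: m_assoc)
      then show "c \<odot>\<^bsub>restr \<eta> (regular A)\<^esub> x \<in> {b \<otimes> a | b. b \<in> carrier A}"
        using b(1) eta(1)[OF c] by blast
    qed
  qed
  from dcc_minimal[OF dcc, of P, OF P0 this] obtain U where U: "P U" "\<forall>V. P V \<longrightarrow> V \<subseteq> U \<longrightarrow> V = U" by blast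
  then obtain a where a: "Q a" "U = {b \<otimes> a | b. b \<in> carrier A}" by (auto simp: P_def)
  note aA = assms(2)[OF a(1)]
  then obtain x where x: "x \<in> rad" "Q (x \<otimes> a)" by blast
  note xA = rad_closed(1)[OF x(1)]
  let ?V = "{b \<otimes> (x \<otimes> a) | b. b \<in> carrier A}"
  have "P ?V" unfolding P_def using x(2) by blast
  moreover have "?V \<subseteq> U"
  proof
    fix v assume "v \<in> ?V"
    then obtain b where "b \<in> carrier A" "v = b \<otimes> (x \<otimes> a)" by auto
    then show "v \<in> U" unfolding a(2) using aA xA by (auto simp: m_assoc[symmetric] intro!: exI[of _ "b \<otimes> x"])
  qed
  ultimately have "?V = U" using U(2) by blast
  moreover have "a \<in> U" unfolding a(2) using aA by (auto intro!: exI[of _ \<one>])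
  ultimately obtain b where b: "b \<in> carrier A" "a = b \<otimes> (x \<otimes> a)" by auto
  then have "a = \<zero>" using aA rad_left[OF x(1) b(1)] xA
    by (intro rad_cancel[of a "b \<otimes> x"]) (simp_all add: m_assoc)
  then show False using aA by simp
qed

lemma rad_nonzero:
  assumes "\<not> skew_field A"
  shows "\<exists>x\<in>rad. x \<noteq> \<zero>"
proof (rule ccontr)
  assume "\<not> ?thesis"
  then have z: "x = \<zero>" if "x \<in> rad" for x using that by blast
  have "\<one> \<noteq> \<zero>" using one_rad zero_rad by auto
  moreover have "Units A = carrier A - {\<zero>}"
  proof (intro equalityI subsetI)
    fix x assume "x \<in> Units A"
    then show "x \<in> carrier A - {\<zero>}" using \<open>\<one> \<noteq> \<zero>\<close> by (auto simp: Units_def)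
  next
    fix x assume "x \<in> carrier A - {\<zero>}"
    then show "x \<in> Units A" using unit_of_notin_rad[of x] z by (auto simp: Units_def)
  qed
  ultimately show False using assms ring_axioms by (simp add: skew_field_def)
qed

text \<open>If every nonzero a had a nonzero product a x with x in the radical, the descent starting
  at 1 would never stop.\<close>

lemma ex_right_socle: "\<exists>r\<in>carrier A. r \<noteq> \<zero> \<and> (\<forall>x\<in>rad. r \<otimes> x = \<zero>)"
proof (rule ccontr)
  assume *: "\<not> ?thesis"
  show False
  proof (rule right_descent[of "\<lambda>a. a \<in> carrier A \<and> a \<noteq> \<zero>" \<one>])
    show "\<one> \<in> carrier A \<and> \<one> \<noteq> \<zero>" using one_rad zero_rad by auto
    show "a \<in> carrier A \<and> a \<noteq> \<zero> \<and> (\<exists>x\<in>rad. a \<otimes> x \<in> carrier A \<and> a \<otimes> x \<noteq> \<zero>)"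
      if "a \<in> carrier A \<and> a \<noteq> \<zero>" for a
      using * that rad_closed(1) by blast
  qed
qed

lemma ex_left_socle: "\<exists>t\<in>carrier A. t \<noteq> \<zero> \<and> (\<forall>x\<in>rad. x \<otimes> t = \<zero>)"
proof (rule ccontr)
  assume *: "\<not> ?thesis"
  show False
  proof (rule left_descent[of "\<lambda>a. a \<in> carrier A \<and> a \<noteq> \<zero>" \<one>])
    show "\<one> \<in> carrier A \<and> \<one> \<noteq> \<zero>" using one_rad zero_rad by auto
    show "a \<in> carrier A \<and> a \<noteq> \<zero> \<and> (\<exists>x\<in>rad. x \<otimes> a \<in> carrier A \<and> x \<otimes> a \<noteq> \<zero>)"
      if "a \<in> carrier A \<and> a \<noteq> \<zero>" for a
      using * that rad_closed(1) by blast
  qed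
qed

text \<open>The sums of products of two radical elements, as a least set: a property closed under
  sums that holds for such products holds throughout.\<close>

definition rad_square :: "'a set" where
  "rad_square = \<Inter>{D. \<zero> \<in> D \<and> (\<forall>x\<in>D. \<forall>y\<in>D. x \<oplus> y \<in> D) \<and> (\<forall>x\<in>rad. \<forall>y\<in>rad. x \<otimes> y \<in> D)}"

lemma rad_square:
  "\<zero> \<in> rad_square" "\<lbrakk>x \<in> rad_square; y \<in> rad_square\<rbrakk> \<Longrightarrow> x \<oplus> y \<in> rad_square"
  "\<lbrakk>x \<in> rad; y \<in> rad\<rbrakk> \<Longrightarrow> x \<otimes> y \<in> rad_square"
  by (auto simp: rad_square_def)

text \<open>If J equalled its square, every a with a J nonzero would have some x in J with (a x) J
  nonzero. Descent starting at 1 excludes this, because J itself is nonzero when the ring is not a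
  skew field.\<close>

lemma ex_notin_rad_square:
  assumes "\<not> skew_field A"
  shows "\<exists>c\<in>rad. c \<notin> rad_square"
proof (rule ccontr)
  assume "\<not> ?thesis"
  then have sub: "rad \<subseteq> rad_square" by blast
  let ?Q = "\<lambda>a. a \<in> carrier A \<and> (\<exists>x\<in>rad. a \<otimes> x \<noteq> \<zero>)"
  show False
  proof (rule right_descent[of ?Q \<one>])
    show "?Q \<one>" using rad_nonzero[OF assms] rad_closed(1) by auto
    fix a assume a: "?Q a"
    have "\<exists>x\<in>rad. \<exists>y\<in>rad. a \<otimes> (x \<otimes> y) \<noteq> \<zero>"
    proof (rule ccontr)
      assume no: "\<not> ?thesis"
      have "rad_square \<subseteq> {d \<in> carrier A. a \<otimes> d = \<zero>}"
        unfolding rad_square_def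
        by (rule Inter_lower) (use a no rad_closed(1) in \<open>auto simp: r_distr\<close>)
      then show False using a sub by blast
    qed
    then obtain x y where xy: "x \<in> rad" "y \<in> rad" "a \<otimes> (x \<otimes> y) \<noteq> \<zero>" by blast
    then have "a \<otimes> x \<otimes> y \<noteq> \<zero>" using a rad_closed(1) by (simp add: m_assoc)
    then have "?Q (a \<otimes> x)" using a xy(1,2) rad_closed(1) by blast
    moreover have "a \<noteq> \<zero>" using a rad_closed(1) by auto
    ultimately show "a \<in> carrier A \<and> a \<noteq> \<zero> \<and> (\<exists>x\<in>rad. ?Q (a \<otimes> x))" using a xy(1) by blast
  qed
qed

end

section \<open>Triangular matrix algebras\<close>

text \<open>The definition of \<open>injective\<close> tests on the carrier type of
  \<open>mod_cat\<close>; copying Y and Z there extends it to finitely generated modules on any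
  type.\<close>

lemma injective_extension:
  assumes I: "injective H I" and YZ: "right_module H Y" "fin_gen H Y" "right_module H Z" "fin_gen H Z"
    and g: "lin H Y Z g" "inj_on g (carrier Y)" and f: "lin H Y I f"
  obtains h where "lin H Z I h" "\<forall>y\<in>carrier Y. h (g y) = f y"
proof -
  obtain Y' where Y': "Y' \<in> mod_cat H" "mod_iso H Y Y'" using ex_mod_cat_iso[OF YZ(1,2)] by blast
  obtain Z' where Z': "Z' \<in> mod_cat H" "mod_iso H Z Z'" using ex_mod_cat_iso[OF YZ(3,4)] by blast
  note rY' = mod_catD(1)[OF Y'(1)] and rZ' = mod_catD(1)[OF Z'(1)]
  obtain u where u: "lin H Y Y' u" "bij_betw u (carrier Y) (carrier Y')" using mod_iso_lin[OF Y'(2)] .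
  obtain v where v: "lin H Z Z' v" "bij_betw v (carrier Z) (carrier Z')" using mod_iso_lin[OF Z'(2)] .
  let ?u = "inv_into (carrier Y) u"
  have ui: "lin H Y' Y ?u" by (rule two_modules.lin_inverse[OF two_modules.intro[OF YZ(1) rY'] u])
  have ub: "bij_betw ?u (carrier Y') (carrier Y)" by (rule bij_betw_inv_into[OF u(2)])
  define g' where "g' = restrict (\<lambda>y. v (g (?u y))) (carrier Y')"
  define f' where "f' = restrict (\<lambda>y. f (?u y)) (carrier Y')"
  have g': "g' \<in> rhom H Y' Z'"
    unfolding g'_def by (rule lin_restrict[OF lin_comp[OF lin_comp[OF ui g(1)] v(1)] rY'])
  have f': "f' \<in> rhom H Y' I"
    unfolding f'_def by (rule lin_restrict[OF lin_comp[OF ui f] rY'])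
  have inj: "inj_on g' (carrier Y')"
  proof (rule inj_onI)
    fix x y assume xy: "x \<in> carrier Y'" "y \<in> carrier Y'" "g' x = g' y"
    have c: "?u x \<in> carrier Y" "?u y \<in> carrier Y" using linD(1)[OF ui] xy by auto
    have "v (g (?u x)) = v (g (?u y))" using xy by (simp add: g'_def)
    then have "g (?u x) = g (?u y)"
      using inj_onD[OF bij_betw_imp_inj_on[OF v(2)]] linD(1)[OF g(1)] c by blast
    then have "?u x = ?u y" using inj_onD[OF g(2)] c by blast
    then show "x = y" using inj_onD[OF bij_betw_imp_inj_on[OF ub]] xy by blast
  qed
  have "\<exists>h\<in>rhom H Z' I. compose (carrier Y') h g' = f'"
    using I Y'(1) Z'(1) g' f' inj unfolding injective_def by blast
  then obtain h where h: "h \<in> rhom H Z' I" "compose (carrier Y') h g' = f'" by blast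
  show ?thesis
  proof (rule that)
    show "lin H Z I (\<lambda>z. h (v z))" by (rule lin_comp[OF v(1) rhom_lin[OF h(1)]])
    show "\<forall>y\<in>carrier Y. h (v (g y)) = f y"
    proof
      fix y assume y: "y \<in> carrier Y"
      have uy: "u y \<in> carrier Y'" "?u (u y) = y"
        using linD(1)[OF u(1) y] bij_betw_inv_into_left[OF u(2) y] by auto
      have "h (g' (u y)) = f' (u y)" using fun_cong[OF h(2), of "u y"] uy(1) by (simp add: compose_def)
      then show "h (v (g y)) = f y" using uy by (simp add: g'_def f'_def)
    qed
  qed
qed

section \<open>Modules over H as modules over the matrix ring\<close>

lemma H_embed_simps [simp]:
  "carrier (H_embed X) = carrier X" "\<zero>\<^bsub>H_embed X\<^esub> = \<zero>\<^bsub>X\<^esub>" "x \<oplus>\<^bsub>H_embed X\<^esub> y = x \<oplus>\<^bsub>X\<^esub> y"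
  "(h, m, r) \<odot>\<^bsub>H_embed X\<^esub> x = h \<odot>\<^bsub>X\<^esub> x"
  by (simp_all add: H_embed_def)

lemma triangular_simps [simp]:
  "carrier (triangular H M R) = carrier H \<times> carrier M \<times> carrier R"
  "\<one>\<^bsub>triangular H M R\<^esub> = (\<one>\<^bsub>H\<^esub>, \<zero>\<^bsub>M\<^esub>, \<one>\<^bsub>R\<^esub>)"
  "\<zero>\<^bsub>triangular H M R\<^esub> = (\<zero>\<^bsub>H\<^esub>, \<zero>\<^bsub>M\<^esub>, \<zero>\<^bsub>R\<^esub>)"
  "(h, m, r) \<oplus>\<^bsub>triangular H M R\<^esub> (h', m', r') = (h \<oplus>\<^bsub>H\<^esub> h', m \<oplus>\<^bsub>M\<^esub> m', r \<oplus>\<^bsub>R\<^esub> r')"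
  "(h, m, r) \<otimes>\<^bsub>triangular H M R\<^esub> (h', m', r') =
    (h \<otimes>\<^bsub>H\<^esub> h', h' \<odot>\<^bsub>M\<^esub> m \<oplus>\<^bsub>M\<^esub> lsmult M r m', r \<otimes>\<^bsub>R\<^esub> r')"
  by (simp_all add: triangular_def)

locale triangular_alg = bimodule R H M
  for R :: "'r ring" and H :: "'h ring" and M :: "('r, 'h, 'm) bimodule" +
  fixes k :: "'k ring" and \<eta> :: "'k \<Rightarrow> 'h \<times> 'm \<times> 'r"
  assumes artin_alg: "artin_alg (triangular H M R) k \<eta>"
    and hereditary_H: "hereditary_ring H" and local_R: "local_ring R" and not_skew: "\<not> skew_field R"
begin

abbreviation T :: "('h \<times> 'm \<times> 'r) ring" where "T \<equiv> triangular H M R"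

text \<open>Fixes the types \<open>'m\<close> and \<open>'r\<close>, which the argument of \<open>H_embed\<close> leaves undetermined.\<close>

abbreviation emb :: "('h, 'y) module \<Rightarrow> ('h \<times> 'm \<times> 'r, 'y) module" where "emb Y \<equiv> H_embed Y"

lemma lsmult_zero [simp]:
  "r \<in> carrier R \<Longrightarrow> lsmult M r \<zero>\<^bsub>M\<^esub> = \<zero>\<^bsub>M\<^esub>" "m \<in> carrier M \<Longrightarrow> lsmult M \<zero>\<^bsub>R\<^esub> m = \<zero>\<^bsub>M\<^esub>"
  using lsmult_r_distr[of r "\<zero>\<^bsub>M\<^esub>" "\<zero>\<^bsub>M\<^esub>"] lsmult_l_distr[of "\<zero>\<^bsub>R\<^esub>" "\<zero>\<^bsub>R\<^esub>" m] by auto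

lemma H_artin: "artin_alg H k (\<lambda>c. fst (\<eta> c))"
proof (rule artin_alg.artin_alg_image[OF artin_alg M.A.ring_axioms])
  show "fst ` carrier T = carrier H"
  proof (intro equalityI subsetI)
    fix x assume "x \<in> carrier H"
    then show "x \<in> fst ` carrier T"
      by (intro image_eqI[of _ _ "(x, \<zero>\<^bsub>M\<^esub>, \<zero>\<^bsub>R\<^esub>)"]) simp_all
  qed (auto split: if_splits)
qed (auto intro!: ring_hom_memI)

lemma R_artin: "artin_alg R k (\<lambda>c. snd (snd (\<eta> c)))"
proof (rule artin_alg.artin_alg_image[OF artin_alg R.ring_axioms])
  show "(\<lambda>a. snd (snd a)) ` carrier T = carrier R"
  proof (intro equalityI subsetI)
    fix x assume "x \<in> carrier R"
    then show "x \<in> (\<lambda>a. snd (snd a)) ` carrier T"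
      by (intro image_eqI[of _ _ "(\<zero>\<^bsub>H\<^esub>, \<zero>\<^bsub>M\<^esub>, x)"]) simp_all
  qed auto
qed (auto intro!: ring_hom_memI)

lemma T_ring: "ring T" by (rule triangular_ring)

lemma embed_right_module:
  fixes Y :: "('h, 'y) module"
  shows "right_module H Y \<Longrightarrow> right_module T (emb Y)"
  by (rule H_embed_right_module)

lemma embed_submodule_iff:
  fixes Y :: "('h, 'y) module"
  assumes "right_module H Y"
  shows "submodule U T (emb Y) \<longleftrightarrow> submodule U H Y"
proof -
  interpret Y: right_module H Y by fact
  interpret TY: right_module T "emb Y" by (rule embed_right_module) fact
  show ?thesis
  proof
    assume "submodule U T (emb Y)"
    note D = TY.submoduleD[OF this]
    show "submodule U H Y"
    proof (rule Y.submoduleI)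
      fix h x assume "h \<in> carrier H" "x \<in> U"
      then show "h \<odot>\<^bsub>Y\<^esub> x \<in> U" using D(5)[of "(h, \<zero>\<^bsub>M\<^esub>, \<zero>\<^bsub>R\<^esub>)" x] by simp
    qed (use D in auto)
  next
    assume "submodule U H Y"
    note D = Y.submoduleD[OF this]
    show "submodule U T (emb Y)"
      by (rule TY.submoduleI) (use D in auto)
  qed
qed

lemma embed_fin_gen_iff:
  fixes Y :: "('h, 'y) module"
  assumes "right_module H Y"
  shows "fin_gen T (emb Y) \<longleftrightarrow> fin_gen H Y"
  unfolding right_module.fin_gen_iff[OF assms] right_module.fin_gen_iff[OF embed_right_module[OF assms]]
    embed_submodule_iff[OF assms] by simp

lemma embed_indecomposable_iff:
  fixes Y :: "('h, 'y) module"
  assumes "right_module H Y"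
  shows "indecomposable T (emb Y) \<longleftrightarrow> indecomposable H Y"
proof -
  have "U <+>\<^bsub>emb Y\<^esub> V = U <+>\<^bsub>Y\<^esub> V" for U V by (simp add: set_add_def')
  then have "internal_dsum T (emb Y) U V \<longleftrightarrow> internal_dsum H Y U V" for U V
    using embed_submodule_iff[OF assms] by (simp add: internal_dsum_def)
  then show ?thesis by (simp add: indecomposable_def)
qed

lemma embed_lin_iff:
  fixes Y :: "('h, 'y) module" and Z :: "('h, 'z) module"
  shows "lin T (emb Y) (emb Z) f \<longleftrightarrow> lin H Y Z f"
proof
  assume f: "lin T (emb Y) (emb Z) f"
  show "lin H Y Z f"
  proof (rule linI)
    fix h x assume "h \<in> carrier H" "x \<in> carrier Y"
    then show "f (h \<odot>\<^bsub>Y\<^esub> x) = h \<odot>\<^bsub>Z\<^esub> f x" using linD(3)[OF f, of "(h, \<zero>\<^bsub>M\<^esub>, \<zero>\<^bsub>R\<^esub>)" x] by simp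
  qed (use linD(1,2)[OF f] in auto)
next
  assume f: "lin H Y Z f"
  show "lin T (emb Y) (emb Z) f"
    by (rule linI) (use linD[OF f] in auto)
qed

text \<open>The inclusion of H as the corner (1 - e) T (1 - e); it sends 1 to 1 - e, not to the unit
  matrix.\<close>

abbreviation \<iota> :: "'h \<Rightarrow> 'h \<times> 'm \<times> 'r" where "\<iota> h \<equiv> (h, \<zero>\<^bsub>M\<^esub>, \<zero>\<^bsub>R\<^esub>)"
abbreviation e :: "'h \<times> 'm \<times> 'r" where "e \<equiv> (\<zero>\<^bsub>H\<^esub>, \<zero>\<^bsub>M\<^esub>, \<one>\<^bsub>R\<^esub>)"

text \<open>The matrix (0, m, r) equals e (0, m, r), so its action passes through X e = 0.\<close>

lemma killed_smult:
  assumes X: "right_module T X" and k: "\<forall>x\<in>carrier X. e \<odot>\<^bsub>X\<^esub> x = \<zero>\<^bsub>X\<^esub>"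
    and a: "(h, m, r) \<in> carrier T" and x: "x \<in> carrier X"
  shows "(h, m, r) \<odot>\<^bsub>X\<^esub> x = \<iota> h \<odot>\<^bsub>X\<^esub> x"
proof -
  interpret X: right_module T X by fact
  have hmr: "h \<in> carrier H" "m \<in> carrier M" "r \<in> carrier R" using a by auto
  have "(\<zero>\<^bsub>H\<^esub>, m, r) \<odot>\<^bsub>X\<^esub> x = (e \<otimes>\<^bsub>T\<^esub> (\<zero>\<^bsub>H\<^esub>, m, r)) \<odot>\<^bsub>X\<^esub> x" using hmr by simp
  also have "\<dots> = (\<zero>\<^bsub>H\<^esub>, m, r) \<odot>\<^bsub>X\<^esub> (e \<odot>\<^bsub>X\<^esub> x)" by (rule X.smult_assoc) (use hmr x in auto)
  also have "\<dots> = \<zero>\<^bsub>X\<^esub>" using k x hmr by simp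
  finally have z: "(\<zero>\<^bsub>H\<^esub>, m, r) \<odot>\<^bsub>X\<^esub> x = \<zero>\<^bsub>X\<^esub>" .
  have "(h, m, r) \<odot>\<^bsub>X\<^esub> x = (\<iota> h \<oplus>\<^bsub>T\<^esub> (\<zero>\<^bsub>H\<^esub>, m, r)) \<odot>\<^bsub>X\<^esub> x" using hmr by simp
  also have "\<dots> = \<iota> h \<odot>\<^bsub>X\<^esub> x \<oplus>\<^bsub>X\<^esub> (\<zero>\<^bsub>H\<^esub>, m, r) \<odot>\<^bsub>X\<^esub> x" by (rule X.smult_l_distr) (use hmr x in auto)
  also have "\<dots> = \<iota> h \<odot>\<^bsub>X\<^esub> x" using z hmr x by simp
  finally show ?thesis .
qed

lemma killed_restr:
  assumes X: "right_module T X" and k: "\<forall>x\<in>carrier X. e \<odot>\<^bsub>X\<^esub> x = \<zero>\<^bsub>X\<^esub>"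
  shows "right_module H (restr \<iota> X)" and "mod_iso T X (emb (restr \<iota> X))"
proof -
  interpret X: right_module T X by fact
  \<comment> \<open>The unit matrix and its upper left part act alike on X, so restriction along the
    non-unital \<iota> is still unital.\<close>
  have one: "\<iota> \<one>\<^bsub>H\<^esub> \<odot>\<^bsub>X\<^esub> x = x" if "x \<in> carrier X" for x
    using killed_smult[OF X k, of "\<one>\<^bsub>H\<^esub>" "\<zero>\<^bsub>M\<^esub>" "\<one>\<^bsub>R\<^esub>" x] X.smult_one[OF that] that by simp
  have "\<iota> (a \<otimes>\<^bsub>H\<^esub> b) = \<iota> a \<otimes>\<^bsub>T\<^esub> \<iota> b" "\<iota> (a \<oplus>\<^bsub>H\<^esub> b) = \<iota> a \<oplus>\<^bsub>T\<^esub> \<iota> b"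
    if "a \<in> carrier H" "b \<in> carrier H" for a b
    using that by simp_all
  then show r: "right_module H (restr \<iota> X)"
    using one by (intro right_module.intro M.A.ring_axioms X.restr_abelian_group right_module_axioms.intro)
      (auto simp del: triangular_simps(4,5) simp: X.smult_l_distr X.smult_r_distr X.smult_assoc)
  show "mod_iso T X (emb (restr \<iota> X))"
  proof (rule mod_isoI[of _ _ _ "\<lambda>x. x"])
    show "lin T X (emb (restr \<iota> X)) (\<lambda>x. x)"
    proof (rule linI)
      fix a x assume a: "a \<in> carrier T" and x: "x \<in> carrier X"
      obtain h m r where a': "a = (h, m, r)" by (cases a)
      show "a \<odot>\<^bsub>X\<^esub> x = a \<odot>\<^bsub>emb (restr \<iota> X)\<^esub> x"
        using killed_smult[OF X k a[unfolded a'] x] by (simp add: a')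
    qed simp_all
  qed (auto simp: bij_betw_def X)
qed

text \<open>The condition e x = 0 deletes the second row, so I consists of the matrices \<iota> h
  with h in a right ideal of H. A dual basis of that right ideal is carried over term by
  term.\<close>

lemma hereditary_T:
  assumes I: "right_ideal I T" and eI: "\<And>x. x \<in> I \<Longrightarrow> e \<otimes>\<^bsub>T\<^esub> x = \<zero>\<^bsub>T\<^esub>"
  shows "dual_basis T ((regular T)\<lparr>carrier := I\<rparr>)"
proof -
  interpret T: ring T by (rule T_ring)
  interpret Tm: right_module T "regular T" by (rule T.regular_right_module)
  interpret Hm: right_module H "regular H" by (rule M.A.regular_right_module)
  note ID = Tm.submoduleD[OF I, simplified]
  have Ii: "x = \<iota> (fst x) \<and> fst x \<in> carrier H" if "x \<in> I" for x
    using eI[OF that] ID(3)[OF that] by (cases x) auto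
  define K where "K = fst ` I"
  have K\<iota>: "\<iota> h \<in> I" if "h \<in> K" for h using that Ii unfolding K_def by force
  have K: "right_ideal K H"
  proof (rule Hm.submoduleI)
    show "K \<subseteq> carrier (regular H)" using Ii by (auto simp: K_def)
    show "\<zero>\<^bsub>regular H\<^esub> \<in> K" unfolding K_def using ID(2) by force
    fix x y assume x: "x \<in> K"
    {
      assume y: "y \<in> K"
      have "fst (\<iota> x \<oplus>\<^bsub>T\<^esub> \<iota> y) \<in> K"
        unfolding K_def using Tm.submoduleD(4)[OF I K\<iota>[OF x] K\<iota>[OF y]] by (intro imageI) simp
      then show "x \<oplus>\<^bsub>regular H\<^esub> y \<in> K" by simp
    }
    fix a assume a: "a \<in> carrier H"
    have "fst (\<iota> x \<otimes>\<^bsub>T\<^esub> \<iota> a) \<in> K"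
      unfolding K_def using Tm.submoduleD(5)[OF I _ K\<iota>[OF x], of "\<iota> a"] a by (intro imageI) simp
    then show "a \<odot>\<^bsub>regular H\<^esub> x \<in> K" by simp
  qed
  let ?K = "(regular H)\<lparr>carrier := K\<rparr>" and ?I = "(regular T)\<lparr>carrier := I\<rparr>"
  have "fin_gen H ?K"
    by (rule artin_alg.sub_fin_gen[OF H_artin Hm.right_module_axioms dual_basis_fin_gen[OF M.A.dual_basis_regular] K])
  moreover have "projective H ?K" using hereditary_H K by (simp add: hereditary_ring_def)
  ultimately have "dual_basis H ?K" by (intro projective_dual_basis)
  then obtain \<phi> where \<phi>: "right_module H ?K" "finite_rank H ?K ?K \<phi>" "\<forall>x\<in>carrier ?K. \<phi> x = x"
    by (rule dual_basisE)
  interpret KK: two_modules H ?K ?K by (intro two_modules.intro \<phi>(1))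
  have fI: "fst x \<in> K" if "x \<in> I" for x using that by (simp add: K_def)
  have KH: "h \<in> carrier H" if "h \<in> K" for h using Hm.submoduleD(3)[OF K that] by simp
  have "\<exists>\<chi>. finite_rank T ?I ?I \<chi> \<and> (\<forall>x\<in>I. \<chi> x = \<iota> (\<psi> (fst x)))" if "finite_rank H ?K ?K \<psi>" for \<psi>
    using that
  proof induction
    case zero
    show ?case using finite_rank.zero[of T ?I ?I] by (intro exI[of _ "\<lambda>x. \<zero>\<^bsub>?I\<^esub>"]) simp
  next
    case (add \<psi> g q)
    then obtain \<chi> where \<chi>: "finite_rank T ?I ?I \<chi>" "\<forall>x\<in>I. \<chi> x = \<iota> (\<psi> (fst x))" by blast
    have q: "q \<in> K" using add.hyps(3) by simp
    have gH: "g h \<in> carrier H" if "h \<in> K" for h using linD(1)[OF add.hyps(2)] that by simp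
    have lin: "lin T ?I (regular T) (\<lambda>x. \<iota> (g (fst x)))"
    proof (rule linI)
      fix x assume "x \<in> carrier ?I"
      then show "\<iota> (g (fst x)) \<in> carrier (regular T)" using gH fI by simp
    next
      fix x y assume xy: "x \<in> carrier ?I" "y \<in> carrier ?I"
      have "fst (x \<oplus>\<^bsub>T\<^esub> y) = fst x \<oplus>\<^bsub>H\<^esub> fst y" by (cases x; cases y) simp
      then show "\<iota> (g (fst (x \<oplus>\<^bsub>?I\<^esub> y))) = \<iota> (g (fst x)) \<oplus>\<^bsub>regular T\<^esub> \<iota> (g (fst y))"
        using linD(2)[OF add.hyps(2), of "fst x" "fst y"] xy fI by simp
    next
      fix a x assume a: "a \<in> carrier T" and x: "x \<in> carrier ?I"
      obtain h m r where hmr: "a = (h, m, r)" "h \<in> carrier H" "m \<in> carrier M" "r \<in> carrier R"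
        using a by auto
      have "fst (x \<otimes>\<^bsub>T\<^esub> a) = fst x \<otimes>\<^bsub>H\<^esub> h" using hmr by (cases x) simp
      then show "\<iota> (g (fst (a \<odot>\<^bsub>?I\<^esub> x))) = a \<odot>\<^bsub>regular T\<^esub> \<iota> (g (fst x))"
        using linD(3)[OF add.hyps(2) hmr(2), of "fst x"] x fI hmr gH by simp
    qed
    have "finite_rank T ?I ?I (\<lambda>x. \<chi> x \<oplus>\<^bsub>?I\<^esub> \<iota> (g (fst x)) \<odot>\<^bsub>?I\<^esub> \<iota> q)"
      by (rule finite_rank.add[OF \<chi>(1) lin]) (simp add: K\<iota>[OF q])
    moreover have "\<chi> x \<oplus>\<^bsub>?I\<^esub> \<iota> (g (fst x)) \<odot>\<^bsub>?I\<^esub> \<iota> q = \<iota> (\<psi> (fst x) \<oplus>\<^bsub>?K\<^esub> g (fst x) \<odot>\<^bsub>?K\<^esub> q)"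
      if x: "x \<in> I" for x
      using \<chi>(2) x gH[OF fI[OF x]] KH[OF q] by simp
    ultimately show ?case by blast
  qed
  from this[OF \<phi>(2)] obtain \<chi> where \<chi>: "finite_rank T ?I ?I \<chi>" "\<forall>x\<in>I. \<chi> x = \<iota> (\<phi> (fst x))" by blast
  have "\<forall>x\<in>I. \<chi> x = x"
  proof
    fix x assume x: "x \<in> I"
    have "\<chi> x = \<iota> (fst x)" using \<chi>(2) \<phi>(3) fI[OF x] x by simp
    then show "\<chi> x = x" using Ii[OF x] by simp
  qed
  then show ?thesis
    unfolding dual_basis_def using Tm.sub_right_module[OF I] \<chi>(1) by (intro conjI exI[of _ \<chi>]) simp_all
qed

text \<open>The abstract setting is instantiated with the matrix algebra; two translations remain,
  of \<open>ind_H\<close> into modules killed by e and of \<open>injective H M\<close> into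
  \<open>M_injective\<close>.\<close>

lemma equivalences:
  "(abelian_exact_subcat T (add_cat T (left_part T)) \<longleftrightarrow> left_part T = ind_H H M R) \<and>
   (left_part T = ind_H H M R \<longleftrightarrow> injective H M)"
proof -
  interpret R: artin_alg R k "\<lambda>c. snd (snd (\<eta> c))" by (rule R_artin)
  interpret R: local_artin_alg R k "\<lambda>c. snd (snd (\<eta> c))" by unfold_locales (rule local_R)
  let ?j = "\<lambda>x :: 'r. (\<zero>\<^bsub>H\<^esub>, \<zero>\<^bsub>M\<^esub>, x)"
  obtain r where r: "r \<in> carrier R" "r \<noteq> \<zero>\<^bsub>R\<^esub>" "\<forall>x\<in>R.rad. r \<otimes>\<^bsub>R\<^esub> x = \<zero>\<^bsub>R\<^esub>"
    using R.ex_right_socle by blast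
  obtain t where t: "t \<in> carrier R" "t \<noteq> \<zero>\<^bsub>R\<^esub>" "\<forall>x\<in>R.rad. x \<otimes>\<^bsub>R\<^esub> t = \<zero>\<^bsub>R\<^esub>"
    using R.ex_left_socle by blast
  obtain c where c: "c \<in> R.rad" "c \<notin> R.rad_square"
    using R.ex_notin_rad_square[OF not_skew] by blast
  note radR = R.rad_closed(1)
  interpret A: artin_alg T k \<eta> by (rule artin_alg)
  \<comment> \<open>The corner e T e is a copy of R in the lower right entry; the radical, its
    square, the two socle elements and a radical element outside of the square are placed
    there.\<close>
  interpret A: local_extension T k \<eta> e "?j r" "?j t" "?j c" "?j ` R.rad" "?j ` R.rad_square"
  proof
    show "e \<in> carrier T" "e \<otimes>\<^bsub>T\<^esub> e = e" by simp_all
    show "a \<otimes>\<^bsub>T\<^esub> e = e \<otimes>\<^bsub>T\<^esub> a \<otimes>\<^bsub>T\<^esub> e" if "a \<in> carrier T" for a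
      using that by (cases a) simp
    show "x \<in> carrier T" "e \<otimes>\<^bsub>T\<^esub> x = x" "x \<otimes>\<^bsub>T\<^esub> e = x" if "x \<in> ?j ` R.rad" for x
      using that radR by auto
    show "x \<oplus>\<^bsub>T\<^esub> y \<in> ?j ` R.rad" if "x \<in> ?j ` R.rad" "y \<in> ?j ` R.rad" for x y
      using that R.rad_closed(2) by auto
    show "e \<notin> ?j ` R.rad" using R.one_rad by auto
    show "\<exists>y\<in>carrier T. x \<otimes>\<^bsub>T\<^esub> y = e \<and> y \<otimes>\<^bsub>T\<^esub> x = e"
      if x: "x \<in> carrier T" "e \<otimes>\<^bsub>T\<^esub> x = x" "x \<otimes>\<^bsub>T\<^esub> e = x" "x \<notin> ?j ` R.rad" for x
    proof -
      obtain h m s where hms: "x = (h, m, s)" "h \<in> carrier H" "m \<in> carrier M" "s \<in> carrier R"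
        using x(1) by auto
      have xs: "x = ?j s" using x(3) hms by simp
      then have "s \<notin> R.rad" using x(4) by blast
      then obtain s' where s': "s' \<in> carrier R" "s \<otimes>\<^bsub>R\<^esub> s' = \<one>\<^bsub>R\<^esub>" "s' \<otimes>\<^bsub>R\<^esub> s = \<one>\<^bsub>R\<^esub>"
        using R.unit_of_notin_rad[OF hms(4)] by blast
      show ?thesis using s' hms(4) unfolding xs by (intro bexI[of _ "?j s'"]) simp_all
    qed
    show "?j r \<in> carrier T" "e \<otimes>\<^bsub>T\<^esub> ?j r = ?j r" "?j r \<otimes>\<^bsub>T\<^esub> e = ?j r" "?j r \<noteq> \<zero>\<^bsub>T\<^esub>"
      using r by simp_all
    show "?j r \<otimes>\<^bsub>T\<^esub> x = \<zero>\<^bsub>T\<^esub>" if "x \<in> ?j ` R.rad" for x using that r by auto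
    show "?j t \<in> carrier T" "e \<otimes>\<^bsub>T\<^esub> ?j t = ?j t" "?j t \<otimes>\<^bsub>T\<^esub> e = ?j t" "?j t \<noteq> \<zero>\<^bsub>T\<^esub>"
      using t by simp_all
    show "x \<otimes>\<^bsub>T\<^esub> ?j t = \<zero>\<^bsub>T\<^esub>" if "x \<in> ?j ` R.rad" for x using that t radR by auto
    show "?j c \<in> ?j ` R.rad" "?j c \<notin> ?j ` R.rad_square" using c by auto
    show "\<zero>\<^bsub>T\<^esub> \<in> ?j ` R.rad_square" using R.rad_square(1) by simp
    show "x \<oplus>\<^bsub>T\<^esub> y \<in> ?j ` R.rad_square" if "x \<in> ?j ` R.rad_square" "y \<in> ?j ` R.rad_square" for x y
      using that R.rad_square(2) by auto
    show "x \<otimes>\<^bsub>T\<^esub> y \<in> ?j ` R.rad_square" if "x \<in> ?j ` R.rad" "y \<in> ?j ` R.rad" for x y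
      using that R.rad_square(3) radR by auto
    show "dual_basis T (regular T\<lparr>carrier := I\<rparr>)"
      if "right_ideal I T" "\<And>x. x \<in> I \<Longrightarrow> e \<otimes>\<^bsub>T\<^esub> x = \<zero>\<^bsub>T\<^esub>" for I
      using that by (rule hereditary_T)
  qed
  have embed_killed: "A.killed (emb Y)" if "right_module H Y" for Y :: "('h, 'h list set) module"
  proof -
    interpret Y: right_module H Y by fact
    show ?thesis by (simp add: A.killed_def)
  qed
  \<comment> \<open>A module over H embeds by letting matrices act through their upper left entry;
    conversely a module killed by e is recovered by restriction along \<iota>.\<close>
  have ind: "ind_H H M R = {X \<in> ind_cat T. A.killed X}"
  proof (intro equalityI subsetI)
    fix N assume "N \<in> ind_H H M R"
    then obtain X where N: "N \<in> mod_cat T" and X: "X \<in> ind_cat H" "mod_iso T N (emb X)"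
      by (auto simp: ind_H_def)
    note rX = ind_catD(2)[OF X(1)] and rN = mod_catD(1)[OF N]
    note iso = mod_iso_sym[OF X(2) rN embed_right_module[OF rX]]
    have "indecomposable T (emb X)" using embed_indecomposable_iff[OF rX] ind_catD(4)[OF X(1)] by simp
    then have "indecomposable T N" by (rule indecomposable_iso[OF iso embed_right_module[OF rX] rN])
    moreover have "A.killed N" by (rule A.killed_iso[OF embed_right_module[OF rX] rN iso embed_killed[OF rX]])
    ultimately show "N \<in> {X \<in> ind_cat T. A.killed X}" using N by (simp add: ind_cat_def)
  next
    fix N assume "N \<in> {X \<in> ind_cat T. A.killed X}"
    then have N: "N \<in> ind_cat T" "A.killed N" by auto
    note rN = ind_catD(2)[OF N(1)]
    have k: "\<forall>x\<in>carrier N. e \<odot>\<^bsub>N\<^esub> x = \<zero>\<^bsub>N\<^esub>" using N(2) by (simp add: A.killed_def)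
    note rY = killed_restr(1)[OF rN k] and iso = killed_restr(2)[OF rN k]
    let ?Y = "restr \<iota> N"
    note rE = embed_right_module[OF rY]
    have "indecomposable T (emb ?Y)" by (rule indecomposable_iso[OF iso rN rE ind_catD(4)[OF N(1)]])
    then have indY: "indecomposable H ?Y" using embed_indecomposable_iff[OF rY] by simp
    obtain f where f: "lin T N (emb ?Y) f" "bij_betw f (carrier N) (carrier (emb ?Y))"
      using mod_iso_lin[OF iso] .
    have "fin_gen T (emb ?Y)"
      by (rule two_modules.fin_gen_image[OF two_modules.intro[OF rN rE] f(1) bij_betw_imp_surj_on[OF f(2)] ind_catD(3)[OF N(1)]])
    then have "fin_gen H ?Y" using embed_fin_gen_iff[OF rY] by simp
    then obtain X where X: "X \<in> ind_cat H" "mod_iso H ?Y X" by (rule ex_ind_cat_iso[OF rY _ indY])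
    obtain u where u: "lin H ?Y X u" "bij_betw u (carrier ?Y) (carrier X)" using mod_iso_lin[OF X(2)] .
    have "mod_iso T (emb ?Y) (emb X)"
      by (rule mod_isoI[of _ _ _ u]) (use u rE embed_lin_iff in auto)
    then have "mod_iso T N (emb X)" by (rule mod_iso_trans[OF iso _ rN])
    then show "N \<in> ind_H H M R" unfolding ind_H_def using X(1) ind_catD(1)[OF N(1)] by blast
  qed
  have Mm: "x \<in> A.M \<longleftrightarrow> (\<exists>m\<in>carrier M. x = (\<zero>\<^bsub>H\<^esub>, m, \<zero>\<^bsub>R\<^esub>))" for x
    by (cases x) (auto simp: A.M_def)
  \<comment> \<open>Both directions identify m with the matrix (0, m, 0) and move the test modules
    between H and T, whose module categories have different carrier types.\<close>
  have inj: "injective H M \<longleftrightarrow> A.M_injective"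
  proof
    assume I: "injective H M"
    show A.M_injective
      unfolding A.M_injective_def
    proof (intro ballI allI impI)
      fix Y Z g f
      assume YZ: "Y \<in> mod_cat T" "Z \<in> mod_cat T" and k: "A.killed Y" "A.killed Z"
        and g: "lin T Y Z g" "inj_on g (carrier Y)" and f: "lin T Y A.Mm f"
      note rY = mod_catD(1)[OF YZ(1)] and rZ = mod_catD(1)[OF YZ(2)]
      have kY: "\<forall>x\<in>carrier Y. e \<odot>\<^bsub>Y\<^esub> x = \<zero>\<^bsub>Y\<^esub>" and kZ: "\<forall>x\<in>carrier Z. e \<odot>\<^bsub>Z\<^esub> x = \<zero>\<^bsub>Z\<^esub>"
        using k by (auto simp: A.killed_def)
      have fg: "fin_gen H (restr \<iota> X)" if X: "X \<in> mod_cat T" and kX: "\<forall>x\<in>carrier X. e \<odot>\<^bsub>X\<^esub> x = \<zero>\<^bsub>X\<^esub>" for X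
      proof -
        note rX = mod_catD(1)[OF X]
        obtain f where f: "lin T X (emb (restr \<iota> X)) f" "bij_betw f (carrier X) (carrier (emb (restr \<iota> X)))"
          using mod_iso_lin[OF killed_restr(2)[OF rX kX]] .
        have "fin_gen T (emb (restr \<iota> X))"
          by (rule two_modules.fin_gen_image[OF two_modules.intro[OF rX embed_right_module[OF killed_restr(1)[OF rX kX]]]
                f(1) bij_betw_imp_surj_on[OF f(2)] mod_catD(2)[OF X]])
        then show ?thesis using embed_fin_gen_iff[OF killed_restr(1)[OF rX kX]] by simp
      qed
      have g': "lin H (restr \<iota> Y) (restr \<iota> Z) g"
        using linD[OF g(1)] by (intro linI) auto
      have fm: "\<exists>m\<in>carrier M. f y = (\<zero>\<^bsub>H\<^esub>, m, \<zero>\<^bsub>R\<^esub>)" if "y \<in> carrier Y" for y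
        using linD(1)[OF f that] Mm by simp
      have f': "lin H (restr \<iota> Y) M (\<lambda>y. fst (snd (f y)))"
      proof (rule linI)
        fix y assume y: "y \<in> carrier (restr \<iota> Y)"
        then show "fst (snd (f y)) \<in> carrier M" using fm[of y] by auto
        {
          fix x assume x: "x \<in> carrier (restr \<iota> Y)"
          show "fst (snd (f (x \<oplus>\<^bsub>restr \<iota> Y\<^esub> y))) = fst (snd (f x)) \<oplus>\<^bsub>M\<^esub> fst (snd (f y))"
            using linD(2)[OF f, of x y] x y fm[of x] fm[of y] by auto
        }
        fix h assume h: "h \<in> carrier H"
        show "fst (snd (f (h \<odot>\<^bsub>restr \<iota> Y\<^esub> y))) = h \<odot>\<^bsub>M\<^esub> fst (snd (f y))"
          using linD(3)[OF f, of "\<iota> h" y] h y fm[of y] by auto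
      qed
      have inj: "inj_on g (carrier (restr \<iota> Y))" using g(2) by simp
      obtain h where h: "lin H (restr \<iota> Z) M h" "\<forall>y\<in>carrier (restr \<iota> Y). h (g y) = fst (snd (f y))"
        using injective_extension[OF I killed_restr(1)[OF rY kY] fg[OF YZ(1) kY]
            killed_restr(1)[OF rZ kZ] fg[OF YZ(2) kZ] g' inj f'] .
      note hD = linD[OF h(1), simplified]
      have "lin T Z A.Mm (\<lambda>z. (\<zero>\<^bsub>H\<^esub>, h z, \<zero>\<^bsub>R\<^esub>))"
      proof (rule linI)
        fix a z assume a: "a \<in> carrier T" and z: "z \<in> carrier Z"
        obtain b m r where a': "a = (b, m, r)" "b \<in> carrier H" "m \<in> carrier M" "r \<in> carrier R"
          using a by auto
        have "a \<odot>\<^bsub>Z\<^esub> z = \<iota> b \<odot>\<^bsub>Z\<^esub> z" unfolding a'(1) by (rule killed_smult[OF rZ kZ]) (use a a' z in auto)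
        then show "(\<zero>\<^bsub>H\<^esub>, h (a \<odot>\<^bsub>Z\<^esub> z), \<zero>\<^bsub>R\<^esub>) = a \<odot>\<^bsub>A.Mm\<^esub> (\<zero>\<^bsub>H\<^esub>, h z, \<zero>\<^bsub>R\<^esub>)"
          using hD(3)[OF a'(2) z] hD(1)[OF z] a' by simp
      qed (use hD Mm in auto)
      moreover have "(\<zero>\<^bsub>H\<^esub>, h (g y), \<zero>\<^bsub>R\<^esub>) = f y" if "y \<in> carrier Y" for y
        using h(2) that fm[OF that] by auto
      ultimately show "\<exists>h. lin T Z A.Mm h \<and> (\<forall>y\<in>carrier Y. h (g y) = f y)"
        by (intro exI[of _ "\<lambda>z. (\<zero>\<^bsub>H\<^esub>, h z, \<zero>\<^bsub>R\<^esub>)"]) simp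
    qed
  next
    assume I: A.M_injective
    show "injective H M"
      unfolding injective_def
    proof (intro conjI ballI impI)
      show "right_module H M" by (rule M.right_module_axioms)
      fix Y Z g f
      assume YZ: "Y \<in> mod_cat H" "Z \<in> mod_cat H" and g: "g \<in> rhom H Y Z" "inj_on g (carrier Y)"
        and f: "f \<in> rhom H Y M"
      note rY = mod_catD(1)[OF YZ(1)] and rZ = mod_catD(1)[OF YZ(2)]
      note rY' = embed_right_module[OF rY] and rZ' = embed_right_module[OF rZ]
      have fgY: "fin_gen T (emb Y)" and fgZ: "fin_gen T (emb Z)"
        using embed_fin_gen_iff[OF rY] embed_fin_gen_iff[OF rZ] mod_catD(2)[OF YZ(1)] mod_catD(2)[OF YZ(2)] by auto
      obtain Y' where Y': "Y' \<in> mod_cat T" "mod_iso T (emb Y) Y'" using ex_mod_cat_iso[OF rY' fgY] by blast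
      obtain Z' where Z': "Z' \<in> mod_cat T" "mod_iso T (emb Z) Z'" using ex_mod_cat_iso[OF rZ' fgZ] by blast
      obtain u where u: "lin T (emb Y) Y' u" "bij_betw u (carrier (emb Y)) (carrier Y')" using mod_iso_lin[OF Y'(2)] .
      obtain v where v: "lin T (emb Z) Z' v" "bij_betw v (carrier (emb Z)) (carrier Z')" using mod_iso_lin[OF Z'(2)] .
      have kY': "A.killed Y'" by (rule A.killed_iso[OF rY' mod_catD(1)[OF Y'(1)] Y'(2) embed_killed[OF rY]])
      have kZ': "A.killed Z'" by (rule A.killed_iso[OF rZ' mod_catD(1)[OF Z'(1)] Z'(2) embed_killed[OF rZ]])
      define w where "w = inv_into (carrier (emb Y)) u"
      have w: "lin T Y' (emb Y) w"
        unfolding w_def by (rule two_modules.lin_inverse[OF two_modules.intro[OF rY' mod_catD(1)[OF Y'(1)]] u])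
      have wb: "bij_betw w (carrier Y') (carrier Y)" unfolding w_def using bij_betw_inv_into[OF u(2)] by simp
      have lg: "lin T (emb Y) (emb Z) g" using rhom_lin[OF g(1)] embed_lin_iff by blast
      have lf: "lin T (emb Y) A.Mm (\<lambda>y. (\<zero>\<^bsub>H\<^esub>, f y, \<zero>\<^bsub>R\<^esub>))"
        by (rule linI) (use linD[OF rhom_lin[OF f]] Mm in auto)
      have inj: "inj_on (\<lambda>y. v (g (w y))) (carrier Y')"
      proof (rule inj_onI)
        fix x y assume xy: "x \<in> carrier Y'" "y \<in> carrier Y'" "v (g (w x)) = v (g (w y))"
        have c: "w x \<in> carrier Y" "w y \<in> carrier Y" using linD(1)[OF w] xy by auto
        then have "g (w x) \<in> carrier Z" "g (w y) \<in> carrier Z" using linD(1)[OF rhom_lin[OF g(1)]] by auto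
        then have "g (w x) = g (w y)" using inj_onD[OF bij_betw_imp_inj_on[OF v(2)] xy(3)] by simp
        then have "w x = w y" using inj_onD[OF g(2)] c by blast
        then show "x = y" using inj_onD[OF bij_betw_imp_inj_on[OF wb]] xy by blast
      qed
      from I[unfolded A.M_injective_def, rule_format, OF Y'(1) Z'(1) kY' kZ'
          lin_comp[OF lin_comp[OF w lg] v(1)] inj lin_comp[OF w lf]]
      obtain h where h: "lin T Z' A.Mm h" "\<forall>y\<in>carrier Y'. h (v (g (w y))) = (\<zero>\<^bsub>H\<^esub>, f (w y), \<zero>\<^bsub>R\<^esub>)" by blast
      note hv = lin_comp[OF v(1) h(1)]
      have hm: "\<exists>m\<in>carrier M. h (v z) = (\<zero>\<^bsub>H\<^esub>, m, \<zero>\<^bsub>R\<^esub>)" if "z \<in> carrier Z" for z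
        using linD(1)[OF hv] that Mm by simp
      have "lin H Z M (\<lambda>z. fst (snd (h (v z))))"
      proof (rule linI)
        fix z assume z: "z \<in> carrier Z"
        then show "fst (snd (h (v z))) \<in> carrier M" using hm[of z] by auto
        {
          fix x assume x: "x \<in> carrier Z"
          show "fst (snd (h (v (x \<oplus>\<^bsub>Z\<^esub> z)))) = fst (snd (h (v x))) \<oplus>\<^bsub>M\<^esub> fst (snd (h (v z)))"
            using linD(2)[OF hv, of x z] x z hm[of x] hm[of z] by auto
        }
        fix b assume b: "b \<in> carrier H"
        show "fst (snd (h (v (b \<odot>\<^bsub>Z\<^esub> z)))) = b \<odot>\<^bsub>M\<^esub> fst (snd (h (v z)))"
          using linD(3)[OF hv, of "\<iota> b" z] b z hm[of z] by auto
      qed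
      from lin_restrict[OF this rZ]
      have "restrict (\<lambda>z. fst (snd (h (v z)))) (carrier Z) \<in> rhom H Z M" .
      moreover have "compose (carrier Y) (restrict (\<lambda>z. fst (snd (h (v z)))) (carrier Z)) g = f"
        unfolding compose_eq_iff[OF rhom_ext[OF f]]
      proof
        fix y assume y: "y \<in> carrier Y"
        have uy: "u y \<in> carrier Y'" "w (u y) = y"
          using linD(1)[OF u(1)] y bij_betw_inv_into_left[OF u(2)] by (auto simp: w_def)
        have "h (v (g y)) = (\<zero>\<^bsub>H\<^esub>, f y, \<zero>\<^bsub>R\<^esub>)" using h(2) uy by metis
        then show "restrict (\<lambda>z. fst (snd (h (v z)))) (carrier Z) (g y) = f y"
          using linD(1)[OF rhom_lin[OF g(1)] y] by simp
      qed
      ultimately show "\<exists>h\<in>rhom H Z M. compose (carrier Y) h g = f" by blast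
    qed
  qed
  show ?thesis
    unfolding ind inj
  proof (intro conjI iffI)
    assume ab: "abelian_exact_subcat T (add_cat T (left_part T))"
    show "left_part T = {X \<in> ind_cat T. A.killed X}"
    proof (intro equalityI subsetI)
      show "X \<in> {X \<in> ind_cat T. A.killed X}" if "X \<in> left_part T" for X
        using A.left_part_killed[OF that] that by (simp add: left_part_def)
      show "X \<in> left_part T" if "X \<in> {X \<in> ind_cat T. A.killed X}" for X
        using A.abelian_imp_left_part[OF ab] that by simp
    qed
  qed (fact A.left_part_imp_abelian A.left_part_imp_injective A.injective_imp_left_part)+
qed

end

theorem proposition3p5:
  fixes H :: "'h ring" and R :: "'r ring" and M :: "('r, 'h, 'm) bimodule"
    and k :: "'k ring" and \<eta> :: "'k \<Rightarrow> 'h \<times> 'm \<times> 'r"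
    and A :: "('h \<times> 'm \<times> 'r) ring"
  assumes "bimodule R H M"
    and "A = triangular H M R"
    and "artin_algebra k \<eta> A"
    and "basic_ring A"
    and "connected_ring A"
    and "hereditary_ring H"
    and "local_ring R"
    and "\<not> skew_field R"
  shows "(abelian_exact_subcat A (add_cat A (left_part A)) \<longleftrightarrow> left_part A = ind_H H M R) \<and>
         (left_part A = ind_H H M R \<longleftrightarrow> injective H M)"
proof -
  have "artin_alg (triangular H M R) k \<eta>"
    using artin_algebra_artin_alg[OF assms(3)] unfolding assms(2) .
  then interpret triangular_alg R H M k \<eta>
    by (intro triangular_alg.intro triangular_alg_axioms.intro assms(1,6-8))
  show ?thesis unfolding assms(2) by (rule equivalences)
qed

end
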